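(* Let $(\mathcal{E},\mathcal{D}(\mathcal{E}))$ be a regular Dirichlet form on $L^2(E;m)$, let $\mu$ be a signed smooth Radon measure such that $(\mathcal{E}^{\mu},\mathcal{D}(\mathcal{E})\cap C_c(E))$ is non-negative definite and closable, and let $\Phi$ be a Bernstein function. Then $$R(\sqrt{-\mathcal{L}^{\mu,\Phi}})=L^2(E;m)\cap\mathcal{D}_e^*(\sqrt{-\mathcal{L}^{\mu,\Phi}})=L^2(E;m)\cap\mathcal{D}^*(\sqrt{-\mathcal{L}^{\mu,\Phi}})=\{f\in L^2(E;m):\langle f,G^{\mu,\Phi}f\rangle_m<\infty\}.$$
   Context: Setting. $E$ is a locally compact separable metric space, $m$ a positive Radon measure on $E$ with full support, $\langle\cdot,\cdot\rangle_m$ the inner product of real $L^2(E;m)$. A Dirichlet form $(\mathcal{E},\mathcal{D}(\mathcal{E}))$ is a densely defined, non-negative definite, symmetric, closed bilinear form on $L^2(E;m)$ that is Markovian: $f\in\mathcal{D}(\mathcal{E})$ implies $g:=(0\vee f)\wedge1\in\mathcal{D}(\mathcal{E})$ and $\mathcal{E}(g,g)\le\mathcal{E}(f,f)$. Put $\mathcal{E}_1:=\mathcal{E}+\langle\cdot,\cdot\rangle_m$. It is regular if $\mathcal{D}(\mathcal{E})\cap C_c(E)$ is $\mathcal{E}_1$-dense in $\mathcal{D}(\mathcal{E})$ and sup-norm dense in $C_c(E)$ (continuous functions with compact support). $\mathcal{L}$ is the non-positive self-adjoint operator with $\mathcal{D}(\mathcal{E})=\mathcal{D}(\sqrt{-\mathcal{L}})$,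 $\mathcal{E}(f,g)=\langle\sqrt{-\mathcal{L}}f,\sqrt{-\mathcal{L}}g\rangle_m$. A nest is an increasing sequence of closed sets $F_k$ with $\bigcup_k\{f\in\mathcal{D}(\mathcal{E}): f=0\ m\text{-a.e. on }E\setminus F_k\}$ $\mathcal{E}_1$-dense in $\mathcal{D}(\mathcal{E})$; a set is $\mathcal{E}$-polar if it is contained in $\bigcap_k(E\setminus F_k)$ for some nest. A positive Borel measure is smooth if it charges no $\mathcal{E}$-polar set and is finite on each $F_k$ of some nest. A signed smooth Radon measure is $\mu=\mu^+-\mu^-$ with $\mu^\pm$ smooth Radon measures. Schrödinger form. $\mathcal{E}^\mu(f,g):=\mathcal{E}(f,g)+\int_E fg\,d\mu^+-\int_E fg\,d\mu^-$ for $f,g\in\mathcal{D}(\mathcal{E})\cap C_c(E)$. When this is non-negative definite and closable on $L^2(E;m)$, $(\mathcal{E}^\mu,\mathcal{D}(\mathcal{E}^\mu))$ denotes its closure, $\mathcal{L}^\mu$ ("$=\mathcal{L}-\mu$") the associated non-positive self-adjoint operator and $T_t^\mu=e^{t\mathcal{L}^\mu}$. Subordination. A Bernstein function here is $\Phi(\lambda)=b\lambda+\int_0^\infty(1-e^{-\lambda s})\,\nu(ds)$ with $b\ge0$ and $\nu$ a Radon measure on $(0,\infty)$ with $\int_0^\infty(1\wedge s)\,\nu(ds)<\infty$. Put $\mathcal{L}^{\mu,\Phi}:=-\Phi(-\mathcal{L}^\mu)$, $T_t^{\mu,\Phi}:=e^{t\mathcal{L}^{\mu,\Phi}}$, $\mathcal{D}(\mathcal{E}^{\mu,\Phi})=\mathcal{D}(\sqrt{-\mathcal{L}^{\mu,\Phi}})$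 and $\mathcal{E}^{\mu,\Phi}(f,g)=\langle\sqrt{-\mathcal{L}^{\mu,\Phi}}f,\sqrt{-\mathcal{L}^{\mu,\Phi}}g\rangle_m$. The range is $R(\sqrt{-\mathcal{L}^{\mu,\Phi}}):=\{\sqrt{-\mathcal{L}^{\mu,\Phi}}u: u\in\mathcal{D}(\sqrt{-\mathcal{L}^{\mu,\Phi}})\}$. Extended space. $\mathcal{D}_e(\sqrt{-\mathcal{L}^{\mu,\Phi}}):=\mathcal{D}_e(\mathcal{E}^{\mu,\Phi})$ is the set of ($m$-classes of) $m$-a.e. finite measurable $u$ for which there is an $\mathcal{E}^{\mu,\Phi}$-Cauchy sequence $\{u_n\}\subset\mathcal{D}(\mathcal{E}^{\mu,\Phi})$ with $u_n\to u$ $m$-a.e. (an approximating sequence); $\mathcal{E}^{\mu,\Phi}(u,u):=\lim_n\mathcal{E}^{\mu,\Phi}(u_n,u_n)$ (well defined). Dual-type spaces. $\mathcal{D}^*(\sqrt{-\mathcal{L}^{\mu,\Phi}})$ is the set of $f$ for which there is $C$ with $|\langle f,u\rangle_m|\le C\sqrt{\mathcal{E}^{\mu,\Phi}(u,u)}$ for all $u\in\mathcal{D}(\sqrt{-\mathcal{L}^{\mu,\Phi}})$. $\mathcal{D}_e^*(\sqrt{-\mathcal{L}^{\mu,\Phi}})$ is the set of $f$ for which there is $C$ with $|\langle f,u\rangle_m|\le C\sqrt{\mathcal{E}^{\mu,\Phi}(u,u)}$ for all $u\in\mathcal{D}_e(\sqrt{-\mathcal{L}^{\mu,\Phi}})$,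 where for such $u$ the pairing $\langle f,u\rangle_m$ is defined as $\lim_n\langle f,u_n\rangle_m$ along an approximating sequence $\{u_n\}$ of $u$ (membership includes existence of this limit and its independence of the approximating sequence). $G^{\mu,\Phi}f:=\int_0^\infty T_t^{\mu,\Phi}f\,dt$, and $\langle f,G^{\mu,\Phi}f\rangle_m$ is understood as $\int_0^\infty\langle f,T_t^{\mu,\Phi}f\rangle_m\,dt\in[0,\infty]$. *)

theory Defs
  imports "HOL-Analysis.Analysis"
begin

section \<open>Real \<open>L\<^sup>2(E;m)\<close>\<close>

text \<open>
  The elements of \<open>L\<^sup>2(E;m)\<close>, and more generally \<open>m\<close>-classes of measurable functions, are handled
  through their real-valued representatives.  Every set of functions and every operator graph below
  that stands for an object on \<open>m\<close>-classes is closed under \<open>m\<close>-a.e. equality, so equality of such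
  sets is equality of the corresponding sets of classes.
\<close>

definition L2_space :: "'a measure \<Rightarrow> ('a \<Rightarrow> real) set" where
  "L2_space m = {f \<in> borel_measurable m. integrable m (\<lambda>x. (f x)\<^sup>2)}"

definition L2_inner :: "'a measure \<Rightarrow> ('a \<Rightarrow> real) \<Rightarrow> ('a \<Rightarrow> real) \<Rightarrow> real" where
  "L2_inner m f g = (\<integral>x. f x * g x \<partial>m)"

definition L2_tendsto ::
    "'a measure \<Rightarrow> (nat \<Rightarrow> 'a \<Rightarrow> real) \<Rightarrow> ('a \<Rightarrow> real) \<Rightarrow> bool" where
  "L2_tendsto m u f \<longleftrightarrow>
     (\<lambda>n. L2_inner m (\<lambda>x. u n x - f x) (\<lambda>x. u n x - f x)) \<longlonglongrightarrow> 0"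


section \<open>Operators and functional calculus on \<open>L\<^sup>2(E;m)\<close>\<close>

text \<open>
  An (unbounded) operator is its graph, a relation between representatives; its domain and range
  are \<^const>\<open>Domain\<close> and \<^const>\<open>Range\<close>.
\<close>

type_synonym 'a operator = "(('a \<Rightarrow> real) \<times> ('a \<Rightarrow> real)) set"

text \<open>A representative of the value of the operator.\<close>

definition op_app :: "'a operator \<Rightarrow> ('a \<Rightarrow> real) \<Rightarrow> ('a \<Rightarrow> real)" where
  "op_app A f = (SOME g. (f, g) \<in> A)"

definition op_neg :: "'a operator \<Rightarrow> 'a operator" where
  "op_neg A = {(f, \<lambda>x. - g x) | f g. (f, g) \<in> A}"

text \<open>
  Densely defined and equal to its adjoint.  Linearity and being single-valued up to \<open>m\<close>-a.e.
  equality follow from \<open>A = A\<^sup>*\<close> and the density of the domain.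
\<close>

definition self_adjoint_op :: "'a measure \<Rightarrow> 'a operator \<Rightarrow> bool" where
  "self_adjoint_op m A \<longleftrightarrow>
     A \<subseteq> L2_space m \<times> L2_space m \<and>
     (\<forall>f\<in>L2_space m. \<forall>e>0. \<exists>g\<in>Domain A. L2_inner m (\<lambda>x. f x - g x) (\<lambda>x. f x - g x) < e) \<and>
     (\<forall>f\<in>L2_space m. \<forall>g\<in>L2_space m.
        (f, g) \<in> A \<longleftrightarrow> (\<forall>(u, v)\<in>A. L2_inner m f v = L2_inner m g u))"

definition nonpos_self_adjoint :: "'a measure \<Rightarrow> 'a operator \<Rightarrow> bool" where
  "nonpos_self_adjoint m L \<longleftrightarrow>
     self_adjoint_op m L \<and> (\<forall>(f, g)\<in>L. L2_inner m g f \<le> 0)"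

text \<open>
  Projection-valued measures on the Borel sets of \<open>[0,\<infinity>)\<close>.  Linearity of \<open>P B\<close> and its
  compatibility with \<open>m\<close>-a.e. equality follow from its symmetry on all of \<open>L\<^sup>2(E;m)\<close>, and
  \<open>P B\<close> is idempotent by the case \<open>B = C\<close> of multiplicativity.
\<close>

definition projection_valued_measure ::
    "'a measure \<Rightarrow> (real set \<Rightarrow> ('a \<Rightarrow> real) \<Rightarrow> ('a \<Rightarrow> real)) \<Rightarrow> bool" where
  "projection_valued_measure m P \<longleftrightarrow>
     (\<forall>B\<in>sets (restrict_space borel {0..}). \<forall>f\<in>L2_space m. P B f \<in> L2_space m) \<and>
     (\<forall>B\<in>sets (restrict_space borel {0..}). \<forall>f\<in>L2_space m. \<forall>g\<in>L2_space m.
        L2_inner m (P B f) g = L2_inner m f (P B g)) \<and>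
     (\<forall>B\<in>sets (restrict_space borel {0..}). \<forall>C\<in>sets (restrict_space borel {0..}).
        \<forall>f\<in>L2_space m. AE x in m. P B (P C f) x = P (B \<inter> C) f x) \<and>
     (\<forall>f\<in>L2_space m. AE x in m. P {0..} f x = f x) \<and>
     (\<forall>B :: nat \<Rightarrow> real set.
        range B \<subseteq> sets (restrict_space borel {0..}) \<and> disjoint_family B \<longrightarrow>
        (\<forall>f\<in>L2_space m.
           (\<lambda>i. L2_inner m (P (B i) f) f) sums L2_inner m (P (\<Union>i. B i) f) f))"

text \<open>The scalar spectral measure \<open>B \<mapsto> \<langle>P(B) f, f\<rangle>\<close> of \<open>f\<close>.\<close>

definition scalar_spectral_measure ::
    "'a measure \<Rightarrow> (real set \<Rightarrow> ('a \<Rightarrow> real) \<Rightarrow> ('a \<Rightarrow> real)) \<Rightarrow> ('a \<Rightarrow> real) \<Rightarrow> real measure" where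
  "scalar_spectral_measure m P f =
     measure_of {0..} (sets (restrict_space borel {0..})) (\<lambda>B. ennreal (L2_inner m (P B f) f))"

text \<open>
  The operator \<open>\<integral> h dP\<close>: its domain consists of the \<open>u\<close> with \<open>\<integral> h\<^sup>2 d\<langle>P u, u\<rangle> < \<infinity>\<close>, and it is
  given there by \<open>\<langle>(\<integral> h dP) u, w\<rangle> = \<integral> h d\<langle>P u, w\<rangle>\<close> for all \<open>w\<close> in the (dense) domain, where the
  signed measure \<open>\<langle>P u, w\<rangle>\<close> is written by polarization.
\<close>

definition spectral_integral ::
    "'a measure \<Rightarrow> (real set \<Rightarrow> ('a \<Rightarrow> real) \<Rightarrow> ('a \<Rightarrow> real)) \<Rightarrow> (real \<Rightarrow> real) \<Rightarrow> 'a operator" where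
  "spectral_integral m P h =
     {(u, v). u \<in> L2_space m \<and> v \<in> L2_space m \<and>
        integrable (scalar_spectral_measure m P u) (\<lambda>l. (h l)\<^sup>2) \<and>
        (\<forall>w\<in>L2_space m. integrable (scalar_spectral_measure m P w) (\<lambda>l. (h l)\<^sup>2) \<longrightarrow>
           L2_inner m v w =
             ((\<integral>l. h l \<partial>scalar_spectral_measure m P (\<lambda>x. u x + w x)) -
              (\<integral>l. h l \<partial>scalar_spectral_measure m P (\<lambda>x. u x - w x))) / 4)}"

text \<open>
  For a non-negative self-adjoint operator the spectral resolution exists by the spectral theorem
  and is unique up to the choice of representatives of \<open>P B f\<close>.
\<close>

definition spectral_resolution ::
    "'a measure \<Rightarrow> 'a operator \<Rightarrow> real set \<Rightarrow> ('a \<Rightarrow> real) \<Rightarrow> ('a \<Rightarrow> real)" where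
  "spectral_resolution m A =
     (SOME P. projection_valued_measure m P \<and> spectral_integral m P (\<lambda>l. l) = A)"

text \<open>\<open>h(A)\<close> for a non-negative self-adjoint \<open>A\<close>; only the values of \<open>h\<close> on \<open>[0,\<infinity>)\<close> matter.\<close>

definition op_fun :: "'a measure \<Rightarrow> (real \<Rightarrow> real) \<Rightarrow> 'a operator \<Rightarrow> 'a operator" where
  "op_fun m h A = spectral_integral m (spectral_resolution m A) h"

definition sqrt_neg :: "'a measure \<Rightarrow> 'a operator \<Rightarrow> 'a operator" where
  "sqrt_neg m L = op_fun m sqrt (op_neg L)"

text \<open>\<open>e\<^bsup>tL\<^esup>\<close> for a non-positive self-adjoint \<open>L\<close>.\<close>

definition semigroup_op :: "'a measure \<Rightarrow> 'a operator \<Rightarrow> real \<Rightarrow> 'a operator" where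
  "semigroup_op m L t = op_fun m (\<lambda>l. exp (- t * l)) (op_neg L)"


section \<open>Symmetric forms\<close>

type_synonym 'a form = "('a \<Rightarrow> real) \<Rightarrow> ('a \<Rightarrow> real) \<Rightarrow> real"

definition form_plus_inner :: "'a measure \<Rightarrow> 'a form \<Rightarrow> 'a form" where
  "form_plus_inner m \<E> f g = \<E> f g + L2_inner m f g"

definition form_Cauchy :: "'a form \<Rightarrow> (nat \<Rightarrow> 'a \<Rightarrow> real) \<Rightarrow> bool" where
  "form_Cauchy \<E> u \<longleftrightarrow>
     (\<forall>e>0. \<exists>N. \<forall>i\<ge>N. \<forall>j\<ge>N. \<E> (\<lambda>x. u i x - u j x) (\<lambda>x. u i x - u j x) < e)"

definition form_dense :: "'a form \<Rightarrow> ('a \<Rightarrow> real) set \<Rightarrow> ('a \<Rightarrow> real) set \<Rightarrow> bool" where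
  "form_dense \<E> S D \<longleftrightarrow>
     (\<forall>f\<in>D. \<forall>e>0. \<exists>g\<in>S. \<E> (\<lambda>x. f x - g x) (\<lambda>x. f x - g x) < e)"

text \<open>
  A densely defined, non-negative definite, symmetric bilinear form on \<open>L\<^sup>2(E;m)\<close>.  The third and
  fourth conjuncts say that the domain and the form are defined on \<open>m\<close>-classes.
\<close>

definition symmetric_form :: "'a measure \<Rightarrow> ('a \<Rightarrow> real) set \<Rightarrow> 'a form \<Rightarrow> bool" where
  "symmetric_form m D \<E> \<longleftrightarrow>
     D \<subseteq> L2_space m \<and>
     (\<forall>f\<in>L2_space m. \<forall>e>0. \<exists>g\<in>D. L2_inner m (\<lambda>x. f x - g x) (\<lambda>x. f x - g x) < e) \<and>
     (\<forall>f\<in>D. \<forall>g\<in>borel_measurable m. (AE x in m. f x = g x) \<longrightarrow> g \<in> D) \<and>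
     (\<forall>f\<in>D. \<forall>g\<in>D. \<forall>h\<in>D. (AE x in m. f x = g x) \<longrightarrow> \<E> f h = \<E> g h) \<and>
     (\<lambda>x. 0) \<in> D \<and>
     (\<forall>f\<in>D. \<forall>g\<in>D. (\<lambda>x. f x + g x) \<in> D) \<and>
     (\<forall>c. \<forall>f\<in>D. (\<lambda>x. c * f x) \<in> D) \<and>
     (\<forall>f\<in>D. \<forall>g\<in>D. \<forall>h\<in>D. \<E> (\<lambda>x. f x + g x) h = \<E> f h + \<E> g h) \<and>
     (\<forall>c. \<forall>f\<in>D. \<forall>g\<in>D. \<E> (\<lambda>x. c * f x) g = c * \<E> f g) \<and>
     (\<forall>f\<in>D. \<forall>g\<in>D. \<E> f g = \<E> g f) \<and>
     (\<forall>f\<in>D. \<E> f f \<ge> 0)"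

definition closed_form :: "'a measure \<Rightarrow> ('a \<Rightarrow> real) set \<Rightarrow> 'a form \<Rightarrow> bool" where
  "closed_form m D \<E> \<longleftrightarrow>
     (\<forall>u. (\<forall>n. u n \<in> D) \<and> form_Cauchy (form_plus_inner m \<E>) u \<longrightarrow>
        (\<exists>f\<in>D. (\<lambda>n. form_plus_inner m \<E> (\<lambda>x. u n x - f x) (\<lambda>x. u n x - f x)) \<longlonglongrightarrow> 0))"

definition dirichlet_form :: "'a measure \<Rightarrow> ('a \<Rightarrow> real) set \<Rightarrow> 'a form \<Rightarrow> bool" where
  "dirichlet_form m D \<E> \<longleftrightarrow>
     symmetric_form m D \<E> \<and> closed_form m D \<E> \<and>
     (\<forall>f\<in>D. (\<lambda>x. min (max 0 (f x)) 1) \<in> D \<and>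
        \<E> (\<lambda>x. min (max 0 (f x)) 1) (\<lambda>x. min (max 0 (f x)) 1) \<le> \<E> f f)"

definition Cc :: "('a::topological_space \<Rightarrow> real) set" where
  "Cc = {f. continuous_on UNIV f \<and> compact (closure {x. f x \<noteq> 0})}"

definition regular_form ::
    "'a::topological_space measure \<Rightarrow> ('a \<Rightarrow> real) set \<Rightarrow> 'a form \<Rightarrow> bool" where
  "regular_form m D \<E> \<longleftrightarrow>
     form_dense (form_plus_inner m \<E>) (D \<inter> Cc) D \<and>
     (\<forall>f\<in>Cc. \<forall>e>0. \<exists>g\<in>D \<inter> Cc. \<forall>x. \<bar>f x - g x\<bar> < e)"

definition nonneg_definite_on :: "('a \<Rightarrow> real) set \<Rightarrow> 'a form \<Rightarrow> bool" where
  "nonneg_definite_on C \<E> \<longleftrightarrow> (\<forall>f\<in>C. \<E> f f \<ge> 0)"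

definition closable_form :: "'a measure \<Rightarrow> ('a \<Rightarrow> real) set \<Rightarrow> 'a form \<Rightarrow> bool" where
  "closable_form m C \<E> \<longleftrightarrow>
     (\<forall>u. (\<forall>n. u n \<in> C) \<and> form_Cauchy \<E> u \<and> L2_tendsto m u (\<lambda>x. 0) \<longrightarrow>
        (\<lambda>n. \<E> (u n) (u n)) \<longlonglongrightarrow> 0)"

definition closure_approx ::
    "'a measure \<Rightarrow> ('a \<Rightarrow> real) set \<Rightarrow> 'a form \<Rightarrow> (nat \<Rightarrow> 'a \<Rightarrow> real) \<Rightarrow> ('a \<Rightarrow> real) \<Rightarrow> bool" where
  "closure_approx m C \<E> u f \<longleftrightarrow> (\<forall>n. u n \<in> C) \<and> form_Cauchy \<E> u \<and> L2_tendsto m u f"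

definition closure_dom :: "'a measure \<Rightarrow> ('a \<Rightarrow> real) set \<Rightarrow> 'a form \<Rightarrow> ('a \<Rightarrow> real) set" where
  "closure_dom m C \<E> = {f \<in> L2_space m. \<exists>u. closure_approx m C \<E> u f}"

definition closure_form :: "'a measure \<Rightarrow> ('a \<Rightarrow> real) set \<Rightarrow> 'a form \<Rightarrow> 'a form" where
  "closure_form m C \<E> f g =
     (THE c. \<forall>u v. closure_approx m C \<E> u f \<and> closure_approx m C \<E> v g \<longrightarrow>
        (\<lambda>n. \<E> (u n) (v n)) \<longlonglongrightarrow> c)"

text \<open>
  The form \<open>\<langle>\<surd>(-L) f, \<surd>(-L) g\<rangle>\<close> on \<open>D(\<surd>(-L))\<close> of a non-positive self-adjoint \<open>L\<close>, and
  conversely the (unique) non-positive self-adjoint operator associated with a closed form.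
\<close>

definition op_form_dom :: "'a measure \<Rightarrow> 'a operator \<Rightarrow> ('a \<Rightarrow> real) set" where
  "op_form_dom m L = Domain (sqrt_neg m L)"

definition op_form :: "'a measure \<Rightarrow> 'a operator \<Rightarrow> 'a form" where
  "op_form m L f g = L2_inner m (op_app (sqrt_neg m L) f) (op_app (sqrt_neg m L) g)"

definition form_generator :: "'a measure \<Rightarrow> ('a \<Rightarrow> real) set \<Rightarrow> 'a form \<Rightarrow> 'a operator" where
  "form_generator m D \<E> =
     (SOME L. nonpos_self_adjoint m L \<and> op_form_dom m L = D \<and>
        (\<forall>f\<in>D. \<forall>g\<in>D. \<E> f g = op_form m L f g))"


section \<open>Radon and smooth measures\<close>

text \<open>
  Radon measures on a subspace \<open>S\<close>.  On the spaces considered here (locally compact and second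
  countable) a Borel measure that is finite on compact sets is automatically regular.
\<close>

definition radon_on :: "'a::topological_space set \<Rightarrow> 'a measure \<Rightarrow> bool" where
  "radon_on S M \<longleftrightarrow>
     sets M = sets (restrict_space borel S) \<and>
     (\<forall>K. compact K \<and> K \<subseteq> S \<longrightarrow> emeasure M K < \<infinity>)"

definition full_support :: "'a::topological_space measure \<Rightarrow> bool" where
  "full_support m \<longleftrightarrow> (\<forall>U. open U \<and> U \<noteq> {} \<longrightarrow> emeasure m U > 0)"

definition is_nest ::
    "'a::topological_space measure \<Rightarrow> ('a \<Rightarrow> real) set \<Rightarrow> 'a form \<Rightarrow> (nat \<Rightarrow> 'a set) \<Rightarrow> bool" where
  "is_nest m D \<E> F \<longleftrightarrow>
     (\<forall>k. closed (F k)) \<and> incseq F \<and>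
     form_dense (form_plus_inner m \<E>) (\<Union>k. {f \<in> D. AE x in m. x \<notin> F k \<longrightarrow> f x = 0}) D"

definition polar_set ::
    "'a::topological_space measure \<Rightarrow> ('a \<Rightarrow> real) set \<Rightarrow> 'a form \<Rightarrow> 'a set \<Rightarrow> bool" where
  "polar_set m D \<E> N \<longleftrightarrow> (\<exists>F. is_nest m D \<E> F \<and> N \<subseteq> (\<Inter>k. - F k))"

definition smooth_measure ::
    "'a::topological_space measure \<Rightarrow> ('a \<Rightarrow> real) set \<Rightarrow> 'a form \<Rightarrow> 'a measure \<Rightarrow> bool" where
  "smooth_measure m D \<E> \<mu> \<longleftrightarrow>
     sets \<mu> = sets borel \<and>
     (\<forall>N\<in>sets borel. polar_set m D \<E> N \<longrightarrow> emeasure \<mu> N = 0) \<and>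
     (\<exists>F. is_nest m D \<E> F \<and> (\<forall>k. emeasure \<mu> (F k) < \<infinity>))"

definition smooth_radon_measure ::
    "'a::topological_space measure \<Rightarrow> ('a \<Rightarrow> real) set \<Rightarrow> 'a form \<Rightarrow> 'a measure \<Rightarrow> bool" where
  "smooth_radon_measure m D \<E> \<mu> \<longleftrightarrow> smooth_measure m D \<E> \<mu> \<and> radon_on UNIV \<mu>"


section \<open>Schroedinger forms and subordination\<close>

text \<open>
  The signed measure \<open>\<mu> = \<mu>\<^sup>+ - \<mu>\<^sup>-\<close> is given by the pair \<open>\<mu>p\<close>, \<open>\<mu>n\<close>.
\<close>

definition schroedinger_form :: "'a form \<Rightarrow> 'a measure \<Rightarrow> 'a measure \<Rightarrow> 'a form" where
  "schroedinger_form \<E> \<mu>p \<mu>n f g = \<E> f g + (\<integral>x. f x * g x \<partial>\<mu>p) - (\<integral>x. f x * g x \<partial>\<mu>n)"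

definition schroedinger_operator ::
    "'a::topological_space measure \<Rightarrow> ('a \<Rightarrow> real) set \<Rightarrow> 'a form \<Rightarrow> 'a measure \<Rightarrow> 'a measure
      \<Rightarrow> 'a operator" where
  "schroedinger_operator m D \<E> \<mu>p \<mu>n =
     form_generator m (closure_dom m (D \<inter> Cc) (schroedinger_form \<E> \<mu>p \<mu>n))
                      (closure_form m (D \<inter> Cc) (schroedinger_form \<E> \<mu>p \<mu>n))"

definition bernstein_function :: "(real \<Rightarrow> real) \<Rightarrow> bool" where
  "bernstein_function \<Phi> \<longleftrightarrow>
     (\<exists>b \<nu>. 0 \<le> b \<and> radon_on {0<..} \<nu> \<and> (\<integral>\<^sup>+ s. ennreal (min 1 s) \<partial>\<nu>) < \<infinity> \<and>
        (\<forall>l\<ge>0. \<Phi> l = b * l + (\<integral>s. 1 - exp (- l * s) \<partial>\<nu>)))"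

definition subordinate_operator :: "'a measure \<Rightarrow> (real \<Rightarrow> real) \<Rightarrow> 'a operator \<Rightarrow> 'a operator" where
  "subordinate_operator m \<Phi> L = op_neg (op_fun m \<Phi> (op_neg L))"


section \<open>Extended space, dual-type spaces, Green energy\<close>

definition ext_approx ::
    "'a measure \<Rightarrow> 'a operator \<Rightarrow> (nat \<Rightarrow> 'a \<Rightarrow> real) \<Rightarrow> ('a \<Rightarrow> real) \<Rightarrow> bool" where
  "ext_approx m L us u \<longleftrightarrow>
     (\<forall>n. us n \<in> op_form_dom m L) \<and> form_Cauchy (op_form m L) us \<and>
     (AE x in m. (\<lambda>n. us n x) \<longlonglongrightarrow> u x)"

text \<open>An \<open>m\<close>-a.e. finite measurable function has a real-valued representative.\<close>

definition ext_dom :: "'a measure \<Rightarrow> 'a operator \<Rightarrow> ('a \<Rightarrow> real) set" where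
  "ext_dom m L = {u \<in> borel_measurable m. \<exists>us. ext_approx m L us u}"

definition ext_form :: "'a measure \<Rightarrow> 'a operator \<Rightarrow> ('a \<Rightarrow> real) \<Rightarrow> real" where
  "ext_form m L u =
     (THE c. \<forall>us. ext_approx m L us u \<longrightarrow> (\<lambda>n. op_form m L (us n) (us n)) \<longlonglongrightarrow> c)"

definition dual_dom :: "'a measure \<Rightarrow> 'a operator \<Rightarrow> ('a \<Rightarrow> real) set" where
  "dual_dom m L =
     {f \<in> borel_measurable m. \<exists>C. \<forall>u\<in>op_form_dom m L.
        integrable m (\<lambda>x. f x * u x) \<and> \<bar>L2_inner m f u\<bar> \<le> C * sqrt (op_form m L u u)}"

text \<open>The number \<open>p\<close> is the pairing \<open>\<langle>f, u\<rangle>\<close> for \<open>u\<close> in the extended space.\<close>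

definition ext_dual_dom :: "'a measure \<Rightarrow> 'a operator \<Rightarrow> ('a \<Rightarrow> real) set" where
  "ext_dual_dom m L =
     {f \<in> borel_measurable m. \<exists>C. \<forall>u\<in>ext_dom m L. \<exists>p.
        (\<forall>us. ext_approx m L us u \<longrightarrow>
           (\<forall>n. integrable m (\<lambda>x. f x * us n x)) \<and> (\<lambda>n. L2_inner m f (us n)) \<longlonglongrightarrow> p) \<and>
        \<bar>p\<bar> \<le> C * sqrt (ext_form m L u)}"

text \<open>\<open>\<langle>f, G f\<rangle> = \<integral>\<^sub>0\<^sup>\<infinity> \<langle>f, T\<^sub>t f\<rangle> dt\<close> in \<open>[0,\<infinity>]\<close>; the integrand is non-negative.\<close>

definition green_energy :: "'a measure \<Rightarrow> 'a operator \<Rightarrow> ('a \<Rightarrow> real) \<Rightarrow> ennreal" where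
  "green_energy m L f =
     (\<integral>\<^sup>+ t \<in> {0..}. ennreal (L2_inner m f (op_app (semigroup_op m L t) f)) \<partial>lborel)"

end

theory Submission
  imports Defs "HOL-Probability.Probability" "HOL-Library.Function_Algebras"
begin

text \<open>
  Let \<open>A\<close> be the negative of the subordinate operator and \<open>\<E>\<close> its form.  If \<open>f = \<surd>A g\<close>, then \<open>\<langle>f, u\<rangle> = \<langle>g, \<surd>A u\<rangle>\<close> is bounded by
  \<open>\<parallel>g\<parallel> \<surd>\<E>(u, u)\<close>; conversely such a bound represents \<open>f\<close> weakly by an \<open>\<E>\<close>-Cauchy sequence \<open>u\<^sub>n\<close>
  (Riesz), and \<open>f = \<surd>A (lim \<surd>A u\<^sub>n)\<close> because \<open>\<surd>A\<close> is self-adjoint.  By Fubini \<open>\<langle>f, G f\<rangle>\<close> is the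
  integral of \<open>1/\<lambda>\<close> against the spectral measure of \<open>f\<close>, which is finite exactly on the range.

  The extended space needs that an \<open>\<E>\<close>-Cauchy sequence tending to \<open>0\<close> a.e. has energies tending to
  \<open>0\<close>.  The form is not Markovian, but \<open>\<E>(|u|, |u|) \<le> \<E>(u, u)\<close> survives all constructions: it holds on
  the core of the Schroedinger form, makes the resolvent (a minimizer) and hence the semigroup
  positivity preserving, and passes from the semigroup to the subordinate form.  By lower
  semicontinuity, the positive parts of members far apart in the sequence have almost nonpositive
  mutual energy, and so have the negative parts; hence averages have small energy.

  The spectral theorem is obtained from the resolvent \<open>G = (1 + A)\<^sup>-\<^sup>1\<close>: since \<open>0 \<le> G \<le> 1\<close>, the numbers
  \<open>\<langle>G\<^sup>n f, f\<rangle>\<close> solve a Hausdorff moment problem, whose solution is the spectral measure of \<open>f\<close>.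
\<close>

section \<open>Semi-inner products on spaces of functions\<close>

text \<open>Functions stand for themselves, not for classes, so inner products and forms are only
  semidefinite and identities of vectors are stated weakly, by pairing with all \<open>w\<close>.
  Since a self-adjoint graph is its own adjoint, the same pairing proves its linearity, closedness
  and invariance under a.e. changes. \<open>spectral_resolution\<close> is an arbitrary choice,
  hence the resolution behind the subordinate operator need not be the image under
  \<open>\<Phi>\<close> of the one behind the Schroedinger operator. The square roots are compared
  through their forms: both closed forms equal \<open>\<langle>A u, u\<rangle>\<close> on the domain
  of \<open>A\<close>, which is a core of both. Closedness controls Cauchy sequences with an
  \<open>L\<^sup>2\<close> limit, but an approximating sequence of the extended space converges only
  a.e. and may be unbounded in \<open>L\<^sup>2\<close>. Domination restores
  \<open>L\<^sup>2\<close> convergence: for nonnegative \<open>u\<close> and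
  \<open>r\<^sub>n\<close> the positive part of \<open>k u - r\<^sub>n\<close> lies between
  \<open>0\<close> and \<open>k u\<close>. In the energies the term
  \<open>k\<^sup>2 \<E>(u, u)\<close> cancels while the cross term is linear in \<open>k\<close>, so
  large \<open>k\<close> forces the cross term to be small.\<close>

instantiation "fun" :: (type, real_vector) real_vector
begin

text \<open>The pointwise structure makes \<open>subspace\<close>, finite sums and their library
  lemmas available for sets of functions such as \<open>L2_space m\<close>.\<close>

definition "c *\<^sub>R f = (\<lambda>x. c *\<^sub>R f x)"

instance
  by standard (simp_all add: scaleR_fun_def fun_eq_iff algebra_simps)

end

lemma scaleR_fun_apply [simp]: "(c *\<^sub>R f) x = c *\<^sub>R f x"
  by (simp add: scaleR_fun_def)

definition form_tendsto :: "'a form \<Rightarrow> (nat \<Rightarrow> 'a \<Rightarrow> real) \<Rightarrow> ('a \<Rightarrow> real) \<Rightarrow> bool" where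
  "form_tendsto B u f \<longleftrightarrow> (\<lambda>n. B (u n - f) (u n - f)) \<longlonglongrightarrow> 0"

lemma L2_tendsto_eq: "L2_tendsto m u f \<longleftrightarrow> form_tendsto (L2_inner m) u f"
  by (simp add: L2_tendsto_def form_tendsto_def fun_diff_def)

lemma form_Cauchy_eq:
  "form_Cauchy B u \<longleftrightarrow> (\<forall>e>0. \<exists>N. \<forall>i\<ge>N. \<forall>j\<ge>N. B (u i - u j) (u i - u j) < e)"
  by (simp add: form_Cauchy_def fun_diff_def)

text \<open>Semidefinite, because a function that vanishes a.e. has norm zero without being
  \<open>0\<close>. The laws are asked only on \<open>V\<close>, since a form carries no information
  outside its domain.\<close>

locale semi_inner_space =
  fixes V :: "('a \<Rightarrow> real) set" and B :: "'a form"
  assumes subspace_V: "subspace V"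
    and add_left: "x \<in> V \<Longrightarrow> y \<in> V \<Longrightarrow> z \<in> V \<Longrightarrow> B (x + y) z = B x z + B y z"
    and scale_left: "x \<in> V \<Longrightarrow> y \<in> V \<Longrightarrow> B (c *\<^sub>R x) y = c * B x y"
    and sym: "x \<in> V \<Longrightarrow> y \<in> V \<Longrightarrow> B x y = B y x"
    and nonneg: "x \<in> V \<Longrightarrow> B x x \<ge> 0"
begin

lemma V_mem [simp, intro]:
  "0 \<in> V" "x \<in> V \<Longrightarrow> y \<in> V \<Longrightarrow> x + y \<in> V" "x \<in> V \<Longrightarrow> y \<in> V \<Longrightarrow> x - y \<in> V"
  "x \<in> V \<Longrightarrow> c *\<^sub>R x \<in> V" "x \<in> V \<Longrightarrow> - x \<in> V"
  using subspace_V by (auto simp: subspace_0 subspace_add subspace_diff subspace_scale subspace_neg)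

lemma V_sum [intro]: "(\<And>i. i \<in> I \<Longrightarrow> f i \<in> V) \<Longrightarrow> (\<Sum>i\<in>I. f i) \<in> V"
  using subspace_V by (rule subspace_sum)

lemma add_right: "x \<in> V \<Longrightarrow> y \<in> V \<Longrightarrow> z \<in> V \<Longrightarrow> B z (x + y) = B z x + B z y"
  by (metis add_left sym V_mem(2))

lemma scale_right: "x \<in> V \<Longrightarrow> y \<in> V \<Longrightarrow> B x (c *\<^sub>R y) = c * B x y"
  by (metis scale_left sym V_mem(4))

lemma minus_left: "x \<in> V \<Longrightarrow> y \<in> V \<Longrightarrow> B (- x) y = - B x y"
  using scale_left[of x y "-1"] by simp

lemma minus_right: "x \<in> V \<Longrightarrow> y \<in> V \<Longrightarrow> B x (- y) = - B x y"
  using scale_right[of x y "-1"] by simp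

lemma diff_left: "x \<in> V \<Longrightarrow> y \<in> V \<Longrightarrow> z \<in> V \<Longrightarrow> B (x - y) z = B x z - B y z"
  using add_left[of x "- y" z] by (simp add: minus_left)

lemma diff_right: "x \<in> V \<Longrightarrow> y \<in> V \<Longrightarrow> z \<in> V \<Longrightarrow> B z (x - y) = B z x - B z y"
  using add_right[of x "- y" z] by (simp add: minus_right)

lemma zero_left [simp]: "x \<in> V \<Longrightarrow> B 0 x = 0"
  using scale_left[of 0 x 0] by simp

lemma zero_right [simp]: "x \<in> V \<Longrightarrow> B x 0 = 0"
  using scale_right[of x 0 0] by simp

lemmas bilin = add_left add_right diff_left diff_right scale_left scale_right minus_left minus_right

lemma sum_left: "(\<And>i. i \<in> I \<Longrightarrow> f i \<in> V) \<Longrightarrow> y \<in> V \<Longrightarrow> B (\<Sum>i\<in>I. f i) y = (\<Sum>i\<in>I. B (f i) y)"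
  by (induction I rule: infinite_finite_induct) (auto simp: add_left V_sum)

lemma sum_right: "(\<And>i. i \<in> I \<Longrightarrow> f i \<in> V) \<Longrightarrow> y \<in> V \<Longrightarrow> B y (\<Sum>i\<in>I. f i) = (\<Sum>i\<in>I. B y (f i))"
  by (induction I rule: infinite_finite_induct) (auto simp: add_right V_sum)

lemma expand_add: "x \<in> V \<Longrightarrow> y \<in> V \<Longrightarrow> B (x + y) (x + y) = B x x + 2 * B x y + B y y"
  by (simp add: bilin sym[of y x])

lemma expand_diff: "x \<in> V \<Longrightarrow> y \<in> V \<Longrightarrow> B (x - y) (x - y) = B x x - 2 * B x y + B y y"
  by (simp add: bilin sym[of y x])

lemma diff_commute: "x \<in> V \<Longrightarrow> y \<in> V \<Longrightarrow> B (x - y) (x - y) = B (y - x) (y - x)"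
  by (simp add: expand_diff sym[of y x])

lemma polarization:
  "x \<in> V \<Longrightarrow> y \<in> V \<Longrightarrow> B x y = (B (x + y) (x + y) - B (x - y) (x - y)) / 4"
  by (simp add: expand_add expand_diff)

lemma Cauchy_Schwarz:
  assumes x: "x \<in> V" and y: "y \<in> V"
  shows "(B x y)\<^sup>2 \<le> B x x * B y y"
proof -
  have *: "0 \<le> B x x - 2 * t * B x y + t\<^sup>2 * B y y" for t
    using nonneg[of "x - t *\<^sub>R y"] x y
    by (simp add: expand_diff bilin power2_eq_square algebra_simps sym[of y x])
  show ?thesis
  proof (cases "B y y = 0")
    case True
    have "B x y = 0"
    proof (rule ccontr)
      assume "B x y \<noteq> 0"
      \<comment> \<open>With \<open>B y y = 0\<close> the polynomial is affine in \<open>t\<close>,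
        and this \<open>t\<close> gives it the value \<open>-1\<close>.\<close>
      then show False
        using *[of "(B x x + 1) / (2 * B x y)"] True by (simp add: field_simps)
    qed
    then show ?thesis using True by simp
  next
    case False
    with nonneg[OF y] have "B y y > 0" by simp
    then show ?thesis using *[of "B x y / B y y"]
      by (simp add: field_simps power2_eq_square)
  qed
qed

lemma abs_le: "x \<in> V \<Longrightarrow> y \<in> V \<Longrightarrow> \<bar>B x y\<bar> \<le> sqrt (B x x) * sqrt (B y y)"
  using Cauchy_Schwarz[of x y] by (metis real_sqrt_abs real_sqrt_le_iff real_sqrt_mult)

lemma null_left: "x \<in> V \<Longrightarrow> y \<in> V \<Longrightarrow> B x x = 0 \<Longrightarrow> B x y = 0"
  using Cauchy_Schwarz[of x y] by simp

lemma triangle: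
  assumes "x \<in> V" "y \<in> V"
  shows "sqrt (B (x + y) (x + y)) \<le> sqrt (B x x) + sqrt (B y y)"
proof (rule real_le_lsqrt)
  show "0 \<le> sqrt (B x x) + sqrt (B y y)" using nonneg assms by simp
  show "B (x + y) (x + y) \<le> (sqrt (B x x) + sqrt (B y y))\<^sup>2"
    using abs_le[OF assms] nonneg assms by (simp add: expand_add power2_sum)
qed

lemma triangle_diff:
  assumes "x \<in> V" "y \<in> V"
  shows "sqrt (B (x - y) (x - y)) \<le> sqrt (B x x) + sqrt (B y y)"
  using triangle[of x "- y"] assms by (simp add: minus_left minus_right)

lemma parallelogram_le:
  assumes "x \<in> V" "y \<in> V"
  shows "B (x + y) (x + y) \<le> 2 * B x x + 2 * B y y" "B (x - y) (x - y) \<le> 2 * B x x + 2 * B y y"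
  using nonneg[of "x - y"] nonneg[of "x + y"] assms by (auto simp: expand_add expand_diff)

lemma dist_sqrt:
  assumes "x \<in> V" "y \<in> V"
  shows "\<bar>sqrt (B x x) - sqrt (B y y)\<bar> \<le> sqrt (B (x - y) (x - y))"
  using triangle[of "x - y" y] triangle[of "y - x" x] assms by (simp add: diff_commute[of y x])

lemma tendsto_left:
  assumes "\<And>n. u n \<in> V" "f \<in> V" "g \<in> V" "form_tendsto B u f"
  shows "(\<lambda>n. B (u n) g) \<longlonglongrightarrow> B f g"
proof -
  have "(\<lambda>n. sqrt (B (u n - f) (u n - f)) * sqrt (B g g)) \<longlonglongrightarrow> sqrt 0 * sqrt (B g g)"
    using assms(4) unfolding form_tendsto_def by (intro tendsto_intros)
  moreover have "norm (B (u n) g - B f g) \<le> sqrt (B (u n - f) (u n - f)) * sqrt (B g g)" for n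
    using abs_le[of "u n - f" g] assms by (simp add: diff_left)
  ultimately have "(\<lambda>n. B (u n) g - B f g) \<longlonglongrightarrow> 0"
    by (intro Lim_null_comparison[of "\<lambda>n. B (u n) g - B f g"]) auto
  then show ?thesis by (simp add: LIM_zero_iff)
qed

lemma tendsto_norm:
  assumes "\<And>n. u n \<in> V" "f \<in> V" "form_tendsto B u f"
  shows "(\<lambda>n. B (u n) (u n)) \<longlonglongrightarrow> B f f"
proof -
  have "(\<lambda>n. B (u n - f) (u n - f) + 2 * B (u n) f - B f f) \<longlonglongrightarrow> 0 + 2 * B f f - B f f"
    using assms(3) tendsto_left[OF assms(1,2,2,3)] unfolding form_tendsto_def
    by (intro tendsto_intros)
  then show ?thesis using assms by (simp add: expand_diff)
qed

lemma tendsto_add: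
  assumes "\<And>n. u n \<in> V" "f \<in> V" "\<And>n. v n \<in> V" "g \<in> V" "form_tendsto B u f" "form_tendsto B v g"
  shows "form_tendsto B (\<lambda>n. u n + v n) (f + g)"
  unfolding form_tendsto_def
proof (rule Lim_null_comparison)
  show "(\<lambda>n. 2 * B (u n - f) (u n - f) + 2 * B (v n - g) (v n - g)) \<longlonglongrightarrow> 0"
    using assms(5,6) unfolding form_tendsto_def by (auto intro!: tendsto_eq_intros)
  have "norm (B (u n + v n - (f + g)) (u n + v n - (f + g))) \<le> 2 * B (u n - f) (u n - f) + 2 * B (v n - g) (v n - g)" for n
    using parallelogram_le(1)[of "u n - f" "v n - g"] nonneg[of "u n + v n - (f + g)"] assms
    by (simp add: algebra_simps)
  then show "\<forall>\<^sub>F n in sequentially. norm (B (u n + v n - (f + g)) (u n + v n - (f + g))) \<le> 2 * B (u n - f) (u n - f) + 2 * B (v n - g) (v n - g)"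
    by simp
qed

lemma tendsto_scale:
  assumes "\<And>n. u n \<in> V" "f \<in> V" "form_tendsto B u f"
  shows "form_tendsto B (\<lambda>n. c *\<^sub>R u n) (c *\<^sub>R f)"
proof -
  have "B (c *\<^sub>R u n - c *\<^sub>R f) (c *\<^sub>R u n - c *\<^sub>R f) = c\<^sup>2 * B (u n - f) (u n - f)" for n
    using assms unfolding scaleR_diff_right[symmetric]
    by (simp add: scale_left scale_right power2_eq_square del: scaleR_diff_right)
  then show ?thesis using assms(3) unfolding form_tendsto_def by (auto intro!: tendsto_eq_intros)
qed

lemma tendsto_diff:
  assumes "\<And>n. u n \<in> V" "f \<in> V" "\<And>n. v n \<in> V" "g \<in> V" "form_tendsto B u f" "form_tendsto B v g"
  shows "form_tendsto B (\<lambda>n. u n - v n) (f - g)"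
  using tendsto_add[of u f "\<lambda>n. (-1) *\<^sub>R v n" "(-1) *\<^sub>R g"] tendsto_scale[of v g "-1"] assms by simp

lemma tendsto_imp_Cauchy:
  assumes "\<And>n. u n \<in> V" "f \<in> V" "form_tendsto B u f"
  shows "form_Cauchy B u"
  unfolding form_Cauchy_eq
proof (intro allI impI)
  fix e :: real assume "e > 0"
  then obtain N where N: "\<And>n. n \<ge> N \<Longrightarrow> B (u n - f) (u n - f) < e / 4"
    using assms(3) order_tendstoD(2)[of "\<lambda>n. B (u n - f) (u n - f)" 0 sequentially "e / 4"]
    unfolding form_tendsto_def eventually_sequentially by auto
  have "B (u i - u j) (u i - u j) < e" if "i \<ge> N" "j \<ge> N" for i j
    using parallelogram_le(2)[of "u i - f" "u j - f"] N[OF that(1)] N[OF that(2)] assms by simp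
  then show "\<exists>N. \<forall>i\<ge>N. \<forall>j\<ge>N. B (u i - u j) (u i - u j) < e" by blast
qed

lemma Cauchy_convergent_norm:
  assumes "\<And>n. u n \<in> V" "form_Cauchy B u"
  shows "convergent (\<lambda>n. B (u n) (u n))"
proof -
  have "Cauchy (\<lambda>n. sqrt (B (u n) (u n)))"
  proof (rule metric_CauchyI)
    fix e :: real assume "e > 0"
    then obtain N where N: "\<And>i j. i \<ge> N \<Longrightarrow> j \<ge> N \<Longrightarrow> B (u i - u j) (u i - u j) < e\<^sup>2"
      using assms(2) unfolding form_Cauchy_eq by (meson zero_less_power)
    have "dist (sqrt (B (u i) (u i))) (sqrt (B (u j) (u j))) < e" if "i \<ge> N" "j \<ge> N" for i j
    proof -
      have "sqrt (B (u i - u j) (u i - u j)) < e"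
        using N[OF that] \<open>e > 0\<close> by (metis real_sqrt_less_iff real_sqrt_abs abs_of_pos)
      with dist_sqrt[of "u i" "u j"] assms(1) show ?thesis by (simp add: dist_real_def)
    qed
    then show "\<exists>M. \<forall>i\<ge>M. \<forall>j\<ge>M. dist (sqrt (B (u i) (u i))) (sqrt (B (u j) (u j))) < e" by blast
  qed
  then obtain l where "(\<lambda>n. sqrt (B (u n) (u n))) \<longlonglongrightarrow> l"
    using Cauchy_convergent convergent_def by blast
  then have "(\<lambda>n. (sqrt (B (u n) (u n)))\<^sup>2) \<longlonglongrightarrow> l\<^sup>2" by (rule tendsto_power)
  then show ?thesis using nonneg assms(1) by (auto simp: convergent_def)
qed

lemma Cauchy_bounded:
  assumes "\<And>n. u n \<in> V" "form_Cauchy B u"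
  obtains K where "K \<ge> 0" "\<And>n. B (u n) (u n) \<le> K"
proof -
  have "Bseq (\<lambda>n. B (u n) (u n))"
    using Cauchy_convergent_norm[OF assms] by (simp add: convergent_imp_Bseq)
  then obtain K where "K > 0" "\<And>n. norm (B (u n) (u n)) \<le> K" by (auto elim: BseqE)
  then show ?thesis by (intro that[of K]) (auto simp: abs_le_iff)
qed

lemma Cauchy_lincomb:
  assumes "\<And>n. u n \<in> V" "\<And>n. v n \<in> V" "form_Cauchy B u" "form_Cauchy B v"
  shows "form_Cauchy B (\<lambda>n. u n + c *\<^sub>R v n)"
  unfolding form_Cauchy_eq
proof (intro allI impI)
  fix e :: real assume "e > 0"
  \<comment> \<open>Scaling by \<open>c\<^sup>2 + 1\<close> rather than \<open>c\<^sup>2\<close>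
    keeps the tolerance for \<open>v\<close> meaningful when \<open>c = 0\<close>.\<close>
  have c1: "c\<^sup>2 + 1 > 0" by (simp add: add_nonneg_pos)
  obtain N where N: "\<And>i j. i \<ge> N \<Longrightarrow> j \<ge> N \<Longrightarrow> B (u i - u j) (u i - u j) < e / 4"
    using assms(3) \<open>e > 0\<close> unfolding form_Cauchy_eq by (meson divide_pos_pos zero_less_numeral)
  have "e / (4 * (c\<^sup>2 + 1)) > 0" using \<open>e > 0\<close> c1 by simp
  then obtain M where M: "\<And>i j. i \<ge> M \<Longrightarrow> j \<ge> M \<Longrightarrow> B (v i - v j) (v i - v j) < e / (4 * (c\<^sup>2 + 1))"
    using assms(4) unfolding form_Cauchy_eq by meson
  have "B (u i + c *\<^sub>R v i - (u j + c *\<^sub>R v j)) (u i + c *\<^sub>R v i - (u j + c *\<^sub>R v j)) < e"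
    if "i \<ge> max N M" "j \<ge> max N M" for i j
  proof -
    have eq: "u i + c *\<^sub>R v i - (u j + c *\<^sub>R v j) = (u i - u j) + c *\<^sub>R (v i - v j)"
      by (simp add: algebra_simps)
    have "c\<^sup>2 * B (v i - v j) (v i - v j) \<le> (c\<^sup>2 + 1) * B (v i - v j) (v i - v j)"
      using nonneg[of "v i - v j"] assms(2) by (simp add: algebra_simps)
    also have "\<dots> \<le> e / 4"
      using M[of i j] that c1 by (simp add: field_simps)
    finally have "c\<^sup>2 * B (v i - v j) (v i - v j) \<le> e / 4" .
    moreover have "B (c *\<^sub>R (v i - v j)) (c *\<^sub>R (v i - v j)) = c\<^sup>2 * B (v i - v j) (v i - v j)"
      using assms(2) by (simp only: scale_left scale_right V_mem power2_eq_square mult.assoc)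
    ultimately show ?thesis
      unfolding eq using parallelogram_le(1)[of "u i - u j" "c *\<^sub>R (v i - v j)"] N[of i j] that assms(1,2)
      by simp
  qed
  then show "\<exists>N. \<forall>i\<ge>N. \<forall>j\<ge>N. B (u i + c *\<^sub>R v i - (u j + c *\<^sub>R v j)) (u i + c *\<^sub>R v i - (u j + c *\<^sub>R v j)) < e"
    by blast
qed

text \<open>The Riesz representation theorem without completeness: a minimizing sequence of
  \<open>v \<mapsto> B v v - 2 \<phi> v\<close> is \<open>B\<close>-Cauchy by the parallelogram law and represents \<open>\<phi>\<close> in the limit.\<close>

lemma Riesz_sequence:
  assumes add: "\<And>x y. x \<in> V \<Longrightarrow> y \<in> V \<Longrightarrow> \<phi> (x + y) = \<phi> x + \<phi> y"
    and scale: "\<And>c x. x \<in> V \<Longrightarrow> \<phi> (c *\<^sub>R x) = c * \<phi> x"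
    and bound: "\<And>x. x \<in> V \<Longrightarrow> (\<phi> x)\<^sup>2 \<le> C * B x x"
  obtains u where "\<And>n. u n \<in> V" "form_Cauchy B u" "\<And>w. w \<in> V \<Longrightarrow> (\<lambda>n. B (u n) w) \<longlonglongrightarrow> \<phi> w"
proof -
  define J where "J v = B v v - 2 * \<phi> v" for v
  have Jge: "- \<bar>C\<bar> \<le> J v" if v: "v \<in> V" for v
  proof -
    have "(\<phi> v)\<^sup>2 \<le> \<bar>C\<bar> * B v v"
      using bound[OF v] nonneg[OF v] by (smt (verit) mult_right_mono)
    then have "\<bar>\<phi> v\<bar> \<le> sqrt (\<bar>C\<bar> * B v v)"
      by (metis real_sqrt_abs real_sqrt_le_iff)
    also have "\<dots> \<le> (\<bar>C\<bar> + B v v) / 2"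
      using arith_geo_mean_sqrt[of "\<bar>C\<bar>" "B v v"] nonneg[OF v] by simp
    finally show ?thesis by (simp add: J_def abs_le_iff field_simps)
  qed
  define d where "d = Inf (J ` V)"
  have bdd: "bdd_below (J ` V)" using Jge by (intro bdd_belowI2)
  have d_le: "d \<le> J v" if "v \<in> V" for v
    unfolding d_def using bdd that by (intro cInf_lower) auto
  have "\<exists>v\<in>V. J v < d + 1 / real (Suc n)" for n
  proof -
    have "d < d + 1 / real (Suc n)" by simp
    then show ?thesis
      using cInf_lessD[of "J ` V" "d + 1 / real (Suc n)"] unfolding d_def by fastforce
  qed
  then obtain u where u: "\<And>n. u n \<in> V" "\<And>n. J (u n) < d + 1 / real (Suc n)" by metis
  have para: "B (u i - u j) (u i - u j) < 2 / real (Suc i) + 2 / real (Suc j)" for i j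
  proof -
    let ?w = "(1/2) *\<^sub>R (u i + u j)"
    have "4 * J ?w = B (u i + u j) (u i + u j) - 4 * \<phi> (u i) - 4 * \<phi> (u j)"
      unfolding J_def using u(1) by (simp add: scale_left scale_right scale add add_divide_distrib)
    then have "B (u i - u j) (u i - u j) = 2 * J (u i) + 2 * J (u j) - 4 * J ?w"
      unfolding J_def[of "u i"] J_def[of "u j"] using u(1) by (simp add: expand_add expand_diff)
    moreover have "d \<le> J ?w" using u(1) by (intro d_le) auto
    ultimately show ?thesis using u(2)[of i] u(2)[of j] by linarith
  qed
  have cau: "form_Cauchy B u"
    unfolding form_Cauchy_eq
  proof (intro allI impI)
    fix e :: real assume "e > 0"
    obtain N where N: "4 / e < real N" using reals_Archimedean2 by blast
    have "B (u i - u j) (u i - u j) < e" if "i \<ge> N" "j \<ge> N" for i j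
    proof -
      have *: "2 / real (Suc k) \<le> e / 2" if "k \<ge> N" for k
      proof -
        have "4 / e < real (Suc k)" using N that by linarith
        then show ?thesis using \<open>e > 0\<close> by (simp add: field_simps)
      qed
      show ?thesis using para[of i j] *[OF that(1)] *[OF that(2)] by linarith
    qed
    then show "\<exists>N. \<forall>i\<ge>N. \<forall>j\<ge>N. B (u i - u j) (u i - u j) < e" by blast
  qed
  have "(\<lambda>n. B (u n) w) \<longlonglongrightarrow> \<phi> w" if w: "w \<in> V" for w
  proof -
    \<comment> \<open>Moving a near minimizer by \<open>- (x / b) w\<close> lowers \<open>J\<close>
      by at least \<open>x\<^sup>2 / b\<close>, which cannot exceed its excess
      \<open>1 / Suc n\<close> over the infimum. The summand \<open>1\<close> keeps \<open>b\<close>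
      positive for a degenerate \<open>w\<close>.\<close>
    define b where "b = B w w + 1"
    have b: "b > 0" using nonneg[OF w] by (simp add: b_def)
    have *: "(B (u n) w - \<phi> w)\<^sup>2 \<le> b * (1 / real (Suc n))" for n
    proof -
      define x where "x = B (u n) w - \<phi> w"
      have "J (u n + t *\<^sub>R w) = J (u n) + 2 * t * x + t\<^sup>2 * B w w" for t
        unfolding J_def x_def using u(1) w
        by (simp add: expand_add scale_left scale_right add scale power2_eq_square algebra_simps)
      then have "- (1 / real (Suc n)) \<le> 2 * t * x + t\<^sup>2 * B w w" for t
        using d_le[of "u n + t *\<^sub>R w"] u(1,2)[of n] w by (smt (verit) V_mem)
      from this[of "- x / b"] have "- (1 / real (Suc n)) \<le> - 2 * x\<^sup>2 / b + x\<^sup>2 / b\<^sup>2 * B w w"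
        by (simp add: power2_eq_square)
      also have "x\<^sup>2 / b\<^sup>2 * B w w \<le> x\<^sup>2 / b\<^sup>2 * b"
        by (intro mult_left_mono) (auto simp: b_def)
      also have "x\<^sup>2 / b\<^sup>2 * b = x\<^sup>2 / b" using b by (simp add: power2_eq_square)
      finally have "x\<^sup>2 / b \<le> 1 / real (Suc n)" by simp
      then show ?thesis using b by (simp add: x_def[symmetric] field_simps)
    qed
    have lim: "(\<lambda>n. b * (1 / real (Suc n))) \<longlonglongrightarrow> b * 0"
      by (intro tendsto_intros LIMSEQ_Suc[OF lim_1_over_n])
    have "(\<lambda>n. (B (u n) w - \<phi> w)\<^sup>2) \<longlonglongrightarrow> 0"
    proof (rule Lim_null_comparison)
      show "\<forall>\<^sub>F n in sequentially. norm ((B (u n) w - \<phi> w)\<^sup>2) \<le> b * (1 / real (Suc n))"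
        using * by simp
    qed (use lim in simp)
    then have "(\<lambda>n. B (u n) w - \<phi> w) \<longlonglongrightarrow> 0"
      by (simp add: power_tendsto_0_iff)
    then show ?thesis by (simp add: LIM_zero_iff)
  qed
  then show ?thesis using that u(1) cau by blast
qed

end

section \<open>Completeness of \<open>L\<^sup>2\<close>\<close>

lemma L2_space_measurable [measurable_dest]: "f \<in> L2_space m \<Longrightarrow> f \<in> borel_measurable m"
  by (simp add: L2_space_def)

lemma L2_space_integrable_mult:
  assumes "f \<in> L2_space m" "g \<in> L2_space m"
  shows "integrable m (\<lambda>x. f x * g x)"
proof (rule Bochner_Integration.integrable_bound)
  show "integrable m (\<lambda>x. (f x)\<^sup>2 + (g x)\<^sup>2)"
    using assms by (auto simp: L2_space_def)
  have "norm (f x * g x) \<le> norm ((f x)\<^sup>2 + (g x)\<^sup>2)" for x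
  proof -
    have "2 * (\<bar>f x\<bar> * \<bar>g x\<bar>) \<le> (f x)\<^sup>2 + (g x)\<^sup>2"
      using sum_squares_bound[of "\<bar>f x\<bar>" "\<bar>g x\<bar>"] by simp
    moreover have "0 \<le> \<bar>f x\<bar> * \<bar>g x\<bar>" by simp
    ultimately have "\<bar>f x\<bar> * \<bar>g x\<bar> \<le> (f x)\<^sup>2 + (g x)\<^sup>2" by linarith
    then show ?thesis by (simp add: abs_mult)
  qed
  then show "AE x in m. norm (f x * g x) \<le> norm ((f x)\<^sup>2 + (g x)\<^sup>2)" by simp
qed (use assms in \<open>auto simp: L2_space_def\<close>)

global_interpretation L2: semi_inner_space "L2_space m" "L2_inner m" for m
proof
  show "subspace (L2_space m)"
  proof (rule subspaceI)
    fix f g assume fg: "f \<in> L2_space m" "g \<in> L2_space m"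
    then have "integrable m (\<lambda>x. (f x)\<^sup>2 + 2 * (f x * g x) + (g x)\<^sup>2)"
      using L2_space_integrable_mult[OF fg] by (auto simp: L2_space_def)
    then show "f + g \<in> L2_space m"
      using fg by (auto simp: L2_space_def power2_sum plus_fun_def algebra_simps)
  qed (auto simp: L2_space_def power_mult_distrib zero_fun_def scaleR_fun_def)
qed (auto simp: L2_inner_def L2_space_integrable_mult ring_distribs mult_ac L2_space_integrable_mult[simplified mult.commute])

lemma L2_inner_self: "L2_inner m f f = (\<integral>x. (f x)\<^sup>2 \<partial>m)"
  by (simp add: L2_inner_def power2_eq_square)

lemma L2_inner_cong_AE:
  assumes "AE x in m. f x = f' x" "AE x in m. g x = g' x"
    "f \<in> borel_measurable m" "f' \<in> borel_measurable m" "g \<in> borel_measurable m" "g' \<in> borel_measurable m"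
  shows "L2_inner m f g = L2_inner m f' g'"
  unfolding L2_inner_def using assms by (intro integral_cong_AE) auto

lemma L2_null_iff:
  assumes "f \<in> L2_space m" "g \<in> L2_space m"
  shows "L2_inner m (f - g) (f - g) = 0 \<longleftrightarrow> (AE x in m. f x = g x)"
proof -
  have "f - g \<in> L2_space m" using assms by simp
  then have "integrable m (\<lambda>x. ((f - g) x)\<^sup>2)" by (simp add: L2_space_def)
  from integral_nonneg_eq_0_iff_AE[OF this] show ?thesis
    by (simp add: L2_inner_self)
qed

text \<open>The usual route to a.e. equality below: weak identities come from symmetry and
  polarization, and testing with \<open>w = f - g\<close> makes the difference null.\<close>

lemma L2_eq_AE_iff:
  assumes "f \<in> L2_space m" "g \<in> L2_space m"
  shows "(AE x in m. f x = g x) \<longleftrightarrow> (\<forall>w\<in>L2_space m. L2_inner m f w = L2_inner m g w)"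
proof
  assume "AE x in m. f x = g x"
  then have "L2_inner m (f - g) (f - g) = 0" using L2_null_iff[OF assms] by simp
  then have "L2_inner m (f - g) w = 0" if "w \<in> L2_space m" for w
    using L2.null_left[of "f - g" m w] assms that by simp
  then show "\<forall>w\<in>L2_space m. L2_inner m f w = L2_inner m g w"
    using assms by (simp add: L2.diff_left)
next
  assume *: "\<forall>w\<in>L2_space m. L2_inner m f w = L2_inner m g w"
  then have "L2_inner m f (f - g) = L2_inner m g (f - g)" using assms by (blast intro: L2.V_mem)
  then have "L2_inner m (f - g) (f - g) = 0" using assms by (simp add: L2.diff_left)
  then show "AE x in m. f x = g x" using L2_null_iff[OF assms] by simp
qed

lemma L2_inner_AE_left:
  assumes "AE x in m. f x = g x" "f \<in> L2_space m" "g \<in> L2_space m" "w \<in> L2_space m"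
  shows "L2_inner m f w = L2_inner m g w"
  using L2_eq_AE_iff[of f m g] assms by blast

lemma L2_tendsto_AE_subseq:
  assumes "\<And>n. u n \<in> L2_space m" "f \<in> L2_space m" "form_tendsto (L2_inner m) u f"
  obtains r where "strict_mono r" "AE x in m. (\<lambda>n. u (r n) x) \<longlonglongrightarrow> f x"
proof -
  have mem: "u n - f \<in> L2_space m" for n using assms by simp
  have "(\<lambda>n. \<integral>x. norm ((u n x - f x)\<^sup>2) \<partial>m) \<longlonglongrightarrow> 0"
    using assms(3) by (simp add: form_tendsto_def L2_inner_self)
  moreover have "integrable m (\<lambda>x. (u n x - f x)\<^sup>2)" for n
    using mem[of n] by (simp add: L2_space_def)
  ultimately obtain r where r: "strict_mono r" "AE x in m. (\<lambda>n. (u (r n) x - f x)\<^sup>2) \<longlonglongrightarrow> 0"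
    using tendsto_L1_AE_subseq[of m "\<lambda>n x. (u n x - f x)\<^sup>2"] by auto
  from r(2) have "AE x in m. (\<lambda>n. u (r n) x) \<longlonglongrightarrow> f x"
    by eventually_elim (simp add: power_tendsto_0_iff LIM_zero_iff)
  with r(1) show ?thesis by (rule that)
qed

lemma L2_norm_nn_integral:
  "f \<in> L2_space m \<Longrightarrow> ennreal (L2_inner m f f) = (\<integral>\<^sup>+x. ennreal ((f x)\<^sup>2) \<partial>m)"
  by (simp add: L2_inner_self L2_space_def nn_integral_eq_integral)

lemma L2_spaceI_nn_integral:
  "f \<in> borel_measurable m \<Longrightarrow> (\<integral>\<^sup>+x. ennreal ((f x)\<^sup>2) \<partial>m) < \<infinity> \<Longrightarrow> f \<in> L2_space m"
  by (simp add: L2_space_def integrableI_nonneg)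

text \<open>Riesz-Fischer. Along a subsequence whose squared increments have integral at most
  \<open>(1/4) ^ k\<close>, the weights \<open>2 ^ k\<close> still give a finite total, so a.e. the
  increments decay geometrically. Fatou's lemma turns the pointwise limit into the
  \<open>L\<^sup>2\<close> limit of the whole sequence.\<close>

theorem L2_complete:
  assumes u: "\<And>n. u n \<in> L2_space m" and cau: "form_Cauchy (L2_inner m) u"
  obtains f where "f \<in> L2_space m" "form_tendsto (L2_inner m) u f"
proof -
  have [measurable]: "u n \<in> borel_measurable m" for n using u by (rule L2_space_measurable)
  have "\<exists>N. \<forall>i\<ge>N. \<forall>j\<ge>N. L2_inner m (u i - u j) (u i - u j) < (1/4) ^ k" for k :: nat
    using cau unfolding form_Cauchy_eq by simp
  then obtain N where N: "\<And>k i j. i \<ge> N k \<Longrightarrow> j \<ge> N k \<Longrightarrow> L2_inner m (u i - u j) (u i - u j) < (1/4) ^ k"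
    by metis
  \<comment> \<open>The partial sum makes \<open>r\<close> monotone and
    \<open>r k \<ge> N k\<close>; the extra \<open>k\<close> makes it tend to infinity.\<close>
  define r where "r k = k + (\<Sum>i\<le>k. N i)" for k
  have r_N: "N k \<le> r k" for k
    unfolding r_def using member_le_sum[of k "{..k}" N] by simp
  have r_Suc: "r k \<le> r (Suc k)" for k by (simp add: r_def)
  have r_ge: "k \<le> r k" for k by (simp add: r_def)
  define g where "g k x = u (r (Suc k)) x - u (r k) x" for k x
  have [measurable]: "g k \<in> borel_measurable m" for k unfolding g_def by measurable
  have g_le: "(\<integral>\<^sup>+x. ennreal ((g k x)\<^sup>2) \<partial>m) \<le> ennreal ((1/4) ^ k)" for k
  proof -
    have "(\<integral>\<^sup>+x. ennreal ((g k x)\<^sup>2) \<partial>m) = ennreal (L2_inner m (u (r (Suc k)) - u (r k)) (u (r (Suc k)) - u (r k)))"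
      using u by (simp add: L2_norm_nn_integral g_def)
    also have "\<dots> \<le> ennreal ((1/4) ^ k)"
      using N[of k "r (Suc k)" "r k"] r_N[of k] r_Suc[of k] by (intro ennreal_leI less_imp_le) simp
    finally show ?thesis .
  qed
  have "(\<integral>\<^sup>+x. (\<Sum>k. ennreal (2 ^ k * (g k x)\<^sup>2)) \<partial>m) = (\<Sum>k. \<integral>\<^sup>+x. ennreal (2 ^ k * (g k x)\<^sup>2) \<partial>m)"
    by (intro nn_integral_suminf) auto
  also have "\<dots> \<le> (\<Sum>k. ennreal ((1/2) ^ k))"
  proof (intro suminf_le summableI)
    fix k
    have "(\<integral>\<^sup>+x. ennreal (2 ^ k * (g k x)\<^sup>2) \<partial>m) = ennreal (2 ^ k) * (\<integral>\<^sup>+x. ennreal ((g k x)\<^sup>2) \<partial>m)"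
      by (simp add: ennreal_mult nn_integral_cmult)
    also have "\<dots> \<le> ennreal (2 ^ k) * ennreal ((1/4) ^ k)"
      by (intro mult_left_mono g_le) simp
    also have "\<dots> = ennreal ((1/2) ^ k)"
      by (simp add: ennreal_mult[symmetric] power_mult_distrib[symmetric])
    finally show "(\<integral>\<^sup>+x. ennreal (2 ^ k * (g k x)\<^sup>2) \<partial>m) \<le> ennreal ((1/2) ^ k)" .
  qed
  also have "\<dots> < \<infinity>"
    by (subst suminf_ennreal2) (auto intro: summable_geometric)
  finally have "AE x in m. (\<Sum>k. ennreal (2 ^ k * (g k x)\<^sup>2)) \<noteq> \<infinity>"
    by (intro nn_integral_PInf_AE) auto
  then have conv: "AE x in m. convergent (\<lambda>k. u (r k) x)"
  proof eventually_elim
    case (elim x)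
    then have sm: "summable (\<lambda>k. 2 ^ k * (g k x)\<^sup>2)"
      by (intro summable_suminf_not_top) auto
    then have "Bseq (\<lambda>k. 2 ^ k * (g k x)\<^sup>2)"
      using summable_LIMSEQ_zero convergent_imp_Bseq convergentI by blast
    then obtain K where K: "K > 0" "\<And>k. norm (2 ^ k * (g k x)\<^sup>2) \<le> K" by (auto elim: BseqE)
    have "norm (g k x) \<le> sqrt K * (1 / sqrt 2) ^ k" for k
    proof -
      have "(g k x)\<^sup>2 \<le> K * (1/2) ^ k"
        using K(2)[of k] by (simp add: field_simps)
      then have "\<bar>g k x\<bar> \<le> sqrt (K * (1/2) ^ k)" by (metis real_sqrt_abs real_sqrt_le_iff)
      then show ?thesis by (simp add: real_sqrt_mult real_sqrt_power real_sqrt_divide)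
    qed
    moreover have "summable (\<lambda>k. sqrt K * (1 / sqrt 2) ^ k)"
      by (intro summable_mult summable_geometric) simp
    ultimately have "summable (\<lambda>k. g k x)"
      using summable_comparison_test'[of "\<lambda>k. sqrt K * (1 / sqrt 2) ^ k" 0 "\<lambda>k. g k x"] by blast
    then have "convergent (\<lambda>n. \<Sum>k<n. g k x)" by (simp add: summable_iff_convergent)
    moreover have "(\<Sum>k<n. g k x) = u (r n) x - u (r 0) x" for n
      unfolding g_def by (rule sum_lessThan_telescope)
    ultimately have "convergent (\<lambda>n. u (r n) x - u (r 0) x)" by simp
    then show "convergent (\<lambda>n. u (r n) x)" by (simp add: convergent_diff_const_right_iff)
  qed
  define f where "f x = lim (\<lambda>k. u (r k) x)" for x
  have [measurable]: "f \<in> borel_measurable m" unfolding f_def by measurable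
  have lim: "AE x in m. (\<lambda>k. u (r k) x) \<longlonglongrightarrow> f x"
    using conv by eventually_elim (simp only: f_def convergent_LIMSEQ_iff)
  have fatou: "(\<integral>\<^sup>+x. ennreal ((u n x - f x)\<^sup>2) \<partial>m) \<le> ennreal ((1/4) ^ k)" if n: "n \<ge> N k" for n k
  proof -
    have "(\<integral>\<^sup>+x. ennreal ((u n x - f x)\<^sup>2) \<partial>m) = (\<integral>\<^sup>+x. liminf (\<lambda>j. ennreal ((u n x - u (r j) x)\<^sup>2)) \<partial>m)"
    proof (rule nn_integral_cong_AE)
      show "AE x in m. ennreal ((u n x - f x)\<^sup>2) = liminf (\<lambda>j. ennreal ((u n x - u (r j) x)\<^sup>2))"
        using lim
      proof eventually_elim
        case (elim x)
        then have "(\<lambda>j. ennreal ((u n x - u (r j) x)\<^sup>2)) \<longlonglongrightarrow> ennreal ((u n x - f x)\<^sup>2)"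
          by (intro tendsto_intros)
        then show ?case by (rule lim_imp_Liminf[OF sequentially_bot, symmetric])
      qed
    qed
    also have "\<dots> \<le> liminf (\<lambda>j. \<integral>\<^sup>+x. ennreal ((u n x - u (r j) x)\<^sup>2) \<partial>m)"
      by (intro nn_integral_liminf) auto
    also have "\<dots> \<le> ennreal ((1/4) ^ k)"
    proof (rule Liminf_le)
      show "\<forall>\<^sub>F j in sequentially. (\<integral>\<^sup>+x. ennreal ((u n x - u (r j) x)\<^sup>2) \<partial>m) \<le> ennreal ((1/4) ^ k)"
        unfolding eventually_sequentially
      proof (intro exI allI impI)
        fix j assume "N k \<le> j"
        then have "N k \<le> r j" using r_ge order_trans by blast
        have "(\<integral>\<^sup>+x. ennreal ((u n x - u (r j) x)\<^sup>2) \<partial>m) = ennreal (L2_inner m (u n - u (r j)) (u n - u (r j)))"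
          using u by (simp add: L2_norm_nn_integral)
        then show "(\<integral>\<^sup>+x. ennreal ((u n x - u (r j) x)\<^sup>2) \<partial>m) \<le> ennreal ((1/4) ^ k)"
          using N[OF n \<open>N k \<le> r j\<close>] by (simp add: ennreal_leI less_imp_le)
      qed
    qed simp
    finally show ?thesis .
  qed
  have mem: "u n - f \<in> L2_space m" if "n \<ge> N 0" for n
  proof (rule L2_spaceI_nn_integral)
    show "(\<integral>\<^sup>+x. ennreal (((u n - f) x)\<^sup>2) \<partial>m) < \<infinity>"
      using le_less_trans[OF fatou[OF that]] by simp
  qed (simp add: fun_diff_def)
  have "u (N 0) - (u (N 0) - f) \<in> L2_space m" using u[of "N 0"] mem[OF order_refl] by (rule L2.V_mem(3))
  moreover have "u (N 0) - (u (N 0) - f) = f" by (simp add: fun_eq_iff)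
  ultimately have f: "f \<in> L2_space m" by simp
  have "form_tendsto (L2_inner m) u f"
    unfolding form_tendsto_def
  proof (rule LIMSEQ_I)
    fix e :: real assume "e > 0"
    then obtain k where k: "(1/4 :: real) ^ k < e" using real_arch_pow_inv[of e "1/4"] by auto
    have "norm (L2_inner m (u n - f) (u n - f) - 0) < e" if "n \<ge> N k" for n
    proof -
      have "ennreal (L2_inner m (u n - f) (u n - f)) \<le> ennreal ((1/4) ^ k)"
        using fatou[OF that] u f by (simp add: L2_norm_nn_integral)
      then have "L2_inner m (u n - f) (u n - f) \<le> (1/4) ^ k" by (simp add: ennreal_le_iff)
      then show ?thesis using k L2.nonneg[of "u n - f" m] u f by simp
    qed
    then show "\<exists>N. \<forall>n\<ge>N. norm (L2_inner m (u n - f) (u n - f) - 0) < e" by blast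
  qed
  with f show ?thesis by (rule that)
qed

theorem L2_Riesz:
  assumes add: "\<And>x y. x \<in> L2_space m \<Longrightarrow> y \<in> L2_space m \<Longrightarrow> \<phi> (x + y) = \<phi> x + \<phi> y"
    and scale: "\<And>c x. x \<in> L2_space m \<Longrightarrow> \<phi> (c *\<^sub>R x) = c * \<phi> x"
    and bound: "\<And>x. x \<in> L2_space m \<Longrightarrow> (\<phi> x)\<^sup>2 \<le> C * L2_inner m x x"
  obtains f where "f \<in> L2_space m" "\<And>w. w \<in> L2_space m \<Longrightarrow> L2_inner m f w = \<phi> w"
proof -
  obtain u where u: "\<And>n. u n \<in> L2_space m" "form_Cauchy (L2_inner m) u"
    "\<And>w. w \<in> L2_space m \<Longrightarrow> (\<lambda>n. L2_inner m (u n) w) \<longlonglongrightarrow> \<phi> w"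
    using L2.Riesz_sequence[of m \<phi> C] assms by blast
  obtain f where f: "f \<in> L2_space m" "form_tendsto (L2_inner m) u f"
    using L2_complete u(1,2) by blast
  have "L2_inner m f w = \<phi> w" if "w \<in> L2_space m" for w
    using L2.tendsto_left[OF u(1) f(1) that f(2)] u(3)[OF that] by (rule LIMSEQ_unique)
  with f(1) show ?thesis by (rule that)
qed

text \<open>Orthogonal projection without completeness of \<open>V\<close>: the Riesz sequence for
  \<open>\<langle>f, _\<rangle>\<close> on \<open>V\<close> has an \<open>L\<^sup>2\<close> limit
  \<open>g\<close>, and \<open>f - g\<close> is orthogonal to \<open>V\<close>, hence null.\<close>

lemma L2_dense_if_orthogonal_trivial:
  assumes V: "subspace V" "V \<subseteq> L2_space m"
    and orth: "\<And>z. z \<in> L2_space m \<Longrightarrow> (\<And>v. v \<in> V \<Longrightarrow> L2_inner m z v = 0) \<Longrightarrow> L2_inner m z z = 0"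
    and f: "f \<in> L2_space m"
  obtains v where "\<And>n. v n \<in> V" "form_tendsto (L2_inner m) v f"
proof -
  interpret V: semi_inner_space V "L2_inner m"
    by standard (use V in \<open>auto simp: L2.bilin L2.nonneg subset_iff intro: L2.sym\<close>)
  obtain v where v: "\<And>n. v n \<in> V" "form_Cauchy (L2_inner m) v"
    "\<And>w. w \<in> V \<Longrightarrow> (\<lambda>n. L2_inner m (v n) w) \<longlonglongrightarrow> L2_inner m f w"
  proof (rule V.Riesz_sequence[of "L2_inner m f" "L2_inner m f f"])
    show "(L2_inner m f x)\<^sup>2 \<le> L2_inner m f f * L2_inner m x x" if "x \<in> V" for x
      using L2.Cauchy_Schwarz[of f m x] f V that by blast
  qed (use f V in \<open>auto simp: L2.bilin subset_iff\<close>)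
  have vL: "v n \<in> L2_space m" for n using v(1) V by blast
  obtain g where g: "g \<in> L2_space m" "form_tendsto (L2_inner m) v g"
    using L2_complete vL v(2) by blast
  have "L2_inner m (f - g) w = 0" if "w \<in> V" for w
  proof -
    have w: "w \<in> L2_space m" using that V by blast
    have "L2_inner m g w = L2_inner m f w"
      using L2.tendsto_left[OF vL g(1) w g(2)] v(3)[OF that] by (rule LIMSEQ_unique)
    then show ?thesis using f g w by (simp add: L2.diff_left)
  qed
  then have "L2_inner m (f - g) (f - g) = 0" using f g by (intro orth) auto
  then have "L2_inner m (g - f) h = 0" if "h \<in> L2_space m" for h
    using L2.null_left[of "g - f" m h] L2.diff_commute[of f m g] f g that by simp
  then have "L2_inner m (v n - f) (v n - f) = L2_inner m (v n - g) (v n - g)" for n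
    using vL[of n] f g L2.expand_add[of "v n - g" m "g - f"] L2.sym[of "v n - g" m "g - f"] by simp
  then have "form_tendsto (L2_inner m) v f" using g(2) by (simp add: form_tendsto_def)
  with v(1) show ?thesis by (rule that)
qed

section \<open>Functional calculus of a projection-valued measure\<close>

text \<open>Signed measures are avoided: an identity between them is the vanishing of a sum over a list of
  weighted measures \<open>(M, w)\<close>.\<close>

lemma linear_relation_integral:
  fixes L :: "('b measure \<times> ('b \<Rightarrow> real)) list"
  assumes sets: "\<And>M w. (M, w) \<in> set L \<Longrightarrow> sets M = sets N"
    and w: "\<And>M w. (M, w) \<in> set L \<Longrightarrow> integrable M w"
    and hw: "\<And>M w. (M, w) \<in> set L \<Longrightarrow> integrable M (\<lambda>x. h x * w x)"
    and h: "h \<in> borel_measurable N"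
    and rel: "\<And>B. B \<in> sets N \<Longrightarrow> (\<Sum>(M, w)\<leftarrow>L. \<integral>x. indicator B x * w x \<partial>M) = 0"
  shows "(\<Sum>(M, w)\<leftarrow>L. \<integral>x. h x * w x \<partial>M) = 0"
proof -
  obtain s where s: "\<And>i. simple_function N (s i)" "\<And>x. x \<in> space N \<Longrightarrow> (\<lambda>i. s i x) \<longlonglongrightarrow> h x"
    "\<And>i x. x \<in> space N \<Longrightarrow> norm (s i x) \<le> 2 * norm (h x)"
    using borel_measurable_implies_sequence_metric[OF h, of 0] unfolding dist_norm diff_zero by metis
  have simple: "(\<Sum>(M, w)\<leftarrow>L. \<integral>x. s i x * w x \<partial>M) = 0" for i
  proof -
    let ?Y = "s i ` space N" let ?B = "\<lambda>y. s i -` {y} \<inter> space N"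
    have fin: "finite ?Y" using s(1) by (rule simple_functionD)
    have B: "?B y \<in> sets N" for y using s(1) by (rule simple_functionD)
    have *: "(\<integral>x. s i x * w x \<partial>M) = (\<Sum>y\<in>?Y. y * (\<integral>x. indicator (?B y) x * w x \<partial>M))" if L: "(M, w) \<in> set L" for M w
    proof -
      have sp: "space M = space N" using sets[OF L] by (rule sets_eq_imp_space_eq)
      have "(\<integral>x. s i x * w x \<partial>M) = (\<integral>x. (\<Sum>y\<in>?Y. y * (indicator (?B y) x * w x)) \<partial>M)"
      proof (rule Bochner_Integration.integral_cong[OF refl])
        fix x assume x: "x \<in> space M"
        have "(\<Sum>y\<in>?Y. y * (indicator (?B y) x * w x)) = (\<Sum>y\<in>?Y. if y = s i x then y * w x else 0)"
          using x sp by (intro sum.cong) (auto simp: indicator_def)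
        then show "s i x * w x = (\<Sum>y\<in>?Y. y * (indicator (?B y) x * w x))"
          using fin x sp by (simp add: sum.delta)
      qed
      also have "\<dots> = (\<Sum>y\<in>?Y. \<integral>x. y * (indicator (?B y) x * w x) \<partial>M)"
        using B sets[OF L] w[OF L] by (intro Bochner_Integration.integral_sum integrable_mult_right integrable_mult_indicator[of _ M w, simplified]) auto
      finally show ?thesis by simp
    qed
    have "(\<Sum>(M, w)\<leftarrow>L. \<integral>x. s i x * w x \<partial>M) = (\<Sum>(M, w)\<leftarrow>L. \<Sum>y\<in>?Y. y * (\<integral>x. indicator (?B y) x * w x \<partial>M))"
      using * by (intro arg_cong[of _ _ sum_list] map_cong) auto
    also have "\<dots> = (\<Sum>y\<in>?Y. y * (\<Sum>(M, w)\<leftarrow>L. \<integral>x. indicator (?B y) x * w x \<partial>M))"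
      by (induction L) (auto simp: sum.distrib distrib_left)
    also have "\<dots> = 0" using rel[OF B] by simp
    finally show ?thesis .
  qed
  have "(\<lambda>i. \<integral>x. s i x * w x \<partial>M) \<longlonglongrightarrow> (\<integral>x. h x * w x \<partial>M)" if L: "(M, w) \<in> set L" for M w
  proof (rule integral_dominated_convergence)
    have sp: "space M = space N" using sets[OF L] by (rule sets_eq_imp_space_eq)
    note [measurable_cong] = sets[OF L]
    have [measurable]: "w \<in> borel_measurable M" "s i \<in> borel_measurable N" "h \<in> borel_measurable N" for i
      using w[OF L] s(1) h by (auto intro: borel_measurable_simple_function)
    show "(\<lambda>x. h x * w x) \<in> borel_measurable M" "\<And>i. (\<lambda>x. s i x * w x) \<in> borel_measurable M" by measurable
    show "integrable M (\<lambda>x. 2 * norm (h x * w x))" using hw[OF L] by auto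
    show "AE x in M. (\<lambda>i. s i x * w x) \<longlonglongrightarrow> h x * w x"
      using s(2) sp by (intro AE_I2 tendsto_intros) auto
    show "AE x in M. norm (s i x * w x) \<le> 2 * norm (h x * w x)" for i
    proof (rule AE_I2)
      fix x assume "x \<in> space M"
      then have "norm (s i x) * norm (w x) \<le> 2 * norm (h x) * norm (w x)"
        using s(3)[of x i] sp by (intro mult_right_mono) auto
      then show "norm (s i x * w x) \<le> 2 * norm (h x * w x)" by (simp add: abs_mult)
    qed
  qed
  then have "(\<lambda>i. \<Sum>(M, w)\<leftarrow>L. \<integral>x. s i x * w x \<partial>M) \<longlonglongrightarrow> (\<Sum>(M, w)\<leftarrow>L. \<integral>x. h x * w x \<partial>M)"
    by (induction L) (auto intro!: tendsto_add)
  then show ?thesis unfolding simple by (simp add: LIMSEQ_const_iff)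
qed

text \<open>Domination on sets passes to simple functions and then to suprema. Two dominating
  measures are allowed because the spectral measure of a sum is bounded by the spectral measures of
  both summands together.\<close>

lemma nn_integral_dominated_measures:
  assumes "sets M = sets N" "sets M1 = sets N" "sets M2 = sets N"
    and dom: "\<And>B. B \<in> sets N \<Longrightarrow> emeasure M B \<le> c * emeasure M1 B + c * emeasure M2 B"
  shows "(\<integral>\<^sup>+x. h x \<partial>M) \<le> c * (\<integral>\<^sup>+x. h x \<partial>M1) + c * (\<integral>\<^sup>+x. h x \<partial>M2)"
  unfolding nn_integral_def[of M]
proof (rule SUP_least)
  fix s assume "s \<in> {g. simple_function M g \<and> g \<le> h}"
  then have s: "simple_function M s" "s \<le> h" by auto
  have sp: "space M = space N" "space M1 = space N" "space M2 = space N"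
    using assms(1-3) by (auto dest: sets_eq_imp_space_eq)
  have s': "simple_function M1 s" "simple_function M2 s"
    using s(1) assms(1-3) sp by (simp_all add: simple_function_def)
  have B: "s -` {y} \<inter> space N \<in> sets N" for y
    using simple_functionD(2)[OF s(1), of "{y}"] assms(1) sp by simp
  have "integral\<^sup>S M s \<le> (\<Sum>y\<in>s ` space N. y * (c * emeasure M1 (s -` {y} \<inter> space N) + c * emeasure M2 (s -` {y} \<inter> space N)))"
    unfolding simple_integral_def sp by (intro sum_mono mult_left_mono dom B) simp
  also have "\<dots> = c * integral\<^sup>S M1 s + c * integral\<^sup>S M2 s"
    unfolding simple_integral_def sp by (simp add: sum_distrib_left sum.distrib[symmetric] distrib_left mult_ac)
  also have "\<dots> = c * (\<integral>\<^sup>+x. s x \<partial>M1) + c * (\<integral>\<^sup>+x. s x \<partial>M2)"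
    using s' by (simp add: nn_integral_eq_simple_integral)
  also have "\<dots> \<le> c * (\<integral>\<^sup>+x. h x \<partial>M1) + c * (\<integral>\<^sup>+x. h x \<partial>M2)"
    using s(2) by (intro add_mono mult_left_mono nn_integral_mono) (auto simp: le_fun_def)
  finally show "integral\<^sup>S M s \<le> c * (\<integral>\<^sup>+x. h x \<partial>M1) + c * (\<integral>\<^sup>+x. h x \<partial>M2)" .
qed

section \<open>Bounded Borel functions on the half line\<close>

abbreviation half_line :: "real measure" where
  "half_line \<equiv> restrict_space borel {0..}"

lemma sets_half_line: "B \<in> sets half_line \<longleftrightarrow> B \<in> sets borel \<and> B \<subseteq> {0..}"
  by (subst sets_restrict_space_iff) auto

lemma space_half_line: "space half_line = {0..}"
  by (simp add: space_restrict_space)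

text \<open>Both conditions concern \<open>[0,\<infinity>)\<close> alone, so that functions like
  \<open>1 / (1 + \<epsilon> * l)\<close> with \<open>\<epsilon> > 0\<close>, which have a pole on
  the negative axis, qualify.\<close>

definition bounded_borel :: "(real \<Rightarrow> real) \<Rightarrow> bool" where
  "bounded_borel h \<longleftrightarrow> h \<in> borel_measurable half_line \<and> (\<exists>K. \<forall>l\<ge>0. \<bar>h l\<bar> \<le> K)"

lemma bounded_borel_measurable [measurable_dest]: "bounded_borel h \<Longrightarrow> h \<in> borel_measurable half_line"
  by (simp add: bounded_borel_def)

lemma bounded_borelE:
  assumes "bounded_borel h"
  obtains K where "K \<ge> 0" "\<And>l. l \<ge> 0 \<Longrightarrow> \<bar>h l\<bar> \<le> K"
proof -
  obtain K where K: "\<And>l. l \<ge> 0 \<Longrightarrow> \<bar>h l\<bar> \<le> K" using assms by (auto simp: bounded_borel_def)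
  moreover have "K \<ge> 0" using K[of 0] by simp
  ultimately show ?thesis using that by blast
qed

lemma bounded_borelI: "h \<in> borel_measurable half_line \<Longrightarrow> (\<And>l. l \<ge> 0 \<Longrightarrow> \<bar>h l\<bar> \<le> K) \<Longrightarrow> bounded_borel h"
  by (auto simp: bounded_borel_def)

lemma bounded_borel_const [intro, simp]: "bounded_borel (\<lambda>l. c)"
  by (rule bounded_borelI[where K = "\<bar>c\<bar>"]) auto

lemma bounded_borel_indicator [intro]: "B \<in> sets half_line \<Longrightarrow> bounded_borel (\<lambda>l. indicator B l)"
  by (rule bounded_borelI[where K = 1]) (auto simp: indicator_def)

lemma bounded_borel_mult [intro]:
  assumes "bounded_borel h" "bounded_borel k"
  shows "bounded_borel (\<lambda>l. h l * k l)"
proof -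
  obtain K where K: "K \<ge> 0" "\<And>l. l \<ge> 0 \<Longrightarrow> \<bar>h l\<bar> \<le> K" using bounded_borelE[OF assms(1)] by blast
  obtain K' where K': "K' \<ge> 0" "\<And>l. l \<ge> 0 \<Longrightarrow> \<bar>k l\<bar> \<le> K'" using bounded_borelE[OF assms(2)] by blast
  show ?thesis
    by (rule bounded_borelI[where K = "K * K'"])
       (use assms K K' in \<open>auto simp: abs_mult intro!: mult_mono borel_measurable_times bounded_borel_measurable\<close>)
qed

lemma bounded_borel_power2 [intro]: "bounded_borel h \<Longrightarrow> bounded_borel (\<lambda>l. (h l)\<^sup>2)"
  unfolding power2_eq_square by (rule bounded_borel_mult)

lemma bounded_borel_add_const [intro]:
  assumes "bounded_borel h" shows "bounded_borel (\<lambda>l. h l + c)"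
proof -
  obtain K where K: "K \<ge> 0" "\<And>l. l \<ge> 0 \<Longrightarrow> \<bar>h l\<bar> \<le> K" using bounded_borelE[OF assms] by blast
  show ?thesis
  proof (rule bounded_borelI)
    show "(\<lambda>l. h l + c) \<in> borel_measurable half_line"
      using bounded_borel_measurable[OF assms] by simp
    show "\<bar>h l + c\<bar> \<le> K + \<bar>c\<bar>" if "l \<ge> 0" for l using K(2)[OF that] by linarith
  qed
qed

section \<open>Scalar spectral measures and the bounded functional calculus\<close>

locale pvm =
  fixes m :: "'a measure" and P
  assumes pvm: "projection_valued_measure m P"
begin

abbreviation "\<mu> \<equiv> scalar_spectral_measure m P"
abbreviation "H \<equiv> L2_space m"
abbreviation "ip \<equiv> L2_inner m"

lemma P_mem [simp, intro]: "B \<in> sets half_line \<Longrightarrow> f \<in> H \<Longrightarrow> P B f \<in> H"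
  using pvm by (auto simp: projection_valued_measure_def)

lemma P_sym: "B \<in> sets half_line \<Longrightarrow> f \<in> H \<Longrightarrow> g \<in> H \<Longrightarrow> ip (P B f) g = ip f (P B g)"
  using pvm by (auto simp: projection_valued_measure_def)

lemma P_mult:
  assumes "B \<in> sets half_line" "C \<in> sets half_line" "f \<in> H" "g \<in> H"
  shows "ip (P B (P C f)) g = ip (P (B \<inter> C) f) g"
  using assms pvm by (intro L2_inner_AE_left) (auto simp: projection_valued_measure_def)

lemma P_total: "f \<in> H \<Longrightarrow> g \<in> H \<Longrightarrow> ip (P {0..} f) g = ip f g"
  using pvm by (intro L2_inner_AE_left) (auto simp: projection_valued_measure_def sets_half_line)

lemma P_norm: "B \<in> sets half_line \<Longrightarrow> f \<in> H \<Longrightarrow> ip (P B f) (P B f) = ip (P B f) f"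
  using P_mult[of B B f f] P_sym[of B "P B f" f] by simp

text \<open>Linearity of \<open>P B\<close> comes from moving it to the other factor, where
  \<open>L2_inner\<close> is linear; positivity is idempotence,
  \<open>\<langle>P B x, x\<rangle> = \<langle>P B x, P B x\<rangle>\<close>.\<close>

lemma semi_inner_P:
  assumes B: "B \<in> sets half_line"
  shows "semi_inner_space H (\<lambda>f g. ip (P B f) g)"
proof
  fix x y assume x: "x \<in> H" and y: "y \<in> H"
  show "ip (P B x) y = ip (P B y) x"
    using P_sym[OF B x y] L2.sym[of x m "P B y"] x y B by simp
  show "ip (P B (c *\<^sub>R x)) y = c * ip (P B x) y" for c
    using P_sym[OF B, of "c *\<^sub>R x" y] P_sym[OF B x y] x y B by (simp add: L2.bilin)
  show "ip (P B (x + y)) z = ip (P B x) z + ip (P B y) z" if z: "z \<in> H" for z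
    using P_sym[of B _ z] x y z B by (simp add: L2.bilin)
  show "0 \<le> ip (P B x) x"
    using P_norm[OF B x] L2.nonneg[of "P B x" m] x B by simp
qed (rule L2.subspace_V)

lemmas PB_zero_left = semi_inner_space.zero_left[OF semi_inner_P]
lemmas PB_nonneg = semi_inner_space.nonneg[OF semi_inner_P]
lemmas PB_diff_commute = semi_inner_space.diff_commute[OF semi_inner_P]
lemmas PB_polarization = semi_inner_space.polarization[OF semi_inner_P]
lemmas PB_parallelogram_le = semi_inner_space.parallelogram_le[OF semi_inner_P]
lemmas PB_add_left = semi_inner_space.add_left[OF semi_inner_P]
lemmas PB_add_right = semi_inner_space.add_right[OF semi_inner_P]
lemmas PB_scale_left = semi_inner_space.scale_left[OF semi_inner_P]
lemmas PB_scale_right = semi_inner_space.scale_right[OF semi_inner_P]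

lemma sets_\<mu> [measurable_cong, simp]: "sets (\<mu> f) = sets half_line"
  and space_\<mu> [simp]: "space (\<mu> f) = {0..}"
proof -
  interpret sigma_algebra "{0..}" "sets half_line"
    using sets.sigma_algebra_axioms[of half_line] by (simp add: space_half_line)
  show "sets (\<mu> f) = sets half_line" "space (\<mu> f) = {0..}"
    unfolding scalar_spectral_measure_def using space_closed
    by (simp_all add: sigma_sets_eq)
qed

lemma emeasure_\<mu>:
  assumes f: "f \<in> H" and B: "B \<in> sets half_line"
  shows "emeasure (\<mu> f) B = ennreal (ip (P B f) f)"
proof -
  interpret sigma_algebra "{0..}" "sets half_line"
    using sets.sigma_algebra_axioms[of half_line] by (simp add: space_half_line)
  have add: "(\<lambda>i. ip (P (C i) f) f) sums ip (P (\<Union>i. C i) f) f"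
    if "range C \<subseteq> sets half_line" "disjoint_family C" for C :: "nat \<Rightarrow> real set"
    using pvm that f unfolding projection_valued_measure_def by blast
  \<comment> \<open>Countable additivity along the constant family of empty sets: a convergent
    series of equal terms has terms \<open>0\<close>.\<close>
  have "(\<lambda>i::nat. ip (P {} f) f) sums ip (P {} f) f"
    using add[of "\<lambda>_. {}"] by (simp add: disjoint_family_on_def)
  then have "(\<lambda>i::nat. ip (P {} f) f) \<longlonglongrightarrow> 0"
    by (intro summable_LIMSEQ_zero) (auto simp: sums_iff)
  then have 0: "ip (P {} f) f = 0" by (simp add: LIMSEQ_const_iff)
  show ?thesis
    unfolding scalar_spectral_measure_def
  proof (rule emeasure_measure_of_sigma[OF sigma_algebra_axioms _ _ B])
    show "positive (sets half_line) (\<lambda>B. ennreal (ip (P B f) f))"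
      using 0 by (simp add: positive_def)
    show "countably_additive (sets half_line) (\<lambda>B. ennreal (ip (P B f) f))"
    proof (rule countably_additiveI)
      fix C :: "nat \<Rightarrow> real set"
      assume C: "range C \<subseteq> sets half_line" "disjoint_family C"
      show "(\<Sum>i. ennreal (ip (P (C i) f) f)) = ennreal (ip (P (\<Union>i. C i) f) f)"
        using add[OF C] C f by (intro suminf_ennreal_eq) (auto intro!: PB_nonneg)
    qed
  qed
qed

lemma measure_\<mu>: "f \<in> H \<Longrightarrow> B \<in> sets half_line \<Longrightarrow> measure (\<mu> f) B = ip (P B f) f"
  by (simp add: measure_def emeasure_\<mu> PB_nonneg)

lemma half_line_UNIV [simp, intro]: "{0..} \<in> sets half_line" by (simp add: sets_half_line)

lemma finite_\<mu> [simp, intro]: "f \<in> H \<Longrightarrow> finite_measure (\<mu> f)"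
  by (rule finite_measureI) (simp add: emeasure_\<mu>)

lemma \<mu>_eqI:
  assumes "\<And>B. B \<in> sets half_line \<Longrightarrow> ip (P B f) f = ip (P B g) g" "f \<in> H" "g \<in> H"
  shows "\<mu> f = \<mu> g"
  using assms by (intro measure_eqI) (auto simp: emeasure_\<mu>)

lemma integrable_bounded [simp, intro]:
  assumes "bounded_borel h" "f \<in> H" shows "integrable (\<mu> f) h"
proof -
  interpret finite_measure "\<mu> f" using assms by simp
  obtain K where K: "\<And>l. l \<ge> 0 \<Longrightarrow> \<bar>h l\<bar> \<le> K" using assms(1) bounded_borelE by blast
  show ?thesis
    by (rule integrable_const_bound[of _ K]) (use assms K in \<open>auto simp: bounded_borel_def\<close>)
qed

text \<open>Integrability of \<open>h\<close> itself; the domain of the operator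
  \<open>\<integral> h dP\<close> is \<open>ispace (\<lambda>l. (h l)\<^sup>2)\<close>.\<close>

definition ispace :: "(real \<Rightarrow> real) \<Rightarrow> ('a \<Rightarrow> real) set" where
  "ispace h = {f \<in> H. integrable (\<mu> f) h}"

text \<open>The integral of \<open>h\<close> against the signed measure
  \<open>\<langle>P f, g\<rangle>\<close>, written by polarization as in
  \<open>spectral_integral\<close>.\<close>

definition bint :: "(real \<Rightarrow> real) \<Rightarrow> 'a form" where
  "bint h f g = ((\<integral>l. h l \<partial>\<mu> (f + g)) - (\<integral>l. h l \<partial>\<mu> (f - g))) / 4"

lemma ispace_bounded [simp]: "bounded_borel h \<Longrightarrow> ispace h = H"
  by (auto simp: ispace_def)

lemma integrable_dominated:
  assumes h: "f1 \<in> ispace h" "f2 \<in> ispace h" and f: "f \<in> H" and c: "c \<ge> 0"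
    and dom: "\<And>B. B \<in> sets half_line \<Longrightarrow> ip (P B f) f \<le> c * ip (P B f1) f1 + c * ip (P B f2) f2"
  shows "f \<in> ispace h"
proof -
  have f12: "f1 \<in> H" "f2 \<in> H" and int: "integrable (\<mu> f1) h" "integrable (\<mu> f2) h"
    using h by (auto simp: ispace_def)
  have "(\<integral>\<^sup>+l. norm (h l) \<partial>\<mu> f) \<le> ennreal c * (\<integral>\<^sup>+l. norm (h l) \<partial>\<mu> f1) + ennreal c * (\<integral>\<^sup>+l. norm (h l) \<partial>\<mu> f2)"
  proof (rule nn_integral_dominated_measures)
    fix B assume B: "B \<in> sets half_line"
    then have "emeasure (\<mu> f) B = ennreal (ip (P B f) f)" using f by (simp add: emeasure_\<mu>)
    also have "\<dots> \<le> ennreal (c * ip (P B f1) f1 + c * ip (P B f2) f2)" using dom[OF B] by (rule ennreal_leI)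
    also have "\<dots> = ennreal c * emeasure (\<mu> f1) B + ennreal c * emeasure (\<mu> f2) B"
      using f12 c PB_nonneg[OF B f12(1)] PB_nonneg[OF B f12(2)] B by (simp add: emeasure_\<mu> ennreal_mult)
    finally show "emeasure (\<mu> f) B \<le> ennreal c * emeasure (\<mu> f1) B + ennreal c * emeasure (\<mu> f2) B" .
  qed auto
  also have "\<dots> < \<infinity>"
    using int unfolding integrable_iff_bounded by (simp add: ennreal_mult_less_top)
  finally show ?thesis
    using f int(1) measurable_cong_sets[OF sets_\<mu>[of f1] refl] measurable_cong_sets[OF sets_\<mu>[of f] refl]
    unfolding ispace_def integrable_iff_bounded by auto
qed

lemma \<mu>_zero: "\<mu> 0 = null_measure half_line"
  by (rule measure_eqI) (auto simp: emeasure_\<mu> PB_zero_left)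

lemma subspace_ispace:
  assumes h: "h \<in> borel_measurable half_line"
  shows "subspace (ispace h)"
proof (rule subspaceI)
  show "0 \<in> ispace h" unfolding ispace_def \<mu>_zero
    using h by (auto simp: integrable_iff_bounded \<mu>_zero)
next
  fix x y assume xy: "x \<in> ispace h" "y \<in> ispace h"
  then have H: "x \<in> H" "y \<in> H" by (auto simp: ispace_def)
  show "x + y \<in> ispace h"
  proof (rule integrable_dominated[OF xy, where c = 2])
    fix B assume "B \<in> sets half_line"
    then show "ip (P B (x + y)) (x + y) \<le> 2 * ip (P B x) x + 2 * ip (P B y) y"
      using PB_parallelogram_le(1)[of B x y] H by simp
  qed (use H in auto)
next
  fix c x assume x: "x \<in> ispace h"
  then have H: "x \<in> H" by (auto simp: ispace_def)
  show "c *\<^sub>R x \<in> ispace h"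
  proof (rule integrable_dominated[OF x x, where c = "c\<^sup>2 / 2"])
    fix B assume B: "B \<in> sets half_line"
    then show "ip (P B (c *\<^sub>R x)) (c *\<^sub>R x) \<le> c\<^sup>2 / 2 * ip (P B x) x + c\<^sup>2 / 2 * ip (P B x) x"
      using H by (simp add: PB_scale_left PB_scale_right power2_eq_square field_simps)
  qed (use H in auto)
qed

lemma ispace_mem [simp, intro]:
  assumes "h \<in> borel_measurable half_line"
  shows "0 \<in> ispace h" "x \<in> ispace h \<Longrightarrow> y \<in> ispace h \<Longrightarrow> x + y \<in> ispace h"
    "x \<in> ispace h \<Longrightarrow> y \<in> ispace h \<Longrightarrow> x - y \<in> ispace h" "x \<in> ispace h \<Longrightarrow> c *\<^sub>R x \<in> ispace h"
  using subspace_ispace[OF assms] by (auto simp: subspace_0 subspace_add subspace_diff subspace_scale)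

lemma ispace_H: "f \<in> ispace h \<Longrightarrow> f \<in> H" by (simp add: ispace_def)

lemma bint_minus: "bint (\<lambda>l. - h l) f g = - bint h f g"
  by (simp add: bint_def minus_divide_left)

lemma bint_indicator:
  assumes "B \<in> sets half_line" "f \<in> H" "g \<in> H"
  shows "bint (indicator B) f g = ip (P B f) g"
  using assms PB_polarization[OF assms] sets.Int_space_eq2[of B half_line]
  by (simp add: bint_def measure_\<mu> space_half_line)

text \<open>Each polarized integral is a pair of weighted measures with weights \<open>w / 4\<close>
  and \<open>- w / 4\<close>, so \<open>linear_relation_integral\<close> applies. The algebraic laws
  of \<open>bint\<close> are checked on indicators, where they are laws of \<open>P\<close>, and
  extended to \<open>h\<close> by this lemma.\<close>

lemma bint_relation:
  assumes fg: "\<And>f g w. (f, g, w) \<in> set L \<Longrightarrow> f + g \<in> ispace w \<and> f - g \<in> ispace w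
      \<and> f + g \<in> ispace (\<lambda>l. h l * w l) \<and> f - g \<in> ispace (\<lambda>l. h l * w l)"
    and h: "h \<in> borel_measurable half_line"
    and rel: "\<And>B. B \<in> sets half_line \<Longrightarrow> (\<Sum>(f, g, w)\<leftarrow>L. bint (\<lambda>l. indicator B l * w l) f g) = 0"
  shows "(\<Sum>(f, g, w)\<leftarrow>L. bint (\<lambda>l. h l * w l) f g) = 0"
proof -
  define L' where "L' = concat (map (\<lambda>p. [(\<mu> (fst p + fst (snd p)), \<lambda>l. snd (snd p) l / 4),
      (\<mu> (fst p - fst (snd p)), \<lambda>l. - snd (snd p) l / 4)]) L)"
  have eq: "(\<Sum>(M, w)\<leftarrow>L'. \<integral>x. k x * w x \<partial>M) = (\<Sum>(f, g, w)\<leftarrow>L. bint (\<lambda>l. k l * w l) f g)" for k :: "real \<Rightarrow> real"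
    unfolding L'_def
  proof (induction L)
    case (Cons a L)
    obtain f g w where a: "a = (f, g, w)" by (cases a)
    show ?case using Cons by (simp add: a bint_def diff_divide_distrib plus_fun_def fun_diff_def)
  qed simp
  have "(\<Sum>(M, w)\<leftarrow>L'. \<integral>x. h x * w x \<partial>M) = 0"
  proof (rule linear_relation_integral[where N = half_line])
    fix M w assume "(M, w) \<in> set L'"
    then obtain f g w' where *: "(f, g, w') \<in> set L"
      "(M = \<mu> (f + g) \<and> w = (\<lambda>l. w' l / 4)) \<or> (M = \<mu> (f - g) \<and> w = (\<lambda>l. - w' l / 4))"
      by (auto simp: L'_def)
    show "sets M = sets half_line" using * by auto
    show "integrable M w" "integrable M (\<lambda>x. h x * w x)"
      using fg[OF *(1)] *(2) by (auto simp: ispace_def)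
  qed (use h rel eq in auto)
  then show ?thesis unfolding eq .
qed

text \<open>\<open>\<mu> (f + f)\<close> is four times \<open>\<mu> f\<close> on every set and
  \<open>\<mu> 0\<close> is null, which cancels the factor \<open>1 / 4\<close> of the
  polarization.\<close>

lemma bint_self:
  assumes h: "f \<in> ispace h" "h \<in> borel_measurable half_line"
  shows "bint h f f = (\<integral>l. h l \<partial>\<mu> f)"
proof -
  have f: "f \<in> H" using h by (simp add: ispace_def)
  define u where "u = f + f"
  have u: "u \<in> ispace h" unfolding u_def using h(2,1,1) by (rule ispace_mem(2))
  then have "u \<in> H" by (rule ispace_H)
  have "(\<Sum>(M, w)\<leftarrow>[(\<mu> u, \<lambda>_::real. 1 :: real), (\<mu> f, \<lambda>_. -4)]. \<integral>x. h x * w x \<partial>M) = 0"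
  proof (rule linear_relation_integral[where N = half_line])
    fix B assume B: "B \<in> sets half_line"
    have "ip (P B u) u = 4 * ip (P B f) f"
      unfolding u_def PB_add_left[OF B f f L2.V_mem(2)[OF f f]] PB_add_right[OF B f f f] by simp
    then show "(\<Sum>(M, w)\<leftarrow>[(\<mu> u, \<lambda>_::real. 1 :: real), (\<mu> f, \<lambda>_. -4)]. \<integral>x. indicator B x * w x \<partial>M) = 0"
      using B f \<open>u \<in> H\<close> sets.Int_space_eq2[of B half_line] by (simp add: measure_\<mu> space_half_line)
  next
    fix M w assume "(M, w) \<in> set [(\<mu> u, \<lambda>_::real. 1 :: real), (\<mu> f, \<lambda>_. -4)]"
    then show "integrable M (\<lambda>x. h x * w x)" "integrable M w" using h f u \<open>u \<in> H\<close>
      by (auto simp: ispace_def)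
  qed (use h f in auto)
  then show ?thesis using h unfolding bint_def u_def[symmetric] by (simp add: \<mu>_zero)
qed

lemma bint_add_left:
  assumes "h \<in> borel_measurable half_line" "f \<in> ispace h" "g \<in> ispace h" "k \<in> ispace h"
  shows "bint h (f + g) k = bint h f k + bint h g k"
proof -
  have H: "f \<in> H" "g \<in> H" "k \<in> H" using assms by (auto simp: ispace_def)
  have mem: "x \<in> ispace (\<lambda>l. - h l)" if "x \<in> ispace h" for x
    using that by (simp add: ispace_def)
  have "(\<Sum>(f, g, w)\<leftarrow>[(f + g, k, \<lambda>_. 1), (f, k, \<lambda>_. -1), (g, k, \<lambda>_. -1)]. bint (\<lambda>l. h l * w l) f g) = 0"
  proof (rule bint_relation)
    fix B assume "B \<in> sets half_line"
    then show "(\<Sum>(f, g, w)\<leftarrow>[(f + g, k, \<lambda>_. 1), (f, k, \<lambda>_. -1), (g, k, \<lambda>_. -1)]. bint (\<lambda>l. indicator B l * w l) f g) = 0"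
      using bint_indicator[of B f k] bint_indicator[of B g k] bint_indicator[of B "f + g" k] H
      by (simp add: bint_def PB_add_left diff_divide_distrib)
  qed (use mem assms H in auto)
  then show ?thesis by (simp add: bint_def field_simps)
qed

lemma bint_scale_left:
  assumes "h \<in> borel_measurable half_line" "f \<in> ispace h" "k \<in> ispace h"
  shows "bint h (c *\<^sub>R f) k = c * bint h f k"
proof -
  have H: "f \<in> H" "k \<in> H" using assms by (auto simp: ispace_def)
  have mem: "x \<in> ispace (\<lambda>l. h l * c)" "x \<in> ispace (\<lambda>l. - (h l * c))" if "x \<in> ispace h" for x
    using that by (auto simp: ispace_def)
  have "(\<Sum>(f, g, w)\<leftarrow>[(c *\<^sub>R f, k, \<lambda>_. 1), (f, k, \<lambda>_. -c)]. bint (\<lambda>l. h l * w l) f g) = 0"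
  proof (rule bint_relation)
    fix B assume "B \<in> sets half_line"
    then show "(\<Sum>(f, g, w)\<leftarrow>[(c *\<^sub>R f, k, \<lambda>_. 1), (f, k, \<lambda>_. -c)]. bint (\<lambda>l. indicator B l * w l) f g) = 0"
      using bint_indicator[of B f k] bint_indicator[of B "c *\<^sub>R f" k] H
      by (simp add: bint_def PB_scale_left field_simps)
  qed (use mem assms H in auto)
  then show ?thesis by (simp add: bint_def field_simps)
qed

lemma bint_sym:
  assumes "f \<in> H" "g \<in> H"
  shows "bint h f g = bint h g f"
proof -
  have "\<mu> (f - g) = \<mu> (g - f)"
    using assms PB_diff_commute[of _ f g] by (intro \<mu>_eqI) auto
  then show ?thesis by (simp add: bint_def add.commute)
qed

lemma bint_one: "f \<in> H \<Longrightarrow> g \<in> H \<Longrightarrow> bint (\<lambda>l. c) f g = c * ip f g"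
proof -
  assume fg: "f \<in> H" "g \<in> H"
  then have "bint (\<lambda>l. c) f g = c * ((ip (f + g) (f + g) - ip (f - g) (f - g)) / 4)"
    by (simp add: bint_def measure_\<mu> P_total algebra_simps)
  then show ?thesis unfolding L2.polarization[OF fg] .
qed

lemma semi_inner_bint:
  assumes h: "h \<in> borel_measurable half_line" and pos: "\<And>l. l \<ge> 0 \<Longrightarrow> h l \<ge> 0"
  shows "semi_inner_space (ispace h) (bint h)"
proof
  show "0 \<le> bint h x x" if "x \<in> ispace h" for x
    unfolding bint_self[OF that h] by (intro integral_nonneg_AE AE_I2) (simp add: pos)
  show "bint h x y = bint h y x" if "x \<in> ispace h" "y \<in> ispace h" for x y
    using that by (intro bint_sym ispace_H)
qed (fact subspace_ispace[OF h] bint_add_left[OF h] bint_scale_left[OF h])+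

lemma bint_cong: "(\<And>l. l \<ge> 0 \<Longrightarrow> h l = k l) \<Longrightarrow> bint h f g = bint k f g"
  unfolding bint_def by (intro arg_cong2[where f = "\<lambda>x y. (x - y) / 4"] Bochner_Integration.integral_cong) auto

text \<open>Cauchy-Schwarz needs a nonnegative integrand. Shifting \<open>h\<close> by its bound
  \<open>K\<close> provides one between \<open>0\<close> and \<open>2 * K\<close>, and removing
  \<open>K \<langle>f, g\<rangle>\<close> again costs
  \<open>(a - b)\<^sup>2 \<le> 2 * a\<^sup>2 + 2 * b\<^sup>2\<close>; hence the constant
  \<open>10 = 2 * 4 + 2\<close>.\<close>

lemma bint_bound:
  assumes h: "bounded_borel h"
  obtains C where "C \<ge> 0" "\<And>f g. f \<in> H \<Longrightarrow> g \<in> H \<Longrightarrow> (bint h f g)\<^sup>2 \<le> C * ip f f * ip g g"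
proof -
  obtain K where K: "K \<ge> 0" "\<And>l. l \<ge> 0 \<Longrightarrow> \<bar>h l\<bar> \<le> K" using bounded_borelE[OF h] by blast
  have hK: "bounded_borel (\<lambda>l. h l + K)" using h by blast
  interpret K: semi_inner_space H "bint (\<lambda>l. h l + K)"
  proof -
    have "0 \<le> h l + K" if "l \<ge> 0" for l using K(2)[OF that] by linarith
    then have "semi_inner_space (ispace (\<lambda>l. h l + K)) (bint (\<lambda>l. h l + K))"
      using bounded_borel_measurable[OF hK] by (intro semi_inner_bint) auto
    then show "semi_inner_space H (bint (\<lambda>l. h l + K))" using hK by simp
  qed
  have self: "bint (\<lambda>l. h l + K) f f \<le> 2 * K * ip f f" if f: "f \<in> H" for f
  proof -
    have "bint (\<lambda>l. h l + K) f f = (\<integral>l. h l + K \<partial>\<mu> f)"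
      using f hK by (intro bint_self) (auto simp: bounded_borel_def)
    also have "\<dots> \<le> (\<integral>l. 2 * K \<partial>\<mu> f)"
      using f hK K by (intro integral_mono_AE) (auto simp: abs_le_iff intro!: AE_I2)
    also have "\<dots> = 2 * K * ip f f" using f by (simp add: measure_\<mu> P_total)
    finally show ?thesis .
  qed
  have "(bint h f g)\<^sup>2 \<le> (10 * K\<^sup>2) * ip f f * ip g g" if fg: "f \<in> H" "g \<in> H" for f g
  proof -
    have "bint (\<lambda>l. h l + K) f g = bint h f g + bint (\<lambda>l. K) f g"
      unfolding bint_def using fg h by (simp add: add_divide_distrib diff_divide_distrib)
    then have eq: "bint h f g = bint (\<lambda>l. h l + K) f g - K * ip f g" using fg by (simp add: bint_one)
    have "(bint (\<lambda>l. h l + K) f g)\<^sup>2 \<le> bint (\<lambda>l. h l + K) f f * bint (\<lambda>l. h l + K) g g"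
      using fg by (rule K.Cauchy_Schwarz)
    also have "\<dots> \<le> (2 * K * ip f f) * (2 * K * ip g g)"
      using fg K(1) by (intro mult_mono self K.nonneg mult_nonneg_nonneg L2.nonneg) auto
    finally have 1: "(bint (\<lambda>l. h l + K) f g)\<^sup>2 \<le> 4 * K\<^sup>2 * ip f f * ip g g"
      by (simp add: power2_eq_square mult_ac)
    have "(K * ip f g)\<^sup>2 \<le> K\<^sup>2 * (ip f f * ip g g)"
      unfolding power_mult_distrib using fg by (intro mult_left_mono L2.Cauchy_Schwarz) auto
    moreover have "(a - b)\<^sup>2 \<le> 2 * a\<^sup>2 + 2 * b\<^sup>2" for a b :: real
      using zero_le_power2[of "a + b"] by (simp add: power2_sum power2_diff)
    ultimately have "(bint h f g)\<^sup>2 \<le> 2 * (4 * K\<^sup>2 * ip f f * ip g g) + 2 * (K\<^sup>2 * (ip f f * ip g g))"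
      unfolding eq using 1 by (smt (verit))
    then show ?thesis by (simp add: algebra_simps)
  qed
  then show ?thesis using that[of "10 * K\<^sup>2"] by simp
qed

text \<open>The bounded operator \<open>\<integral> h dP\<close>. Its value is a representative
  picked by \<open>SOME\<close>, so linearity and multiplicativity hold after pairing with a vector,
  not as equality of functions.\<close>

definition T :: "(real \<Rightarrow> real) \<Rightarrow> ('a \<Rightarrow> real) \<Rightarrow> 'a \<Rightarrow> real" where
  "T h f = (SOME v. v \<in> H \<and> (\<forall>w\<in>H. ip v w = bint h f w))"

lemma T_ex:
  assumes h: "bounded_borel h" and f: "f \<in> H"
  shows "\<exists>v. v \<in> H \<and> (\<forall>w\<in>H. ip v w = bint h f w)"
proof -
  obtain C where C: "\<And>f g. f \<in> H \<Longrightarrow> g \<in> H \<Longrightarrow> (bint h f g)\<^sup>2 \<le> C * ip f f * ip g g"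
    by (rule bint_bound[OF h]) blast
  have hm: "h \<in> borel_measurable half_line" using h by (simp add: bounded_borel_def)
  obtain v where "v \<in> H" "\<And>w. w \<in> H \<Longrightarrow> ip v w = bint h f w"
  proof (rule L2_Riesz[of m "bint h f" "C * ip f f"])
    show "bint h f (x + y) = bint h f x + bint h f y" if "x \<in> H" "y \<in> H" for x y
      unfolding bint_sym[OF f \<open>x \<in> H\<close>] bint_sym[OF f \<open>y \<in> H\<close>] bint_sym[OF f L2.V_mem(2)[OF that]]
      using that f h by (intro bint_add_left hm) auto
    show "bint h f (c *\<^sub>R x) = c * bint h f x" if "x \<in> H" for c x
      unfolding bint_sym[OF f \<open>x \<in> H\<close>] bint_sym[OF f L2.V_mem(4)[OF that]]
      using that f h by (intro bint_scale_left hm) auto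
    show "(bint h f x)\<^sup>2 \<le> C * ip f f * ip x x" if "x \<in> H" for x
      using C[OF f that] .
  qed blast
  then show ?thesis by blast
qed

lemma T_mem [simp, intro]: "bounded_borel h \<Longrightarrow> f \<in> H \<Longrightarrow> T h f \<in> H"
  and T_ip: "bounded_borel h \<Longrightarrow> f \<in> H \<Longrightarrow> w \<in> H \<Longrightarrow> ip (T h f) w = bint h f w"
  using someI_ex[OF T_ex[of h f]] by (auto simp: T_def)

lemma T_sym: "bounded_borel h \<Longrightarrow> f \<in> H \<Longrightarrow> g \<in> H \<Longrightarrow> ip (T h f) g = ip f (T h g)"
  by (metis T_ip T_mem L2.sym bint_sym)

lemma T_indicator: "B \<in> sets half_line \<Longrightarrow> f \<in> H \<Longrightarrow> g \<in> H \<Longrightarrow> ip (T (indicator B) f) g = ip (P B f) g"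
  using T_ip[of "indicator B" f g] bounded_borel_indicator[of B] by (simp add: bint_indicator)

text \<open>On indicators this is the multiplicativity of \<open>P\<close>: \<open>\<langle>P C f, P
  B g\<rangle> = \<langle>P (B \<inter> C) f, g\<rangle>\<close>. Integrability conditions stand in
  for boundedness of \<open>h\<close>, as the analysis of unbounded integrals requires.\<close>

lemma bint_P_gen:
  assumes h: "h \<in> borel_measurable half_line" and B: "B \<in> sets half_line"
    and fg: "f \<in> ispace h" "g \<in> H" "P B g \<in> ispace h" "g \<in> ispace (\<lambda>l. h l * indicator B l)"
  shows "bint h f (P B g) = bint (\<lambda>l. h l * indicator B l) f g"
proof -
  have f: "f \<in> H" using fg(1) by (rule ispace_H)
  have [simp]: "bounded_borel (\<lambda>l. - indicator B l)"
    using bounded_borel_mult[OF bounded_borel_const[of "-1"] bounded_borel_indicator[OF B]] by simp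
  have [measurable]: "B \<in> sets half_line" "h \<in> borel_measurable half_line" by (fact B h)+
  have hm: "(\<lambda>l. h l * indicator B l) \<in> borel_measurable half_line" by measurable
  have "f \<in> ispace (\<lambda>l. h l * indicator B l)"
    using fg(1) B integrable_real_mult_indicator[of B "\<mu> f" h] by (simp add: ispace_def)
  then have mem: "f + g \<in> ispace (\<lambda>l. h l * indicator B l)" "f - g \<in> ispace (\<lambda>l. h l * indicator B l)"
    "f + P B g \<in> ispace h" "f - P B g \<in> ispace h"
    using ispace_mem(2,3)[OF hm] ispace_mem(2,3)[OF h] fg by auto
  then have mem': "f + g \<in> ispace (\<lambda>l. - (h l * indicator B l))" "f - g \<in> ispace (\<lambda>l. - (h l * indicator B l))"
    by (auto simp: ispace_def)
  have "(\<Sum>(f, g, w)\<leftarrow>[(f, P B g, \<lambda>_. 1), (f, g, \<lambda>l. - indicator B l)]. bint (\<lambda>l. h l * w l) f g) = 0"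
  proof (rule bint_relation)
    fix C assume C: "C \<in> sets half_line"
    have "bint (\<lambda>l. indicator C l) f (P B g) = ip (P C f) (P B g)"
      using bint_indicator[of C f "P B g"] C B f fg by simp
    also have "\<dots> = ip (P (B \<inter> C) f) g"
      using P_sym[of B "P C f" g] P_mult[of B C f g] B C f fg by simp
    also have "\<dots> = bint (\<lambda>l. indicator C l * indicator B l) f g"
    proof -
      have "indicator (B \<inter> C) = (\<lambda>l. indicator C l * indicator B l :: real)"
        by (auto simp: indicator_def fun_eq_iff)
      then show ?thesis using bint_indicator[of "B \<inter> C" f g] B C f fg by simp
    qed
    finally show "(\<Sum>(f, g, w)\<leftarrow>[(f, P B g, \<lambda>_. 1), (f, g, \<lambda>l. - indicator B l)]. bint (\<lambda>l. indicator C l * w l) f g) = 0"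
      by (simp add: bint_minus)
  qed (use h B f fg mem mem' in auto)
  then show ?thesis by (simp add: bint_minus)
qed

lemma bint_P:
  assumes "bounded_borel h" "B \<in> sets half_line" "f \<in> H" "g \<in> H"
  shows "bint h f (P B g) = bint (\<lambda>l. h l * indicator B l) f g"
  using assms by (intro bint_P_gen) (auto simp: bounded_borel_mult bounded_borel_indicator bounded_borel_measurable)

text \<open>For an indicator \<open>k\<close> the projection \<open>P B\<close> moves to the second
  slot, where the defining property of \<open>T\<close> and \<open>bint_P\<close> apply;
  \<open>bint_relation\<close> then extends the law to bounded \<open>k\<close>.\<close>

lemma bint_T:
  assumes h: "bounded_borel h" and k: "bounded_borel k" and fg: "f \<in> H" "g \<in> H"
  shows "bint k (T h f) g = bint (\<lambda>l. k l * h l) f g"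
proof -
  have [simp]: "bounded_borel (\<lambda>l. - h l)" "bounded_borel (\<lambda>l. - (k l * h l))"
    using bounded_borel_mult[OF bounded_borel_const[of "-1"] h]
      bounded_borel_mult[OF bounded_borel_const[of "-1"] bounded_borel_mult[OF k h]]
    by auto
  have "(\<Sum>(f, g, w)\<leftarrow>[(T h f, g, \<lambda>_. 1), (f, g, \<lambda>l. - h l)]. bint (\<lambda>l. k l * w l) f g) = 0"
  proof (rule bint_relation)
    fix B assume B: "B \<in> sets half_line"
    have "bint (\<lambda>l. indicator B l) (T h f) g = ip (T h f) (P B g)"
      using bint_indicator[of B "T h f" g] P_sym[of B "T h f" g] B h fg by simp
    also have "\<dots> = bint (\<lambda>l. indicator B l * h l) f g"
      using T_ip[of h f "P B g"] bint_P[of h B f g] B h fg by (simp add: mult.commute)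
    finally show "(\<Sum>(f, g, w)\<leftarrow>[(T h f, g, \<lambda>_. 1), (f, g, \<lambda>l. - h l)]. bint (\<lambda>l. indicator B l * w l) f g) = 0"
      by (simp add: bint_minus)
  qed (use h k fg in \<open>auto simp: bounded_borel_measurable\<close>)
  then show ?thesis by (simp add: bint_minus)
qed

lemma T_mult:
  assumes "bounded_borel h" "bounded_borel k" "f \<in> H" "g \<in> H"
  shows "ip (T k (T h f)) g = ip (T (\<lambda>l. k l * h l) f) g"
  using assms by (simp add: T_ip bint_T bounded_borel_mult)

lemma T_inner:
  assumes "bounded_borel h" "bounded_borel k" "f \<in> H" "g \<in> H"
  shows "ip (T h f) (T k g) = bint (\<lambda>l. h l * k l) f g"
  using assms T_sym[of k "T h f" g] by (simp add: T_ip bint_T bounded_borel_mult mult.commute)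

lemma T_norm:
  assumes "bounded_borel h" "f \<in> H"
  shows "ip (T h f) (T h f) = (\<integral>l. (h l)\<^sup>2 \<partial>\<mu> f)"
  using assms bounded_borel_power2[OF assms(1)]
  by (simp add: T_inner bint_self power2_eq_square[symmetric] bounded_borel_def)

lemma T_add: "bounded_borel h \<Longrightarrow> f \<in> H \<Longrightarrow> g \<in> H \<Longrightarrow> w \<in> H \<Longrightarrow> ip (T h (f + g)) w = ip (T h f) w + ip (T h g) w"
  by (simp add: T_ip bint_add_left bounded_borel_def)

lemma T_scale: "bounded_borel h \<Longrightarrow> f \<in> H \<Longrightarrow> w \<in> H \<Longrightarrow> ip (T h (c *\<^sub>R f)) w = c * ip (T h f) w"
  by (simp add: T_ip bint_scale_left bounded_borel_def)

lemma T_diff: "bounded_borel h \<Longrightarrow> f \<in> H \<Longrightarrow> g \<in> H \<Longrightarrow> w \<in> H \<Longrightarrow> ip (T h (f - g)) w = ip (T h f) w - ip (T h g) w"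
  using T_add[of h f "(-1) *\<^sub>R g" w] T_scale[of h g w "-1"] by simp

lemma T_cong: "(\<And>l. l \<ge> 0 \<Longrightarrow> h l = k l) \<Longrightarrow> T h f = T k f"
  unfolding T_def using bint_cong[of h k f] by simp

lemma T_tendsto:
  assumes h: "bounded_borel h" and u: "\<And>n. u n \<in> H" and f: "f \<in> H" and lim: "form_tendsto ip u f"
  shows "form_tendsto ip (\<lambda>n. T h (u n)) (T h f)"
proof -
  obtain C where C: "C \<ge> 0" "\<And>f g. f \<in> H \<Longrightarrow> g \<in> H \<Longrightarrow> (bint (\<lambda>l. h l * h l) f g)\<^sup>2 \<le> C * ip f f * ip g g"
    using bint_bound[OF bounded_borel_mult[OF h h]] by blast
  have lim0: "(\<lambda>n. sqrt C * ip (u n - f) (u n - f)) \<longlonglongrightarrow> 0"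
    using lim unfolding form_tendsto_def by (auto intro!: tendsto_eq_intros)
  have "norm (ip (T h (u n) - T h f) (T h (u n) - T h f)) \<le> sqrt C * ip (u n - f) (u n - f)" for n
  proof -
    let ?v = "T h (u n) - T h f" and ?w = "u n - f"
    have w: "?w \<in> H" using u f by simp
    have *: "ip ?v z = ip (T h ?w) z" if "z \<in> H" for z
      using T_diff[of h "u n" f z] h u f that by (simp add: L2.diff_left)
    have v: "?v \<in> H" and Tw: "T h ?w \<in> H" using h u f w by auto
    have "ip ?v ?v = ip (T h ?w) (T h ?w)"
      using *[OF v] *[OF Tw] L2.sym[OF v Tw] by metis
    also have "\<dots> = bint (\<lambda>l. h l * h l) ?w ?w" by (rule T_inner[OF h h w w])
    also have "\<dots> \<le> sqrt C * ip ?w ?w"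
    proof (rule power2_le_imp_le)
      show "(bint (\<lambda>l. h l * h l) ?w ?w)\<^sup>2 \<le> (sqrt C * ip ?w ?w)\<^sup>2"
        using C(2)[OF w w] C(1) by (simp add: power_mult_distrib power2_eq_square[of "ip ?w ?w"])
      show "0 \<le> sqrt C * ip ?w ?w" using C(1) L2.nonneg[OF w] by simp
    qed
    finally show ?thesis using L2.nonneg[of ?v m] h u f by simp
  qed
  then show ?thesis
    unfolding form_tendsto_def by (intro Lim_null_comparison[OF _ lim0] always_eventually) blast
qed

text \<open>On each Borel set the indicator enters the calculus as one more factor, so both copies
  of \<open>h\<close> multiply it. Used with indicators, where it shows that cutting off the
  spectrum brings a vector into the domain of unbounded integrals.\<close>

lemma \<mu>_T:
  assumes h: "bounded_borel h" and f: "f \<in> H"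
  shows "\<mu> (T h f) = density (\<mu> f) (\<lambda>l. ennreal ((h l)\<^sup>2))"
proof (rule measure_eqI)
  fix B assume "B \<in> sets (\<mu> (T h f))"
  then have B: "B \<in> sets half_line" by simp
  have bb: "bounded_borel (\<lambda>l. indicator B l * (h l * h l))" using B h by (intro bounded_borel_mult bounded_borel_indicator)
  have "ip (P B (T h f)) (T h f) = bint (\<lambda>l. indicator B l * h l) f (T h f)"
    using bint_T[of h "indicator B" f "T h f"] B h f bounded_borel_indicator[OF B]
      bint_indicator[of B "T h f" "T h f"] by simp
  also have "\<dots> = bint (\<lambda>l. indicator B l * (h l * h l)) f f"
    using bint_sym[of f "T h f"] bint_T[of h "\<lambda>l. indicator B l * h l" f f] B h f
    by (simp add: bounded_borel_mult bounded_borel_indicator mult.assoc)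
  also have "\<dots> = (\<integral>l. indicator B l * (h l * h l) \<partial>\<mu> f)"
    using bb f by (intro bint_self) (auto simp: bounded_borel_def)
  finally have "emeasure (\<mu> (T h f)) B = ennreal (\<integral>l. indicator B l * (h l * h l) \<partial>\<mu> f)"
    using B h f by (simp add: emeasure_\<mu>)
  also have "\<dots> = (\<integral>\<^sup>+l. ennreal (indicator B l * (h l * h l)) \<partial>\<mu> f)"
    using bb f by (intro nn_integral_eq_integral[symmetric]) auto
  also have "\<dots> = (\<integral>\<^sup>+l. ennreal ((h l)\<^sup>2) * indicator B l \<partial>\<mu> f)"
    by (intro nn_integral_cong) (auto simp: indicator_def power2_eq_square)
  also have "\<dots> = emeasure (density (\<mu> f) (\<lambda>l. ennreal ((h l)\<^sup>2))) B"
    using B h f by (subst emeasure_density) (auto simp: bounded_borel_def cong: measurable_cong_sets)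
  finally show "emeasure (\<mu> (T h f)) B = emeasure (density (\<mu> f) (\<lambda>l. ennreal ((h l)\<^sup>2))) B" .
qed simp

end

section \<open>Self-adjoint operators and unbounded spectral integrals\<close>

lemma self_adjoint_op_sym:
  assumes "self_adjoint_op m A" "(f, g) \<in> A" "(u, v) \<in> A"
  shows "L2_inner m f v = L2_inner m g u"
  using assms unfolding self_adjoint_op_def by blast

lemma self_adjoint_op_mem:
  assumes "self_adjoint_op m A" "(f, g) \<in> A" shows "f \<in> L2_space m" "g \<in> L2_space m"
  using assms unfolding self_adjoint_op_def by blast+

lemma self_adjoint_opI:
  assumes "self_adjoint_op m A" "f \<in> L2_space m" "g \<in> L2_space m"
    "\<And>u v. (u, v) \<in> A \<Longrightarrow> L2_inner m f v = L2_inner m g u"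
  shows "(f, g) \<in> A"
  using assms unfolding self_adjoint_op_def by blast

text \<open>\<open>A\<close> equals its adjoint, so membership of a pair is a family of equations
  \<open>\<langle>f, v\<rangle> = \<langle>g, u\<rangle>\<close> that is linear and
  \<open>L\<^sup>2\<close>-continuous in the pair. Linearity here, and closedness and invariance
  under a.e. equality below, all come from this.\<close>

lemma self_adjoint_op_lincomb:
  assumes A: "self_adjoint_op m A" and fg: "(f, g) \<in> A" "(f', g') \<in> A"
  shows "(f + c *\<^sub>R f', g + c *\<^sub>R g') \<in> A"
proof (rule self_adjoint_opI[OF A])
  note mem = self_adjoint_op_mem[OF A]
  show "f + c *\<^sub>R f' \<in> L2_space m" "g + c *\<^sub>R g' \<in> L2_space m" using mem fg by blast+
  fix u v assume uv: "(u, v) \<in> A"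
  then show "L2_inner m (f + c *\<^sub>R f') v = L2_inner m (g + c *\<^sub>R g') u"
    using self_adjoint_op_sym[OF A fg(1) uv] self_adjoint_op_sym[OF A fg(2) uv] mem[OF uv] mem[OF fg(1)] mem[OF fg(2)]
    by (simp add: L2.bilin)
qed

lemma self_adjoint_op_zero:
  assumes A: "self_adjoint_op m A" shows "(0, 0) \<in> A"
  by (rule self_adjoint_opI[OF A]) (use self_adjoint_op_mem[OF A] in auto)

lemma self_adjoint_op_scale:
  assumes A: "self_adjoint_op m A" and fg: "(f, g) \<in> A"
  shows "(c *\<^sub>R f, c *\<^sub>R g) \<in> A"
  using self_adjoint_op_lincomb[OF A self_adjoint_op_zero[OF A] fg, of c] by simp

lemma self_adjoint_op_add:
  assumes A: "self_adjoint_op m A" and fg: "(f, g) \<in> A" "(f', g') \<in> A"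
  shows "(f + f', g + g') \<in> A"
  using self_adjoint_op_lincomb[OF A fg, of 1] by simp

lemma self_adjoint_op_diff:
  assumes A: "self_adjoint_op m A" and fg: "(f, g) \<in> A" "(f', g') \<in> A"
  shows "(f - f', g - g') \<in> A"
  using self_adjoint_op_lincomb[OF A fg, of "-1"] by simp

lemma self_adjoint_op_subspace: "self_adjoint_op m A \<Longrightarrow> subspace (Domain A)"
  by (rule subspaceI)
     (auto intro: DomainI self_adjoint_op_zero self_adjoint_op_add self_adjoint_op_scale)

lemma self_adjoint_op_closed:
  assumes A: "self_adjoint_op m A" and uv: "\<And>n. (u n, v n) \<in> A" and fg: "f \<in> L2_space m" "g \<in> L2_space m"
    and lim: "form_tendsto (L2_inner m) u f" "form_tendsto (L2_inner m) v g"
  shows "(f, g) \<in> A"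
proof (rule self_adjoint_opI[OF A fg])
  note mem = self_adjoint_op_mem[OF A]
  fix x y assume xy: "(x, y) \<in> A"
  have "(\<lambda>n. L2_inner m (u n) y) \<longlonglongrightarrow> L2_inner m f y" "(\<lambda>n. L2_inner m (v n) x) \<longlonglongrightarrow> L2_inner m g x"
    using mem[OF uv] mem[OF xy] fg lim by (auto intro!: L2.tendsto_left)
  moreover have "L2_inner m (u n) y = L2_inner m (v n) x" for n
    using A uv xy by (rule self_adjoint_op_sym)
  ultimately show "L2_inner m f y = L2_inner m g x" by (simp add: LIMSEQ_unique)
qed

lemma self_adjoint_op_cong_AE:
  assumes A: "self_adjoint_op m A" and uv: "(u, v) \<in> A" and fg: "f \<in> L2_space m" "g \<in> L2_space m"
    and eq: "AE x in m. u x = f x" "AE x in m. v x = g x"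
  shows "(f, g) \<in> A"
proof (rule self_adjoint_opI[OF A fg])
  note mem = self_adjoint_op_mem[OF A]
  fix x y assume xy: "(x, y) \<in> A"
  show "L2_inner m f y = L2_inner m g x"
    using self_adjoint_op_sym[OF A uv xy] L2_inner_AE_left[OF eq(1) mem(1)[OF uv] fg(1) mem(2)[OF xy]]
      L2_inner_AE_left[OF eq(2) mem(2)[OF uv] fg(2) mem(1)[OF xy]] by simp
qed

text \<open>An approximant \<open>g\<close> orthogonal to \<open>z\<close> satisfies
  \<open>\<parallel>z\<parallel> \<le> \<parallel>z - g\<parallel>\<close>, and density makes the
  right-hand side small.\<close>

lemma self_adjoint_op_dense:
  assumes A: "self_adjoint_op m A" and z: "z \<in> L2_space m"
    and orth: "\<And>u v. (u, v) \<in> A \<Longrightarrow> L2_inner m z u = 0"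
  shows "L2_inner m z z = 0"
proof -
  have "\<exists>g\<in>Domain A. L2_inner m (z - g) (z - g) < 1 / real (Suc n)" for n
    using A z unfolding self_adjoint_op_def fun_diff_def by (metis of_nat_0_less_iff zero_less_Suc zero_less_divide_1_iff)
  then obtain g where g: "\<And>n. g n \<in> Domain A" "\<And>n. L2_inner m (z - g n) (z - g n) < 1 / real (Suc n)" by metis
  have gm: "g n \<in> L2_space m" for n using g(1)[of n] self_adjoint_op_mem[OF A] by blast
  have "L2_inner m z z \<le> 1 / real (Suc n)" for n
  proof -
    have "L2_inner m z (g n) = 0" using g(1)[of n] orth by blast
    then have "L2_inner m z z \<le> L2_inner m (z - g n) (z - g n)"
      using z gm[of n] L2.nonneg[of "g n" m] by (simp add: L2.expand_diff)
    then show ?thesis using g(2)[of n] by simp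
  qed
  moreover have "(\<lambda>n. 1 / real (Suc n)) \<longlonglongrightarrow> 0" by (rule LIMSEQ_Suc[OF lim_1_over_n])
  ultimately have "L2_inner m z z \<le> 0" by (intro LIMSEQ_le_const) auto
  then show ?thesis using L2.nonneg[OF z] by simp
qed

lemma self_adjoint_op_unique:
  assumes A: "self_adjoint_op m A" and uv: "(u, v) \<in> A" "(u, v') \<in> A"
  shows "AE x in m. v x = v' x"
proof -
  note mem = self_adjoint_op_mem[OF A]
  have "L2_inner m (v - v') (v - v') = 0"
  proof (rule self_adjoint_op_dense[OF A])
    show "v - v' \<in> L2_space m" using mem uv by blast
    fix x y assume xy: "(x, y) \<in> A"
    show "L2_inner m (v - v') x = 0"
      using self_adjoint_op_sym[OF A uv(1) xy] self_adjoint_op_sym[OF A uv(2) xy] mem[OF xy] mem[OF uv(1)] mem[OF uv(2)]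
      by (simp add: L2.diff_left)
  qed
  then show ?thesis using L2_null_iff mem uv by blast
qed

lemma op_app_mem: "u \<in> Domain A \<Longrightarrow> (u, op_app A u) \<in> A"
  unfolding op_app_def by (erule DomainE) (rule someI[of "\<lambda>g. (u, g) \<in> A"])

section \<open>Unbounded spectral integrals\<close>

context pvm
begin

lemma spectral_integral_eq:
  "spectral_integral m P h = {(u, v). u \<in> ispace (\<lambda>l. (h l)\<^sup>2) \<and> v \<in> H \<and> (\<forall>w\<in>ispace (\<lambda>l. (h l)\<^sup>2). ip v w = bint h u w)}"
  by (auto simp: spectral_integral_def ispace_def bint_def plus_fun_def fun_diff_def)

lemma ispace_le:
  assumes f: "f \<in> ispace k" and h: "h \<in> borel_measurable half_line" and le: "\<And>l. l \<ge> 0 \<Longrightarrow> \<bar>h l\<bar> \<le> \<bar>k l\<bar>"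
  shows "f \<in> ispace h"
  using f h le unfolding ispace_def
  by (auto intro!: Bochner_Integration.integrable_bound[of "\<mu> f" k h] AE_I2)

lemma ispace_add:
  assumes f: "f \<in> ispace h" "f \<in> ispace k" shows "f \<in> ispace (\<lambda>l. h l + k l)"
  using f by (auto simp: ispace_def)

text \<open>Spectral measures are finite, so the pointwise bound of \<open>\<bar>h l\<bar>\<close>
  by \<open>1 + (h l)\<^sup>2\<close> suffices.\<close>

lemma ispace_square:
  assumes f: "f \<in> ispace (\<lambda>l. (h l)\<^sup>2)" and h: "h \<in> borel_measurable half_line"
  shows "f \<in> ispace h"
proof (rule ispace_le[OF _ h])
  have "f \<in> ispace (\<lambda>l. 1)" using f by (auto simp: ispace_def)
  then show "f \<in> ispace (\<lambda>l. 1 + (h l)\<^sup>2)" using f by (rule ispace_add)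
  show "\<bar>h l\<bar> \<le> \<bar>1 + (h l)\<^sup>2\<bar>" for l
  proof -
    have "0 \<le> (\<bar>h l\<bar> - 1)\<^sup>2" by simp
    then show ?thesis by (simp add: power2_diff)
  qed
qed

lemma bint_tendsto:
  assumes fg: "f \<in> ispace k" "g \<in> ispace k" and k: "k \<in> borel_measurable half_line"
    and hn: "\<And>n. h n \<in> borel_measurable half_line" and h: "h' \<in> borel_measurable half_line"
    and le: "\<And>n l. l \<ge> 0 \<Longrightarrow> \<bar>h n l\<bar> \<le> k l" and lim: "\<And>l. l \<ge> 0 \<Longrightarrow> (\<lambda>n. h n l) \<longlonglongrightarrow> h' l"
  shows "(\<lambda>n. bint (h n) f g) \<longlonglongrightarrow> bint h' f g"
proof -
  have *: "(\<lambda>n. \<integral>l. h n l \<partial>\<mu> x) \<longlonglongrightarrow> (\<integral>l. h' l \<partial>\<mu> x)" if x: "x \<in> ispace k" for x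
    by (rule integral_dominated_convergence[where w = k])
       (use x hn h le lim in \<open>auto simp: ispace_def\<close>)
  show ?thesis unfolding bint_def
    using fg k by (intro tendsto_intros * ispace_mem) auto
qed

text \<open>These spectral sets increase to \<open>[0,\<infinity>)\<close> with \<open>n\<close>,
  and on each of them the bounded calculus is available for \<open>h\<close>.\<close>

definition cut :: "(real \<Rightarrow> real) \<Rightarrow> nat \<Rightarrow> real set" where
  "cut h n = {l \<in> {0..}. \<bar>h l\<bar> \<le> real n}"

definition trunc :: "(real \<Rightarrow> real) \<Rightarrow> nat \<Rightarrow> real \<Rightarrow> real" where
  "trunc h n l = h l * indicator (cut h n) l"

lemma cut_sets [simp, intro]:
  assumes "h \<in> borel_measurable half_line" shows "cut h n \<in> sets half_line"
proof -
  have "{l \<in> space half_line. \<bar>h l\<bar> \<le> real n} \<in> sets half_line"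
    using assms by measurable
  then show ?thesis by (simp add: cut_def space_half_line)
qed

lemma indicator_cut_measurable [simp, intro]:
  "h \<in> borel_measurable half_line \<Longrightarrow> indicator (cut h n) \<in> borel_measurable half_line"
  by (intro borel_measurable_indicator cut_sets)

lemma trunc_measurable [simp, intro]:
  "h \<in> borel_measurable half_line \<Longrightarrow> trunc h n \<in> borel_measurable half_line"
  unfolding trunc_def[abs_def] by (intro borel_measurable_times indicator_cut_measurable)

lemma trunc_bounded [simp, intro]: "h \<in> borel_measurable half_line \<Longrightarrow> bounded_borel (trunc h n)"
  by (rule bounded_borelI[where K = "real n"]) (auto simp: trunc_def cut_def indicator_def)

lemma indicator_cut_tendsto: "l \<ge> 0 \<Longrightarrow> (\<lambda>n. indicator (cut h n) l :: real) \<longlonglongrightarrow> 1"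
proof -
  assume l: "l \<ge> 0"
  obtain N :: nat where N: "\<bar>h l\<bar> \<le> real N" using real_arch_simple by blast
  have "indicator (cut h n) l = (1 :: real)" if "n \<ge> N" for n
    using l N that by (auto simp: cut_def indicator_def)
  then show ?thesis by (intro tendsto_eventually) (auto simp: eventually_sequentially)
qed

lemma trunc_tendsto: "l \<ge> 0 \<Longrightarrow> (\<lambda>n. trunc h n l) \<longlonglongrightarrow> h l"
  unfolding trunc_def using indicator_cut_tendsto[of l h] by (auto intro!: tendsto_eq_intros)

lemma abs_trunc_le: "\<bar>trunc h n l\<bar> \<le> \<bar>h l\<bar>"
  by (auto simp: trunc_def indicator_def)

lemma P_cut_weak:
  assumes h: "h \<in> borel_measurable half_line" and "f \<in> H" "g \<in> H"
  shows "(\<lambda>n. ip (P (cut h n) f) g) \<longlonglongrightarrow> ip f g"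
proof -
  have "(\<lambda>n. bint (indicator (cut h n)) f g) \<longlonglongrightarrow> bint (\<lambda>l. 1) f g"
    by (rule bint_tendsto[where k = "\<lambda>l. 1"])
       (use assms indicator_cut_tendsto in \<open>auto simp: indicator_le_1\<close>)
  then show ?thesis using assms by (simp add: bint_indicator bint_one)
qed

lemma P_cut_tendsto:
  assumes h: "h \<in> borel_measurable half_line" and f: "f \<in> H"
  shows "form_tendsto ip (\<lambda>n. P (cut h n) f) f"
proof -
  have "ip (P (cut h n) f - f) (P (cut h n) f - f) = ip f f - ip (P (cut h n) f) f" for n
    using h f P_norm[of "cut h n" f] by (simp add: L2.expand_diff)
  moreover have "(\<lambda>n. ip f f - ip (P (cut h n) f) f) \<longlonglongrightarrow> ip f f - ip f f"
    using h f by (intro tendsto_intros P_cut_weak)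
  ultimately show ?thesis by (simp add: form_tendsto_def)
qed

text \<open>\<open>P B f\<close> and \<open>T (indicator B) f\<close> have the same spectral
  measure, which by \<open>\<mu>_T\<close> is \<open>\<mu> f\<close> restricted to \<open>B\<close>,
  where \<open>h\<close> is bounded.\<close>

lemma P_ispace:
  assumes B: "B \<in> sets half_line" and f: "f \<in> H" and h: "h \<in> borel_measurable half_line"
    and b: "bounded_borel (\<lambda>l. h l * indicator B l)"
  shows "P B f \<in> ispace h"
proof -
  have bi: "bounded_borel (indicator B)" using bounded_borel_indicator[OF B] by simp
  have "\<mu> (P B f) = \<mu> (T (indicator B) f)"
  proof (rule \<mu>_eqI)
    fix C assume C: "C \<in> sets half_line"
    have Tf: "T (indicator B) f \<in> H" using bi f by blast
    have "ip (P C (T (indicator B) f)) (T (indicator B) f) = ip (P B f) (P C (T (indicator B) f))"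
      using T_indicator[OF B f, of "P C (T (indicator B) f)"] P_sym[OF C Tf Tf] C Tf by simp
    also have "\<dots> = ip (T (indicator B) f) (P C (P B f))"
      using P_sym[OF C, of "P B f" "T (indicator B) f"] L2.sym[of "P C (P B f)" m "T (indicator B) f"] B C Tf f by simp
    also have "\<dots> = ip (P C (P B f)) (P B f)"
      using T_indicator[OF B f, of "P C (P B f)"] L2.sym[of "P B f" m "P C (P B f)"] B C f by simp
    finally show "ip (P C (P B f)) (P B f) = ip (P C (T (indicator B) f)) (T (indicator B) f)" by simp
  qed (use B f bi in auto)
  also have "\<dots> = density (\<mu> f) (\<lambda>l. ennreal ((indicator B l)\<^sup>2))"
    using bi f by (rule \<mu>_T)
  also have "integrable \<dots> h"
  proof -
    have "(\<lambda>l. (indicator B l)\<^sup>2 *\<^sub>R h l) = (\<lambda>l. h l * indicator B l)"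
      by (auto simp: fun_eq_iff indicator_def)
    then show ?thesis
      using integrable_bounded[OF b f] h B
      by (subst integrable_density) (auto simp: power2_eq_square cong: measurable_cong_sets)
  qed
  finally show ?thesis using B f by (simp add: ispace_def)
qed

lemma P_cut_ispace:
  assumes h: "h \<in> borel_measurable half_line" and f: "f \<in> H"
  shows "P (cut h n) f \<in> ispace (\<lambda>l. (h l)\<^sup>2)"
proof (rule P_ispace)
  have "bounded_borel (\<lambda>l. (trunc h n l)\<^sup>2)" using h by blast
  moreover have "(\<lambda>l. (trunc h n l)\<^sup>2) = (\<lambda>l. (h l)\<^sup>2 * indicator (cut h n) l)"
    by (auto simp: trunc_def indicator_def)
  ultimately show "bounded_borel (\<lambda>l. (h l)\<^sup>2 * indicator (cut h n) l)" by simp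
qed (use h f in auto)

text \<open>All properties of \<open>\<integral> h dP\<close> are reduced to the bounded functional calculus through this
  characterization.\<close>

lemma spectral_integral_iff:
  assumes h: "h \<in> borel_measurable half_line"
  shows "(u, v) \<in> spectral_integral m P h \<longleftrightarrow>
    u \<in> H \<and> v \<in> H \<and> (\<forall>n. \<forall>w\<in>H. ip (P (cut h n) v) w = ip (T (trunc h n) u) w)"
proof (intro iffI conjI allI ballI)
  assume uv: "(u, v) \<in> spectral_integral m P h"
  then have u2: "u \<in> ispace (\<lambda>l. (h l)\<^sup>2)" and v: "v \<in> H" and *: "\<And>w. w \<in> ispace (\<lambda>l. (h l)\<^sup>2) \<Longrightarrow> ip v w = bint h u w"
    by (auto simp: spectral_integral_eq)
  show u: "u \<in> H" using u2 by (rule ispace_H)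
  show "v \<in> H" by fact
  fix n w assume w: "w \<in> H"
  have Pw: "P (cut h n) w \<in> ispace (\<lambda>l. (h l)\<^sup>2)" using h w by (rule P_cut_ispace)
  have "ip (P (cut h n) v) w = bint h u (P (cut h n) w)"
    using *[OF Pw] P_sym[of "cut h n" v w] h v w by simp
  also have "\<dots> = bint (trunc h n) u w"
  proof -
    have eq: "trunc h n = (\<lambda>l. h l * indicator (cut h n) l)" by (simp add: trunc_def fun_eq_iff)
    have "w \<in> ispace (\<lambda>l. h l * indicator (cut h n) l)"
      using trunc_bounded[OF h, of n] w unfolding eq[symmetric] by simp
    then show ?thesis
      unfolding eq using bint_P_gen[OF h cut_sets[OF h] ispace_square[OF u2 h] w ispace_square[OF Pw h]] by blast
  qed
  also have "\<dots> = ip (T (trunc h n) u) w" using h u w by (simp add: T_ip)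
  finally show "ip (P (cut h n) v) w = ip (T (trunc h n) u) w" .
next
  assume "u \<in> H \<and> v \<in> H \<and> (\<forall>n. \<forall>w\<in>H. ip (P (cut h n) v) w = ip (T (trunc h n) u) w)"
  then have u: "u \<in> H" and v: "v \<in> H" and *: "\<And>n w. w \<in> H \<Longrightarrow> ip (P (cut h n) v) w = ip (T (trunc h n) u) w"
    by auto
  \<comment> \<open>Weak equality of \<open>P (cut h n) v\<close> and
    \<open>T (trunc h n) u\<close>, used with each as test vector, gives equality of norms. So the
    truncated integrals of \<open>h\<^sup>2\<close> are at most
    \<open>\<parallel>v\<parallel>\<^sup>2\<close>, and Fatou's lemma puts \<open>u\<close> into the
    domain.\<close>
  have le: "(\<integral>\<^sup>+l. ennreal ((trunc h n l)\<^sup>2) \<partial>\<mu> u) \<le> ennreal (ip v v)" for n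
  proof -
    have "(\<integral>\<^sup>+l. ennreal ((trunc h n l)\<^sup>2) \<partial>\<mu> u) = ennreal (\<integral>l. (trunc h n l)\<^sup>2 \<partial>\<mu> u)"
      using u h by (intro nn_integral_eq_integral integrable_bounded bounded_borel_power2) auto
    also have "(\<integral>l. (trunc h n l)\<^sup>2 \<partial>\<mu> u) = ip (T (trunc h n) u) (T (trunc h n) u)"
      using u h by (simp add: T_norm)
    also have "\<dots> = ip (P (cut h n) v) (P (cut h n) v)"
      using *[of "T (trunc h n) u" n] *[of "P (cut h n) v" n] L2.sym[of "P (cut h n) v" m "T (trunc h n) u"] u v h by simp
    also have "\<dots> \<le> ip v v"
    proof -
      have c: "cut h n \<in> sets half_line" using h by simp
      have "0 \<le> ip (v - P (cut h n) v) (v - P (cut h n) v)" using c v by (intro L2.nonneg) auto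
      then show ?thesis
        using P_norm[OF c v] L2.sym[of v m "P (cut h n) v"] c v by (simp add: L2.expand_diff)
    qed
    finally show ?thesis by (simp add: ennreal_leI)
  qed
  have "(\<integral>\<^sup>+l. ennreal ((h l)\<^sup>2) \<partial>\<mu> u) = (\<integral>\<^sup>+l. liminf (\<lambda>n. ennreal ((trunc h n l)\<^sup>2)) \<partial>\<mu> u)"
  proof (rule nn_integral_cong)
    fix l assume "l \<in> space (\<mu> u)"
    then have "(\<lambda>n. ennreal ((trunc h n l)\<^sup>2)) \<longlonglongrightarrow> ennreal ((h l)\<^sup>2)"
      by (intro tendsto_intros trunc_tendsto) simp
    then show "ennreal ((h l)\<^sup>2) = liminf (\<lambda>n. ennreal ((trunc h n l)\<^sup>2))"
      by (rule lim_imp_Liminf[OF sequentially_bot, symmetric])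
  qed
  also have "\<dots> \<le> liminf (\<lambda>n. \<integral>\<^sup>+l. ennreal ((trunc h n l)\<^sup>2) \<partial>\<mu> u)"
    using bounded_borel_measurable[OF trunc_bounded[OF h]] by (intro nn_integral_liminf) auto
  also have "\<dots> \<le> ennreal (ip v v)" using le by (intro Liminf_le) auto
  also have "\<dots> < \<infinity>" by simp
  finally have u2: "u \<in> ispace (\<lambda>l. (h l)\<^sup>2)"
    using h u by (auto simp: ispace_def intro!: integrableI_nonneg)
  have "ip v w = bint h u w" if w2: "w \<in> ispace (\<lambda>l. (h l)\<^sup>2)" for w
  proof (rule LIMSEQ_unique)
    have w: "w \<in> H" using w2 by (rule ispace_H)
    show "(\<lambda>n. ip (P (cut h n) v) w) \<longlonglongrightarrow> ip v w" using h v w by (rule P_cut_weak)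
    have "(\<lambda>n. bint (trunc h n) u w) \<longlonglongrightarrow> bint h u w"
    proof (rule bint_tendsto[where k = "\<lambda>l. \<bar>h l\<bar>"])
      show "u \<in> ispace (\<lambda>l. \<bar>h l\<bar>)" "w \<in> ispace (\<lambda>l. \<bar>h l\<bar>)"
        using ispace_square[OF u2 h] ispace_square[OF w2 h] by (auto simp: ispace_def)
    qed (use h in \<open>auto simp: abs_trunc_le trunc_tendsto bounded_borel_measurable\<close>)
    then show "(\<lambda>n. ip (P (cut h n) v) w) \<longlonglongrightarrow> bint h u w"
      using h u w by (simp add: * T_ip)
  qed
  then show "(u, v) \<in> spectral_integral m P h" using u2 v by (auto simp: spectral_integral_eq)
qed

lemma spectral_integral_T_tendsto:
  assumes h: "h \<in> borel_measurable half_line" and uv: "(u, v) \<in> spectral_integral m P h" and w: "w \<in> H"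
  shows "(\<lambda>n. ip (T (trunc h n) u) w) \<longlonglongrightarrow> ip v w"
proof -
  have *: "v \<in> H" "\<And>n. ip (P (cut h n) v) w = ip (T (trunc h n) u) w"
    using uv w spectral_integral_iff[OF h] by auto
  show ?thesis using P_cut_weak[OF h *(1) w] unfolding *(2) .
qed

lemma spectral_integral_norm:
  assumes h: "h \<in> borel_measurable half_line" and uv: "(u, v) \<in> spectral_integral m P h"
  shows "ip v v = (\<integral>l. (h l)\<^sup>2 \<partial>\<mu> u)"
proof -
  have u: "u \<in> H" and v: "v \<in> H" and *: "\<And>n w. w \<in> H \<Longrightarrow> ip (P (cut h n) v) w = ip (T (trunc h n) u) w"
    using uv spectral_integral_iff[OF h] by auto
  have u2: "u \<in> ispace (\<lambda>l. (h l)\<^sup>2)" using uv by (auto simp: spectral_integral_eq)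
  have c: "cut h n \<in> sets half_line" for n using h by simp
  have "ip (P (cut h n) v) v = (\<integral>l. (trunc h n l)\<^sup>2 \<partial>\<mu> u)" for n
  proof -
    have "ip (P (cut h n) v) v = ip (P (cut h n) v) (P (cut h n) v)" using P_norm[OF c v] by simp
    also have "\<dots> = ip (T (trunc h n) u) (T (trunc h n) u)"
      using *[of "T (trunc h n) u" n] *[of "P (cut h n) v" n] L2.sym[of "P (cut h n) v" m "T (trunc h n) u"] u v h by simp
    finally show ?thesis using u h by (simp add: T_norm)
  qed
  moreover have "(\<lambda>n. \<integral>l. (trunc h n l)\<^sup>2 \<partial>\<mu> u) \<longlonglongrightarrow> (\<integral>l. (h l)\<^sup>2 \<partial>\<mu> u)"
  proof (rule integral_dominated_convergence[where w = "\<lambda>l. (h l)\<^sup>2"])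
    show "AE l in \<mu> u. norm ((trunc h n l)\<^sup>2) \<le> (h l)\<^sup>2" for n
      by (auto simp: trunc_def indicator_def)
    show "AE l in \<mu> u. (\<lambda>n. (trunc h n l)\<^sup>2) \<longlonglongrightarrow> (h l)\<^sup>2"
      by (intro AE_I2 tendsto_intros trunc_tendsto) simp
    show "(\<lambda>l. (trunc h n l)\<^sup>2) \<in> borel_measurable (\<mu> u)" for n
      using borel_measurable_power[OF trunc_measurable[OF h]] by simp
  qed (use u2 h in \<open>auto simp: ispace_def bounded_borel_measurable\<close>)
  ultimately show ?thesis using P_cut_weak[OF h v v] by (simp add: LIMSEQ_unique)
qed

text \<open>Composition of a bounded with an unbounded function whose product is bounded; it is what
  lets \<open>1 / sqrt l\<close>, cut off near \<open>0\<close> and \<open>\<infinity>\<close>, undo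
  a square root.\<close>

lemma spectral_integral_T:
  assumes h: "h \<in> borel_measurable half_line" and uv: "(u, v) \<in> spectral_integral m P h" and w: "w \<in> H"
    and k: "bounded_borel k" "bounded_borel (\<lambda>l. k l * h l)"
  shows "ip (T k v) w = ip (T (\<lambda>l. k l * h l) u) w"
proof -
  have u: "u \<in> H" and v: "v \<in> H" using uv spectral_integral_iff[OF h] by auto
  have "ip (T k v) w = ip v (T k w)" using k v w by (simp add: T_sym)
  moreover have "(\<lambda>n. ip (T (trunc h n) u) (T k w)) \<longlonglongrightarrow> ip v (T k w)"
    using h uv k w by (intro spectral_integral_T_tendsto) auto
  moreover have "ip (T (trunc h n) u) (T k w) = bint (\<lambda>l. trunc h n l * k l) u w" for n
    using h k u w by (intro T_inner) auto
  moreover have "(\<lambda>n. bint (\<lambda>l. trunc h n l * k l) u w) \<longlonglongrightarrow> bint (\<lambda>l. k l * h l) u w"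
  proof -
    have hk: "bounded_borel (\<lambda>l. \<bar>k l * h l\<bar>)"
      using k(2) by (auto simp: bounded_borel_def)
    show ?thesis
    proof (rule bint_tendsto[where k = "\<lambda>l. \<bar>k l * h l\<bar>"])
      show "(\<lambda>n. trunc h n l * k l) \<longlonglongrightarrow> k l * h l" if "l \<ge> 0" for l
        using trunc_tendsto[OF that, of h] by (auto intro!: tendsto_eq_intros)
      show "\<bar>trunc h n l * k l\<bar> \<le> \<bar>k l * h l\<bar>" for n l
        using mult_right_mono[OF abs_trunc_le[of h n l], of "\<bar>k l\<bar>"] by (simp add: abs_mult mult.commute)
      show "(\<lambda>l. trunc h n l * k l) \<in> borel_measurable half_line" for n
        using h k by (intro borel_measurable_times) (auto simp: bounded_borel_measurable)
    qed (use h k hk u w in \<open>auto simp: bounded_borel_measurable\<close>)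
  qed
  ultimately show ?thesis using T_ip[OF k(2) u w] by (simp add: LIMSEQ_unique)
qed

text \<open>The vectors \<open>T (trunc h n) u\<close> are Cauchy: the squared distance of two of
  them is at most the integral of \<open>h\<^sup>2\<close> outside the smaller of the two cuts, a
  tail of a convergent integral.\<close>

lemma spectral_integral_ex:
  assumes h: "h \<in> borel_measurable half_line" and u2: "u \<in> ispace (\<lambda>l. (h l)\<^sup>2)"
  obtains v where "(u, v) \<in> spectral_integral m P h"
proof -
  have u: "u \<in> H" using u2 by (rule ispace_H)
  define x where "x n = T (trunc h n) u" for n
  have x: "x n \<in> H" for n using h u by (auto simp: x_def)
  define c where "c n = (\<integral>l. (h l)\<^sup>2 * (1 - indicator (cut h n) l) \<partial>\<mu> u)" for n
  have "c \<longlonglongrightarrow> (\<integral>l. 0 \<partial>\<mu> u)"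
    unfolding c_def
  proof (rule integral_dominated_convergence[where w = "\<lambda>l. (h l)\<^sup>2"])
    show "AE l in \<mu> u. (\<lambda>n. (h l)\<^sup>2 * (1 - indicator (cut h n) l)) \<longlonglongrightarrow> 0"
      using indicator_cut_tendsto[of _ h] by (intro AE_I2) (auto intro!: tendsto_eq_intros)
    show "(\<lambda>l. (h l)\<^sup>2 * (1 - indicator (cut h n) l)) \<in> borel_measurable (\<mu> u)" for n
      using borel_measurable_times[OF borel_measurable_power[OF h] borel_measurable_diff[OF borel_measurable_const indicator_cut_measurable[OF h]]]
      by simp
  qed (use u2 h in \<open>auto simp: ispace_def indicator_def\<close>)
  then have c0: "c \<longlonglongrightarrow> 0" by simp
  have diff: "ip (x i - x j) (x i - x j) \<le> c (min i j)" for i j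
  proof -
    have "ip (x i - x j) (x i - x j) = (\<integral>l. (trunc h i l)\<^sup>2 \<partial>\<mu> u) - 2 * (\<integral>l. trunc h i l * trunc h j l \<partial>\<mu> u) + (\<integral>l. (trunc h j l)\<^sup>2 \<partial>\<mu> u)"
      using h u x[of i] x[of j] bounded_borel_mult[OF trunc_bounded[OF h, of i] trunc_bounded[OF h, of j]]
      by (simp add: L2.expand_diff x_def T_norm T_inner bint_self bounded_borel_measurable)
    also have "\<dots> = (\<integral>l. (trunc h i l)\<^sup>2 - 2 * (trunc h i l * trunc h j l) + (trunc h j l)\<^sup>2 \<partial>\<mu> u)"
      using h u by (simp add: bounded_borel_mult bounded_borel_power2)
    also have "\<dots> \<le> c (min i j)"
      unfolding c_def
    proof (rule integral_mono_AE)
      show "integrable (\<mu> u) (\<lambda>l. (h l)\<^sup>2 * (1 - indicator (cut h (min i j)) l))"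
      proof (rule Bochner_Integration.integrable_bound[of _ "\<lambda>l. (h l)\<^sup>2"])
        show "(\<lambda>l. (h l)\<^sup>2 * (1 - indicator (cut h (min i j)) l)) \<in> borel_measurable (\<mu> u)"
          using borel_measurable_times[OF borel_measurable_power[OF h] borel_measurable_diff[OF borel_measurable_const indicator_cut_measurable[OF h]]]
          by simp
      qed (use u2 in \<open>auto simp: ispace_def indicator_def\<close>)
      show "AE l in \<mu> u. (trunc h i l)\<^sup>2 - 2 * (trunc h i l * trunc h j l) + (trunc h j l)\<^sup>2 \<le> (h l)\<^sup>2 * (1 - indicator (cut h (min i j)) l)"
        by (intro AE_I2) (auto simp: trunc_def indicator_def cut_def power2_eq_square)
    qed (use h u in \<open>simp add: bounded_borel_mult bounded_borel_power2\<close>)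
    finally show ?thesis .
  qed
  have cau: "form_Cauchy ip x"
    unfolding form_Cauchy_eq
  proof (intro allI impI)
    fix e :: real assume "e > 0"
    then obtain N where N: "\<And>n. n \<ge> N \<Longrightarrow> c n < e"
      using order_tendstoD(2)[OF c0] unfolding eventually_sequentially by blast
    have "ip (x i - x j) (x i - x j) < e" if "i \<ge> N" "j \<ge> N" for i j
      using diff[of i j] N[of "min i j"] that by simp
    then show "\<exists>N. \<forall>i\<ge>N. \<forall>j\<ge>N. ip (x i - x j) (x i - x j) < e" by blast
  qed
  obtain v where v: "v \<in> H" "form_tendsto ip x v" using x cau by (rule L2_complete)
  have "ip (P (cut h k) v) w = ip (T (trunc h k) u) w" if w: "w \<in> H" for k w
  proof -
    have c: "cut h k \<in> sets half_line" using h by simp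
    have "(\<lambda>n. ip (x n) (P (cut h k) w)) \<longlonglongrightarrow> ip v (P (cut h k) w)"
      using x v c w by (intro L2.tendsto_left) auto
    moreover have "ip (x n) (P (cut h k) w) = ip (T (trunc h k) u) w" if "n \<ge> k" for n
    proof -
      have "ip (x n) (P (cut h k) w) = bint (trunc h n) u (P (cut h k) w)"
        unfolding x_def using h u c w by (intro T_ip) auto
      also have "\<dots> = bint (\<lambda>l. trunc h n l * indicator (cut h k) l) u w"
        using h u c w by (intro bint_P) auto
      also have "(\<lambda>l. trunc h n l * indicator (cut h k) l) = trunc h k"
        using that by (auto simp: trunc_def indicator_def cut_def fun_eq_iff)
      finally show ?thesis using h u w by (simp add: T_ip)
    qed
    then have "(\<lambda>n. ip (x n) (P (cut h k) w)) \<longlonglongrightarrow> ip (T (trunc h k) u) w"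
      by (intro tendsto_eventually) (auto simp: eventually_sequentially)
    ultimately have "ip v (P (cut h k) w) = ip (T (trunc h k) u) w" by (rule LIMSEQ_unique)
    then show ?thesis using P_sym[OF c v(1) w] by simp
  qed
  then have "(u, v) \<in> spectral_integral m P h" using spectral_integral_iff[OF h] u v by blast
  then show ?thesis by (rule that)
qed

lemma Domain_spectral_integral:
  assumes h: "h \<in> borel_measurable half_line"
  shows "Domain (spectral_integral m P h) = ispace (\<lambda>l. (h l)\<^sup>2)"
  using spectral_integral_ex[OF h] by (auto simp: spectral_integral_eq elim!: DomainE) blast

lemma spectral_integral_cut:
  assumes h: "h \<in> borel_measurable half_line" and w: "w \<in> H"
  shows "(P (cut h n) w, T (trunc h n) w) \<in> spectral_integral m P h"
proof -
  have c: "cut h k \<in> sets half_line" for k using h by simp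
  have "ip (P (cut h k) (T (trunc h n) w)) z = ip (T (trunc h k) (P (cut h n) w)) z" if z: "z \<in> H" for k z
  proof -
    have "ip (P (cut h k) (T (trunc h n) w)) z = bint (trunc h n) w (P (cut h k) z)"
      using P_sym[OF c, of "T (trunc h n) w" z] h w z c by (simp add: T_ip)
    also have "\<dots> = bint (\<lambda>l. trunc h n l * indicator (cut h k) l) w z"
      using h w z c by (intro bint_P) auto
    also have "(\<lambda>l. trunc h n l * indicator (cut h k) l) = (\<lambda>l. trunc h k l * indicator (cut h n) l)"
      by (auto simp: trunc_def fun_eq_iff)
    also have "bint \<dots> w z = bint (trunc h k) (P (cut h n) w) z"
      using bint_P[of "trunc h k" "cut h n" z w] bint_sym h w z c by simp
    finally show ?thesis using h w z c by (simp add: T_ip)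
  qed
  then show ?thesis using spectral_integral_iff[OF h] h w c by auto
qed

text \<open>Symmetry passes to the limit from the truncations. Conversely a pair of the adjoint,
  tested with the members of the graph from \<open>spectral_integral_cut\<close>, satisfies the
  criterion \<open>spectral_integral_iff\<close>.\<close>

theorem spectral_integral_self_adjoint:
  assumes h: "h \<in> borel_measurable half_line"
  shows "self_adjoint_op m (spectral_integral m P h)"
  unfolding self_adjoint_op_def
proof (intro conjI ballI allI impI)
  show "spectral_integral m P h \<subseteq> H \<times> H" by (auto simp: spectral_integral_def)
next
  fix f and e :: real assume f: "f \<in> H" and e: "e > 0"
  have "\<forall>\<^sub>F n in sequentially. ip (P (cut h n) f - f) (P (cut h n) f - f) < e"
    using P_cut_tendsto[OF h f] e unfolding form_tendsto_def by (rule order_tendstoD(2))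
  then obtain n where "ip (P (cut h n) f - f) (P (cut h n) f - f) < e"
    unfolding eventually_sequentially by blast
  then have "ip (f - P (cut h n) f) (f - P (cut h n) f) < e"
    using L2.diff_commute[of f m "P (cut h n) f"] f h by simp
  then show "\<exists>g\<in>Domain (spectral_integral m P h). ip (\<lambda>x. f x - g x) (\<lambda>x. f x - g x) < e"
    using spectral_integral_cut[OF h f, of n] unfolding fun_diff_def by blast
next
  fix f g assume f: "f \<in> H" and g: "g \<in> H"
  have c: "cut h k \<in> sets half_line" for k using h by simp
  show "(f, g) \<in> spectral_integral m P h \<longleftrightarrow> (\<forall>(u, v)\<in>spectral_integral m P h. ip f v = ip g u)"
  proof
    assume fg: "(f, g) \<in> spectral_integral m P h"
    have "ip f v = ip g u" if uv: "(u, v) \<in> spectral_integral m P h" for u v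
    proof -
      have uvH: "u \<in> H" "v \<in> H" using uv by (auto simp: spectral_integral_def)
      have "(\<lambda>n. ip (T (trunc h n) f) u) \<longlonglongrightarrow> ip g u"
        using h fg uvH(1) by (rule spectral_integral_T_tendsto)
      moreover have "(\<lambda>n. ip (T (trunc h n) u) f) \<longlonglongrightarrow> ip v f"
        using h uv f by (rule spectral_integral_T_tendsto)
      moreover have "ip (T (trunc h n) f) u = ip (T (trunc h n) u) f" for n
        using T_sym[OF trunc_bounded[OF h] f uvH(1)] L2.sym[OF f, of "T (trunc h n) u"] h uvH by simp
      ultimately have "ip g u = ip v f" by (simp add: LIMSEQ_unique)
      then show ?thesis using L2.sym[OF f uvH(2)] by simp
    qed
    then show "\<forall>(u, v)\<in>spectral_integral m P h. ip f v = ip g u" by blast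
  next
    assume *: "\<forall>(u, v)\<in>spectral_integral m P h. ip f v = ip g u"
    have "ip (P (cut h n) g) w = ip (T (trunc h n) f) w" if w: "w \<in> H" for n w
      using * spectral_integral_cut[OF h w, of n] P_sym[OF c g w, of n] T_sym[OF trunc_bounded[OF h] f w, of n]
      by fastforce
    then show "(f, g) \<in> spectral_integral m P h" using spectral_integral_iff[OF h] f g by blast
  qed
qed

end

section \<open>Image of a spectral measure and the Hausdorff moment problem\<close>

text \<open>The spectral resolution of \<open>\<phi>(A)\<close> if \<open>P\<close> resolves
  \<open>A\<close> and \<open>\<phi>\<close> maps the half line into itself; the intersection keeps
  preimages inside the half line.\<close>

definition push :: "(real \<Rightarrow> real) \<Rightarrow> (real set \<Rightarrow> ('a \<Rightarrow> real) \<Rightarrow> 'a \<Rightarrow> real) \<Rightarrow> real set \<Rightarrow> ('a \<Rightarrow> real) \<Rightarrow> 'a \<Rightarrow> real" where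
  "push \<phi> P B = P (\<phi> -` B \<inter> {0..})"

context pvm
begin

lemma preimage_half_line:
  assumes "\<phi> \<in> half_line \<rightarrow>\<^sub>M half_line" "B \<in> sets half_line"
  shows "\<phi> -` B \<inter> {0..} \<in> sets half_line"
  using measurable_sets[OF assms] by (simp add: space_half_line)

lemma pvm_push:
  assumes \<phi>: "\<phi> \<in> half_line \<rightarrow>\<^sub>M half_line"
  shows "pvm m (push \<phi> P)"
proof
  have \<phi>0: "\<phi> l \<ge> 0" if "l \<ge> 0" for l
    using measurable_space[OF \<phi>, of l] that by (simp add: space_half_line)
  note pre = preimage_half_line[OF \<phi>]
  have P_AE: "AE x in m. P B (P C f) x = P (B \<inter> C) f x"
    if "B \<in> sets half_line" "C \<in> sets half_line" "f \<in> H" for B C f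
    using pvm that unfolding projection_valued_measure_def by blast
  have P_tot: "AE x in m. P {0..} f x = f x" if "f \<in> H" for f
    using pvm that unfolding projection_valued_measure_def by blast
  have P_sums: "(\<lambda>i. ip (P (C i) f) f) sums ip (P (\<Union>i. C i) f) f"
    if "range C \<subseteq> sets half_line" "disjoint_family C" "f \<in> H" for C :: "nat \<Rightarrow> real set" and f
    using pvm that unfolding projection_valued_measure_def by blast
  show "projection_valued_measure m (push \<phi> P)"
    unfolding projection_valued_measure_def push_def
  proof (intro conjI ballI allI impI)
    fix B C f assume B: "B \<in> sets half_line" and C: "C \<in> sets half_line" and f: "f \<in> H"
    have "\<phi> -` B \<inter> {0..} \<inter> (\<phi> -` C \<inter> {0..}) = \<phi> -` (B \<inter> C) \<inter> {0..}" by auto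
    then show "AE x in m. P (\<phi> -` B \<inter> {0..}) (P (\<phi> -` C \<inter> {0..}) f) x = P (\<phi> -` (B \<inter> C) \<inter> {0..}) f x"
      using P_AE[OF pre[OF B] pre[OF C] f] by simp
  next
    fix f assume f: "f \<in> H"
    have "\<phi> -` {0..} \<inter> {0..} = {0..}" using \<phi>0 by auto
    then show "AE x in m. P (\<phi> -` {0..} \<inter> {0..}) f x = f x" using P_tot[OF f] by simp
  next
    fix C :: "nat \<Rightarrow> real set" and f
    assume C: "range C \<subseteq> sets half_line \<and> disjoint_family C" and f: "f \<in> H"
    have "\<phi> -` (\<Union>i. C i) \<inter> {0..} = (\<Union>i. \<phi> -` C i \<inter> {0..})" by auto
    moreover have "disjoint_family (\<lambda>i. \<phi> -` C i \<inter> {0..})"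
      using C unfolding disjoint_family_on_def by blast
    moreover have "range (\<lambda>i. \<phi> -` C i \<inter> {0..}) \<subseteq> sets half_line" using C pre by blast
    ultimately show "(\<lambda>i. ip (P (\<phi> -` C i \<inter> {0..}) f) f) sums ip (P (\<phi> -` (\<Union>i. C i) \<inter> {0..}) f) f"
      using P_sums[of "\<lambda>i. \<phi> -` C i \<inter> {0..}" f] f by metis
  qed (use P_mem[OF pre] P_sym[OF pre] in blast)+
qed

lemma scalar_spectral_measure_push:
  assumes \<phi>: "\<phi> \<in> half_line \<rightarrow>\<^sub>M half_line" and f: "f \<in> H"
  shows "scalar_spectral_measure m (push \<phi> P) f = distr (\<mu> f) half_line \<phi>"
proof -
  interpret Q: pvm m "push \<phi> P" using \<phi> by (rule pvm_push)
  have [measurable]: "\<phi> \<in> \<mu> f \<rightarrow>\<^sub>M half_line" using \<phi> by simp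
  show ?thesis
    by (rule measure_eqI)
       (use f preimage_half_line[OF \<phi>] in \<open>auto simp: emeasure_distr Q.emeasure_\<mu> emeasure_\<mu> push_def\<close>)
qed

text \<open>Change of variables in the scalar measures. It is used for \<open>1 / l - 1\<close> in
  the spectral theorem and for the Bernstein function in the subordination.\<close>

lemma spectral_integral_push:
  assumes \<phi>: "\<phi> \<in> half_line \<rightarrow>\<^sub>M half_line" and h: "h \<in> borel_measurable half_line"
  shows "spectral_integral m (push \<phi> P) h = spectral_integral m P (\<lambda>l. h (\<phi> l))"
proof -
  interpret Q: pvm m "push \<phi> P" using \<phi> by (rule pvm_push)
  have \<phi>': "\<phi> \<in> \<mu> f \<rightarrow>\<^sub>M half_line" for f using \<phi> by simp
  have "integrable (Q.\<mu> f) (\<lambda>l. (h l)\<^sup>2) \<longleftrightarrow> integrable (\<mu> f) (\<lambda>l. (h (\<phi> l))\<^sup>2)" if "f \<in> H" for f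
    unfolding scalar_spectral_measure_push[OF \<phi> that] using h by (intro integrable_distr_eq \<phi>') auto
  then have isp: "Q.ispace (\<lambda>l. (h l)\<^sup>2) = ispace (\<lambda>l. (h (\<phi> l))\<^sup>2)"
    by (auto simp: Q.ispace_def ispace_def)
  have "(\<integral>l. h l \<partial>Q.\<mu> f) = (\<integral>l. h (\<phi> l) \<partial>\<mu> f)" if "f \<in> H" for f
    unfolding scalar_spectral_measure_push[OF \<phi> that] using h by (intro integral_distr \<phi>') auto
  then have bint: "Q.bint h u w = bint (\<lambda>l. h (\<phi> l)) u w"
    if "u \<in> ispace (\<lambda>l. (h (\<phi> l))\<^sup>2)" "w \<in> ispace (\<lambda>l. (h (\<phi> l))\<^sup>2)" for u w
    using ispace_H[OF that(1)] ispace_H[OF that(2)] by (simp add: Q.bint_def bint_def)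
  show ?thesis
    unfolding Q.spectral_integral_eq spectral_integral_eq isp
  proof (intro Collect_cong, clarify)
    fix u v
    show "(u \<in> ispace (\<lambda>l. (h (\<phi> l))\<^sup>2) \<and> v \<in> H \<and> (\<forall>w\<in>ispace (\<lambda>l. (h (\<phi> l))\<^sup>2). ip v w = Q.bint h u w)) =
      (u \<in> ispace (\<lambda>l. (h (\<phi> l))\<^sup>2) \<and> v \<in> H \<and> (\<forall>w\<in>ispace (\<lambda>l. (h (\<phi> l))\<^sup>2). ip v w = bint (\<lambda>l. h (\<phi> l)) u w))"
      by (intro conj_cong ball_cong refl) (simp add: bint)
  qed
qed

end

text \<open>The atomic measures \<open>\<Sum>\<^sub>k (n choose k) D k (n - k) \<delta>\<^bsub>k/n\<^esub>\<close> have the right factorial moments exactly,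
  and power moments and factorial moments agree in the limit.\<close>

theorem Hausdorff_moment_problem_normalized:
  fixes D :: "nat \<Rightarrow> nat \<Rightarrow> real"
  assumes rec: "\<And>k l. D k (Suc l) = D k l - D (Suc k) l" and nonneg: "\<And>k l. D k l \<ge> 0"
    and one: "D 0 0 = 1"
  obtains M where "real_distribution M" "AE x in M. 0 \<le> x \<and> x \<le> 1" "\<And>n. (\<integral>x. x ^ n \<partial>M) = D n 0"
proof -
  \<comment> \<open>Pascal's rule: \<open>D a b = D a (Suc b) + D (Suc a) b\<close>, applied
    \<open>r\<close> times.\<close>
  have binom: "(\<Sum>i\<le>r. real (r choose i) * D (a + i) (b + r - i)) = D a b" for r a b
  proof (induction r arbitrary: a b)
    case (Suc r)
    have "(\<Sum>i\<le>Suc r. real (Suc r choose i) * D (a + i) (b + Suc r - i))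
        = D a (b + Suc r) + (\<Sum>i\<le>r. real (Suc r choose Suc i) * D (a + Suc i) (b + r - i))"
      by (subst sum.atMost_Suc_shift) simp
    also have "\<dots> = (D a (b + Suc r) + (\<Sum>i\<le>r. real (r choose Suc i) * D (a + Suc i) (b + r - i)))
        + (\<Sum>i\<le>r. real (r choose i) * D (Suc a + i) (b + r - i))"
      by (simp add: distrib_right sum.distrib)
    also have "D a (b + Suc r) + (\<Sum>i\<le>r. real (r choose Suc i) * D (a + Suc i) (b + r - i))
        = (\<Sum>i\<le>Suc r. real (r choose i) * D (a + i) (Suc b + r - i))"
      by (subst sum.atMost_Suc_shift) simp
    also have "\<dots> = (\<Sum>i\<le>r. real (r choose i) * D (a + i) (Suc b + r - i))"
      by simp
    finally show ?case using Suc.IH[of a "Suc b"] Suc.IH[of "Suc a" b] rec[of a b] by simp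
  qed simp
  \<comment> \<open>\<open>(n choose k) * (k choose j) = (n choose j) * ((n - j) choose (k -
    j))\<close> turns the sum into \<open>binom\<close> with \<open>r = n - j\<close>.\<close>
  have fact_moment: "(\<Sum>k\<le>n. real (n choose k) * D k (n - k) * real (k choose j)) = real (n choose j) * D j 0"
    if "j \<le> n" for n j
  proof -
    have "(\<Sum>k\<le>n. real (n choose k) * D k (n - k) * real (k choose j))
        = (\<Sum>k\<in>{j..n}. real (n choose k) * D k (n - k) * real (k choose j))"
      by (intro sum.mono_neutral_right) auto
    also have "\<dots> = (\<Sum>i\<in>{0..n - j}. real (n choose (i + j)) * D (i + j) (n - (i + j)) * real ((i + j) choose j))"
      using that sum.shift_bounds_cl_nat_ivl[of "\<lambda>k. real (n choose k) * D k (n - k) * real (k choose j)" 0 j "n - j"] by simp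
    also have "\<dots> = (\<Sum>i\<le>n - j. real (n choose j) * (real ((n - j) choose i) * D (j + i) (n - j - i)))"
    proof (rule sum.cong)
      fix i assume "i \<in> {..n - j}"
      then have "(n choose (i + j)) * ((i + j) choose j) = (n choose j) * ((n - j) choose i)"
        using choose_mult[of j "i + j" n] that by simp
      then have "real (n choose (i + j)) * real ((i + j) choose j) = real (n choose j) * real ((n - j) choose i)"
        by (metis of_nat_mult)
      then show "real (n choose (i + j)) * D (i + j) (n - (i + j)) * real ((i + j) choose j)
          = real (n choose j) * (real ((n - j) choose i) * D (j + i) (n - j - i))"
        by (simp add: algebra_simps)
    qed auto
    also have "\<dots> = real (n choose j) * D j 0"
      using binom[where r = "n - j" and a = j and b = 0] by (simp add: sum_distrib_left[symmetric])
    finally show ?thesis .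
  qed
  define w where "w n k = real (n choose k) * D k (n - k)" for n k
  have w0: "w n k \<ge> 0" for n k using nonneg by (simp add: w_def)
  have wsum: "(\<Sum>k\<le>n. w n k) = 1" for n using fact_moment[of 0 n] one by (simp add: w_def)
  \<comment> \<open>The weights add up to \<open>1\<close> by the case \<open>j = 0\<close>. For
    \<open>n = 0\<close> the single atom sits at \<open>0\<close>, because
    \<open>0 / 0 = 0\<close>.\<close>
  define Mn where "Mn n = distr (point_measure {..n} (\<lambda>k. ennreal (w n k))) borel (\<lambda>k. real k / real n)" for n
  have integral_Mn: "(\<integral>x. g x \<partial>Mn n) = (\<Sum>k\<le>n. w n k * g (real k / real n))" if "g \<in> borel_measurable borel" for g :: "real \<Rightarrow> real" and n
    unfolding Mn_def using that w0 by (subst integral_distr) (auto simp: lebesgue_integral_point_measure_finite)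
  have prob: "real_distribution (Mn n)" for n
  proof -
    have "prob_space (point_measure {..n} (\<lambda>k. ennreal (w n k)))"
      by (rule prob_spaceI) (simp add: space_point_measure emeasure_point_measure_finite w0 wsum)
    then have "prob_space (Mn n)" unfolding Mn_def by (rule prob_space.prob_space_distr) simp
    then show ?thesis by (simp add: real_distribution_def real_distribution_axioms_def Mn_def)
  qed
  have "tight Mn"
    unfolding tight_def
  proof (intro conjI allI impI prob)
    fix e :: real assume "e > 0"
    \<comment> \<open>Tightness is stated with intervals open on the left, and there may be an atom
      at \<open>0\<close>; hence the left end \<open>-1\<close>.\<close>
    have "measure (Mn n) {-1<..1} = 1" for n
    proof -
      interpret real_distribution "Mn n" by (rule prob)
      have "measure (Mn n) {-1<..1} = (\<integral>x. indicator {-1<..1} x \<partial>Mn n)"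
        by simp
      also have "\<dots> = (\<Sum>k\<le>n. w n k * indicator {-1<..1} (real k / real n))"
        by (rule integral_Mn) simp
      also have "\<dots> = (\<Sum>k\<le>n. w n k)"
      proof (rule sum.cong)
        fix k assume k: "k \<in> {..n}"
        have "-1 < real k / real n" by (rule less_le_trans[of _ 0]) auto
        then show "w n k * indicator {-1<..1} (real k / real n) = w n k"
          using k by (auto simp: indicator_def divide_le_eq_1)
      qed simp
      finally show ?thesis using wsum by simp
    qed
    then show "\<exists>a b. a < b \<and> (\<forall>n. measure (Mn n) {a<..b} > 1 - e)"
      using \<open>e > 0\<close> by (intro exI[of _ "-1"] exI[of _ 1]) auto
  qed
  then obtain r M where r: "strict_mono r" "real_distribution M" "weak_conv_m (Mn \<circ> id \<circ> r) M"
    using tight_imp_convergent_subsubsequence[of Mn id] strict_mono_id by blast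
  interpret M: real_distribution M by (rule r(2))
  have lim: "(\<lambda>n. \<integral>x. g x \<partial>Mn (r n)) \<longlonglongrightarrow> (\<integral>x. g x \<partial>M)"
    if "continuous_on UNIV g" "\<And>x. norm (g x) \<le> B" for g :: "real \<Rightarrow> real" and B
  proof -
    have "isCont g x" for x using that(1) by (simp add: continuous_on_eq_continuous_at)
    moreover have "real_distribution ((Mn \<circ> id \<circ> r) n)" for n using prob by simp
    ultimately show ?thesis
      using weak_conv_imp_integral_bdd_continuous_conv[OF _ r(2,3), of g B] that(2) by simp
  qed
  \<comment> \<open>Weak convergence needs bounded continuous test functions on the whole line, so
    powers are taken of the clamped variable.\<close>
  define c where "c x = max 0 (min 1 x)" for x :: real
  have c: "continuous_on UNIV c" unfolding c_def by (intro continuous_intros)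
  have c01: "0 \<le> c x" "c x \<le> 1" for x by (auto simp: c_def)
  have supp: "AE x in M. 0 \<le> x \<and> x \<le> 1"
  proof -
    define g where "g x = min 1 \<bar>x - c x\<bar>" for x
    have gc: "continuous_on UNIV g" unfolding g_def using c by (intro continuous_intros)
    then have [measurable]: "g \<in> borel_measurable borel" by (rule borel_measurable_continuous_onI)
    have "(\<integral>x. g x \<partial>Mn n) = 0" for n
    proof -
      have "g (real k / real n) = 0" if "k \<le> n" for k
      proof -
        have "real k / real n \<le> 1" using that by (cases "n = 0") (auto simp: divide_le_eq_1)
        then show ?thesis by (simp add: g_def c_def)
      qed
      then show ?thesis by (simp add: integral_Mn)
    qed
    moreover have "(\<lambda>n. \<integral>x. g x \<partial>Mn (r n)) \<longlonglongrightarrow> (\<integral>x. g x \<partial>M)"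
      by (rule lim[OF gc, of 1]) (simp add: g_def)
    ultimately have "(\<integral>x. g x \<partial>M) = 0" by (simp add: LIMSEQ_const_iff)
    moreover have "integrable M g" by (rule M.integrable_const_bound[of _ 1]) (auto simp: g_def)
    ultimately have "AE x in M. g x = 0"
      by (subst (asm) integral_nonneg_eq_0_iff_AE) (auto simp: g_def)
    then show ?thesis by eventually_elim (auto simp: g_def c_def max_def min_def split: if_splits)
  qed
  have "(\<integral>x. x ^ j \<partial>M) = D j 0" for j
  proof -
    have cj: "continuous_on UNIV (\<lambda>x. c x ^ j)" using c by (intro continuous_intros)
    then have [measurable]: "(\<lambda>x. c x ^ j) \<in> borel_measurable borel" by (rule borel_measurable_continuous_onI)
    \<comment> \<open>Compare the power \<open>(k / n) ^ j\<close> with the product of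
      \<open>(k - i) / (n - i)\<close> over \<open>i < j\<close>. For \<open>n > 2 * j\<close> all
      factors have modulus at most \<open>1\<close>, also the negative ones with
      \<open>k < i\<close>, so the products differ by at most the sum of the \<open>j\<close>
      differences of factors.\<close>
    have "\<bar>(\<integral>x. c x ^ j \<partial>Mn n) - D j 0\<bar> \<le> real j * (real j / (real n - real j))" if n: "n > 2 * j" for n
    proof -
      have "n choose j > 0" using n by (intro zero_less_binomial) simp
      then have nj: "real (n choose j) > 0" by simp
      have "(\<Sum>k\<le>n. w n k * (real (k choose j) / real (n choose j))) = (\<Sum>k\<le>n. w n k * real (k choose j)) / real (n choose j)"
        by (simp add: sum_divide_distrib)
      also have "\<dots> = D j 0"
        using fact_moment[of j n] n nj by (simp add: w_def)
      finally have Dj: "D j 0 = (\<Sum>k\<le>n. w n k * (real (k choose j) / real (n choose j)))" by simp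
      have factor: "\<bar>c (real k / real n) ^ j - real (k choose j) / real (n choose j)\<bar> \<le> real j * (real j / (real n - real j))" if k: "k \<le> n" for k
      proof -
        have "c (real k / real n) = real k / real n"
        proof -
          have "real k / real n \<le> 1" using k n by (simp add: divide_le_eq_1)
          then show ?thesis by (simp add: c_def)
        qed
        then have 1: "c (real k / real n) ^ j = (\<Prod>i<j. real k / real n)" by simp
        have 2: "real (k choose j) / real (n choose j) = (\<Prod>i<j. (real k - real i) / (real n - real i))"
          by (simp add: binomial_gbinomial gbinomial_prod_rev prod_dividef atLeast0LessThan)
        have "norm ((\<Prod>i<j. real k / real n) - (\<Prod>i<j. (real k - real i) / (real n - real i)))
            \<le> (\<Sum>i<j. norm (real k / real n - (real k - real i) / (real n - real i)))"
        proof (rule norm_prod_diff)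
          fix i assume i: "i \<in> {..<j}"
          show "norm (real k / real n) \<le> 1" using k n by (simp add: divide_le_eq_1)
          have "\<bar>real k - real i\<bar> \<le> real n - real i" proof -
            have "real i \<ge> 0" "real i < real j" "2 * real j < real n" "real k \<le> real n" using i n k by auto
            then show ?thesis by linarith
          qed
          then show "norm ((real k - real i) / (real n - real i)) \<le> 1"
            using i n by (simp add: divide_le_eq_1)
        qed
        also have "\<dots> \<le> (\<Sum>i<j. real j / (real n - real j))"
        proof (rule sum_mono)
          fix i assume i: "i \<in> {..<j}"
          have pos: "real n > 0" "real n - real i > 0" "real n - real j > 0" using i n by auto
          have "real k / real n - (real k - real i) / (real n - real i) = real i * (real n - real k) / (real n * (real n - real i))"
            using pos by (simp add: field_simps)
          also have "\<bar>\<dots>\<bar> = (real i / (real n - real i)) * ((real n - real k) / real n)"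
            using pos k by (simp add: abs_mult)
          also have "\<dots> \<le> (real i / (real n - real i)) * 1"
            using pos k by (intro mult_left_mono) (auto simp: divide_le_eq_1)
          also have "\<dots> \<le> real j / (real n - real j)"
            using pos i by (simp, intro frac_le) auto
          finally show "norm (real k / real n - (real k - real i) / (real n - real i)) \<le> real j / (real n - real j)" by simp
        qed
        finally show ?thesis unfolding 1 2 by simp
      qed
      have "(\<integral>x. c x ^ j \<partial>Mn n) - D j 0 = (\<Sum>k\<le>n. w n k * (c (real k / real n) ^ j - real (k choose j) / real (n choose j)))"
        unfolding Dj by (simp add: integral_Mn right_diff_distrib sum_subtractf)
      also have "\<bar>\<dots>\<bar> \<le> (\<Sum>k\<le>n. w n k * (real j * (real j / (real n - real j))))"
      proof (intro order_trans[OF sum_abs] sum_mono)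
        fix k assume "k \<in> {..n}"
        then show "\<bar>w n k * (c (real k / real n) ^ j - real (k choose j) / real (n choose j))\<bar> \<le> w n k * (real j * (real j / (real n - real j)))"
          unfolding abs_mult using factor[of k] w0[of n k] by (simp only: abs_of_nonneg) (intro mult_left_mono; simp)
      qed
      also have "\<dots> = real j * (real j / (real n - real j))"
        by (simp only: sum_distrib_right[symmetric] wsum mult_1)
      finally show ?thesis .
    qed
    then have "\<forall>\<^sub>F n in sequentially. norm ((\<integral>x. c x ^ j \<partial>Mn n) - D j 0) \<le> real j * (real j / (real n - real j))"
      by (intro eventually_mono[OF eventually_gt_at_top[of "2 * j"]]) simp
    moreover have "(\<lambda>n. real j * (real j / (real n - real j))) \<longlonglongrightarrow> 0"
      by real_asymp
    ultimately have "(\<lambda>n. (\<integral>x. c x ^ j \<partial>Mn n) - D j 0) \<longlonglongrightarrow> 0"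
      by (rule Lim_null_comparison)
    then have "(\<lambda>n. \<integral>x. c x ^ j \<partial>Mn n) \<longlonglongrightarrow> D j 0" by (simp add: LIM_zero_iff)
    from LIMSEQ_subseq_LIMSEQ[OF this r(1)] have "(\<lambda>n. \<integral>x. c x ^ j \<partial>Mn (r n)) \<longlonglongrightarrow> D j 0" by (simp add: o_def)
    moreover have "(\<lambda>n. \<integral>x. c x ^ j \<partial>Mn (r n)) \<longlonglongrightarrow> (\<integral>x. c x ^ j \<partial>M)"
      using c01 by (intro lim[OF cj, of 1]) (simp add: power_le_one)
    ultimately have "(\<integral>x. c x ^ j \<partial>M) = D j 0" by (simp add: LIMSEQ_unique)
    moreover have "(\<integral>x. c x ^ j \<partial>M) = (\<integral>x. x ^ j \<partial>M)"
    proof (rule integral_cong_AE)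
      show "AE x in M. c x ^ j = x ^ j" using supp by eventually_elim (simp add: c_def)
    qed auto
    ultimately show ?thesis by simp
  qed
  then show ?thesis using that r(2) supp by blast
qed

text \<open>Dividing by the mass gives the normalized case if \<open>D 0 0 > 0\<close>. If
  \<open>D 0 0 = 0\<close>, then \<open>0 \<le> D (Suc n) 0 \<le> D n 0\<close> makes all moments
  vanish, and the null measure is a solution.\<close>

theorem Hausdorff_moment_problem:
  fixes D :: "nat \<Rightarrow> nat \<Rightarrow> real"
  assumes rec: "\<And>k l. D k (Suc l) = D k l - D (Suc k) l" and nonneg: "\<And>k l. D k l \<ge> 0"
  obtains M :: "real measure" where "finite_measure M" "sets M = sets borel" "AE x in M. 0 \<le> x \<and> x \<le> 1"
    "\<And>n. (\<integral>x. x ^ n \<partial>M) = D n 0"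
proof (cases "D 0 0 = 0")
  case True
  have "D n 0 = 0" for n
  proof (induction n)
    case (Suc n)
    then show ?case using rec[of n 0] nonneg[of n 1] nonneg[of "Suc n" 0] by simp
  qed (use True in simp)
  moreover have "AE x in null_measure borel. 0 \<le> x \<and> x \<le> (1 :: real)"
    by (rule AE_I[where N = UNIV]) auto
  ultimately show ?thesis by (intro that[of "null_measure borel"]) (auto intro!: finite_measureI)
next
  case False
  then have d: "D 0 0 > 0" using nonneg[of 0 0] by simp
  obtain M where M: "real_distribution M" "AE x in M. 0 \<le> x \<and> x \<le> 1" "\<And>n. (\<integral>x. x ^ n \<partial>M) = D n 0 / D 0 0"
  proof (rule Hausdorff_moment_problem_normalized[of "\<lambda>k l. D k l / D 0 0"])
    show "D k (Suc l) / D 0 0 = D k l / D 0 0 - D (Suc k) l / D 0 0" for k l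
      by (simp add: rec diff_divide_distrib)
  qed (use nonneg d in auto)
  interpret M: real_distribution M by (rule M(1))
  let ?M = "density M (\<lambda>_. ennreal (D 0 0))"
  show ?thesis
  proof (rule that[of ?M])
    show "finite_measure ?M"
      using M.emeasure_space_1 by (intro finite_measureI) (simp add: emeasure_density_const)
    show "AE x in ?M. 0 \<le> x \<and> x \<le> 1" using M(2) by (simp add: AE_density)
    show "(\<integral>x. x ^ n \<partial>?M) = D n 0" for n
      using d M(3)[of n] by (subst integral_density) auto
  qed simp
qed

text \<open>A linear relation between all moments extends to Bernstein polynomials, by uniform
  approximation to continuous functions, by steeper and steeper ramps to indicators of
  \<open>{..a}\<close>, and by Dynkin's lemma to Borel sets. Weights make relations between signed
  measures expressible.\<close>

theorem moments_determine_measures: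
  fixes L :: "(real measure \<times> (real \<Rightarrow> real)) list"
  assumes fin: "\<And>M w. (M, w) \<in> set L \<Longrightarrow> finite_measure M"
    and sets: "\<And>M w. (M, w) \<in> set L \<Longrightarrow> sets M = sets borel"
    and supp: "\<And>M w. (M, w) \<in> set L \<Longrightarrow> AE x in M. 0 \<le> x \<and> x \<le> 1"
    and w: "\<And>M w. (M, w) \<in> set L \<Longrightarrow> w \<in> borel_measurable borel \<and> (\<exists>K. \<forall>x\<in>{0..1}. \<bar>w x\<bar> \<le> K)"
    and mom: "\<And>n. (\<Sum>(M, w)\<leftarrow>L. \<integral>x. x ^ n * w x \<partial>M) = 0"
    and B: "B \<in> sets borel"
  shows "(\<Sum>(M, w)\<leftarrow>L. \<integral>x. indicator B x * w x \<partial>M) = 0"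
proof -
  have int: "integrable M (\<lambda>x. g x * w x)"
    if L: "(M, w) \<in> set L" and g: "g \<in> borel_measurable borel" "\<And>x. x \<in> {0..1} \<Longrightarrow> \<bar>g x\<bar> \<le> C" for M w g C
  proof -
    interpret finite_measure M using fin[OF L] .
    obtain K where K: "\<And>x. x \<in> {0..1} \<Longrightarrow> \<bar>w x\<bar> \<le> K" using w[OF L] by blast
    have [measurable]: "w \<in> borel_measurable M" "g \<in> borel_measurable M"
      using w[OF L] g(1) sets[OF L] by (auto cong: measurable_cong_sets)
    have "C \<ge> 0" using g(2)[of 0] by simp
    show ?thesis
    proof (rule integrable_const_bound[of _ "C * K"])
      show "AE x in M. norm (g x * w x) \<le> C * K"
        using supp[OF L] by eventually_elim (use g(2) K \<open>C \<ge> 0\<close> in \<open>auto simp: abs_mult intro!: mult_mono\<close>)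
    qed simp
  qed
  have poly: "(\<Sum>(M, w)\<leftarrow>L. \<integral>x. (\<Sum>i\<le>n. a i * x ^ i) * w x \<partial>M) = 0" for n :: nat and a :: "nat \<Rightarrow> real"
  proof -
    have "(\<Sum>(M, w)\<leftarrow>L. \<integral>x. (\<Sum>i\<le>n. a i * x ^ i) * w x \<partial>M) = (\<Sum>(M, w)\<leftarrow>L. \<Sum>i\<le>n. a i * (\<integral>x. x ^ i * w x \<partial>M))"
    proof (intro arg_cong[of _ _ sum_list] map_cong refl, clarify)
      fix M w assume L: "(M, w) \<in> set L"
      have "integrable M (\<lambda>x. x ^ i * w x)" for i
        by (rule int[OF L, of _ 1]) (auto simp: power_le_one)
      then show "(\<integral>x. (\<Sum>i\<le>n. a i * x ^ i) * w x \<partial>M) = (\<Sum>i\<le>n. a i * (\<integral>x. x ^ i * w x \<partial>M))"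
        by (simp add: sum_distrib_right mult.assoc)
    qed
    also have "\<dots> = (\<Sum>i\<le>n. a i * (\<Sum>(M, w)\<leftarrow>L. \<integral>x. x ^ i * w x \<partial>M))"
      by (induction L) (auto simp: sum.distrib distrib_left)
    finally show ?thesis using mom by simp
  qed
  have bernstein: "\<exists>a. \<forall>x. Bernstein n k x = (\<Sum>i\<le>n. a i * x ^ i)" if "k \<le> n" for n k
  proof -
    have 1: "Bernstein n k x = (\<Sum>i\<le>n - k. real (n choose k) * real ((n - k) choose i) * (-1) ^ i * x ^ (i + k))" for x
    proof -
      have "(1 - x) ^ (n - k) = (\<Sum>i\<le>n - k. real ((n - k) choose i) * (- x) ^ i * 1 ^ (n - k - i))"
        using binomial_ring[of "- x" 1 "n - k"] by simp
      then show ?thesis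
        by (simp add: Bernstein_def sum_distrib_left power_add power_minus[of x] algebra_simps)
    qed
    have 2: "(\<Sum>i\<le>n - k. real (n choose k) * real ((n - k) choose i) * (-1) ^ i * x ^ (i + k))
        = (\<Sum>i\<le>n. (if k \<le> i then real (n choose k) * real ((n - k) choose (i - k)) * (-1) ^ (i - k) else 0) * x ^ i)" for x :: real
    proof -
      let ?f = "\<lambda>i. real (n choose k) * real ((n - k) choose (i - k)) * (-1) ^ (i - k) * x ^ i"
      have "(\<Sum>i\<le>n. (if k \<le> i then real (n choose k) * real ((n - k) choose (i - k)) * (-1) ^ (i - k) else 0) * x ^ i) = (\<Sum>i\<in>{k..n}. ?f i)"
        by (intro sum.mono_neutral_cong_right) auto
      also have "\<dots> = (\<Sum>i\<in>{0..n - k}. ?f (i + k))"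
        using that sum.shift_bounds_cl_nat_ivl[of ?f 0 k "n - k"] by simp
      finally show "(\<Sum>i\<le>n - k. real (n choose k) * real ((n - k) choose i) * (-1) ^ i * x ^ (i + k))
        = (\<Sum>i\<le>n. (if k \<le> i then real (n choose k) * real ((n - k) choose (i - k)) * (-1) ^ (i - k) else 0) * x ^ i)"
        by (simp add: atMost_atLeast0)
    qed
    show ?thesis unfolding 1 2
      by (rule exI[of _ "\<lambda>i. if k \<le> i then real (n choose k) * real ((n - k) choose (i - k)) * (-1) ^ (i - k) else 0"]) simp
  qed
  have bern0: "(\<Sum>(M, w)\<leftarrow>L. \<integral>x. (\<Sum>k\<le>n. b k * Bernstein n k x) * w x \<partial>M) = 0" for n :: nat and b :: "nat \<Rightarrow> real"
  proof -
    have "\<forall>k\<in>{..n}. \<exists>a. \<forall>x. Bernstein n k x = (\<Sum>i\<le>n. a i * x ^ i)" using bernstein by simp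
    from bchoice[OF this] obtain a where a: "\<And>k x. k \<le> n \<Longrightarrow> Bernstein n k x = (\<Sum>i\<le>n. a k i * x ^ i)" by auto
    have "(\<Sum>k\<le>n. b k * Bernstein n k x) = (\<Sum>i\<le>n. (\<Sum>k\<le>n. b k * a k i) * x ^ i)" for x
    proof -
      have "(\<Sum>k\<le>n. b k * Bernstein n k x) = (\<Sum>k\<le>n. \<Sum>i\<le>n. b k * a k i * x ^ i)"
        by (intro sum.cong refl) (simp add: a sum_distrib_left mult.assoc)
      also have "\<dots> = (\<Sum>i\<le>n. \<Sum>k\<le>n. b k * a k i * x ^ i)" by (rule sum.swap)
      finally show ?thesis by (simp add: sum_distrib_right)
    qed
    then show ?thesis by (simp add: poly)
  qed
  have cont: "(\<Sum>(M, w)\<leftarrow>L. \<integral>x. g x * w x \<partial>M) = 0" if g: "continuous_on UNIV g" for g :: "real \<Rightarrow> real"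
  proof -
    have gb: "g \<in> borel_measurable borel" using g by (rule borel_measurable_continuous_onI)
    have "compact (g ` {0..1})" using g by (intro compact_continuous_image continuous_on_subset[OF g]) auto
    then obtain C where C: "\<And>x. x \<in> {0..1} \<Longrightarrow> \<bar>g x\<bar> \<le> C"
      using compact_imp_bounded[of "g ` {0..1}"] unfolding bounded_iff by fastforce
    define p where "p n x = (\<Sum>k\<le>n. g (real k / real n) * Bernstein n k x)" for n x
    have pc: "continuous_on UNIV (p n)" for n
      unfolding p_def Bernstein_def by (intro continuous_intros)
    have unif: "uniform_limit {0..1} p g sequentially"
      unfolding uniform_limit_sequentially_iff
    proof (intro allI impI)
      fix e :: real assume "e > 0"
      then obtain N where "\<forall>n x. N \<le> n \<and> x \<in> {0..1} \<longrightarrow> \<bar>g x - p n x\<bar> < e"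
        using Bernstein_Weierstrass[OF continuous_on_subset[OF g], of e] unfolding p_def by auto
      then show "\<exists>N. \<forall>n\<ge>N. \<forall>x\<in>{0..1}. dist (p n x) (g x) < e"
        by (intro exI[of _ N]) (auto simp: dist_real_def abs_minus_commute)
    qed
    have pg: "\<bar>p n x\<bar> \<le> C" if x: "x \<in> {0..1}" for n x
    proof (cases "n = 0")
      case True
      then show ?thesis using C[of 0] by (simp add: p_def Bernstein_def)
    next
      case False
      have "\<bar>p n x\<bar> \<le> (\<Sum>k\<le>n. C * Bernstein n k x)"
        unfolding p_def using x False
        by (intro order_trans[OF sum_abs] sum_mono) (auto simp: abs_mult Bernstein_nonneg divide_le_eq_1 intro!: mult_right_mono C)
      also have "\<dots> = C" by (simp add: sum_distrib_left[symmetric])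
      finally show ?thesis .
    qed
    have "(\<lambda>n. \<integral>x. p n x * w x \<partial>M) \<longlonglongrightarrow> (\<integral>x. g x * w x \<partial>M)" if L: "(M, w) \<in> set L" for M w
    proof (rule integral_dominated_convergence[where w = "\<lambda>x. C * \<bar>w x\<bar>"])
      have [measurable]: "w \<in> borel_measurable M" "g \<in> borel_measurable M" "p n \<in> borel_measurable M" for n
        using w[OF L] gb borel_measurable_continuous_onI[OF pc] sets[OF L] by (auto cong: measurable_cong_sets)
      show "integrable M (\<lambda>x. C * \<bar>w x\<bar>)" using int[OF L, of "\<lambda>_. 1" 1] by (auto intro: integrable_abs)
      show "AE x in M. (\<lambda>n. p n x * w x) \<longlonglongrightarrow> g x * w x"
        using supp[OF L] by eventually_elim (auto intro!: tendsto_intros tendsto_uniform_limitI[OF unif])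
      show "AE x in M. norm (p n x * w x) \<le> C * \<bar>w x\<bar>" for n
        using supp[OF L] by eventually_elim (auto simp: abs_mult intro!: mult_right_mono pg)
      show "(\<lambda>x. g x * w x) \<in> borel_measurable M" "\<And>n. (\<lambda>x. p n x * w x) \<in> borel_measurable M" by measurable
    qed
    then have "(\<lambda>n. \<Sum>(M, w)\<leftarrow>L. \<integral>x. p n x * w x \<partial>M) \<longlonglongrightarrow> (\<Sum>(M, w)\<leftarrow>L. \<integral>x. g x * w x \<partial>M)"
      by (induction L) (auto intro!: tendsto_add)
    then show ?thesis unfolding p_def bern0 by (simp add: LIMSEQ_const_iff)
  qed
  have atMost: "(\<Sum>(M, w)\<leftarrow>L. \<integral>x. indicator {..a} x * w x \<partial>M) = 0" for a
  proof -
    define g where "g n x = max 0 (min 1 (1 - real n * (x - a)))" for n :: nat and x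
    have gc: "continuous_on UNIV (g n)" for n unfolding g_def by (intro continuous_intros)
    have lim: "(\<lambda>n. g n x) \<longlonglongrightarrow> indicator {..a} x" for x
    proof (cases "x \<le> a")
      case True
      then have "real n * (x - a) \<le> 0" for n by (simp add: mult_le_0_iff)
      then have "g n x = 1" for n unfolding g_def by (smt (verit))
      then show ?thesis using True by simp
    next
      case False
      obtain N :: nat where N: "1 / (x - a) < real N" using reals_Archimedean2 by blast
      have "g n x = 0" if "n \<ge> N" for n
      proof -
        have "1 / (x - a) < real n" using N that by linarith
        then have "1 < real n * (x - a)" using False by (simp add: field_simps)
        then show ?thesis by (simp add: g_def)
      qed
      then show ?thesis using False by (intro tendsto_eventually) (auto simp: eventually_sequentially)
    qed
    have "(\<lambda>n. \<integral>x. g n x * w x \<partial>M) \<longlonglongrightarrow> (\<integral>x. indicator {..a} x * w x \<partial>M)" if L: "(M, w) \<in> set L" for M w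
    proof (rule integral_dominated_convergence[where w = "\<lambda>x. \<bar>w x\<bar>"])
      have [measurable]: "w \<in> borel_measurable M" "g n \<in> borel_measurable M" "{..a} \<in> sets M" for n
        using w[OF L] borel_measurable_continuous_onI[OF gc] sets[OF L] by (auto cong: measurable_cong_sets)
      show "integrable M (\<lambda>x. \<bar>w x\<bar>)" using int[OF L, of "\<lambda>_. 1" 1] by (auto intro: integrable_abs)
      show "AE x in M. (\<lambda>n. g n x * w x) \<longlonglongrightarrow> indicator {..a} x * w x"
        using lim by (intro AE_I2 tendsto_intros)
      show "AE x in M. norm (g n x * w x) \<le> \<bar>w x\<bar>" for n
        by (intro AE_I2) (auto simp: abs_mult g_def intro!: mult_left_le_one_le)
      show "(\<lambda>x. indicator {..a} x * w x) \<in> borel_measurable M" "\<And>n. (\<lambda>x. g n x * w x) \<in> borel_measurable M" by measurable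
    qed
    then have "(\<lambda>n. \<Sum>(M, w)\<leftarrow>L. \<integral>x. g n x * w x \<partial>M) \<longlonglongrightarrow> (\<Sum>(M, w)\<leftarrow>L. \<integral>x. indicator {..a} x * w x \<partial>M)"
      by (induction L) (auto intro!: tendsto_add)
    then show ?thesis unfolding cont[OF gc] by (simp add: LIMSEQ_const_iff)
  qed
  have "Int_stable (range (\<lambda>a::real. {..a}))"
    by (auto simp: Int_stable_def)
  moreover have "range (\<lambda>a::real. {..a}) \<subseteq> Pow UNIV" by simp
  moreover have "B \<in> sigma_sets UNIV (range (\<lambda>a::real. {..a}))"
    using B unfolding borel_eq_atMost by simp
  ultimately show ?thesis
  proof (induction rule: sigma_sets_induct_disjoint)
    case (basic A)
    then show ?case using atMost by auto
  next
    case empty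
    show ?case by (induction L) auto
  next
    case (compl A)
    then have A: "A \<in> sets borel" unfolding borel_eq_atMost by simp
    have "(\<Sum>(M, w)\<leftarrow>L. \<integral>x. indicator (UNIV - A) x * w x \<partial>M) = (\<Sum>(M, w)\<leftarrow>L. (\<integral>x. 1 * w x \<partial>M) - (\<integral>x. indicator A x * w x \<partial>M))"
    proof (intro arg_cong[of _ _ sum_list] map_cong refl, clarify)
      fix M w assume L: "(M, w) \<in> set L"
      have "integrable M (\<lambda>x. indicator A x * w x)"
        by (rule int[OF L, of _ 1]) (use A in \<open>auto simp: indicator_def\<close>)
      moreover have "integrable M (\<lambda>x. 1 * w x)"
        by (rule int[OF L, of _ 1]) auto
      ultimately have "(\<integral>x. 1 * w x \<partial>M) - (\<integral>x. indicator A x * w x \<partial>M) = (\<integral>x. 1 * w x - indicator A x * w x \<partial>M)" by simp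
      also have "(\<lambda>x. 1 * w x - indicator A x * w x) = (\<lambda>x. indicator (UNIV - A) x * w x)"
        by (auto simp: indicator_def fun_eq_iff)
      finally show "(\<integral>x. indicator (UNIV - A) x * w x \<partial>M) = (\<integral>x. 1 * w x \<partial>M) - (\<integral>x. indicator A x * w x \<partial>M)" by simp
    qed
    also have "\<dots> = (\<Sum>(M, w)\<leftarrow>L. \<integral>x. 1 * w x \<partial>M) - (\<Sum>(M, w)\<leftarrow>L. \<integral>x. indicator A x * w x \<partial>M)"
      by (induction L) auto
    finally show ?case using compl(2) cont[of "\<lambda>_. 1"] by simp
  next
    case (union A)
    then have A: "A i \<in> sets borel" for i unfolding borel_eq_atMost by auto
    have "(\<lambda>i. \<integral>x. indicator (A i) x * w x \<partial>M) sums (\<integral>x. indicator (\<Union>i. A i) x * w x \<partial>M)" if L: "(M, w) \<in> set L" for M w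
      unfolding sums_def
    proof -
      have iA: "integrable M (\<lambda>x. indicator B x * w x)" if "B \<in> sets borel" for B
        by (rule int[OF L, of _ 1]) (use that in \<open>auto simp: indicator_def\<close>)
      have "(\<Sum>i<n. \<integral>x. indicator (A i) x * w x \<partial>M) = (\<integral>x. indicator (\<Union>i<n. A i) x * w x \<partial>M)" for n
      proof -
        have "(\<Sum>i<n. \<integral>x. indicator (A i) x * w x \<partial>M) = (\<integral>x. (\<Sum>i<n. indicator (A i) x * w x) \<partial>M)"
          using iA[OF A] by (intro Bochner_Integration.integral_sum[symmetric])
        also have "\<dots> = (\<integral>x. indicator (\<Union>i<n. A i) x * w x \<partial>M)"
          using union(1) by (simp add: sum_distrib_right[symmetric] indicator_UN_disjoint disjoint_family_on_mono[of "{..<n}" UNIV])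
        finally show ?thesis .
      qed
      moreover have "(\<lambda>n. \<integral>x. indicator (\<Union>i<n. A i) x * w x \<partial>M) \<longlonglongrightarrow> (\<integral>x. indicator (\<Union>i. A i) x * w x \<partial>M)"
      proof (rule integral_dominated_convergence[where w = "\<lambda>x. \<bar>w x\<bar>"])
        show "integrable M (\<lambda>x. \<bar>w x\<bar>)" using int[OF L, of "\<lambda>_. 1" 1] by (auto intro: integrable_abs)
        show "AE x in M. (\<lambda>n. indicator (\<Union>i<n. A i) x * w x) \<longlonglongrightarrow> indicator (\<Union>i. A i) x * w x"
          by (intro AE_I2 tendsto_intros LIMSEQ_indicator_UN)
        show "AE x in M. norm (indicator (\<Union>i<n. A i) x * w x) \<le> \<bar>w x\<bar>" for n
          by (intro AE_I2) (auto simp: indicator_def)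
        show "(\<lambda>x. indicator (\<Union>i. A i) x * w x) \<in> borel_measurable M" "\<And>n. (\<lambda>x. indicator (\<Union>i<n. A i) x * w x) \<in> borel_measurable M"
          using iA A by (auto intro!: borel_measurable_integrable sets.countable_UN)
      qed
      ultimately show "(\<lambda>n. \<Sum>i<n. \<integral>x. indicator (A i) x * w x \<partial>M) \<longlonglongrightarrow> (\<integral>x. indicator (\<Union>i. A i) x * w x \<partial>M)"
        by simp
    qed
    then have "(\<lambda>i. \<Sum>(M, w)\<leftarrow>L. \<integral>x. indicator (A i) x * w x \<partial>M) sums (\<Sum>(M, w)\<leftarrow>L. \<integral>x. indicator (\<Union>i. A i) x * w x \<partial>M)"
      by (induction L) (auto intro!: sums_add)
    then show ?case using union(3) by (simp add: sums_unique2[OF _ sums_zero])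
  qed
qed

section \<open>The spectral theorem\<close>

lemma id_half_line [simp]: "(\<lambda>l. l) \<in> borel_measurable half_line"
  by (simp add: measurable_restrict_space1)

text \<open>The resolvent seen as an operator with \<open>0 \<le> G \<le> 1\<close>. Symmetry on all
  of \<open>L\<^sup>2\<close> makes it linear up to a.e. equality.\<close>

locale positive_contraction =
  fixes m :: "'a measure" and G :: "('a \<Rightarrow> real) \<Rightarrow> 'a \<Rightarrow> real"
  assumes G_mem [simp, intro]: "f \<in> L2_space m \<Longrightarrow> G f \<in> L2_space m"
    and G_sym: "f \<in> L2_space m \<Longrightarrow> g \<in> L2_space m \<Longrightarrow> L2_inner m (G f) g = L2_inner m f (G g)"
    and G_nonneg: "f \<in> L2_space m \<Longrightarrow> 0 \<le> L2_inner m (G f) f"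
    and G_le: "f \<in> L2_space m \<Longrightarrow> L2_inner m (G f) f \<le> L2_inner m f f"
begin

abbreviation "H \<equiv> L2_space m"
abbreviation "ip \<equiv> L2_inner m"

definition R :: "('a \<Rightarrow> real) \<Rightarrow> 'a \<Rightarrow> real" where "R f = f - G f"

lemma R_mem [simp, intro]: "f \<in> H \<Longrightarrow> R f \<in> H" by (simp add: R_def)

lemma R_sym: "f \<in> H \<Longrightarrow> g \<in> H \<Longrightarrow> ip (R f) g = ip f (R g)"
  by (simp add: R_def L2.diff_left L2.diff_right G_sym)

lemma Gn_mem [simp, intro]: "f \<in> H \<Longrightarrow> (G ^^ n) f \<in> H" by (induction n) auto
lemma Rn_mem [simp, intro]: "f \<in> H \<Longrightarrow> (R ^^ n) f \<in> H" by (induction n) auto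

lemma Gn_sym: "f \<in> H \<Longrightarrow> g \<in> H \<Longrightarrow> ip ((G ^^ n) f) g = ip f ((G ^^ n) g)"
proof (induction n arbitrary: g)
  case (Suc n)
  then show ?case by (simp add: G_sym funpow_swap1[of G n g])
qed simp

lemma GR: "f \<in> H \<Longrightarrow> w \<in> H \<Longrightarrow> ip (G (R f)) w = ip (R (G f)) w"
  by (simp add: G_sym R_def L2.diff_left)

lemma R_Gn: "f \<in> H \<Longrightarrow> w \<in> H \<Longrightarrow> ip (R ((G ^^ n) f)) w = ip ((G ^^ n) (R f)) w"
proof (induction n arbitrary: w)
  case (Suc n)
  have "ip (R (G ((G ^^ n) f))) w = ip (G (R ((G ^^ n) f))) w" using Suc.prems by (simp add: GR)
  also have "\<dots> = ip (R ((G ^^ n) f)) (G w)" using Suc.prems by (simp add: G_sym)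
  also have "\<dots> = ip ((G ^^ n) (R f)) (G w)" using Suc by simp
  also have "\<dots> = ip (G ((G ^^ n) (R f))) w" using Suc.prems by (simp add: G_sym)
  finally show ?case by simp
qed simp

lemma G_Rn: "f \<in> H \<Longrightarrow> w \<in> H \<Longrightarrow> ip (G ((R ^^ n) f)) w = ip ((R ^^ n) (G f)) w"
proof (induction n arbitrary: w)
  case (Suc n)
  have "ip (G (R ((R ^^ n) f))) w = ip (R (G ((R ^^ n) f))) w" using Suc.prems by (simp add: GR)
  also have "\<dots> = ip (G ((R ^^ n) f)) (R w)" using Suc.prems by (simp add: R_sym)
  also have "\<dots> = ip ((R ^^ n) (G f)) (R w)" using Suc by simp
  also have "\<dots> = ip (R ((R ^^ n) (G f))) w" using Suc.prems by (simp add: R_sym)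
  finally show ?case by simp
qed simp

text \<open>The iterated differences of the sequence
  \<open>\<langle>G\<^sup>k f, f\<rangle>\<close>; their nonnegativity is Hausdorff's condition for
  a moment sequence on \<open>[0,1]\<close>.\<close>

definition D :: "('a \<Rightarrow> real) \<Rightarrow> nat \<Rightarrow> nat \<Rightarrow> real" where
  "D f k l = ip ((G ^^ k) ((R ^^ l) f)) f"

lemma D_rec:
  assumes f: "f \<in> H" shows "D f k (Suc l) = D f k l - D f (Suc k) l"
proof -
  let ?y = "(R ^^ l) f"
  have y: "?y \<in> H" using f by simp
  have "D f k (Suc l) = ip (?y - G ?y) ((G ^^ k) f)"
    using f y by (simp add: D_def Gn_sym R_def)
  also have "\<dots> = ip ((G ^^ k) ?y) f - ip ((G ^^ k) (G ?y)) f"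
    using f y by (simp add: L2.diff_left Gn_sym)
  finally show ?thesis by (simp add: D_def funpow_swap1)
qed

lemma D_step_G: "f \<in> H \<Longrightarrow> D f (Suc (Suc k)) l = D (G f) k l"
proof -
  assume f: "f \<in> H"
  have "D f (Suc (Suc k)) l = ip (G ((G ^^ k) ((R ^^ l) f))) (G f)"
    using f by (simp add: D_def G_sym[of _ f])
  also have "\<dots> = ip ((G ^^ k) (G ((R ^^ l) f))) (G f)" by (simp add: funpow_swap1)
  also have "\<dots> = ip (G ((R ^^ l) f)) ((G ^^ k) (G f))" using f by (simp add: Gn_sym)
  also have "\<dots> = ip ((R ^^ l) (G f)) ((G ^^ k) (G f))" using f by (simp add: G_Rn)
  also have "\<dots> = D (G f) k l" using f by (simp add: D_def Gn_sym)
  finally show ?thesis .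
qed

lemma D_step_R: "f \<in> H \<Longrightarrow> D f k (Suc (Suc l)) = D (R f) k l"
proof -
  assume f: "f \<in> H"
  let ?z = "(R ^^ l) (R f)"
  have z: "?z \<in> H" using f by auto
  have "D f k (Suc (Suc l)) = ip ((G ^^ k) (R ?z)) f" by (simp add: D_def funpow_swap1)
  also have "\<dots> = ip ?z (R ((G ^^ k) f))" using f z by (simp add: Gn_sym R_sym)
  also have "\<dots> = ip (R ((G ^^ k) f)) ?z" using f z by (intro L2.sym) auto
  also have "\<dots> = ip ((G ^^ k) (R f)) ?z" using f z by (simp add: R_Gn)
  also have "\<dots> = D (R f) k l" using f z L2.sym[of ?z m "(G ^^ k) (R f)"] by (simp add: D_def Gn_sym)
  finally show ?thesis .
qed

text \<open>Two factors \<open>G\<close>, or two factors \<open>R\<close>, can be absorbed into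
  \<open>f\<close> by symmetry, which leaves exponents at most \<open>1\<close>. The case of one
  each is \<open>G R = R G R + G R G\<close>, from \<open>G + R = 1\<close>.\<close>

lemma D_nonneg: "f \<in> H \<Longrightarrow> 0 \<le> D f k l"
proof (induction "k + l" arbitrary: k l f rule: less_induct)
  case less
  note f = less.prems
  have R: "0 \<le> ip (R g) g" if "g \<in> H" for g using G_le[OF that] that by (simp add: R_def L2.diff_left)
  consider k' where "k = Suc (Suc k')" | l' where "l = Suc (Suc l')"
    | "k = 0" "l = 0" | "k = 1" "l = 0" | "k = 0" "l = 1" | "k = 1" "l = 1"
    by (cases k rule: nat.exhaust; cases l; cases "k - 1"; cases "l - 1") auto
  then show ?case
  proof cases
    case 1 then show ?thesis using less.hyps[of k' l "G f"] f by (simp add: D_step_G)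
  next
    case 2 then show ?thesis using less.hyps[of k l' "R f"] f by (simp add: D_step_R)
  next
    case 3 then show ?thesis using f by (simp add: D_def L2.nonneg)
  next
    case 4 then show ?thesis using f by (simp add: D_def G_nonneg)
  next
    case 5 then show ?thesis using f R by (simp add: D_def)
  next
    case 6
    have "D f k l = ip (G (R f)) f" using 6 by (simp add: D_def)
    also have "\<dots> = ip (G (R f)) (R f) + ip (G (R f)) (G f)" using f by (simp add: R_def L2.diff_right)
    also have "ip (G (R f)) (G f) = ip (R (G f)) (G f)" using f by (simp add: GR)
    finally show ?thesis using G_nonneg[of "R f"] R[of "G f"] f by simp
  qed
qed

definition M :: "('a \<Rightarrow> real) \<Rightarrow> real measure" where
  "M f = (SOME M. finite_measure M \<and> sets M = sets borel \<and> (AE x in M. 0 \<le> x \<and> x \<le> 1) \<and>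
    (\<forall>n. (\<integral>x. x ^ n \<partial>M) = ip ((G ^^ n) f) f))"

lemma M:
  assumes f: "f \<in> H"
  shows M_finite: "finite_measure (M f)" and sets_M: "sets (M f) = sets borel"
    and M_supp: "AE x in M f. 0 \<le> x \<and> x \<le> 1" and M_moment: "(\<integral>x. x ^ n \<partial>M f) = ip ((G ^^ n) f) f"
proof -
  obtain N :: "real measure" where "finite_measure N" "sets N = sets borel" "AE x in N. 0 \<le> x \<and> x \<le> 1"
    "\<And>n. (\<integral>x. x ^ n \<partial>N) = D f n 0"
    using Hausdorff_moment_problem[of "D f"] D_rec[OF f] D_nonneg[OF f] by blast
  then have "\<exists>M. finite_measure M \<and> sets M = sets borel \<and> (AE x in M. 0 \<le> x \<and> x \<le> 1) \<and>
    (\<forall>n. (\<integral>x. x ^ n \<partial>M) = ip ((G ^^ n) f) f)" by (auto simp: D_def)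
  from someI_ex[OF this] show "finite_measure (M f)" "sets (M f) = sets borel"
    "AE x in M f. 0 \<le> x \<and> x \<le> 1" "(\<integral>x. x ^ n \<partial>M f) = ip ((G ^^ n) f) f"
    unfolding M_def by auto
qed

lemma semi_inner_Gn: "semi_inner_space H (\<lambda>f g. ip ((G ^^ n) f) g)"
proof
  show "ip ((G ^^ n) x) y = ip ((G ^^ n) y) x" if "x \<in> H" "y \<in> H" for x y
    using Gn_sym[OF that] L2.sym[of x m "(G ^^ n) y"] that by simp
  show "0 \<le> ip ((G ^^ n) x) x" if "x \<in> H" for x using D_nonneg[OF that, of n 0] by (simp add: D_def)
qed (auto simp: Gn_sym L2.bilin L2.subspace_V)

text \<open>The spectral measure of a pair of vectors by polarization, at a stage where
  \<open>M f\<close> is characterized only by its moments.\<close>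

definition J :: "(real \<Rightarrow> real) \<Rightarrow> 'a form" where
  "J w f g = ((\<integral>x. w x \<partial>M (f + g)) - (\<integral>x. w x \<partial>M (f - g))) / 4"

lemma J_moment: "f \<in> H \<Longrightarrow> g \<in> H \<Longrightarrow> J (\<lambda>x. x ^ n) f g = ip ((G ^^ n) f) g"
  using semi_inner_space.polarization[OF semi_inner_Gn, of f g n] by (simp add: J_def M_moment)

lemma J_minus: "J (\<lambda>x. - w x) f g = - J w f g"
  by (simp add: J_def minus_divide_left)

lemma J_cmult: "J (\<lambda>x. c * w x) f g = c * J w f g"
  by (simp add: J_def right_diff_distrib)

lemma J_relation:
  assumes fg: "\<And>f g w. (f, g, w) \<in> set L \<Longrightarrow> f \<in> H \<and> g \<in> H \<and> w \<in> borel_measurable borel \<and> (\<exists>K. \<forall>x\<in>{0..1}. \<bar>w x\<bar> \<le> K)"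
    and rel: "\<And>n. (\<Sum>(f, g, w)\<leftarrow>L. J (\<lambda>x. x ^ n * w x) f g) = 0"
    and B: "B \<in> sets borel"
  shows "(\<Sum>(f, g, w)\<leftarrow>L. J (\<lambda>x. indicator B x * w x) f g) = 0"
proof -
  define L' where "L' = concat (map (\<lambda>p. [(M (fst p + fst (snd p)), \<lambda>l. snd (snd p) l / 4),
      (M (fst p - fst (snd p)), \<lambda>l. - snd (snd p) l / 4)]) L)"
  have eq: "(\<Sum>(M, w)\<leftarrow>L'. \<integral>x. k x * w x \<partial>M) = (\<Sum>(f, g, w)\<leftarrow>L. J (\<lambda>l. k l * w l) f g)" for k :: "real \<Rightarrow> real"
    unfolding L'_def
  proof (induction L)
    case (Cons a L)
    obtain f g w where a: "a = (f, g, w)" by (cases a)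
    show ?case using Cons by (simp add: a J_def diff_divide_distrib plus_fun_def fun_diff_def)
  qed simp
  have "(\<Sum>(M, w)\<leftarrow>L'. \<integral>x. indicator B x * w x \<partial>M) = 0"
  proof (rule moments_determine_measures)
    fix N w assume "(N, w) \<in> set L'"
    then obtain f g w' where *: "(f, g, w') \<in> set L"
      "(N = M (f + g) \<and> w = (\<lambda>l. w' l / 4)) \<or> (N = M (f - g) \<and> w = (\<lambda>l. - w' l / 4))"
      by (auto simp: L'_def)
    then have H: "f + g \<in> H" "f - g \<in> H" and w': "w' \<in> borel_measurable borel" "\<exists>K. \<forall>x\<in>{0..1}. \<bar>w' x\<bar> \<le> K"
      using fg[OF *(1)] by auto
    show "finite_measure N" "sets N = sets borel" "AE x in N. 0 \<le> x \<and> x \<le> 1"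
      using *(2) H M_finite sets_M M_supp by auto
    from w'(2) obtain K where "\<forall>x\<in>{0..1}. \<bar>w' x\<bar> \<le> K" by blast
    then have "\<forall>x\<in>{0..1}. \<bar>w x\<bar> \<le> K / 4" using *(2) by auto
    then have "\<exists>K. \<forall>x\<in>{0..1}. \<bar>w x\<bar> \<le> K" by blast
    then show "w \<in> borel_measurable borel \<and> (\<exists>K. \<forall>x\<in>{0..1}. \<bar>w x\<bar> \<le> K)"
      using *(2) w'(1) by (intro conjI) auto
  qed (use rel eq B in auto)
  then show ?thesis unfolding eq .
qed

lemma J_self:
  assumes f: "f \<in> H" and B: "B \<in> sets borel"
  shows "J (indicator B) f f = measure (M f) B"
proof -
  define u where "u = f + f"
  have u: "u \<in> H" unfolding u_def using f f by (rule L2.V_mem(2))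
  have sp: "space (M g) = UNIV" if "g \<in> H" for g using sets_eq_imp_space_eq[OF sets_M[OF that]] by simp
  \<comment> \<open>\<open>M 0\<close> is a measure picked by \<open>SOME\<close>, so it is carried
    along in the relation; its moments vanish.\<close>
  have "(\<Sum>(N, w)\<leftarrow>[(M u, \<lambda>_::real. 1 :: real), (M 0, \<lambda>_. -1), (M f, \<lambda>_. -4)]. \<integral>x. indicator B x * w x \<partial>N) = 0"
  proof (rule moments_determine_measures[OF _ _ _ _ _ B])
    fix n
    have "ip ((G ^^ n) u) u = 4 * ip ((G ^^ n) f) f"
      unfolding u_def using semi_inner_space.expand_add[OF semi_inner_Gn f f, of n] by simp
    then show "(\<Sum>(N, w)\<leftarrow>[(M u, \<lambda>_::real. 1 :: real), (M 0, \<lambda>_. -1), (M f, \<lambda>_. -4)]. \<integral>x. x ^ n * w x \<partial>N) = 0"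
      using f u semi_inner_space.zero_right[OF semi_inner_Gn, of 0 n] by (simp add: M_moment)
  qed (use f u M_finite sets_M M_supp in auto)
  then have "measure (M u) B - measure (M 0) B = 4 * measure (M f) B"
    using f u sp by simp
  then show ?thesis using f u sp unfolding J_def u_def[symmetric] by simp
qed

text \<open>The linear laws and symmetry hold for \<open>\<langle>G\<^sup>n f, g\<rangle>\<close>,
  that is for all moments, and \<open>J_relation\<close> carries them over to Borel sets; positivity
  comes from \<open>J_self\<close>.\<close>

lemma semi_inner_J:
  assumes B: "B \<in> sets borel"
  shows "semi_inner_space H (J (indicator B))"
proof
  fix x y assume xy: "x \<in> H" "y \<in> H"
  have "(\<Sum>(f, g, w)\<leftarrow>[(x, y, \<lambda>_. 1), (y, x, \<lambda>_. -1)]. J (\<lambda>x. indicator B x * w x) f g) = 0"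
  proof (rule J_relation[OF _ _ B])
    show "(\<Sum>(f, g, w)\<leftarrow>[(x, y, \<lambda>_. 1), (y, x, \<lambda>_. -1)]. J (\<lambda>x. x ^ n * w x) f g) = 0" for n
      using xy semi_inner_space.sym[OF semi_inner_Gn xy, of n] by (simp add: J_minus J_moment)
  qed (use xy in auto)
  then show "J (indicator B) x y = J (indicator B) y x" by (simp add: J_minus)
  show "J (indicator B) (c *\<^sub>R x) y = c * J (indicator B) x y" for c
  proof -
    have "(\<Sum>(f, g, w)\<leftarrow>[(c *\<^sub>R x, y, \<lambda>_. 1), (x, y, \<lambda>_. - c)]. J (\<lambda>x. indicator B x * w x) f g) = 0"
    proof (rule J_relation[OF _ _ B])
      show "(\<Sum>(f, g, w)\<leftarrow>[(c *\<^sub>R x, y, \<lambda>_. 1), (x, y, \<lambda>_. - c)]. J (\<lambda>x. x ^ n * w x) f g) = 0" for n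
        using xy semi_inner_space.scale_left[OF semi_inner_Gn xy, of n c] J_cmult[of c "\<lambda>x. x ^ n" x y]
        by (simp add: J_minus J_moment mult.commute)
    qed (use xy in auto)
    then show ?thesis using J_cmult[of c "indicator B" x y] by (simp add: J_minus mult.commute)
  qed
  show "0 \<le> J (indicator B) x x" using J_self[OF xy(1) B] by simp
  show "J (indicator B) (x + y) z = J (indicator B) x z + J (indicator B) y z" if z: "z \<in> H" for z
  proof -
    have "(\<Sum>(f, g, w)\<leftarrow>[(x + y, z, \<lambda>_. 1), (x, z, \<lambda>_. -1), (y, z, \<lambda>_. -1)]. J (\<lambda>x. indicator B x * w x) f g) = 0"
    proof (rule J_relation[OF _ _ B])
      show "(\<Sum>(f, g, w)\<leftarrow>[(x + y, z, \<lambda>_. 1), (x, z, \<lambda>_. -1), (y, z, \<lambda>_. -1)]. J (\<lambda>x. x ^ n * w x) f g) = 0" for n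
        using xy z semi_inner_space.add_left[OF semi_inner_Gn xy z, of n] by (simp add: J_minus J_moment)
    qed (use xy z in auto)
    then show ?thesis by (simp add: J_minus)
  qed
qed (rule L2.subspace_V)

lemma J_self_le: "f \<in> H \<Longrightarrow> B \<in> sets borel \<Longrightarrow> J (indicator B) f f \<le> ip f f"
proof -
  assume f: "f \<in> H" and B: "B \<in> sets borel"
  interpret finite_measure "M f" using f by (rule M_finite)
  have "measure (M f) B \<le> measure (M f) (space (M f))" by (rule bounded_measure)
  also have "\<dots> = ip f f" using M_moment[OF f, of 0] by simp
  finally show ?thesis using f B by (simp add: J_self)
qed

text \<open>The spectral projection \<open>1\<^sub>B(G)\<close>, obtained from the bounded form
  \<open>J (indicator B)\<close> by Riesz.\<close>

definition Q :: "real set \<Rightarrow> ('a \<Rightarrow> real) \<Rightarrow> 'a \<Rightarrow> real" where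
  "Q B f = (SOME v. v \<in> H \<and> (\<forall>w\<in>H. ip v w = J (indicator B) f w))"

lemma Q:
  assumes B: "B \<in> sets borel" and f: "f \<in> H"
  shows Q_mem: "Q B f \<in> H" and Q_ip: "w \<in> H \<Longrightarrow> ip (Q B f) w = J (indicator B) f w"
proof -
  interpret B: semi_inner_space H "J (indicator B)" using B by (rule semi_inner_J)
  have "\<exists>v. v \<in> H \<and> (\<forall>w\<in>H. ip v w = J (indicator B) f w)"
  proof (rule L2_Riesz[of m "J (indicator B) f" "ip f f"])
    show "(J (indicator B) f x)\<^sup>2 \<le> ip f f * ip x x" if x: "x \<in> H" for x
    proof -
      have "(J (indicator B) f x)\<^sup>2 \<le> J (indicator B) f f * J (indicator B) x x"
        using f x by (rule B.Cauchy_Schwarz)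
      also have "\<dots> \<le> ip f f * ip x x"
        using f x B by (intro mult_mono J_self_le B.nonneg L2.nonneg)
      finally show ?thesis .
    qed
  qed (use f in \<open>auto simp: B.add_right B.scale_right\<close>)
  from someI_ex[OF this] show "Q B f \<in> H" "w \<in> H \<Longrightarrow> ip (Q B f) w = J (indicator B) f w"
    unfolding Q_def by auto
qed

lemma J_Gn:
  assumes B: "B \<in> sets borel" and fg: "f \<in> H" "g \<in> H"
  shows "J (indicator B) ((G ^^ n) f) g = J (\<lambda>x. indicator B x * x ^ n) f g"
proof -
  have "(\<Sum>(f, g, w)\<leftarrow>[((G ^^ n) f, g, \<lambda>_. 1), (f, g, \<lambda>x. - (x ^ n))]. J (\<lambda>x. indicator B x * w x) f g) = 0"
  proof (rule J_relation[OF _ _ B])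
    show "(\<Sum>(f, g, w)\<leftarrow>[((G ^^ n) f, g, \<lambda>_. 1), (f, g, \<lambda>x. - (x ^ n))]. J (\<lambda>x. x ^ k * w x) f g) = 0" for k
      using fg by (simp add: J_minus J_moment power_add[symmetric] funpow_add)
    fix f' g' w assume "(f', g', w) \<in> set [((G ^^ n) f, g, \<lambda>_. 1), (f, g, \<lambda>x :: real. - (x ^ n))]"
    then show "f' \<in> H \<and> g' \<in> H \<and> w \<in> borel_measurable borel \<and> (\<exists>K. \<forall>x\<in>{0..1}. \<bar>w x\<bar> \<le> K)"
      using fg by (auto intro!: exI[of _ 1] simp: power_le_one)
  qed
  then show ?thesis by (simp add: J_minus)
qed

text \<open>The source of the multiplicativity of \<open>Q\<close>. By \<open>J_Gn\<close> the
  moments of the pair \<open>f\<close>, \<open>Q B g\<close> are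
  \<open>J (\<lambda>x. x ^ n * indicator B x) f g\<close>, those of the pair \<open>f\<close>,
  \<open>g\<close> restricted to \<open>B\<close>.\<close>

lemma J_Q:
  assumes B: "B \<in> sets borel" and C: "C \<in> sets borel" and fg: "f \<in> H" "g \<in> H"
  shows "J (indicator C) f (Q B g) = J (indicator (B \<inter> C)) f g"
proof -
  interpret B: semi_inner_space H "J (indicator B)" using B by (rule semi_inner_J)
  have Qg: "Q B g \<in> H" using B fg by (intro Q_mem)
  have "(\<Sum>(f, g, w)\<leftarrow>[(f, Q B g, \<lambda>_. 1), (f, g, \<lambda>x. - indicator B x)]. J (\<lambda>x. indicator C x * w x) f g) = 0"
  proof (rule J_relation[OF _ _ C])
    fix n
    have "ip ((G ^^ n) f) (Q B g) = J (indicator B) ((G ^^ n) f) g"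
      using Q_ip[OF B fg(2), of "(G ^^ n) f"] L2.sym[of "(G ^^ n) f" m "Q B g"] B.sym[of g "(G ^^ n) f"] Qg fg by simp
    also have "\<dots> = J (\<lambda>x. x ^ n * indicator B x) f g" using J_Gn[OF B fg] by (simp add: mult.commute)
    finally show "(\<Sum>(f, g, w)\<leftarrow>[(f, Q B g, \<lambda>_. 1), (f, g, \<lambda>x. - indicator B x)]. J (\<lambda>x. x ^ n * w x) f g) = 0"
      using fg Qg by (simp add: J_minus J_moment)
  next
    fix f' g' w assume "(f', g', w) \<in> set [(f, Q B g, \<lambda>_. 1), (f, g, \<lambda>x. - indicator B x :: real)]"
    then show "f' \<in> H \<and> g' \<in> H \<and> w \<in> borel_measurable borel \<and> (\<exists>K. \<forall>x\<in>{0..1}. \<bar>w x\<bar> \<le> K)"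
      using fg Qg B by (auto intro!: exI[of _ 1] simp: indicator_le_1)
  qed
  moreover have "indicator (B \<inter> C) = (\<lambda>x. indicator C x * indicator B x :: real)"
    by (auto simp: indicator_def fun_eq_iff)
  ultimately show ?thesis by (simp add: J_minus)
qed

lemma pvm_Q: "pvm m Q"
proof
  have hb: "B \<in> sets borel" if "B \<in> sets half_line" for B using that by (simp add: sets_half_line)
  have sym: "ip (Q B f) g = ip f (Q B g)" if "B \<in> sets half_line" "f \<in> H" "g \<in> H" for B f g
    using Q_ip[OF hb[OF that(1)]] Q_mem[OF hb[OF that(1)]] that(2,3)
      semi_inner_space.sym[OF semi_inner_J[OF hb[OF that(1)]] that(2,3)]
      L2.sym[of f m "Q B g"] by simp
  show "projection_valued_measure m Q"
    unfolding projection_valued_measure_def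
  proof (intro conjI ballI allI impI)
    fix B C f assume B: "B \<in> sets half_line" and C: "C \<in> sets half_line" and f: "f \<in> H"
    have m: "Q B (Q C f) \<in> H" "Q (B \<inter> C) f \<in> H" "Q C f \<in> H" using B C f by (auto intro!: Q_mem hb)
    have "ip (Q B (Q C f)) w = ip (Q (B \<inter> C) f) w" if w: "w \<in> H" for w
    proof -
      have Qw: "Q B w \<in> H" using B w by (intro Q_mem hb)
      have "ip (Q B (Q C f)) w = J (indicator C) f (Q B w)"
        using sym[OF B m(3) w] Q_ip[OF hb[OF C] f Qw] by simp
      also have "\<dots> = ip (Q (B \<inter> C) f) w"
        using J_Q[OF hb[OF B] hb[OF C] f w] Q_ip[OF sets.Int[OF hb[OF B] hb[OF C]] f w] by simp
      finally show ?thesis .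
    qed
    then show "AE x in m. Q B (Q C f) x = Q (B \<inter> C) f x" using L2_eq_AE_iff[OF m(1,2)] by blast
  next
    fix f assume f: "f \<in> H"
    have "ip (Q {0..} f) w = ip f w" if w: "w \<in> H" for w
    proof -
      have "(\<integral>x. indicator {0..} x \<partial>M g) = (\<integral>x. x ^ 0 \<partial>M g)" if g: "g \<in> H" for g
      proof (rule integral_cong_AE)
        have [measurable_cong]: "sets (M g) = sets borel" by (rule sets_M[OF g])
        show "(indicator {0..} :: real \<Rightarrow> real) \<in> borel_measurable (M g)" "(\<lambda>x. x ^ 0 :: real) \<in> borel_measurable (M g)"
          by measurable
        show "AE x in M g. indicator {0..} x = x ^ 0" using M_supp[OF g] by eventually_elim simp
      qed
      then have "J (indicator {0..}) f w = J (\<lambda>x. x ^ 0) f w" using f w by (simp add: J_def)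
      then show ?thesis using Q_ip[of "{0..}" f w] J_moment[OF f w, of 0] f w by simp
    qed
    moreover have "Q {0..} f \<in> H" using f by (intro Q_mem) auto
    ultimately show "AE x in m. Q {0..} f x = f x" using L2_eq_AE_iff[of "Q {0..} f" m f] f by blast
  next
    fix B :: "nat \<Rightarrow> real set" and f
    assume B: "range B \<subseteq> sets half_line \<and> disjoint_family B" and f: "f \<in> H"
    interpret finite_measure "M f" using f by (rule M_finite)
    have Bi: "B i \<in> sets borel" for i using B hb by blast
    have "(\<lambda>i. measure (M f) (B i)) sums measure (M f) (\<Union>i. B i)"
      using B Bi sets_M[OF f] by (intro finite_measure_UNION) auto
    then show "(\<lambda>i. ip (Q (B i) f) f) sums ip (Q (\<Union>i. B i) f) f"
      using Q_ip[OF Bi f f] Q_ip[of "\<Union>i. B i" f f] Bi f by (simp add: J_self)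
  qed (use sym Q_mem hb in blast)+
qed

sublocale Q: pvm m Q by (rule pvm_Q)

lemma scalar_spectral_measure_Q:
  assumes f: "f \<in> H" shows "Q.\<mu> f = restrict_space (M f) {0..}"
proof (rule measure_eqI)
  have sp: "space (M f) = UNIV" using sets_eq_imp_space_eq[OF sets_M[OF f]] by simp
  show "sets (Q.\<mu> f) = sets (restrict_space (M f) {0..})"
    using sets_M[OF f] by (simp add: sets_restrict_space)
  fix B assume "B \<in> sets (Q.\<mu> f)"
  then have B: "B \<in> sets half_line" by simp
  then have Bb: "B \<in> sets borel" "B \<subseteq> {0..}" by (auto simp: sets_half_line)
  interpret finite_measure "M f" using f by (rule M_finite)
  have "emeasure (Q.\<mu> f) B = ennreal (measure (M f) B)"
    using Q.emeasure_\<mu>[OF f B] Q_ip[OF Bb(1) f f] J_self[OF f Bb(1)] by simp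
  also have "\<dots> = emeasure (restrict_space (M f) {0..}) B"
    using Bb sets_M[OF f] sp by (simp add: emeasure_restrict_space emeasure_eq_measure)
  finally show "emeasure (Q.\<mu> f) B = emeasure (restrict_space (M f) {0..}) B" .
qed

lemma AE_\<mu>_le_1:
  assumes f: "f \<in> H" shows "AE l in Q.\<mu> f. l \<le> 1"
proof -
  have sp: "space (M f) = UNIV" using sets_eq_imp_space_eq[OF sets_M[OF f]] by simp
  show ?thesis
    unfolding scalar_spectral_measure_Q[OF f] using M_supp[OF f] sets_M[OF f] sp
    by (subst AE_restrict_space_iff) (auto elim: eventually_mono)
qed

lemma ispace_Q:
  assumes f: "f \<in> H" and h: "h \<in> borel_measurable half_line" and K: "\<And>x. x \<in> {0..1} \<Longrightarrow> \<bar>h x\<bar> \<le> K"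
  shows "f \<in> Q.ispace h"
proof -
  interpret finite_measure "Q.\<mu> f" using f by simp
  have "AE l in Q.\<mu> f. norm (h l) \<le> K"
    using AE_\<mu>_le_1[OF f] AE_space by eventually_elim (use K in auto)
  then have "integrable (Q.\<mu> f) h" using h by (intro integrable_const_bound[of _ K]) auto
  then show ?thesis using f by (simp add: Q.ispace_def)
qed

lemma spectral_integral_Q:
  assumes f: "f \<in> H"
  shows "(f, G f) \<in> spectral_integral m Q (\<lambda>l. l)"
  unfolding Q.spectral_integral_eq
proof (simp, intro conjI ballI)
  show "f \<in> Q.ispace power2" using f by (rule ispace_Q[where K = 1]) (auto simp: power_le_one intro!: measurable_restrict_space1)
  show "G f \<in> H" using f by simp
  fix w assume "w \<in> Q.ispace power2"
  then have w: "w \<in> H" by (rule Q.ispace_H)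
  have "(\<integral>l. l \<partial>Q.\<mu> g) = (\<integral>x. x ^ 1 \<partial>M g)" if g: "g \<in> H" for g
  proof -
    have sp: "space (M g) = UNIV" using sets_eq_imp_space_eq[OF sets_M[OF g]] by simp
    have [measurable_cong]: "sets (M g) = sets borel" by (rule sets_M[OF g])
    have "(\<integral>l. l \<partial>Q.\<mu> g) = (\<integral>x. indicator {0..} x *\<^sub>R x \<partial>M g)"
      unfolding scalar_spectral_measure_Q[OF g] using sp sets_M[OF g] by (intro integral_restrict_space) auto
    also have "\<dots> = (\<integral>x. x ^ 1 \<partial>M g)"
    proof (rule integral_cong_AE)
      show "AE x in M g. indicator {0..} x *\<^sub>R x = x ^ 1" using M_supp[OF g] by eventually_elim simp
    qed measurable
    finally show ?thesis .
  qed
  then have "Q.bint (\<lambda>l. l) f w = J (\<lambda>x. x ^ 1) f w" using f w by (simp add: Q.bint_def J_def)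
  then show "ip (G f) w = Q.bint (\<lambda>l. l) f w" using J_moment[OF f w, of 1] by simp
qed

end

text \<open>Solving \<open>u + A u = f\<close> weakly in the form \<open>\<langle>u, w\<rangle> + \<langle>A u, w\<rangle>\<close> on the domain of \<open>A\<close>
  and passing to the limit in \<open>L\<^sup>2\<close>, self-adjointness puts the limit back into the domain.\<close>

lemma self_adjoint_resolvent_ex:
  assumes A: "self_adjoint_op m A" and pos: "\<And>u v. (u, v) \<in> A \<Longrightarrow> L2_inner m v u \<ge> 0" and f: "f \<in> L2_space m"
  obtains u where "(u, f - u) \<in> A"
proof -
  note mem = self_adjoint_op_mem[OF A]
  let ?ip = "L2_inner m"
  have app: "(u, op_app A u) \<in> A" if "u \<in> Domain A" for u using that by (rule op_app_mem)
  have DH: "u \<in> L2_space m" "op_app A u \<in> L2_space m" if "u \<in> Domain A" for u using mem[OF app[OF that]] by auto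
  define q where "q u w = ?ip u w + ?ip (op_app A u) w" for u w
  have symA: "?ip (op_app A u) w = ?ip u (op_app A w)" if "u \<in> Domain A" "w \<in> Domain A" for u w
    using self_adjoint_op_sym[OF A app[OF that(1)] app[OF that(2)]] by simp
  interpret q: semi_inner_space "Domain A" q
  proof
    show "subspace (Domain A)" using A by (rule self_adjoint_op_subspace)
    fix x y z assume x: "x \<in> Domain A" and y: "y \<in> Domain A"
    show "q x y = q y x"
      using symA[OF x y] L2.sym[of x m y] L2.sym[of x m "op_app A y"] DH[OF x] DH[OF y] by (simp add: q_def)
    have cx: "c *\<^sub>R x \<in> Domain A" "x + y \<in> Domain A" for c
      using self_adjoint_op_subspace[OF A] x y by (auto simp: subspace_scale subspace_add)
    show "q (c *\<^sub>R x) y = c * q x y" for c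
      using symA[OF cx(1) y] symA[OF x y] DH[OF x] DH[OF y] by (simp add: q_def L2.bilin algebra_simps)
    show "q (x + y) z = q x z + q y z" if z: "z \<in> Domain A"
      using symA[OF cx(2) z] symA[OF x z] symA[OF y z] DH[OF x] DH[OF y] DH[OF z] by (simp add: q_def L2.bilin)
    show "0 \<le> q x x" using pos[OF app[OF x]] L2.nonneg[OF DH(1)[OF x]] by (simp add: q_def)
  qed
  have ipq: "?ip u u \<le> q u u" if "u \<in> Domain A" for u using pos[OF app[OF that]] by (simp add: q_def)
  obtain u where u: "\<And>n. u n \<in> Domain A" "form_Cauchy q u" "\<And>w. w \<in> Domain A \<Longrightarrow> (\<lambda>n. q (u n) w) \<longlonglongrightarrow> ?ip f w"
  proof (rule q.Riesz_sequence[of "?ip f" "?ip f f"])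
    show "(?ip f x)\<^sup>2 \<le> ?ip f f * q x x" if x: "x \<in> Domain A" for x
      using L2.Cauchy_Schwarz[OF f DH(1)[OF x]] ipq[OF x] L2.nonneg[OF f]
      by (meson mult_left_mono order_trans)
  qed (use f DH in \<open>auto simp: L2.add_right L2.scale_right\<close>)
  have uH: "u n \<in> L2_space m" for n using u(1) DH by blast
  have "form_Cauchy ?ip u"
    unfolding form_Cauchy_eq
  proof (intro allI impI)
    fix e :: real assume "e > 0"
    then obtain N where N: "\<And>i j. i \<ge> N \<Longrightarrow> j \<ge> N \<Longrightarrow> q (u i - u j) (u i - u j) < e"
      using u(2) unfolding form_Cauchy_eq by blast
    have "?ip (u i - u j) (u i - u j) < e" if "i \<ge> N" "j \<ge> N" for i j
      using N[OF that] ipq[of "u i - u j"] u(1) by (meson le_less_trans q.V_mem(3))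
    then show "\<exists>N. \<forall>i\<ge>N. \<forall>j\<ge>N. ?ip (u i - u j) (u i - u j) < e" by blast
  qed
  with uH obtain g where g: "g \<in> L2_space m" "form_tendsto ?ip u g" by (rule L2_complete)
  have "(g, f - g) \<in> A"
  proof (rule self_adjoint_opI[OF A g(1)])
    show "f - g \<in> L2_space m" using f g by simp
    fix w v assume wv: "(w, v) \<in> A"
    have w: "w \<in> Domain A" and wH: "w \<in> L2_space m" and vH: "v \<in> L2_space m" using wv mem[OF wv] by auto
    have "q (u n) w = ?ip (u n) w + ?ip (u n) v" for n
      using self_adjoint_op_sym[OF A app[OF u(1)] wv] by (simp add: q_def)
    moreover have "(\<lambda>n. ?ip (u n) w + ?ip (u n) v) \<longlonglongrightarrow> ?ip g w + ?ip g v"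
      using uH g wH vH by (intro tendsto_intros L2.tendsto_left)
    ultimately have "?ip f w = ?ip g w + ?ip g v" using u(3)[OF w] by (simp add: LIMSEQ_unique)
    then show "?ip g v = ?ip (f - g) w" using f g wH by (simp add: L2.diff_left)
  qed
  then show ?thesis by (rule that)
qed

text \<open>The spectral resolution of the resolvent \<open>G = (1 + A)\<^sup>-\<^sup>1\<close>, transported by
  \<open>x \<mapsto> 1/x - 1\<close>; the values of this map outside \<open>(0,1]\<close> only matter in that the
  sublevel sets stay bounded.\<close>

theorem spectral_theorem_nonneg:
  assumes A: "self_adjoint_op m A" and pos: "\<And>u v. (u, v) \<in> A \<Longrightarrow> L2_inner m v u \<ge> 0"
  obtains P where "pvm m P" "spectral_integral m P (\<lambda>l. l) = A"
proof -
  note mem = self_adjoint_op_mem[OF A]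
  let ?ip = "L2_inner m" and ?H = "L2_space m"
  have "\<forall>f. \<exists>u. f \<in> ?H \<longrightarrow> (u, f - u) \<in> A" using self_adjoint_resolvent_ex[OF A pos] by metis
  then obtain G where G: "\<And>f. f \<in> ?H \<Longrightarrow> (G f, f - G f) \<in> A" by metis
  have GH: "G f \<in> ?H" if "f \<in> ?H" for f using mem(1)[OF G[OF that]] .
  interpret positive_contraction m G
  proof
    fix f assume f: "f \<in> ?H"
    show "G f \<in> ?H" using f by (rule GH)
    have *: "0 \<le> ?ip (f - G f) (G f)" using pos[OF G[OF f]] .
    show "0 \<le> ?ip (G f) f"
      using * L2.nonneg[OF GH[OF f]] L2.sym[OF f GH[OF f]] f GH[OF f] by (simp add: L2.diff_left)
    have "0 \<le> ?ip (f - G f) (f - G f)" using f GH by (intro L2.nonneg) auto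
    then show "?ip (G f) f \<le> ?ip f f"
      using * L2.sym[OF f GH[OF f]] f GH[OF f] by (simp add: L2.diff_left L2.diff_right)
    fix g assume g: "g \<in> ?H"
    show "?ip (G f) g = ?ip f (G g)"
      using self_adjoint_op_sym[OF A G[OF f] G[OF g]] f g GH by (simp add: L2.diff_left L2.diff_right)
  qed
  \<comment> \<open>\<open>G y = 0\<close> puts \<open>(0, y)\<close> into the graph of
    \<open>A\<close>, so \<open>y\<close> is orthogonal to the domain.\<close>
  have inj: "?ip y y = 0" if y: "y \<in> ?H" and Gy: "\<And>w. w \<in> ?H \<Longrightarrow> ?ip (G y) w = 0" for y
  proof -
    have "AE x in m. G y x = (0 :: _ \<Rightarrow> real) x"
      using L2_eq_AE_iff[OF GH[OF y], of 0] Gy y by simp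
    moreover have "AE x in m. (y - G y) x = y x" using calculation by eventually_elim simp
    ultimately have "(0, y) \<in> A"
      using self_adjoint_op_cong_AE[OF A G[OF y], of 0 y] y by simp
    then have "?ip y u = 0" if "(u, v) \<in> A" for u v
      using self_adjoint_op_sym[OF A _ that] mem(2)[OF that] by fastforce
    then show ?thesis by (rule self_adjoint_op_dense[OF A y])
  qed
  \<comment> \<open>The spectral projection of \<open>G\<close> at \<open>0\<close> maps into the
    kernel of \<open>G\<close>, so no spectral measure charges \<open>0\<close>, where
    \<open>1 / l - 1\<close> has its pole.\<close>
  have null0: "AE l in Q.\<mu> f. l \<noteq> 0" if f: "f \<in> ?H" for f
  proof -
    have s0: "{0} \<in> sets half_line" by (simp add: sets_half_line)
    have Qf: "Q {0} f \<in> ?H" using f s0 by simp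
    have "?ip (Q {0} f) (Q {0} f) = 0"
    proof (rule inj[OF Qf])
      fix w assume w: "w \<in> ?H"
      have k: "bounded_borel (indicator {0})" "bounded_borel (\<lambda>l. indicator {0} l * l)"
      proof -
        show "bounded_borel (indicator {0})" using bounded_borel_indicator[OF s0] by simp
        have "(\<lambda>l::real. indicator {0} l * l) = (\<lambda>l. 0)" by (auto simp: indicator_def)
        then show "bounded_borel (\<lambda>l. indicator {0} l * l)" by simp
      qed
      have "?ip (G (Q {0} f)) w = ?ip f (Q {0} (G w))"
        using G_sym[OF Qf w] Q.P_sym[OF s0 f, of "G w"] w by simp
      also have "\<dots> = ?ip (Q.T (indicator {0}) (G w)) f"
        using Q.T_indicator[OF s0, of "G w" f] L2.sym[of f m "Q {0} (G w)"] f w s0 by simp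
      also have "\<dots> = ?ip (Q.T (\<lambda>l. indicator {0} l * l) w) f"
        using Q.spectral_integral_T[OF id_half_line spectral_integral_Q[OF w] f k] by simp
      also have "\<dots> = Q.bint (\<lambda>l. 0 * l) w f"
        using k(2) w f by (subst Q.T_ip) (auto intro!: Q.bint_cong simp: indicator_def)
      finally show "?ip (G (Q {0} f)) w = 0" using w f by (simp add: Q.bint_one)
    qed
    then have "emeasure (Q.\<mu> f) {0} = 0" using Q.emeasure_\<mu>[OF f s0] Q.P_norm[OF s0 f] by simp
    then show ?thesis using s0 by (intro AE_I[where N = "{0}"]) auto
  qed
  define \<phi> :: "real \<Rightarrow> real" where "\<phi> l = (if l = 0 then 0 else if l \<le> 1 then 1 / l - 1 else l)" for l
  have \<phi>b: "\<phi> \<in> borel_measurable borel" unfolding \<phi>_def by measurable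
  then have \<phi>m: "\<phi> \<in> borel_measurable half_line" by (rule measurable_restrict_space1)
  have \<phi>0: "\<phi> l \<ge> 0" if "l \<ge> 0" for l using that by (auto simp: \<phi>_def)
  have \<phi>h: "\<phi> \<in> half_line \<rightarrow>\<^sub>M half_line"
    using \<phi>m \<phi>0 by (intro measurable_restrict_space2) (auto simp: space_half_line)
  let ?S = "spectral_integral m Q \<phi>"
  have S: "self_adjoint_op m ?S" using \<phi>m by (rule Q.spectral_integral_self_adjoint)
  have key: "(G f, f - G f) \<in> ?S" if f: "f \<in> ?H" for f
    unfolding Q.spectral_integral_iff[OF \<phi>m]
  proof (intro conjI allI ballI)
    show "G f \<in> ?H" "f - G f \<in> ?H" using f by auto
    fix n w assume w: "w \<in> ?H"
    let ?c = "Q.cut \<phi> n"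
    have c: "?c \<in> sets half_line" using \<phi>m by simp
    have bc: "bounded_borel (indicator ?c)" using bounded_borel_indicator[OF c] by simp
    have cl: "l \<le> max 1 (real n)" if "l \<in> ?c" for l
      using that by (auto simp: Q.cut_def \<phi>_def split: if_splits)
    have [measurable]: "?c \<in> sets half_line" by (rule c)
    have idm: "(\<lambda>l. l) \<in> borel_measurable half_line" by (simp add: measurable_restrict_space1)
    have b1: "bounded_borel (\<lambda>l. indicator ?c l * l)"
    proof (rule bounded_borelI[where K = "max 1 (real n)"])
      show "(\<lambda>l. indicator ?c l * l) \<in> borel_measurable half_line"
        using \<phi>m idm by (intro borel_measurable_times Q.indicator_cut_measurable)
      show "\<bar>indicator ?c l * l\<bar> \<le> max 1 (real n)" if "l \<ge> 0" for l
        using cl[of l] that by (auto simp: indicator_def)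
    qed
    have tr: "Q.trunc \<phi> n l * l = \<phi> l * (indicator ?c l * l)" for l by (simp add: Q.trunc_def)
    have b2: "bounded_borel (\<lambda>l. Q.trunc \<phi> n l * l)"
    proof -
      have "bounded_borel (\<lambda>l. Q.trunc \<phi> n l * (indicator ?c l * l))"
        using Q.trunc_bounded[OF \<phi>m] b1 by (rule bounded_borel_mult)
      moreover have "(\<lambda>l. Q.trunc \<phi> n l * (indicator ?c l * l)) = (\<lambda>l. Q.trunc \<phi> n l * l)"
        by (auto simp: Q.trunc_def indicator_def)
      ultimately show ?thesis by simp
    qed
    have "?ip (Q ?c (f - G f)) w = ?ip (f - G f) (Q ?c w)" using Q.P_sym[OF c _ w, of "f - G f"] f by simp
    also have "\<dots> = ?ip f (Q ?c w) - ?ip (G f) (Q ?c w)" using f w c by (simp add: L2.diff_left)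
    also have "?ip f (Q ?c w) = Q.bint (indicator ?c) f w"
      using Q.P_sym[OF c f w] Q.bint_indicator[OF c f w] by simp
    also have "?ip (G f) (Q ?c w) = ?ip (Q.T (indicator ?c) (G f)) w"
      using Q.P_sym[OF c _ w, of "G f"] Q.T_indicator[OF c _ w, of "G f"] f by simp
    also have "\<dots> = Q.bint (\<lambda>l. indicator ?c l * l) f w"
      using Q.spectral_integral_T[OF idm spectral_integral_Q[OF f] w bc b1] Q.T_ip[OF b1 f w] by simp
    also have "Q.bint (indicator ?c) f w - Q.bint (\<lambda>l. indicator ?c l * l) f w = Q.bint (\<lambda>l. indicator ?c l - indicator ?c l * l) f w"
      using Q.integrable_bounded[OF bc] Q.integrable_bounded[OF b1] f w
      by (simp add: Q.bint_def diff_divide_distrib)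
    also have "\<dots> = Q.bint (\<lambda>l. Q.trunc \<phi> n l * l) f w"
    proof -
      have "(\<integral>l. indicator ?c l - indicator ?c l * l \<partial>Q.\<mu> g) = (\<integral>l. Q.trunc \<phi> n l * l \<partial>Q.\<mu> g)" if g: "g \<in> ?H" for g
      proof (rule integral_cong_AE)
        show "(\<lambda>l. indicator ?c l - indicator ?c l * l) \<in> borel_measurable (Q.\<mu> g)" "(\<lambda>l. Q.trunc \<phi> n l * l) \<in> borel_measurable (Q.\<mu> g)"
          using Q.integrable_bounded[OF bc g] Q.integrable_bounded[OF b1 g] Q.integrable_bounded[OF b2 g] by auto
        show "AE l in Q.\<mu> g. indicator ?c l - indicator ?c l * l = Q.trunc \<phi> n l * l"
          using null0[OF g] AE_\<mu>_le_1[OF g] AE_space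
          by eventually_elim (auto simp: Q.trunc_def \<phi>_def indicator_def field_simps)
      qed
      then show ?thesis using f w by (simp add: Q.bint_def)
    qed
    also have "\<dots> = ?ip (Q.T (Q.trunc \<phi> n) (G f)) w"
      using Q.spectral_integral_T[OF idm spectral_integral_Q[OF f] w Q.trunc_bounded[OF \<phi>m] b2] Q.T_ip[OF b2 f w] by simp
    finally show "?ip (Q ?c (f - G f)) w = ?ip (Q.T (Q.trunc \<phi> n) (G f)) w" .
  qed
  \<comment> \<open>\<open>u\<close> and \<open>G (u + v)\<close> both solve
    \<open>x + A x = u + v\<close>, and the positivity of \<open>A\<close> makes the difference of
    two solutions null.\<close>
  have sub: "A \<subseteq> ?S"
  proof clarify
    fix u v assume uv: "(u, v) \<in> A"
    have u: "u \<in> ?H" and v: "v \<in> ?H" using mem[OF uv] by auto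
    define f where "f = u + v"
    have f: "f \<in> ?H" using u v by (simp add: f_def)
    let ?z = "u - G f"
    have "(?z, v - (f - G f)) \<in> A" using self_adjoint_op_diff[OF A uv G[OF f]] .
    moreover have "v - (f - G f) = - ?z" by (simp add: f_def)
    ultimately have "0 \<le> ?ip (- ?z) ?z" using pos by metis
    then have "?ip ?z ?z = 0"
      using L2.minus_left[of ?z m ?z] L2.nonneg[of ?z m] u f by simp
    then have "AE x in m. u x = G f x" using L2_null_iff[of u m "G f"] u f by simp
    then have "AE x in m. G f x = u x" "AE x in m. (f - G f) x = v x"
      by (eventually_elim, simp add: f_def)+
    then show "(u, v) \<in> ?S" using self_adjoint_op_cong_AE[OF S key[OF f] u v] by blast
  qed
  \<comment> \<open>A self-adjoint operator has no proper symmetric extension: pairs of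
    \<open>?S\<close> pass the adjoint test against \<open>A \<subseteq> ?S\<close>.\<close>
  have "?S \<subseteq> A"
  proof clarify
    fix u v assume uv: "(u, v) \<in> ?S"
    show "(u, v) \<in> A"
      using self_adjoint_op_mem[OF S uv] self_adjoint_op_sym[OF S uv] sub
      by (intro self_adjoint_opI[OF A]) auto
  qed
  with sub have "?S = A" by simp
  moreover have "spectral_integral m (push \<phi> Q) (\<lambda>l. l) = ?S"
    using Q.spectral_integral_push[OF \<phi>h, of "\<lambda>l. l"] by (simp add: measurable_restrict_space1)
  ultimately show ?thesis using that[OF Q.pvm_push[OF \<phi>h]] by simp
qed

section \<open>Closed forms and their generators\<close>

lemma op_neg_iff: "(f, g) \<in> op_neg A \<longleftrightarrow> (f, - g) \<in> A"
proof
  assume "(f, g) \<in> op_neg A"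
  then obtain g' where g': "g = (\<lambda>x. - g' x)" "(f, g') \<in> A" by (auto simp: op_neg_def)
  then have "- g = g'" by (simp add: fun_eq_iff)
  then show "(f, - g) \<in> A" using g' by simp
next
  assume *: "(f, - g) \<in> A"
  have "g = (\<lambda>x. - (- g) x)" by simp
  with * show "(f, g) \<in> op_neg A" unfolding op_neg_def by blast
qed

lemma op_neg_neg [simp]: "op_neg (op_neg A) = A"
  by (auto simp: op_neg_iff)

lemma self_adjoint_op_neg:
  assumes A: "self_adjoint_op m A"
  shows "self_adjoint_op m (op_neg A)"
proof -
  let ?ip = "L2_inner m" and ?H = "L2_space m"
  note mem = self_adjoint_op_mem[OF A]
  have "Domain (op_neg A) = Domain A" by (auto simp: op_neg_def)
  moreover have "(f, g) \<in> op_neg A \<longleftrightarrow> (\<forall>(u, v)\<in>op_neg A. ?ip f v = ?ip g u)" if fg: "f \<in> ?H" "g \<in> ?H" for f g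
  proof -
    have "(f, g) \<in> op_neg A \<longleftrightarrow> (\<forall>(u, v)\<in>A. ?ip f v = ?ip (- g) u)"
      unfolding op_neg_iff using A fg unfolding self_adjoint_op_def by blast
    also have "\<dots> \<longleftrightarrow> (\<forall>(u, v)\<in>A. ?ip f (- v) = ?ip g u)"
    proof -
      have "?ip f v = ?ip (- g) u \<longleftrightarrow> ?ip f (- v) = ?ip g u" if "(u, v) \<in> A" for u v
        using mem[OF that] fg by (simp add: L2.minus_left L2.minus_right) linarith
      then show ?thesis by blast
    qed
    also have "\<dots> \<longleftrightarrow> (\<forall>(u, v)\<in>op_neg A. ?ip f v = ?ip g u)"
      by (auto simp: op_neg_def fun_Compl_def)
    finally show ?thesis .
  qed
  moreover have "op_neg A \<subseteq> ?H \<times> ?H"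
  proof clarify
    fix f g assume "(f, g) \<in> op_neg A"
    then have "(f, - g) \<in> A" by (simp add: op_neg_iff)
    then have "f \<in> ?H" "- g \<in> ?H" using mem by auto
    then show "f \<in> ?H \<and> g \<in> ?H" using L2.V_mem(5)[of "- g" m] by simp
  qed
  ultimately show ?thesis using A unfolding self_adjoint_op_def by simp
qed

lemma nonpos_self_adjoint_iff:
  "nonpos_self_adjoint m L \<longleftrightarrow>
     self_adjoint_op m (op_neg L) \<and> (\<forall>(f, g)\<in>op_neg L. 0 \<le> L2_inner m g f)"
proof -
  have iff: "self_adjoint_op m (op_neg L) \<longleftrightarrow> self_adjoint_op m L"
    using self_adjoint_op_neg[of m L] self_adjoint_op_neg[of m "op_neg L"] by auto
  have sign: "(\<forall>(f, g)\<in>op_neg L. 0 \<le> L2_inner m g f) \<longleftrightarrow> (\<forall>(f, g)\<in>L. L2_inner m g f \<le> 0)"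
  proof -
    have "op_neg L = (\<lambda>(f, g). (f, \<lambda>x. - g x)) ` L" by (auto simp: op_neg_def image_iff)
    then show ?thesis by (simp add: L2_inner_def split_beta)
  qed
  show ?thesis by (simp only: nonpos_self_adjoint_def iff sign)
qed

lemma spectral_resolution_pvm:
  assumes "pvm m P" "spectral_integral m P (\<lambda>l. l) = A"
  shows "pvm m (spectral_resolution m A)" "spectral_integral m (spectral_resolution m A) (\<lambda>l. l) = A"
proof -
  have "\<exists>P. projection_valued_measure m P \<and> spectral_integral m P (\<lambda>l. l) = A"
    using assms pvm.pvm by blast
  from someI_ex[OF this] show "pvm m (spectral_resolution m A)" "spectral_integral m (spectral_resolution m A) (\<lambda>l. l) = A"
    unfolding spectral_resolution_def by (auto intro: pvm.intro)
qed

definition graph_form :: "'a measure \<Rightarrow> 'a operator \<Rightarrow> 'a form" where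
  "graph_form m S f g = L2_inner m (op_app S f) (op_app S g)"

lemma op_form_eq: "op_form m L = graph_form m (sqrt_neg m L)"
  by (auto simp: op_form_def graph_form_def fun_eq_iff)

text \<open>The limit \<open>f\<close> ranges over all its representatives, so constant sequences
  show that \<open>V\<close> and \<open>E\<close> respect a.e. equality.\<close>

definition closed_L2_form :: "'a measure \<Rightarrow> ('a \<Rightarrow> real) set \<Rightarrow> 'a form \<Rightarrow> bool" where
  "closed_L2_form m V E \<longleftrightarrow> semi_inner_space V E \<and> V \<subseteq> L2_space m \<and>
    (\<forall>u f. (\<forall>n. u n \<in> V) \<longrightarrow> form_Cauchy E u \<longrightarrow> f \<in> L2_space m \<longrightarrow> form_tendsto (L2_inner m) u f \<longrightarrow>
      f \<in> V \<and> form_tendsto E u f)"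

definition form_core :: "'a measure \<Rightarrow> ('a \<Rightarrow> real) set \<Rightarrow> 'a form \<Rightarrow> ('a \<Rightarrow> real) set \<Rightarrow> bool" where
  "form_core m V E C \<longleftrightarrow> C \<subseteq> V \<and>
    (\<forall>f\<in>V. \<exists>u. (\<forall>n. u n \<in> C) \<and> form_tendsto (L2_inner m) u f \<and> form_tendsto E u f)"

lemma closed_L2_formD:
  assumes "closed_L2_form m V E"
  shows "semi_inner_space V E" "f \<in> V \<Longrightarrow> f \<in> L2_space m"
    "(\<And>n. u n \<in> V) \<Longrightarrow> form_Cauchy E u \<Longrightarrow> f \<in> L2_space m \<Longrightarrow> form_tendsto (L2_inner m) u f \<Longrightarrow> f \<in> V \<and> form_tendsto E u f"
  using assms unfolding closed_L2_form_def by blast+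

lemma form_Cauchy_cong:
  assumes "\<And>i j. E (u i - u j) (u i - u j) = E' (u i - u j) (u i - u j)" "form_Cauchy E u"
  shows "form_Cauchy E' u"
  using assms unfolding form_Cauchy_eq by simp

lemma closed_form_core_le:
  assumes E: "closed_L2_form m V E" and E': "closed_L2_form m V' E'"
    and C: "form_core m V E C" and C': "C \<subseteq> V'" and sub: "subspace C"
    and eq: "\<And>f. f \<in> C \<Longrightarrow> E f f = E' f f" and f: "f \<in> V"
  shows "f \<in> V'" "E f f = E' f f"
proof -
  interpret E: semi_inner_space V E using closed_L2_formD[OF E] by blast
  interpret E': semi_inner_space V' E' using closed_L2_formD[OF E'] by blast
  obtain u where u: "\<And>n. u n \<in> C" "form_tendsto (L2_inner m) u f" "form_tendsto E u f"
    using C f unfolding form_core_def by blast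
  have uV: "u n \<in> V" for n using u(1) C unfolding form_core_def by blast
  have uV': "u n \<in> V'" for n using u(1) C' by blast
  have "form_Cauchy E u" using E.tendsto_imp_Cauchy[OF uV f u(3)] .
  then have "form_Cauchy E' u"
    by (rule form_Cauchy_cong[rotated]) (use u(1) sub eq in \<open>auto simp: subspace_diff\<close>)
  then have "f \<in> V' \<and> form_tendsto E' u f"
    using closed_L2_formD(3)[OF E', of u f] uV' closed_L2_formD(2)[OF E f] u(2) by blast
  then have *: "f \<in> V'" "form_tendsto E' u f" by auto
  have "(\<lambda>n. E (u n) (u n)) \<longlonglongrightarrow> E f f" using E.tendsto_norm[OF uV f u(3)] .
  moreover have "(\<lambda>n. E' (u n) (u n)) \<longlonglongrightarrow> E' f f" using E'.tendsto_norm[OF uV' *] .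
  ultimately show "E f f = E' f f" using eq[OF u(1)] by (simp add: LIMSEQ_unique)
  show "f \<in> V'" by fact
qed

text \<open>Approximants from a common core are Cauchy for both forms, because only the values on
  differences inside the core enter; polarization then recovers the bilinear form. Forms built from
  different spectral resolutions are compared in this way.\<close>

lemma closed_form_eqI:
  assumes E: "closed_L2_form m V E" and E': "closed_L2_form m V' E'"
    and C: "form_core m V E C" "form_core m V' E' C" and sub: "subspace C"
    and eq: "\<And>f. f \<in> C \<Longrightarrow> E f f = E' f f"
  shows "V = V'" "f \<in> V \<Longrightarrow> g \<in> V \<Longrightarrow> E f g = E' f g"
proof -
  interpret E: semi_inner_space V E using closed_L2_formD[OF E] by blast
  interpret E': semi_inner_space V' E' using closed_L2_formD[OF E'] by blast
  have CV: "C \<subseteq> V" "C \<subseteq> V'" using C unfolding form_core_def by auto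
  note 1 = closed_form_core_le[OF E E' C(1) CV(2) sub eq]
  note 2 = closed_form_core_le[OF E' E C(2) CV(1) sub eq[symmetric]]
  show VV: "V = V'" using 1(1) 2(1) by blast
  assume f: "f \<in> V" and g: "g \<in> V"
  then have "f \<in> V'" "g \<in> V'" using VV by auto
  moreover have "E (f + g) (f + g) = E' (f + g) (f + g)" "E (f - g) (f - g) = E' (f - g) (f - g)"
    using f g by (auto intro!: 1(2))
  ultimately show "E f g = E' f g"
    using E.polarization[OF f g] E'.polarization[of f g] by presburger
qed

context
  fixes m :: "'a measure" and S :: "'a operator"
  assumes S: "self_adjoint_op m S"
begin

lemma op_app_L2: "f \<in> Domain S \<Longrightarrow> f \<in> L2_space m" "f \<in> Domain S \<Longrightarrow> op_app S f \<in> L2_space m"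
  using self_adjoint_op_mem[OF S op_app_mem] by auto

lemma op_app_AE: "(f, g) \<in> S \<Longrightarrow> AE x in m. op_app S f x = g x"
  using self_adjoint_op_unique[OF S op_app_mem] by blast

lemma op_app_inner:
  assumes "(f, g) \<in> S" "w \<in> L2_space m" shows "L2_inner m (op_app S f) w = L2_inner m g w"
  using assms op_app_AE[OF assms(1)] op_app_L2[of f] self_adjoint_op_mem[OF S assms(1)]
  by (intro L2_inner_AE_left) auto

lemma graph_form_eq:
  assumes "(f, g) \<in> S" "(f', g') \<in> S" shows "graph_form m S f f' = L2_inner m g g'"
proof -
  have f: "f \<in> Domain S" "f' \<in> Domain S" using assms by auto
  note mem = self_adjoint_op_mem[OF S assms(1)] self_adjoint_op_mem[OF S assms(2)]
  have "graph_form m S f f' = L2_inner m g (op_app S f')"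
    unfolding graph_form_def using op_app_inner[OF assms(1)] op_app_L2[OF f(2)] by simp
  also have "\<dots> = L2_inner m (op_app S f') g" using mem op_app_L2[OF f(2)] by (intro L2.sym)
  also have "\<dots> = L2_inner m g' g" using op_app_inner[OF assms(2)] mem by simp
  also have "\<dots> = L2_inner m g g'" using mem by (intro L2.sym)
  finally show ?thesis .
qed

lemma semi_inner_graph_form: "semi_inner_space (Domain S) (graph_form m S)"
proof
  show "subspace (Domain S)" using S by (rule self_adjoint_op_subspace)
  fix x y assume x: "x \<in> Domain S" and y: "y \<in> Domain S"
  note xS = op_app_mem[OF x] and yS = op_app_mem[OF y]
  show "graph_form m S x y = graph_form m S y x"
    unfolding graph_form_def using op_app_L2 x y by (intro L2.sym)
  show "graph_form m S (c *\<^sub>R x) y = c * graph_form m S x y" for c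
    using graph_form_eq[OF self_adjoint_op_scale[OF S xS] yS] op_app_L2 x y
    by (simp add: graph_form_def L2.scale_left)
  show "0 \<le> graph_form m S x x" unfolding graph_form_def using op_app_L2 x by (intro L2.nonneg)
  show "graph_form m S (x + y) z = graph_form m S x z + graph_form m S y z" if z: "z \<in> Domain S" for z
    using graph_form_eq[OF self_adjoint_op_add[OF S xS yS] op_app_mem[OF z]] op_app_L2 x y z
    by (simp add: graph_form_def L2.add_left)
qed

lemma graph_form_diff:
  assumes x: "x \<in> Domain S" and y: "y \<in> Domain S"
  shows "graph_form m S (x - y) (x - y) = L2_inner m (op_app S x - op_app S y) (op_app S x - op_app S y)"
  using graph_form_eq[OF self_adjoint_op_diff[OF S op_app_mem[OF x] op_app_mem[OF y]] self_adjoint_op_diff[OF S op_app_mem[OF x] op_app_mem[OF y]]] .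

lemma graph_form_Cauchy:
  assumes "\<And>n. u n \<in> Domain S"
  shows "form_Cauchy (graph_form m S) u \<longleftrightarrow> form_Cauchy (L2_inner m) (\<lambda>n. op_app S (u n))"
  using assms by (simp add: form_Cauchy_eq graph_form_diff)

lemma graph_form_tendsto:
  assumes "\<And>n. u n \<in> Domain S" "f \<in> Domain S"
  shows "form_tendsto (graph_form m S) u f \<longleftrightarrow> form_tendsto (L2_inner m) (\<lambda>n. op_app S (u n)) (op_app S f)"
  using assms by (simp add: form_tendsto_def graph_form_diff)

lemma L2_tendsto_cong_AE:
  assumes "AE x in m. f x = g x" "f \<in> L2_space m" "g \<in> L2_space m" "\<And>n. u n \<in> L2_space m" "form_tendsto (L2_inner m) u f"
  shows "form_tendsto (L2_inner m) u g"
proof -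
  have "L2_inner m (u n - f) (u n - f) = L2_inner m (u n - g) (u n - g)" for n
    using assms(1,2,3) assms(4)[of n] by (intro L2_inner_cong_AE) (auto simp: fun_diff_def L2_space_measurable)
  then show ?thesis using assms(5) by (simp add: form_tendsto_def)
qed

lemma closed_graph_form: "closed_L2_form m (Domain S) (graph_form m S)"
  unfolding closed_L2_form_def
proof (intro conjI allI impI)
  show "semi_inner_space (Domain S) (graph_form m S)" by (rule semi_inner_graph_form)
  show "Domain S \<subseteq> L2_space m" using op_app_L2 by blast
  fix u f assume u: "\<forall>n. u n \<in> Domain S" and cau: "form_Cauchy (graph_form m S) u"
    and f: "f \<in> L2_space m" and lim: "form_tendsto (L2_inner m) u f"
  have uD: "u n \<in> Domain S" for n using u by blast
  have Su: "op_app S (u n) \<in> L2_space m" for n using op_app_L2 uD by blast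
  have "form_Cauchy (L2_inner m) (\<lambda>n. op_app S (u n))" using graph_form_Cauchy[of u] u cau by blast
  with Su obtain g where g: "g \<in> L2_space m" "form_tendsto (L2_inner m) (\<lambda>n. op_app S (u n)) g" by (rule L2_complete)
  have fg: "(f, g) \<in> S" by (rule self_adjoint_op_closed[OF S op_app_mem[OF uD] f g(1) lim g(2)])
  then show fD: "f \<in> Domain S" by blast
  have "AE x in m. g x = op_app S f x" using op_app_AE[OF fg] by eventually_elim simp
  from L2_tendsto_cong_AE[OF this g(1) op_app_L2(2)[OF fD] Su g(2)]
  show "form_tendsto (graph_form m S) u f" using graph_form_tendsto[of u f] uD fD by blast
qed

end

section \<open>The form of the square root and its independence of the resolution\<close>

lemma sqrt_half_line [simp]: "sqrt \<in> borel_measurable half_line"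
  by (intro measurable_restrict_space1) measurable

context pvm
begin

abbreviation "A1 \<equiv> spectral_integral m P (\<lambda>l. l)"
abbreviation "A2 \<equiv> spectral_integral m P sqrt"

lemma ispace_cong: "(\<And>l. l \<ge> 0 \<Longrightarrow> h l = k l) \<Longrightarrow> ispace h = ispace k"
  unfolding ispace_def by (intro Collect_cong conj_cong refl Bochner_Integration.integrable_cong) auto

lemma Domain_sqrt: "Domain A2 = ispace (\<lambda>l. l)"
  unfolding Domain_spectral_integral[OF sqrt_half_line] by (rule ispace_cong) simp

lemma A1_self_adjoint: "self_adjoint_op m A1" by (rule spectral_integral_self_adjoint) simp
lemma A2_self_adjoint: "self_adjoint_op m A2" by (rule spectral_integral_self_adjoint) simp

lemma sqrt_norm: "u \<in> Domain A2 \<Longrightarrow> graph_form m A2 u u = (\<integral>l. l \<partial>\<mu> u)"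
  unfolding graph_form_def spectral_integral_norm[OF sqrt_half_line op_app_mem]
  by (intro Bochner_Integration.integral_cong) auto

lemma Domain_A1_A2: "Domain A1 \<subseteq> Domain A2"
  unfolding Domain_sqrt Domain_spectral_integral[OF id_half_line]
  using ispace_square[OF _ id_half_line] by blast

lemma A1_inner_self:
  assumes "(u, v) \<in> A1" shows "ip v u = (\<integral>l. l \<partial>\<mu> u)"
proof -
  have u: "u \<in> ispace (\<lambda>l. l\<^sup>2)" "ip v u = bint (\<lambda>l. l) u u" using assms by (auto simp: spectral_integral_eq)
  then show ?thesis using bint_self[OF ispace_square[OF u(1) id_half_line] id_half_line] by simp
qed

text \<open>The spectral cutoffs \<open>P (cut sqrt n) u\<close> lie in the domain of
  \<open>A1\<close> and commute with the square root up to a.e. equality, so their images under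
  \<open>A2\<close> are cutoffs of \<open>op_app A2 u\<close> and converge to it.\<close>

lemma core_A1: "form_core m (Domain A2) (graph_form m A2) (Domain A1)"
  unfolding form_core_def
proof (intro conjI ballI)
  show "Domain A1 \<subseteq> Domain A2" by (rule Domain_A1_A2)
  fix u assume u: "u \<in> Domain A2"
  have uH: "u \<in> H" "op_app A2 u \<in> H" using op_app_L2[OF A2_self_adjoint u] by auto
  let ?u = "\<lambda>n. P (cut sqrt n) u"
  have c: "cut sqrt n \<in> sets half_line" for n by simp
  have D1: "?u n \<in> Domain A1" for n
    unfolding Domain_spectral_integral[OF id_half_line]
  proof (rule P_ispace[OF c uH(1)])
    show m2: "(\<lambda>l::real. l\<^sup>2) \<in> borel_measurable half_line" by (intro borel_measurable_power) simp
    show "bounded_borel (\<lambda>l. l\<^sup>2 * indicator (cut sqrt n) l)"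
    \<comment> \<open>On the cut \<open>sqrt l \<le> n\<close>, hence
      \<open>l\<^sup>2 \<le> n ^ 4\<close>.\<close>
    proof (rule bounded_borelI[where K = "real n ^ 4"])
      show "(\<lambda>l. l\<^sup>2 * indicator (cut sqrt n) l) \<in> borel_measurable half_line"
        by (intro borel_measurable_times m2 indicator_cut_measurable sqrt_half_line)
      fix l :: real assume l: "l \<ge> 0"
      show "\<bar>l\<^sup>2 * indicator (cut sqrt n) l\<bar> \<le> real n ^ 4"
      proof (cases "l \<in> cut sqrt n")
        case True
        then have "sqrt l \<le> real n" by (simp add: cut_def abs_le_iff)
        then have "sqrt l ^ 4 \<le> real n ^ 4" using l by (intro power_mono) auto
        moreover have "sqrt l ^ 4 = l\<^sup>2" using l by (metis numeral_Bit0 mult_2 power_add power2_eq_square real_sqrt_pow2 numeral_eq_Suc power_mult[of "sqrt l" 2 2] mult_2_right[of "2::nat"] one_add_one)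
        ultimately show ?thesis using True by simp
      qed simp
    qed
  qed
  have D2: "?u n \<in> Domain A2" for n using D1 Domain_A1_A2 by blast
  have "form_tendsto ip (\<lambda>n. op_app A2 (?u n)) (op_app A2 u)"
  proof -
    have "ip (op_app A2 (?u n) - op_app A2 u) (op_app A2 (?u n) - op_app A2 u)
        = ip (P (cut sqrt n) (op_app A2 u) - op_app A2 u) (P (cut sqrt n) (op_app A2 u) - op_app A2 u)" for n
    proof -
      have e: "op_app A2 (?u n) \<in> H" "T (trunc sqrt n) u \<in> H" "P (cut sqrt n) (op_app A2 u) \<in> H"
        using op_app_L2[OF A2_self_adjoint D2] uH c by auto
      have "ip (op_app A2 (?u n)) w = ip (P (cut sqrt n) (op_app A2 u)) w" if w: "w \<in> H" for w
        using op_app_inner[OF A2_self_adjoint spectral_integral_cut[OF sqrt_half_line uH(1)] w]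
          op_app_mem[OF u] spectral_integral_iff[OF sqrt_half_line, of u "op_app A2 u"] w by simp
      then have ae: "AE x in m. op_app A2 (?u n) x = P (cut sqrt n) (op_app A2 u) x"
        using L2_eq_AE_iff[OF e(1,3)] by blast
      then have "AE x in m. (op_app A2 (?u n) - op_app A2 u) x = (P (cut sqrt n) (op_app A2 u) - op_app A2 u) x"
        by eventually_elim simp
      then show ?thesis using e uH by (intro L2_inner_cong_AE L2_space_measurable L2.V_mem)
    qed
    then show ?thesis using P_cut_tendsto[OF sqrt_half_line uH(2)] by (simp add: form_tendsto_def)
  qed
  then have "form_tendsto (graph_form m A2) ?u u"
    using graph_form_tendsto[OF A2_self_adjoint, of ?u u] D2 u by blast
  then show "\<exists>ua. (\<forall>n. ua n \<in> Domain A1) \<and> form_tendsto ip ua u \<and> form_tendsto (graph_form m A2) ua u"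
    using D1 P_cut_tendsto[OF sqrt_half_line uH(1)] by (intro exI[of _ ?u]) simp
qed

end

text \<open>On the domain of the common operator \<open>A\<close> both quadratic forms equal
  \<open>\<langle>A f, f\<rangle>\<close>, and this domain is a core of both by
  \<open>core_A1\<close>. It connects an explicit resolution with the one that
  \<open>sqrt_neg\<close> picks by \<open>SOME\<close>.\<close>

lemma sqrt_form_unique:
  assumes "pvm m P" "pvm m P'" and eq: "spectral_integral m P (\<lambda>l. l) = spectral_integral m P' (\<lambda>l. l)"
  shows "Domain (spectral_integral m P sqrt) = Domain (spectral_integral m P' sqrt)"
    "f \<in> Domain (spectral_integral m P sqrt) \<Longrightarrow> g \<in> Domain (spectral_integral m P sqrt) \<Longrightarrow>
      graph_form m (spectral_integral m P sqrt) f g = graph_form m (spectral_integral m P' sqrt) f g"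
proof -
  interpret P: pvm m P by fact
  interpret P': pvm m P' by fact
  have *: "graph_form m P.A2 f f = graph_form m P'.A2 f f" if f: "f \<in> Domain P.A1" for f
  proof -
    obtain v where v: "(f, v) \<in> P.A1" "(f, v) \<in> P'.A1" using f eq by auto
    have "f \<in> Domain P.A2" "f \<in> Domain P'.A2" using v P.Domain_A1_A2 P'.Domain_A1_A2 by auto
    then show ?thesis using P.sqrt_norm P'.sqrt_norm P.A1_inner_self[OF v(1)] P'.A1_inner_self[OF v(2)] by simp
  qed
  have core': "form_core m (Domain P'.A2) (graph_form m P'.A2) (Domain P.A1)" using P'.core_A1 eq by simp
  note c = closed_form_eqI[OF closed_graph_form[OF P.A2_self_adjoint] closed_graph_form[OF P'.A2_self_adjoint]
      P.core_A1 core' self_adjoint_op_subspace[OF P.A1_self_adjoint] *]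
  show "Domain P.A2 = Domain P'.A2" using c(1) by blast
  show "f \<in> Domain P.A2 \<Longrightarrow> g \<in> Domain P.A2 \<Longrightarrow> graph_form m P.A2 f g = graph_form m P'.A2 f g"
    using c(2) by blast
qed

section \<open>The representation theorem for densely defined closed forms\<close>

locale dense_closed_form =
  fixes m :: "'a measure" and V :: "('a \<Rightarrow> real) set" and E :: "'a form"
  assumes closed: "closed_L2_form m V E"
    and dense: "\<And>f. f \<in> L2_space m \<Longrightarrow> (\<And>v. v \<in> V \<Longrightarrow> L2_inner m f v = 0) \<Longrightarrow> L2_inner m f f = 0"
begin

definition form_operator :: "'a operator" where
  "form_operator = {(u, v). u \<in> V \<and> v \<in> L2_space m \<and> (\<forall>w\<in>V. E u w = L2_inner m v w)}"

interpretation E: semi_inner_space V E using closed_L2_formD[OF closed] by blast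

abbreviation (input) "ip \<equiv> L2_inner m"
abbreviation (input) "H \<equiv> L2_space m"

lemma VH: "f \<in> V \<Longrightarrow> f \<in> H" using closed_L2_formD(2)[OF closed] .

definition E1 :: "'a form" where "E1 f g = E f g + ip f g"

lemma semi_inner_E1: "semi_inner_space V E1"
  by standard (auto simp: E1_def E.subspace_V E.add_left E.scale_left L2.add_left L2.scale_left VH distrib_left
      E.nonneg L2.nonneg intro!: add_nonneg_nonneg arg_cong2[where f = "(+)"] E.sym L2.sym)

interpretation E1: semi_inner_space V E1 by (rule semi_inner_E1)

lemma E1_Cauchy:
  assumes u: "\<And>n. u n \<in> V" and cau: "form_Cauchy E1 u"
  obtains f where "f \<in> V" "form_tendsto ip u f" "form_tendsto E u f"
proof -
  have le: "E (u i - u j) (u i - u j) \<le> E1 (u i - u j) (u i - u j)" "ip (u i - u j) (u i - u j) \<le> E1 (u i - u j) (u i - u j)" for i j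
    using E.nonneg[of "u i - u j"] L2.nonneg[of "u i - u j" m] u VH by (auto simp: E1_def)
  have c: "form_Cauchy E u" "form_Cauchy ip u"
    using cau le unfolding form_Cauchy_eq by (meson le_less_trans)+
  have uH: "u n \<in> H" for n using u VH by blast
  obtain f where f: "f \<in> H" "form_tendsto ip u f" using uH c(2) by (rule L2_complete)
  have "f \<in> V \<and> form_tendsto E u f" using closed_L2_formD(3)[OF closed, of u f] u c(1) f by blast
  then show ?thesis using that f(2) by blast
qed

lemma form_resolvent_ex:
  assumes f: "f \<in> H" obtains u where "(u, f - u) \<in> form_operator"
proof -
  obtain u where u: "\<And>n. u n \<in> V" "form_Cauchy E1 u" "\<And>w. w \<in> V \<Longrightarrow> (\<lambda>n. E1 (u n) w) \<longlonglongrightarrow> ip f w"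
  proof (rule E1.Riesz_sequence[of "ip f" "ip f f"])
    show "(ip f x)\<^sup>2 \<le> ip f f * E1 x x" if "x \<in> V" for x
      using L2.Cauchy_Schwarz[OF f VH[OF that]] E.nonneg[OF that] L2.nonneg[OF f]
      unfolding E1_def by (smt (verit) mult_left_mono)
  qed (use f VH in \<open>auto simp: L2.add_right L2.scale_right\<close>)
  obtain g where g: "g \<in> V" "form_tendsto ip u g" "form_tendsto E u g" using E1_Cauchy[OF u(1,2)] by blast
  have "E g w = ip (f - g) w" if w: "w \<in> V" for w
  proof -
    have "(\<lambda>n. E (u n) w + ip (u n) w) \<longlonglongrightarrow> E g w + ip g w"
      using u(1) g w VH by (intro tendsto_intros E.tendsto_left L2.tendsto_left) auto
    then have "ip f w = E g w + ip g w" using u(3)[OF w] by (simp add: E1_def LIMSEQ_unique)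
    then show ?thesis using f g(1) w VH by (simp add: L2.diff_left)
  qed
  then have "(g, f - g) \<in> form_operator" using f g(1) VH by (auto simp: form_operator_def)
  then show ?thesis by (rule that)
qed

text \<open>The constant sequence \<open>u\<close> tends to \<open>u'\<close> in
  \<open>L\<^sup>2\<close>, so closedness puts \<open>u'\<close> into \<open>V\<close> at
  \<open>E\<close>-distance zero from \<open>u\<close>.\<close>

lemma form_operator_closed_AE:
  assumes "(u, v) \<in> form_operator" "u' \<in> H" "v' \<in> H" "AE x in m. u x = u' x" "AE x in m. v x = v' x"
  shows "(u', v') \<in> form_operator"
proof -
  have u: "u \<in> V" "v \<in> H" "\<And>w. w \<in> V \<Longrightarrow> E u w = ip v w" using assms(1) by (auto simp: form_operator_def)
  have "ip (u - u') (u - u') = 0" using L2_null_iff[of u m u'] u VH assms by blast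
  then have t: "form_tendsto ip (\<lambda>n. u) u'" by (simp add: form_tendsto_def)
  have "form_Cauchy E (\<lambda>n. u)" using E.zero_left[of 0] by (simp add: form_Cauchy_eq)
  then have u': "u' \<in> V" "form_tendsto E (\<lambda>n. u) u'" using closed_L2_formD(3)[OF closed, of "\<lambda>n. u" u'] u assms(2) t by auto
  then have "E (u - u') (u - u') = 0" by (simp add: form_tendsto_def LIMSEQ_const_iff)
  then have "E (u - u') w = 0" if "w \<in> V" for w using E.null_left[of "u - u'" w] u u' that by simp
  then have "E u' w = ip v' w" if "w \<in> V" for w
    using L2_inner_AE_left[OF assms(5) u(2) assms(3) VH[OF that]] u(3)[OF that] E.diff_left[OF u(1) u'(1) that] that by simp
  then show ?thesis using u'(1) assms(3) by (auto simp: form_operator_def)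
qed

lemma form_operator_sym:
  assumes "(f, g) \<in> form_operator" "(u, v) \<in> form_operator" shows "ip f v = ip g u"
  using assms E.sym[of f u] L2.sym[of f m v] VH by (auto simp: form_operator_def)

lemma subspace_Domain_form_operator: "subspace (Domain form_operator)"
proof (rule subspaceI)
  show "0 \<in> Domain form_operator"
    by (rule DomainI[of _ 0]) (auto simp: form_operator_def L2.zero_left VH)
  fix x y assume "x \<in> Domain form_operator" "y \<in> Domain form_operator"
  then obtain x' y' where "(x, x') \<in> form_operator" "(y, y') \<in> form_operator" by blast
  then have "(x + y, x' + y') \<in> form_operator" by (auto simp: form_operator_def E.add_left L2.add_left VH)
  then show "x + y \<in> Domain form_operator" by blast
next
  fix c x assume "x \<in> Domain form_operator"
  then obtain x' where "(x, x') \<in> form_operator" by blast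
  then have "(c *\<^sub>R x, c *\<^sub>R x') \<in> form_operator" by (auto simp: form_operator_def E.scale_left L2.scale_left VH)
  then show "c *\<^sub>R x \<in> Domain form_operator" by blast
qed

text \<open>Density: a vector \<open>z\<close> orthogonal to the domain is orthogonal to its own
  resolvent \<open>u\<close>, so \<open>E u u + \<langle>u, u\<rangle> = 0\<close>. Maximality: for
  \<open>(f, g)\<close> in the adjoint and \<open>u\<close> the resolvent of \<open>f + g\<close>,
  testing with the resolvent of \<open>f - u\<close> gives \<open>f = u\<close> a.e.\<close>

lemma form_operator_self_adjoint: "self_adjoint_op m form_operator"
  unfolding self_adjoint_op_def
proof (intro conjI ballI allI impI)
  show "form_operator \<subseteq> H \<times> H" using VH by (auto simp: form_operator_def)
  have orth: "ip z z = 0" if z: "z \<in> H" "\<And>v. v \<in> Domain form_operator \<Longrightarrow> ip z v = 0" for z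
  proof -
    obtain u where u: "(u, z - u) \<in> form_operator" using form_resolvent_ex[OF z(1)] by blast
    then have uV: "u \<in> V" "\<And>w. w \<in> V \<Longrightarrow> E u w = ip (z - u) w" by (auto simp: form_operator_def)
    note uH = VH[OF uV(1)]
    have "ip z u = 0" using z(2) u by blast
    then have "E u u + ip u u = 0" using uV(2)[OF uV(1)] z(1) uH by (simp add: L2.diff_left)
    then have E0: "E u u = 0" "ip u u = 0" using E.nonneg[OF uV(1)] L2.nonneg[OF uH] by linarith+
    have "ip z v = 0" if v: "v \<in> V" for v
      using uV(2)[OF v] E.null_left[OF uV(1) v E0(1)] L2.null_left[OF uH VH[OF v] E0(2)] z(1) uH VH[OF v]
      by (simp add: L2.diff_left)
    then show ?thesis using dense z(1) by blast
  qed
  fix f and e :: real assume f: "f \<in> H" and e: "e > 0"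
  have sub: "Domain form_operator \<subseteq> H" using VH by (auto simp: form_operator_def)
  obtain v where v: "\<And>n. v n \<in> Domain form_operator" "form_tendsto ip v f"
    using L2_dense_if_orthogonal_trivial[OF subspace_Domain_form_operator sub orth f] by blast
  have "\<forall>\<^sub>F n in sequentially. ip (v n - f) (v n - f) < e"
    using v(2) e unfolding form_tendsto_def by (rule order_tendstoD(2))
  then obtain n where n: "ip (v n - f) (v n - f) < e" unfolding eventually_sequentially by blast
  then have "ip (f - v n) (f - v n) < e" using L2.diff_commute[of f m "v n"] f v(1)[of n] sub by auto
  then show "\<exists>g\<in>Domain form_operator. ip (\<lambda>x. f x - g x) (\<lambda>x. f x - g x) < e"
    using v(1) unfolding fun_diff_def by blast
next
  fix f g assume f: "f \<in> H" and g: "g \<in> H"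
  show "(f, g) \<in> form_operator \<longleftrightarrow> (\<forall>(u, v)\<in>form_operator. ip f v = ip g u)"
  proof
    assume "(f, g) \<in> form_operator"
    then show "\<forall>(u, v)\<in>form_operator. ip f v = ip g u" using form_operator_sym by blast
  next
    assume *: "\<forall>(u, v)\<in>form_operator. ip f v = ip g u"
    have fgH: "f + g \<in> H" using f g by simp
    obtain u where u: "(u, (f + g) - u) \<in> form_operator" using form_resolvent_ex[OF fgH] by blast
    have uH: "u \<in> H" using u VH by (auto simp: form_operator_def)
    have fu: "f - u \<in> H" using f uH by simp
    obtain w where w: "(w, (f - u) - w) \<in> form_operator" using form_resolvent_ex[OF fu] by blast
    have wH: "w \<in> H" using w VH by (auto simp: form_operator_def)
    have "ip f (f - u - w) = ip g w" using * w by blast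
    moreover have "ip u (f - u - w) = ip (f + g - u) w" using form_operator_sym[OF u w] .
    ultimately have "ip (f - u) (f - u) = 0"
      using f g uH wH by (simp add: L2.bilin)
    then have ae: "AE x in m. u x = f x" using L2_null_iff[OF f uH] by (auto elim: eventually_mono)
    then have "AE x in m. (f + g - u) x = g x" by eventually_elim simp
    with ae show "(f, g) \<in> form_operator"
      using form_operator_closed_AE[OF u f g] by blast
  qed
qed

lemma form_operator_nonneg: "(u, v) \<in> form_operator \<Longrightarrow> 0 \<le> ip v u"
proof -
  assume "(u, v) \<in> form_operator"
  then have "u \<in> V" "E u u = ip v u" by (auto simp: form_operator_def)
  then show ?thesis using E.nonneg[of u] by simp
qed

text \<open>Let \<open>g\<close> be the \<open>E1\<close>-projection of \<open>u\<close> onto the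
  closure of the domain. Then \<open>u - g\<close> is \<open>E1\<close>-orthogonal to the resolvent
  \<open>w\<close> of \<open>u - g\<close>, while \<open>E1 w (u - g)\<close> equals
  \<open>\<langle>u - g, u - g\<rangle>\<close>.\<close>

lemma core_form_operator: "form_core m V E (Domain form_operator)"
  unfolding form_core_def
proof (intro conjI ballI)
  show sub: "Domain form_operator \<subseteq> V" by (auto simp: form_operator_def)
  fix u assume u: "u \<in> V"
  have "semi_inner_space (Domain form_operator) E1"
    by standard (use sub in \<open>auto simp: subspace_Domain_form_operator subset_iff E1.add_left E1.scale_left E1.nonneg intro: E1.sym\<close>)
  then interpret D1: semi_inner_space "Domain form_operator" E1 .
  obtain v where v: "\<And>n. v n \<in> Domain form_operator" "form_Cauchy E1 v"
    "\<And>w. w \<in> Domain form_operator \<Longrightarrow> (\<lambda>n. E1 (v n) w) \<longlonglongrightarrow> E1 u w"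
  proof (rule D1.Riesz_sequence[of "E1 u" "E1 u u"])
    show "(E1 u x)\<^sup>2 \<le> E1 u u * E1 x x" if "x \<in> Domain form_operator" for x
      using E1.Cauchy_Schwarz[OF u] that sub by blast
  qed (use u sub in \<open>auto simp: E1.add_right E1.scale_right subset_iff\<close>)
  have vV: "v n \<in> V" for n using v(1) sub by blast
  obtain g where g: "g \<in> V" "form_tendsto ip v g" "form_tendsto E v g" using E1_Cauchy[OF vV v(2)] by blast
  note uH = VH[OF u] and gH = VH[OF g(1)]
  have ugH: "u - g \<in> H" using uH gH by simp
  obtain w where w: "(w, (u - g) - w) \<in> form_operator" using form_resolvent_ex[OF ugH] by blast
  then have wV: "w \<in> V" "w \<in> Domain form_operator" and wE: "\<And>x. x \<in> V \<Longrightarrow> E w x = ip (u - g - w) x"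
    by (auto simp: form_operator_def)
  note wH = VH[OF wV(1)]
  have "(\<lambda>n. E (v n) w + ip (v n) w) \<longlonglongrightarrow> E g w + ip g w"
    using vV g wV(1) VH by (intro tendsto_intros E.tendsto_left L2.tendsto_left) auto
  then have "E1 g w = E1 u w" using v(3)[OF wV(2)] by (simp add: E1_def LIMSEQ_unique)
  then have "E1 w (u - g) = 0"
    using E1.sym[of w "u - g"] u g(1) wV(1) by (simp add: E1.diff_left)
  then have "ip (u - g) (u - g) = 0"
    using wE[of "u - g"] u g(1) uH gH wH by (simp add: E1_def L2.diff_left)
  then have ae: "AE x in m. g x = u x" using L2_null_iff[OF uH gH] by (auto elim: eventually_mono)
  have "form_tendsto ip v u" using L2_tendsto_cong_AE[OF form_operator_self_adjoint ae gH uH _ g(2)] vV VH by blast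
  moreover have "form_Cauchy E v" using E.tendsto_imp_Cauchy[OF vV g(1,3)] .
  ultimately have "form_tendsto E v u" using closed_L2_formD(3)[OF closed, of v u] vV uH by blast
  then show "\<exists>v. (\<forall>n. v n \<in> Domain form_operator) \<and> form_tendsto ip v u \<and> form_tendsto E v u"
    using v(1) \<open>form_tendsto ip v u\<close> by blast
qed

text \<open>\<open>op_neg form_operator\<close> is a witness for the \<open>SOME\<close> in
  \<open>form_generator\<close>: its square-root form and \<open>E\<close> take the same values on
  \<open>Domain form_operator\<close>, a core of both.\<close>

theorem form_generator_closed_form:
  shows "nonpos_self_adjoint m (form_generator m V E)" "op_form_dom m (form_generator m V E) = V"
    "f \<in> V \<Longrightarrow> g \<in> V \<Longrightarrow> E f g = op_form m (form_generator m V E) f g"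
proof -
  let ?A = form_operator
  obtain P0 where "pvm m P0" "spectral_integral m P0 (\<lambda>l. l) = ?A"
    using spectral_theorem_nonneg[OF form_operator_self_adjoint form_operator_nonneg] by blast
  note P = spectral_resolution_pvm[OF this]
  interpret P: pvm m "spectral_resolution m ?A" by (rule P(1))
  have eqA: "P.A1 = ?A" by (rule P(2))
  have *: "E f f = graph_form m P.A2 f f" if f: "f \<in> Domain ?A" for f
  proof -
    obtain v where v: "(f, v) \<in> ?A" using f by blast
    then have "E f f = ip v f" by (auto simp: form_operator_def)
    moreover have "f \<in> Domain P.A2" using f eqA P.Domain_A1_A2 by auto
    ultimately show ?thesis using P.sqrt_norm P.A1_inner_self[of f v] v eqA by simp
  qed
  have core': "form_core m (Domain P.A2) (graph_form m P.A2) (Domain ?A)" using P.core_A1 eqA by simp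
  note c = closed_form_eqI[OF closed closed_graph_form[OF P.A2_self_adjoint] core_form_operator core' subspace_Domain_form_operator *]
  have sq: "sqrt_neg m (op_neg ?A) = P.A2" by (simp add: sqrt_neg_def op_fun_def)
  have nonpos: "nonpos_self_adjoint m (op_neg ?A)"
    using form_operator_self_adjoint form_operator_nonneg by (auto simp: nonpos_self_adjoint_iff)
  have "\<exists>L. nonpos_self_adjoint m L \<and> op_form_dom m L = V \<and> (\<forall>f\<in>V. \<forall>g\<in>V. E f g = op_form m L f g)"
  proof (intro exI[of _ "op_neg ?A"] conjI ballI nonpos)
    show "op_form_dom m (op_neg ?A) = V" using c(1) by (simp add: op_form_dom_def sq)
    show "E f g = op_form m (op_neg ?A) f g" if "f \<in> V" "g \<in> V" for f g
      using c(2)[OF _ that] by (simp add: op_form_eq sq)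
  qed
  from someI_ex[OF this] show "nonpos_self_adjoint m (form_generator m V E)"
    "op_form_dom m (form_generator m V E) = V"
    "f \<in> V \<Longrightarrow> g \<in> V \<Longrightarrow> E f g = op_form m (form_generator m V E) f g"
    unfolding form_generator_def by blast+
qed

end

section \<open>Closable forms and Schroedinger forms\<close>

locale closable_L2_form =
  fixes m :: "'a measure" and C :: "('a \<Rightarrow> real) set" and E :: "'a form"
  assumes semi_inner: "semi_inner_space C E" and CH: "C \<subseteq> L2_space m" and closable: "closable_form m C E"
begin

interpretation E: semi_inner_space C E by (rule semi_inner)

abbreviation (input) "ip \<equiv> L2_inner m"
abbreviation (input) "H \<equiv> L2_space m"
abbreviation (input) "approx \<equiv> closure_approx m C E"
abbreviation (input) "V \<equiv> closure_dom m C E"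
abbreviation (input) "cf \<equiv> closure_form m C E"

lemma approx_iff: "approx u f \<longleftrightarrow> (\<forall>n. u n \<in> C) \<and> form_Cauchy E u \<and> form_tendsto ip u f"
  by (simp add: closure_approx_def L2_tendsto_eq)

lemma approx_lincomb:
  assumes "approx u f" "approx v g" "f \<in> H" "g \<in> H"
  shows "approx (\<lambda>n. u n + c *\<^sub>R v n) (f + c *\<^sub>R g)"
proof -
  have u: "\<And>n. u n \<in> C" "\<And>n. v n \<in> C" "form_Cauchy E u" "form_Cauchy E v" "form_tendsto ip u f" "form_tendsto ip v g"
    using assms by (auto simp: approx_iff)
  have uH: "u n \<in> H" "v n \<in> H" for n using u CH by auto
  show ?thesis unfolding approx_iff
  proof (intro conjI allI)
    show "u n + c *\<^sub>R v n \<in> C" for n using u by simp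
    show "form_Cauchy E (\<lambda>n. u n + c *\<^sub>R v n)" using u by (intro E.Cauchy_lincomb)
    show "form_tendsto ip (\<lambda>n. u n + c *\<^sub>R v n) (f + c *\<^sub>R g)"
      using u uH assms by (intro L2.tendsto_add L2.tendsto_scale) auto
  qed
qed

lemma approx_const:
  assumes "f \<in> C" shows "approx (\<lambda>n. f) f"
  using assms E.zero_left[of 0] L2.zero_left[of 0 m] by (simp add: approx_iff form_Cauchy_eq form_tendsto_def)

lemma approx_unique:
  assumes "approx u f" "approx v f" "f \<in> H"
  shows "(\<lambda>n. E (u n - v n) (u n - v n)) \<longlonglongrightarrow> 0"
proof -
  have "approx (\<lambda>n. u n + (-1) *\<^sub>R v n) (f + (-1) *\<^sub>R f)" using assms by (intro approx_lincomb)
  then have "approx (\<lambda>n. u n - v n) 0" by simp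
  then have *: "\<forall>n. u n - v n \<in> C" "form_Cauchy E (\<lambda>n. u n - v n)" "L2_tendsto m (\<lambda>n. u n - v n) (\<lambda>x. 0)"
    by (auto simp: closure_approx_def zero_fun_def)
  show ?thesis using closable[unfolded closable_form_def, rule_format, of "\<lambda>n. u n - v n"] * by blast
qed

lemma approx_convergent:
  assumes "approx u f" "approx v g"
  shows "convergent (\<lambda>n. E (u n) (v n))"
proof -
  have u: "\<And>n. u n \<in> C" "\<And>n. v n \<in> C" "form_Cauchy E u" "form_Cauchy E v"
    using assms by (auto simp: approx_iff)
  have "convergent (\<lambda>n. E (u n + 1 *\<^sub>R v n) (u n + 1 *\<^sub>R v n))" "convergent (\<lambda>n. E (u n + (-1) *\<^sub>R v n) (u n + (-1) *\<^sub>R v n))"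
    using u by (intro E.Cauchy_convergent_norm E.Cauchy_lincomb; simp)+
  then have "convergent (\<lambda>n. E (u n + v n) (u n + v n) - E (u n - v n) (u n - v n))"
    by (intro convergent_diff) simp_all
  then have "convergent (\<lambda>n. (E (u n + v n) (u n + v n) - E (u n - v n) (u n - v n)) * (1 / 4))"
    by (intro convergent_mult convergent_const)
  then show ?thesis using u by (simp add: E.expand_add E.expand_diff)
qed

lemma product_tendsto_0:
  assumes u: "\<And>n. u n \<in> C" and v: "\<And>n. v n \<in> C" and lim: "(\<lambda>n. E (u n) (u n)) \<longlonglongrightarrow> 0" and cau: "form_Cauchy E v"
  shows "(\<lambda>n. E (u n) (v n)) \<longlonglongrightarrow> 0"
proof -
  obtain K where K: "K \<ge> 0" "\<And>n. E (v n) (v n) \<le> K" using E.Cauchy_bounded[OF v cau] by blast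
  have "(\<lambda>n. sqrt (E (u n) (u n)) * sqrt K) \<longlonglongrightarrow> sqrt 0 * sqrt K" using lim by (intro tendsto_intros)
  moreover have "norm (E (u n) (v n)) \<le> sqrt (E (u n) (u n)) * sqrt K" for n
    using E.abs_le[OF u v, of n n] K(2)[of n] E.nonneg[OF u, of n]
    by (smt (verit) mult_left_mono real_norm_def real_sqrt_ge_zero real_sqrt_le_iff)
  ultimately show ?thesis by (intro Lim_null_comparison[of "\<lambda>n. E (u n) (v n)"]) auto
qed

text \<open>By closability two approximants of the same function differ by an energy tending to
  \<open>0\<close>, and Cauchy sequences have bounded energy; so the limit is the same for all
  approximants and the \<open>THE\<close> in \<open>closure_form\<close> denotes it.\<close>

lemma closure_form_lim:
  assumes u: "approx u f" and v: "approx v g" and H: "f \<in> H" "g \<in> H"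
  shows "(\<lambda>n. E (u n) (v n)) \<longlonglongrightarrow> cf f g"
proof -
  have lim: "(\<lambda>n. E (u n) (v n)) \<longlonglongrightarrow> lim (\<lambda>n. E (u n) (v n))" if "approx u f" "approx v g" for u v
    using approx_convergent[OF that] by (simp add: convergent_LIMSEQ_iff)
  let ?c = "lim (\<lambda>n. E (u n) (v n))"
  have all: "(\<lambda>n. E (u' n) (v' n)) \<longlonglongrightarrow> ?c" if u': "approx u' f" and v': "approx v' g" for u' v'
  proof -
    have C: "\<And>n. u n \<in> C" "\<And>n. v n \<in> C" "\<And>n. u' n \<in> C" "\<And>n. v' n \<in> C" "form_Cauchy E v" "form_Cauchy E u'"
      using u v u' v' by (auto simp: approx_iff)
    have 1: "(\<lambda>n. E (u' n - u n) (v n)) \<longlonglongrightarrow> 0"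
      using C by (intro product_tendsto_0[OF _ C(2) approx_unique[OF u' u H(1)] C(5)]) simp
    have 2: "(\<lambda>n. E (v' n - v n) (u' n)) \<longlonglongrightarrow> 0"
      using C by (intro product_tendsto_0[OF _ C(3) approx_unique[OF v' v H(2)] C(6)]) simp
    have "E (u' n) (v' n) = E (u n) (v n) + E (u' n - u n) (v n) + E (v' n - v n) (u' n)" for n
      using C by (simp add: E.diff_left E.sym[of "u' n"])
    moreover have "(\<lambda>n. E (u n) (v n) + E (u' n - u n) (v n) + E (v' n - v n) (u' n)) \<longlonglongrightarrow> ?c + 0 + 0"
      by (intro tendsto_intros lim u v 1 2)
    ultimately show ?thesis by simp
  qed
  have "cf f g = ?c"
    unfolding closure_form_def
  proof (rule the_equality)
    show "\<forall>u v. approx u f \<and> approx v g \<longrightarrow> (\<lambda>n. E (u n) (v n)) \<longlonglongrightarrow> ?c" using all by blast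
    show "c = ?c" if "\<forall>u v. approx u f \<and> approx v g \<longrightarrow> (\<lambda>n. E (u n) (v n)) \<longlonglongrightarrow> c" for c
      using that u v lim[OF u v] LIMSEQ_unique by blast
  qed
  then show ?thesis using lim[OF u v] by simp
qed

lemma closure_domE:
  assumes "f \<in> V" obtains u where "approx u f" "f \<in> H"
  using assms by (auto simp: closure_dom_def)

lemma closure_dom_lincomb: "f \<in> V \<Longrightarrow> g \<in> V \<Longrightarrow> f + c *\<^sub>R g \<in> V"
  by (elim closure_domE) (auto simp: closure_dom_def dest: approx_lincomb)

lemma C_closure_dom: "C \<subseteq> V"
  using approx_const CH by (auto simp: closure_dom_def)

lemma closure_form_eq: "f \<in> C \<Longrightarrow> g \<in> C \<Longrightarrow> cf f g = E f g"
  using closure_form_lim[OF approx_const approx_const subsetD[OF CH] subsetD[OF CH], of f g]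
  by (simp add: LIMSEQ_const_iff)

lemma semi_inner_closure_form: "semi_inner_space V cf"
proof
  show "subspace V"
  proof (rule subspaceI)
    show 0: "0 \<in> V" using C_closure_dom E.V_mem(1) by blast
    show "x + y \<in> V" if "x \<in> V" "y \<in> V" for x y using closure_dom_lincomb[OF that, of 1] by simp
    show "c *\<^sub>R x \<in> V" if "x \<in> V" for c x using closure_dom_lincomb[OF 0 that, of c] by simp
  qed
  fix x y assume "x \<in> V" "y \<in> V"
  then obtain u v where u: "approx u x" "x \<in> H" and v: "approx v y" "y \<in> H" by (metis closure_domE)
  have C: "\<And>n. u n \<in> C" "\<And>n. v n \<in> C" using u v by (auto simp: approx_iff)
  note xy = closure_form_lim[OF u(1) v(1) u(2) v(2)]
  show "cf x y = cf y x"
    using closure_form_lim[OF v(1) u(1) v(2) u(2)] xy C by (simp add: E.sym LIMSEQ_unique)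
  show "0 \<le> cf x x"
    using closure_form_lim[OF u(1) u(1) u(2) u(2)] C by (intro LIMSEQ_le_const) (auto intro: E.nonneg)
  have z0: "approx (\<lambda>n. 0) 0" "0 \<in> H" using approx_const[OF E.V_mem(1)] by auto
  show "cf (c *\<^sub>R x) y = c * cf x y" for c
  proof -
    have "approx (\<lambda>n. c *\<^sub>R u n) (c *\<^sub>R x)" using approx_lincomb[OF z0(1) u(1) z0(2) u(2), of c] by simp
    from closure_form_lim[OF this v(1)] have "(\<lambda>n. c * E (u n) (v n)) \<longlonglongrightarrow> cf (c *\<^sub>R x) y"
      using u v C by (simp add: E.scale_left)
    moreover have "(\<lambda>n. c * E (u n) (v n)) \<longlonglongrightarrow> c * cf x y" using xy by (intro tendsto_intros)
    ultimately show ?thesis by (rule LIMSEQ_unique)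
  qed
  show "cf (x + y) z = cf x z + cf y z" if "z \<in> V" for z
  proof -
    obtain w where w: "approx w z" "z \<in> H" using \<open>z \<in> V\<close> by (rule closure_domE)
    have Cw: "\<And>n. w n \<in> C" using w by (auto simp: approx_iff)
    have "approx (\<lambda>n. u n + v n) (x + y)" using approx_lincomb[OF u(1) v(1) u(2) v(2), of 1] by simp
    from closure_form_lim[OF this w(1)] have "(\<lambda>n. E (u n) (w n) + E (v n) (w n)) \<longlonglongrightarrow> cf (x + y) z"
      using u v w C Cw by (simp add: E.add_left)
    moreover have "(\<lambda>n. E (u n) (w n) + E (v n) (w n)) \<longlonglongrightarrow> cf x z + cf y z"
      using closure_form_lim[OF u(1) w(1) u(2) w(2)] closure_form_lim[OF v(1) w(1) v(2) w(2)] by (intro tendsto_intros)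
    ultimately show ?thesis by (rule LIMSEQ_unique)
  qed
qed

lemma approx_tendsto_closure_form:
  assumes u: "approx u f" and f: "f \<in> H"
  shows "form_tendsto cf u f"
  unfolding form_tendsto_def
proof (rule LIMSEQ_I)
  interpret cf: semi_inner_space V cf by (rule semi_inner_closure_form)
  have C: "\<And>n. u n \<in> C" and cau: "form_Cauchy E u" using u by (auto simp: approx_iff)
  have V: "u n \<in> V" "f \<in> V" for n using C C_closure_dom u f by (auto simp: closure_dom_def)
  fix e :: real assume "e > 0"
  then have "e / 2 > 0" by simp
  then obtain N where N: "\<And>i j. i \<ge> N \<Longrightarrow> j \<ge> N \<Longrightarrow> E (u i - u j) (u i - u j) < e / 2"
    using cau unfolding form_Cauchy_eq by blast
  have "norm (cf (u n - f) (u n - f) - 0) < e" if n: "n \<ge> N" for n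
  proof -
    have "approx (\<lambda>k. u n + (-1) *\<^sub>R u k) (u n + (-1) *\<^sub>R f)"
      using C CH by (intro approx_lincomb approx_const u f) auto
    then have a: "approx (\<lambda>k. u n - u k) (u n - f)" by simp
    have "u n - f \<in> H" using C CH f by auto
    then have "(\<lambda>k. E (u n - u k) (u n - u k)) \<longlonglongrightarrow> cf (u n - f) (u n - f)" by (intro closure_form_lim a)
    moreover have "\<forall>k\<ge>N. E (u n - u k) (u n - u k) \<le> e / 2" using N[OF n] by (auto intro: less_imp_le)
    ultimately have "cf (u n - f) (u n - f) \<le> e / 2" by (intro LIMSEQ_le_const2) auto
    then show ?thesis using cf.nonneg[of "u n - f"] V \<open>e > 0\<close> by simp
  qed
  then show "\<exists>N. \<forall>n\<ge>N. norm (cf (u n - f) (u n - f) - 0) < e" by blast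
qed

theorem core_closure: "form_core m V cf C"
  unfolding form_core_def
proof (intro conjI ballI C_closure_dom)
  fix f assume "f \<in> V"
  then obtain u where u: "approx u f" "f \<in> H" by (rule closure_domE)
  then show "\<exists>u. (\<forall>n. u n \<in> C) \<and> form_tendsto ip u f \<and> form_tendsto cf u f"
    using approx_tendsto_closure_form[OF u] by (auto simp: approx_iff)
qed

text \<open>A diagonal argument: each \<open>u n\<close> is replaced by a member of \<open>C\<close>
  within \<open>1 / Suc n\<close> in energy and in \<open>L\<^sup>2\<close>. The new sequence
  approximates \<open>f\<close> in the sense of \<open>closure_approx\<close>.\<close>

theorem closed_closure_form: "closed_L2_form m V cf"
  unfolding closed_L2_form_def
proof (intro conjI allI impI)
  show "semi_inner_space V cf" by (rule semi_inner_closure_form)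
  interpret cf: semi_inner_space V cf by (rule semi_inner_closure_form)
  show VH: "V \<subseteq> H" by (auto simp: closure_dom_def)
  fix u f assume uV: "\<forall>n. u n \<in> V" and cau: "form_Cauchy cf u" and f: "f \<in> H" and lim: "form_tendsto ip u f"
  have u: "u n \<in> V" and uH: "u n \<in> H" for n using uV VH by auto
  have "\<exists>w\<in>C. cf (w - u n) (w - u n) < 1 / real (Suc n) \<and> ip (w - u n) (w - u n) < 1 / real (Suc n)" for n
  proof -
    obtain w where w: "\<And>k. w k \<in> C" "form_tendsto ip w (u n)" "form_tendsto cf w (u n)"
      using core_closure u[of n] unfolding form_core_def by blast
    have "\<forall>\<^sub>F k in sequentially. cf (w k - u n) (w k - u n) < 1 / real (Suc n)"
      using w(3) unfolding form_tendsto_def by (rule order_tendstoD(2)) simp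
    moreover have "\<forall>\<^sub>F k in sequentially. ip (w k - u n) (w k - u n) < 1 / real (Suc n)"
      using w(2) unfolding form_tendsto_def by (rule order_tendstoD(2)) simp
    ultimately have "\<forall>\<^sub>F k in sequentially. cf (w k - u n) (w k - u n) < 1 / real (Suc n) \<and> ip (w k - u n) (w k - u n) < 1 / real (Suc n)"
      by (rule eventually_conj)
    then show ?thesis using w(1) unfolding eventually_sequentially by blast
  qed
  then obtain w where w: "\<And>n. w n \<in> C" "\<And>n. cf (w n - u n) (w n - u n) < 1 / real (Suc n)"
    "\<And>n. ip (w n - u n) (w n - u n) < 1 / real (Suc n)" by metis
  have wV: "w n \<in> V" and wH: "w n \<in> H" for n using w(1) C_closure_dom CH by auto
  have inv0: "(\<lambda>n. 1 / real (Suc n)) \<longlonglongrightarrow> 0" by (rule LIMSEQ_Suc[OF lim_1_over_n])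
  have d1: "(\<lambda>n. cf (w n - u n) (w n - u n)) \<longlonglongrightarrow> 0"
    by (rule tendsto_sandwich[OF _ _ tendsto_const inv0])
       (use cf.nonneg u wV w(2) in \<open>auto intro!: always_eventually less_imp_le\<close>)
  have "0 \<le> ip (w n - u n) (w n - u n)" for n using uH wH by (intro L2.nonneg) auto
  then have d2: "(\<lambda>n. ip (w n - u n) (w n - u n)) \<longlonglongrightarrow> 0"
    by (intro tendsto_sandwich[OF _ _ tendsto_const inv0] always_eventually allI less_imp_le[OF w(3)])
  have t1: "form_tendsto cf (\<lambda>n. w n - u n) 0" and t2: "form_tendsto ip (\<lambda>n. w n - u n) 0"
    using d1 d2 by (auto simp: form_tendsto_def)
  have "form_tendsto ip (\<lambda>n. (w n - u n) + u n) (0 + f)"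
    using t2 lim uH wH f by (intro L2.tendsto_add) auto
  then have wf: "form_tendsto ip w f" by simp
  have "form_Cauchy cf (\<lambda>n. w n - u n)"
    by (rule cf.tendsto_imp_Cauchy[OF _ cf.V_mem(1) t1]) (use wV u in auto)
  then have "form_Cauchy cf (\<lambda>n. (w n - u n) + 1 *\<^sub>R u n)" using cau wV u by (intro cf.Cauchy_lincomb) auto
  then have "form_Cauchy cf w" by simp
  then have "form_Cauchy E w"
    by (rule form_Cauchy_cong[rotated]) (use w(1) in \<open>auto simp: closure_form_eq\<close>)
  then have a: "approx w f" using w(1) wf by (simp add: approx_iff)
  then show fV: "f \<in> V" using f by (auto simp: closure_dom_def)
  have "form_tendsto cf (\<lambda>n. w n - (w n - u n)) (f - 0)"
    using approx_tendsto_closure_form[OF a f] t1 wV u fV by (intro cf.tendsto_diff) auto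
  then show "form_tendsto cf u f" by simp
qed

end

section \<open>Schroedinger forms on continuous functions with compact support\<close>

lemma radon_Cc_integrable:
  fixes \<mu> :: "'a::{metric_space, second_countable_topology} measure"
  assumes "radon_on UNIV \<mu>" "f \<in> Cc" "g \<in> Cc"
  shows "integrable \<mu> (\<lambda>x. f x * g x)"
proof -
  have sets: "sets \<mu> = sets borel" using assms(1) by (simp add: radon_on_def)
  let ?K = "closure {x. f x \<noteq> 0}"
  have K: "compact ?K" using assms(2) by (simp add: Cc_def)
  have cont: "continuous_on UNIV (\<lambda>x. f x * g x)" using assms by (auto simp: Cc_def intro: continuous_intros)
  have "compact ((\<lambda>x. f x * g x) ` ?K)" using K by (intro compact_continuous_image continuous_on_subset[OF cont]) auto
  from compact_imp_bounded[OF this] obtain B where B: "\<And>x. x \<in> ?K \<Longrightarrow> \<bar>f x * g x\<bar> \<le> B"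
    unfolding bounded_iff by fastforce
  have Ks: "?K \<in> sets \<mu>" using sets by simp
  have "emeasure \<mu> ?K < \<infinity>" using assms(1) K by (simp add: radon_on_def)
  then have "integrable \<mu> (\<lambda>x. indicator ?K x * \<bar>B\<bar>)" using Ks by simp
  then show ?thesis
  proof (rule Bochner_Integration.integrable_bound)
    show "(\<lambda>x. f x * g x) \<in> borel_measurable \<mu>"
      by (simp only: measurable_cong_sets[OF sets refl] borel_measurable_continuous_onI[OF cont])
    have "norm (f x * g x) \<le> norm (indicator ?K x * \<bar>B\<bar>)" for x
    proof (cases "x \<in> ?K")
      case False
      then have "f x = 0" using closure_subset[of "{x. f x \<noteq> 0}"] by auto
      then show ?thesis by simp
    next
      case True
      then show ?thesis using B[OF True] by (simp add: abs_mult)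
    qed
    then show "AE x in \<mu>. norm (f x * g x) \<le> norm (indicator ?K x * \<bar>B\<bar>)" by simp
  qed
qed

lemma compact_closed_subset: "compact K \<Longrightarrow> closed S \<Longrightarrow> S \<subseteq> K \<Longrightarrow> compact S" for K :: "'a::t2_space set"
  using compact_Int_closed[of K S] by (simp add: Int_absorb1)

lemma subspace_Cc: "subspace (Cc :: ('a::metric_space \<Rightarrow> real) set)"
proof (rule subspaceI)
  show "0 \<in> (Cc :: ('a \<Rightarrow> real) set)" by (simp add: Cc_def zero_fun_def)
next
  fix f g :: "'a \<Rightarrow> real" assume fg: "f \<in> Cc" "g \<in> Cc"
  have "closure {x. (f + g) x \<noteq> 0} \<subseteq> closure ({x. f x \<noteq> 0} \<union> {x. g x \<noteq> 0})" by (intro closure_mono) auto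
  also have "\<dots> = closure {x. f x \<noteq> 0} \<union> closure {x. g x \<noteq> 0}" by (rule closure_Un)
  finally have "compact (closure {x. (f + g) x \<noteq> 0})"
    using fg by (rule_tac compact_closed_subset[OF compact_Un closed_closure]) (auto simp: Cc_def)
  then show "f + g \<in> Cc" using fg by (auto simp: Cc_def plus_fun_def intro: continuous_intros)
next
  fix c and f :: "'a \<Rightarrow> real" assume f: "f \<in> Cc"
  have "closure {x. (c *\<^sub>R f) x \<noteq> 0} \<subseteq> closure {x. f x \<noteq> 0}" by (intro closure_mono) auto
  then have "compact (closure {x. (c *\<^sub>R f) x \<noteq> 0})"
    using f by (rule_tac compact_closed_subset[OF _ closed_closure]) (auto simp: Cc_def)
  then show "c *\<^sub>R f \<in> Cc" using f by (auto simp: Cc_def scaleR_fun_def intro: continuous_intros)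
qed

lemma Cc_comp:
  fixes f :: "'a::metric_space \<Rightarrow> real"
  assumes f: "f \<in> Cc" and h: "continuous_on UNIV h" "h 0 = (0 :: real)"
  shows "(\<lambda>x. h (f x)) \<in> Cc"
proof -
  have "closure {x. h (f x) \<noteq> 0} \<subseteq> closure {x. f x \<noteq> 0}" using h(2) by (intro closure_mono) auto
  then have "compact (closure {x. h (f x) \<noteq> 0})"
    using f by (rule_tac compact_closed_subset[OF _ closed_closure]) (auto simp: Cc_def)
  moreover have "continuous_on UNIV (\<lambda>x. h (f x))"
    using f continuous_on_compose2[OF h(1), of UNIV f] by (auto simp: Cc_def)
  ultimately show ?thesis by (simp add: Cc_def)
qed

lemma symmetric_formD:
  assumes "symmetric_form m D \<E>"
  shows "semi_inner_space D \<E>" "D \<subseteq> L2_space m"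
proof -
  show "D \<subseteq> L2_space m" using assms by (simp add: symmetric_form_def)
  have ops: "0 \<in> D" "x + y \<in> D" "c *\<^sub>R x \<in> D"
    "\<E> (x + y) z = \<E> x z + \<E> y z" "\<E> (c *\<^sub>R x) y = c * \<E> x y"
    if "x \<in> D" "y \<in> D" "z \<in> D" for x y z c
    using assms that
    unfolding symmetric_form_def plus_fun_def scaleR_fun_def real_scaleR_def zero_fun_def by blast+
  have "(\<lambda>x. 0) \<in> D" using assms by (simp add: symmetric_form_def)
  then have ne: "\<exists>x. x \<in> D" by blast
  show "semi_inner_space D \<E>"
  proof
    show "subspace D" using ops ne by (intro subspaceI) blast+
    show "\<E> x y = \<E> y x" if "x \<in> D" "y \<in> D" for x y
      using assms that unfolding symmetric_form_def by blast
    show "0 \<le> \<E> x x" if "x \<in> D" for x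
      using assms that unfolding symmetric_form_def by blast
    show "\<E> (x + y) z = \<E> x z + \<E> y z" if "x \<in> D" "y \<in> D" "z \<in> D" for x y z
      using that by (rule ops(4))
    show "\<E> (c *\<^sub>R x) y = c * \<E> x y" if "x \<in> D" "y \<in> D" for x y c
      using that(1,2,1) by (rule ops(5))
  qed
qed

text \<open>For a bounded function the positive part is a unit contraction up to scaling; testing
  it on \<open>f\<^sup>+ - c f\<^sup>-\<close> and letting \<open>c \<rightarrow> 0\<close> gives \<open>\<E>(f\<^sup>+, f\<^sup>-) \<le> 0\<close>.\<close>

lemma dirichlet_form_pos_neg:
  assumes df: "dirichlet_form m D \<E>" and f: "f \<in> D" and B: "\<And>x. \<bar>f x\<bar> \<le> B"
  defines "fp \<equiv> \<lambda>x. max 0 (f x)" and "fn \<equiv> \<lambda>x. max 0 (- f x)"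
  shows "fp \<in> D" "fn \<in> D" "\<E> fp fn \<le> 0"
proof -
  have sf: "symmetric_form m D \<E>" using df by (simp add: dirichlet_form_def)
  interpret E: semi_inner_space D \<E> using symmetric_formD[OF sf] by blast
  have pos: "(\<lambda>x. max 0 (g x)) \<in> D \<and> \<E> (\<lambda>x. max 0 (g x)) (\<lambda>x. max 0 (g x)) \<le> \<E> g g"
    if g: "g \<in> D" "\<And>x. \<bar>g x\<bar> \<le> K" for g K
  proof -
    define M where "M = \<bar>K\<bar> + 1"
    have M: "M > 0" by (simp add: M_def)
    let ?h = "\<lambda>x. min (max 0 (((1 / M) *\<^sub>R g) x)) 1"
    have "(1 / M) *\<^sub>R g \<in> D" using g by simp
    then have h: "?h \<in> D" "\<E> ?h ?h \<le> \<E> ((1 / M) *\<^sub>R g) ((1 / M) *\<^sub>R g)" using df unfolding dirichlet_form_def by blast+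
    have eq: "M *\<^sub>R ?h = (\<lambda>x. max 0 (g x))"
    proof
      fix x
      have "\<bar>g x\<bar> \<le> M" using g(2)[of x] by (simp add: M_def)
      then have "g x / M \<le> 1" using M by (simp add: divide_le_eq)
      then show "(M *\<^sub>R ?h) x = max 0 (g x)"
        using M by (auto simp: max_def min_def zero_le_divide_iff)
    qed
    have "(\<lambda>x. max 0 (g x)) \<in> D" using E.V_mem(4)[OF h(1), of M] unfolding eq .
    moreover have "\<E> (M *\<^sub>R ?h) (M *\<^sub>R ?h) = M\<^sup>2 * \<E> ?h ?h" using h(1) by (simp add: E.scale_left E.scale_right power2_eq_square)
    moreover have "\<E> ((1 / M) *\<^sub>R g) ((1 / M) *\<^sub>R g) = \<E> g g / M\<^sup>2" using g(1) by (simp add: E.scale_left E.scale_right power2_eq_square)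
    moreover have "M\<^sup>2 * \<E> ?h ?h \<le> M\<^sup>2 * \<E> ((1 / M) *\<^sub>R g) ((1 / M) *\<^sub>R g)"
      using h(2) by (intro mult_left_mono) auto
    ultimately show ?thesis using M unfolding eq by simp
  qed
  show fp: "fp \<in> D" unfolding fp_def using pos[OF f B] by blast
  have "- f \<in> D" using f by simp
  moreover have "\<bar>(- f) x\<bar> \<le> B" for x using B[of x] by simp
  ultimately show fn: "fn \<in> D" unfolding fn_def using pos[of "- f" B] by simp
  have key: "2 * \<E> fp fn \<le> c * \<E> fn fn" if c: "c > 0" for c
  proof -
    let ?g = "fp - c *\<^sub>R fn"
    have g: "?g \<in> D" using fp fn by simp
    have "\<bar>?g x\<bar> \<le> B + c * B" for x
    proof -
      have "\<bar>fp x\<bar> \<le> B" "\<bar>fn x\<bar> \<le> B" using B[of x] by (auto simp: fp_def fn_def)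
      then have "\<bar>fp x\<bar> + c * \<bar>fn x\<bar> \<le> B + c * B" using c by (intro add_mono mult_left_mono) auto
      moreover have "\<bar>?g x\<bar> \<le> \<bar>fp x\<bar> + c * \<bar>fn x\<bar>" using c abs_triangle_ineq4[of "fp x" "c * fn x"] by (simp add: abs_mult)
      ultimately show ?thesis by linarith
    qed
    then have "\<E> (\<lambda>x. max 0 (?g x)) (\<lambda>x. max 0 (?g x)) \<le> \<E> ?g ?g" using pos[OF g] by blast
    moreover have "(\<lambda>x. max 0 (?g x)) = fp"
      using c by (auto simp: fp_def fn_def fun_eq_iff max_def mult_le_0_iff zero_le_mult_iff)
    ultimately have "\<E> fp fp \<le> \<E> fp fp - 2 * c * \<E> fp fn + c\<^sup>2 * \<E> fn fn"
      using fp fn by (simp add: E.expand_diff E.scale_left E.scale_right power2_eq_square algebra_simps)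
    then have "c * (2 * \<E> fp fn) \<le> c * (c * \<E> fn fn)" by (simp add: power2_eq_square algebra_simps)
    then show ?thesis using c by simp
  qed
  show "\<E> fp fn \<le> 0"
  proof (rule ccontr)
    assume "\<not> \<E> fp fn \<le> 0"
    then have p: "\<E> fp fn > 0" by simp
    have n: "\<E> fn fn \<ge> 0" using fn by (rule E.nonneg)
    \<comment> \<open>The choice \<open>c = \<E> fp fn / (\<E> fn fn + 1)\<close> makes the
      right-hand side at most \<open>\<E> fp fn\<close>; the summand \<open>1\<close> guards against
      \<open>\<E> fn fn = 0\<close>.\<close>
    have "2 * \<E> fp fn \<le> \<E> fp fn / (\<E> fn fn + 1) * \<E> fn fn" using p n by (intro key) simp
    also have "\<dots> \<le> \<E> fp fn" using p n by (simp add: field_simps)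
    finally show False using p by simp
  qed
qed

lemma schroedinger_semi_inner:
  fixes m :: "'a::{metric_space, second_countable_topology} measure"
  assumes df: "dirichlet_form m D \<E>" and \<mu>: "radon_on UNIV \<mu>p" "radon_on UNIV \<mu>n"
    and nonneg: "nonneg_definite_on (D \<inter> Cc) (schroedinger_form \<E> \<mu>p \<mu>n)"
  shows "semi_inner_space (D \<inter> Cc) (schroedinger_form \<E> \<mu>p \<mu>n)"
proof -
  have sf: "symmetric_form m D \<E>" using df by (simp add: dirichlet_form_def)
  interpret E: semi_inner_space D \<E> using symmetric_formD[OF sf] by blast
  note int = radon_Cc_integrable[OF \<mu>(1)] radon_Cc_integrable[OF \<mu>(2)]
  show ?thesis
  proof
    show "subspace (D \<inter> Cc)" using E.subspace_V subspace_Cc by (rule subspace_inter)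
    fix x y z assume x: "x \<in> D \<inter> Cc" and y: "y \<in> D \<inter> Cc"
    show "schroedinger_form \<E> \<mu>p \<mu>n x y = schroedinger_form \<E> \<mu>p \<mu>n y x"
      using x y E.sym[of x y] by (simp add: schroedinger_form_def mult.commute)
    show "0 \<le> schroedinger_form \<E> \<mu>p \<mu>n x x" using nonneg x by (simp add: nonneg_definite_on_def)
    show "schroedinger_form \<E> \<mu>p \<mu>n (c *\<^sub>R x) y = c * schroedinger_form \<E> \<mu>p \<mu>n x y" for c
      using x y by (simp add: schroedinger_form_def E.scale_left algebra_simps)
    show "schroedinger_form \<E> \<mu>p \<mu>n (x + y) z = schroedinger_form \<E> \<mu>p \<mu>n x z + schroedinger_form \<E> \<mu>p \<mu>n y z"
      if z: "z \<in> D \<inter> Cc"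
      using x y z int[of x z] int[of y z] by (simp add: schroedinger_form_def E.add_left distrib_right)
  qed
qed

text \<open>The integrals against \<open>\<mu>p\<close> and \<open>\<mu>n\<close> see only
  \<open>f\<^sup>2\<close>, and \<open>\<E>(|f|, |f|) - \<E>(f, f)\<close> is
  \<open>4 \<E>(f\<^sup>+, f\<^sup>-)\<close>. Members of \<open>Cc\<close> are bounded, as
  \<open>dirichlet_form_pos_neg\<close> requires.\<close>

lemma schroedinger_abs:
  fixes m :: "'a::{metric_space, second_countable_topology} measure"
  assumes df: "dirichlet_form m D \<E>" and f: "f \<in> D \<inter> Cc"
  shows "(\<lambda>x. \<bar>f x\<bar>) \<in> D \<inter> Cc"
    "schroedinger_form \<E> \<mu>p \<mu>n (\<lambda>x. \<bar>f x\<bar>) (\<lambda>x. \<bar>f x\<bar>) \<le> schroedinger_form \<E> \<mu>p \<mu>n f f"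
proof -
  have sf: "symmetric_form m D \<E>" using df by (simp add: dirichlet_form_def)
  interpret E: semi_inner_space D \<E> using symmetric_formD[OF sf] by blast
  have K: "compact (closure {x. f x \<noteq> 0})" and cont: "continuous_on UNIV f" using f by (auto simp: Cc_def)
  have "compact (f ` closure {x. f x \<noteq> 0})" using K by (intro compact_continuous_image continuous_on_subset[OF cont]) auto
  from compact_imp_bounded[OF this] obtain B0 where B0: "\<And>x. x \<in> closure {x. f x \<noteq> 0} \<Longrightarrow> \<bar>f x\<bar> \<le> B0"
    unfolding bounded_iff by fastforce
  have B: "\<bar>f x\<bar> \<le> \<bar>B0\<bar>" for x
  proof (cases "f x = 0")
    case False
    then have "x \<in> closure {x. f x \<noteq> 0}" using closure_subset[of "{x. f x \<noteq> 0}"] by auto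
    from B0[OF this] show ?thesis by linarith
  qed simp
  let ?p = "\<lambda>x. max 0 (f x)" and ?n = "\<lambda>x. max 0 (- f x)"
  have "f \<in> D" using f by simp
  note pn = dirichlet_form_pos_neg[OF df this B]
  have abs_eq: "(\<lambda>x. \<bar>f x\<bar>) = ?p + ?n" and eq: "f = ?p - ?n" by (auto simp: fun_eq_iff)
  have "(\<lambda>x. \<bar>f x\<bar>) \<in> D" unfolding abs_eq using pn by simp
  moreover have "(\<lambda>x. \<bar>f x\<bar>) \<in> Cc" using f by (intro Cc_comp[of f abs]) (auto intro: continuous_intros)
  ultimately show "(\<lambda>x. \<bar>f x\<bar>) \<in> D \<inter> Cc" by simp
  have "\<E> (\<lambda>x. \<bar>f x\<bar>) (\<lambda>x. \<bar>f x\<bar>) = \<E> ?p ?p + 2 * \<E> ?p ?n + \<E> ?n ?n"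
    unfolding abs_eq using pn by (intro E.expand_add)
  moreover have "\<E> f f = \<E> ?p ?p - 2 * \<E> ?p ?n + \<E> ?n ?n"
    by (subst (1 2) eq) (use pn in \<open>intro E.expand_diff\<close>)
  ultimately have "\<E> (\<lambda>x. \<bar>f x\<bar>) (\<lambda>x. \<bar>f x\<bar>) \<le> \<E> f f" using pn(3) by linarith
  then show "schroedinger_form \<E> \<mu>p \<mu>n (\<lambda>x. \<bar>f x\<bar>) (\<lambda>x. \<bar>f x\<bar>) \<le> schroedinger_form \<E> \<mu>p \<mu>n f f"
    by (simp add: schroedinger_form_def abs_mult[symmetric])
qed

text \<open>\<open>D\<close> is dense in \<open>L\<^sup>2\<close>, and \<open>D \<inter> Cc\<close>
  is dense in \<open>D\<close> for a norm that dominates the \<open>L\<^sup>2\<close> norm; an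
  approximant orthogonal to \<open>f\<close> is no closer to \<open>f\<close> than \<open>0\<close>
  is.\<close>

lemma regular_form_orthogonal_trivial:
  fixes m :: "'a::{metric_space, second_countable_topology} measure"
  assumes df: "dirichlet_form m D \<E>" and reg: "regular_form m D \<E>"
    and f: "f \<in> L2_space m" and orth: "\<And>v. v \<in> D \<inter> Cc \<Longrightarrow> L2_inner m f v = 0"
  shows "L2_inner m f f = 0"
proof -
  have sf: "symmetric_form m D \<E>" using df by (simp add: dirichlet_form_def)
  interpret E: semi_inner_space D \<E> using symmetric_formD[OF sf] by blast
  have DH: "D \<subseteq> L2_space m" using symmetric_formD[OF sf] by blast
  have le_e: "L2_inner m f f \<le> e" if e: "e > 0" for e
  proof -
    have e4: "e / 4 > 0" using e by simp
    have "\<forall>f\<in>L2_space m. \<forall>e>0. \<exists>g\<in>D. L2_inner m (f - g) (f - g) < e"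
      using sf by (simp add: symmetric_form_def fun_diff_def)
    then obtain g where g: "g \<in> D" "L2_inner m (f - g) (f - g) < e / 4" using f e4 by blast
    have "\<forall>f\<in>D. \<forall>e>0. \<exists>g\<in>D \<inter> Cc. form_plus_inner m \<E> (f - g) (f - g) < e"
      using reg by (simp add: regular_form_def form_dense_def fun_diff_def)
    then obtain h where h: "h \<in> D \<inter> Cc" "form_plus_inner m \<E> (g - h) (g - h) < e / 4" using g(1) e4 by blast
    have gH: "g \<in> L2_space m" "h \<in> L2_space m" "g - h \<in> D" using g h DH by auto
    have "L2_inner m (g - h) (g - h) < e / 4"
      using h(2) E.nonneg[OF gH(3)] by (simp add: form_plus_inner_def)
    moreover have "L2_inner m (f - h) (f - h) \<le> 2 * L2_inner m (f - g) (f - g) + 2 * L2_inner m (g - h) (g - h)"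
      using L2.parallelogram_le(1)[of "f - g" m "g - h"] f gH by simp
    moreover have "L2_inner m f f \<le> L2_inner m (f - h) (f - h)"
      using orth[OF h(1)] f gH L2.nonneg[OF gH(2)] by (simp add: L2.expand_diff)
    ultimately show ?thesis using g(2) by linarith
  qed
  have "L2_inner m f f \<le> 0"
  proof (rule field_le_epsilon)
    fix e :: real assume "e > 0"
    from le_e[OF this] show "L2_inner m f f \<le> 0 + e" by simp
  qed
  then show ?thesis using L2.nonneg[OF f] by simp
qed

section \<open>Positivity and subordination\<close>

definition abs_contractive :: "('a \<Rightarrow> real) set \<Rightarrow> 'a form \<Rightarrow> bool" where
  "abs_contractive C B \<longleftrightarrow>
     (\<forall>f\<in>C. (\<lambda>x. \<bar>f x\<bar>) \<in> C \<and> B (\<lambda>x. \<bar>f x\<bar>) (\<lambda>x. \<bar>f x\<bar>) \<le> B f f)"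

lemma L2_abs: "f \<in> L2_space m \<Longrightarrow> (\<lambda>x. \<bar>f x\<bar>) \<in> L2_space m"
  by (auto simp: L2_space_def)

lemma L2_max_0: "f \<in> L2_space m \<Longrightarrow> (\<lambda>x. max 0 (f x)) \<in> L2_space m"
proof -
  assume f: "f \<in> L2_space m"
  have "(\<lambda>x. max 0 (f x)) = (1 / 2) *\<^sub>R (f + (\<lambda>x. \<bar>f x\<bar>))" by (auto simp: fun_eq_iff)
  then show ?thesis using L2.V_mem(4)[OF L2.V_mem(2)[OF f L2_abs[OF f]], of "1 / 2"] by (simp only:)
qed

lemma L2_inner_nonneg_AE:
  assumes "AE x in m. 0 \<le> f x" "AE x in m. 0 \<le> g x"
  shows "0 \<le> L2_inner m f g"
proof -
  have "AE x in m. 0 \<le> f x * g x" using assms by eventually_elim simp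
  then show ?thesis unfolding L2_inner_def by (rule integral_nonneg_AE)
qed

lemma inverse_one_plus_le: "x \<ge> 0 \<Longrightarrow> 1 / (1 + x) \<le> (1 :: real)"
  by (simp add: divide_le_eq_1)

section \<open>Positivity of the resolvent and of the semigroup\<close>

context pvm
begin

text \<open>With \<open>h l = l\<close> and \<open>k l = 1 / (1 + \<epsilon> * l)\<close> this
  places resolvent vectors in the domain. Truncations of \<open>h\<close> meet \<open>k\<close> only
  through the bounded product, so \<open>bint_P\<close> and \<open>T_mult\<close> verify the
  criterion \<open>spectral_integral_iff\<close>.\<close>

lemma spectral_integral_T_mem:
  assumes h: "h \<in> borel_measurable half_line" and k: "bounded_borel k" "bounded_borel (\<lambda>l. k l * h l)" and f: "f \<in> H"
  shows "(T k f, T (\<lambda>l. k l * h l) f) \<in> spectral_integral m P h"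
  unfolding spectral_integral_iff[OF h]
proof (intro conjI allI ballI)
  show "T k f \<in> H" "T (\<lambda>l. k l * h l) f \<in> H" using k f by auto
  fix n w assume w: "w \<in> H"
  have c: "cut h n \<in> sets half_line" using h by simp
  have "ip (P (cut h n) (T (\<lambda>l. k l * h l) f)) w = bint (\<lambda>l. k l * h l) f (P (cut h n) w)"
    using P_sym[OF c _ w] T_ip[OF k(2) f] k f w c by simp
  also have "\<dots> = bint (\<lambda>l. k l * h l * indicator (cut h n) l) f w" using k(2) c f w by (rule bint_P)
  also have "\<dots> = bint (\<lambda>l. trunc h n l * k l) f w" by (rule bint_cong) (simp add: trunc_def)
  also have "\<dots> = ip (T (\<lambda>l. trunc h n l * k l) f) w"
    using bounded_borel_mult[OF trunc_bounded[OF h] k(1)] f w by (simp add: T_ip)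
  also have "\<dots> = ip (T (trunc h n) (T k f)) w" using T_mult[OF k(1) trunc_bounded[OF h] f w] by simp
  finally show "ip (P (cut h n) (T (\<lambda>l. k l * h l) f)) w = ip (T (trunc h n) (T k f)) w" .
qed

lemma graph_form_sqrt_bint:
  assumes u: "u \<in> Domain A2" and w: "w \<in> Domain A2"
  shows "graph_form m A2 u w = bint (\<lambda>l. l) u w"
proof -
  interpret q: semi_inner_space "Domain A2" "graph_form m A2" by (rule semi_inner_graph_form[OF A2_self_adjoint])
  have "graph_form m A2 (u + w) (u + w) = (\<integral>l. l \<partial>\<mu> (u + w))" "graph_form m A2 (u - w) (u - w) = (\<integral>l. l \<partial>\<mu> (u - w))"
    using u w by (auto intro!: sqrt_norm)
  then show ?thesis using q.polarization[OF u w] by (simp add: bint_def)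
qed

lemma graph_form_sqrt_A1:
  assumes uv: "(u, v) \<in> A1" and w: "w \<in> Domain A2"
  shows "graph_form m A2 u w = ip v w"
proof -
  have u: "u \<in> Domain A2" using uv Domain_A1_A2 by blast
  have wH: "w \<in> H" using op_app_L2[OF A2_self_adjoint w] by simp
  have uH: "u \<in> H" using op_app_L2[OF A2_self_adjoint u] by simp
  have "(\<lambda>n. bint (trunc (\<lambda>l. l) n) u w) \<longlonglongrightarrow> bint (\<lambda>l. l) u w"
  proof (rule bint_tendsto[where k = "\<lambda>l. l"])
    show "u \<in> ispace (\<lambda>l. l)" "w \<in> ispace (\<lambda>l. l)" using u w by (simp_all add: Domain_sqrt)
    show "\<bar>trunc (\<lambda>l. l) n l\<bar> \<le> l" if "l \<ge> 0" for n l using abs_trunc_le[of "\<lambda>l. l" n l] that by simp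
  qed (auto intro: trunc_tendsto)
  moreover have "bint (trunc (\<lambda>l. l) n) u w = ip (T (trunc (\<lambda>l. l) n) u) w" for n
    using uH wH by (simp add: T_ip)
  ultimately have "bint (\<lambda>l. l) u w = ip v w"
    using spectral_integral_T_tendsto[OF id_half_line uv wH] by (simp add: LIMSEQ_unique)
  then show ?thesis using graph_form_sqrt_bint[OF u w] by simp
qed

lemma bint_cmult: "bint (\<lambda>l. c * h l) f g = c * bint h f g"
  by (simp add: bint_def right_diff_distrib)

text \<open>The resolvent \<open>u = (1 + \<epsilon> A)\<^sup>-\<^sup>1 f\<close> is the unique minimizer of
  \<open>y \<mapsto> E(y, y) + (\<langle>y, y\<rangle> - 2 \<langle>f, y\<rangle>) / \<epsilon>\<close>.  If \<open>f \<ge> 0\<close>, replacing the members of a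
  minimizing sequence from the core by their absolute values keeps it minimizing.\<close>

lemma resolvent_nonneg:
  assumes core: "form_core m (Domain A2) (graph_form m A2) C"
    and abs: "abs_contractive C (graph_form m A2)"
    and eps: "\<epsilon> > 0" and f: "f \<in> H" and f0: "AE x in m. 0 \<le> f x"
  shows "AE x in m. 0 \<le> T (\<lambda>l. 1 / (1 + \<epsilon> * l)) f x"
proof -
  let ?q = "graph_form m A2" and ?k = "\<lambda>l. 1 / (1 + \<epsilon> * l)"
  interpret q: semi_inner_space "Domain A2" ?q by (rule semi_inner_graph_form[OF A2_self_adjoint])
  have kb: "?k \<in> borel_measurable borel" by measurable
  have k: "bounded_borel ?k"
    by (rule bounded_borelI[where K = 1]) (use eps kb in \<open>auto intro!: measurable_restrict_space1 simp: inverse_one_plus_le\<close>)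
  have kl: "bounded_borel (\<lambda>l. ?k l * l)"
  proof (rule bounded_borelI[where K = "1 / \<epsilon>"])
    show "(\<lambda>l. ?k l * l) \<in> borel_measurable half_line"
      by (intro measurable_restrict_space1) measurable
    fix l :: real assume "l \<ge> 0"
    then have "\<epsilon> * l \<ge> 0" using eps by simp
    then have pos: "1 + \<epsilon> * l > 0" by simp
    have "\<epsilon> * l / (1 + \<epsilon> * l) \<le> 1" using pos by (simp add: divide_le_eq_1)
    then have "(\<epsilon> * l / (1 + \<epsilon> * l)) / \<epsilon> \<le> 1 / \<epsilon>" using eps by (intro divide_right_mono) auto
    then show "\<bar>?k l * l\<bar> \<le> 1 / \<epsilon>" using pos eps \<open>l \<ge> 0\<close> by (simp add: abs_mult)
  qed
  define u where "u = T ?k f"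
  define v where "v = T (\<lambda>l. ?k l * l) f"
  have uv: "(u, v) \<in> A1" unfolding u_def v_def using k kl f by (intro spectral_integral_T_mem) auto
  have u: "u \<in> Domain A2" using uv Domain_A1_A2 by blast
  have uH: "u \<in> H" and vH: "v \<in> H" using k kl f by (auto simp: u_def v_def)
  have v_eq: "\<epsilon> * ip v y = ip f y - ip u y" if y: "y \<in> H" for y
  proof -
    have "ip f y - ip u y = bint (\<lambda>l. 1) f y - bint ?k f y" using f y k by (simp add: bint_one u_def T_ip)
    also have "\<dots> = bint (\<lambda>l. 1 - ?k l) f y"
      using f y k by (simp add: bint_def diff_divide_distrib)
    also have "\<dots> = bint (\<lambda>l. \<epsilon> * (?k l * l)) f y"
    proof (rule bint_cong)
      fix l :: real assume "l \<ge> 0"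
      then have "1 + \<epsilon> * l > 0" using eps by (simp add: add_pos_nonneg)
      then show "1 - ?k l = \<epsilon> * (?k l * l)" by (simp add: field_simps)
    qed
    also have "\<dots> = \<epsilon> * bint (\<lambda>l. ?k l * l) f y" by (rule bint_cmult)
    also have "bint (\<lambda>l. ?k l * l) f y = ip v y" using f y kl by (simp add: v_def T_ip)
    finally show ?thesis by simp
  qed
  define J where "J y = \<epsilon> * ?q y y + ip y y - 2 * ip f y" for y
  \<comment> \<open>Completing the square: the linear terms cancel because
    \<open>u + \<epsilon> A u = f\<close>, so the excess of \<open>J\<close> over its minimum
    dominates \<open>\<parallel>y - u\<parallel>\<^sup>2\<close>.\<close>
  have J: "J y = J u + \<epsilon> * ?q (y - u) (y - u) + ip (y - u) (y - u)" if y: "y \<in> Domain A2" for y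
  proof -
    have yH: "y \<in> H" using op_app_L2[OF A2_self_adjoint y] by simp
    have 1: "\<epsilon> * ?q u y = ip f y - ip u y" "\<epsilon> * ?q u u = ip f u - ip u u"
      using graph_form_sqrt_A1[OF uv] v_eq y u yH uH by auto
    have "\<epsilon> * ?q (y - u) (y - u) = \<epsilon> * ?q y y - 2 * (\<epsilon> * ?q u y) + \<epsilon> * ?q u u"
      using q.expand_diff[OF y u] q.sym[OF y u] by (simp only: right_diff_distrib distrib_left mult.left_commute)
    moreover have "ip (y - u) (y - u) = ip y y - 2 * ip u y + ip u u"
      using L2.expand_diff[OF yH uH] L2.sym[OF yH uH] by simp
    ultimately show ?thesis using 1 by (simp add: J_def)
  qed
  obtain w where w: "\<And>n. w n \<in> C" "form_tendsto ip w u" "form_tendsto ?q w u"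
    using core u unfolding form_core_def by blast
  have CD: "C \<subseteq> Domain A2" using core unfolding form_core_def by blast
  have wD: "w n \<in> Domain A2" for n using w(1) CD by blast
  have wH: "w n \<in> H" for n using op_app_L2[OF A2_self_adjoint wD] by simp
  define a where "a n = (\<lambda>x. \<bar>w n x\<bar>)" for n
  have aC: "a n \<in> C" for n using abs w(1) by (simp add: a_def abs_contractive_def)
  have aD: "a n \<in> Domain A2" for n using aC CD by blast
  have aH: "a n \<in> H" for n using op_app_L2[OF A2_self_adjoint aD] by simp
  have "J (a n) \<le> J (w n)" for n
  proof -
    have "ip (a n) (a n) = ip (w n) (w n)" by (simp add: L2_inner_def a_def)
    moreover have "ip f (w n) \<le> ip f (a n)"
      unfolding L2_inner_def
    proof (rule integral_mono_AE)
      show "integrable m (\<lambda>x. f x * w n x)" "integrable m (\<lambda>x. f x * a n x)"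
        by (rule L2_space_integrable_mult[OF f wH], rule L2_space_integrable_mult[OF f aH])
      show "AE x in m. f x * w n x \<le> f x * a n x"
        using f0 by eventually_elim (auto simp: a_def intro: mult_left_mono)
    qed
    moreover have "\<epsilon> * ?q (a n) (a n) \<le> \<epsilon> * ?q (w n) (w n)"
      using abs w(1)[of n] eps by (simp add: a_def abs_contractive_def)
    ultimately show ?thesis by (simp add: J_def)
  qed
  then have le: "ip (a n - u) (a n - u) \<le> \<epsilon> * ?q (w n - u) (w n - u) + ip (w n - u) (w n - u)" for n
  proof -
    have "0 \<le> \<epsilon> * ?q (a n - u) (a n - u)" using q.nonneg[of "a n - u"] aD u eps by simp
    then show ?thesis using \<open>J (a n) \<le> J (w n)\<close> J[OF aD, of n] J[OF wD, of n] by linarith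
  qed
  have "(\<lambda>n. \<epsilon> * ?q (w n - u) (w n - u) + ip (w n - u) (w n - u)) \<longlonglongrightarrow> \<epsilon> * 0 + 0"
    using w(2,3) unfolding form_tendsto_def by (intro tendsto_intros)
  then have lim: "(\<lambda>n. \<epsilon> * ?q (w n - u) (w n - u) + ip (w n - u) (w n - u)) \<longlonglongrightarrow> 0" by simp
  have "0 \<le> ip (a n - u) (a n - u)" for n using aH uH by (intro L2.nonneg) auto
  then have "form_tendsto ip a u"
    unfolding form_tendsto_def
    by (intro tendsto_sandwich[OF _ _ tendsto_const lim] always_eventually allI le)
  then obtain r where "AE x in m. (\<lambda>n. a (r n) x) \<longlonglongrightarrow> u x"
    using L2_tendsto_AE_subseq[of a m u] aH uH by blast
  then have "AE x in m. 0 \<le> u x"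
  proof eventually_elim
    case (elim x)
    then show ?case by (rule LIMSEQ_le_const) (auto simp: a_def)
  qed
  then show ?thesis by (simp add: u_def)
qed

text \<open>\<open>exp (- s * l)\<close> is the bounded pointwise limit of
  \<open>1 / (1 + s * l / n) ^ n\<close>, so the semigroup inherits positivity from powers of the
  resolvent.\<close>

lemma exp_bint_nonneg:
  assumes core: "form_core m (Domain A2) (graph_form m A2) C"
    and abs: "abs_contractive C (graph_form m A2)"
    and s: "s > 0" and f: "f \<in> H" "AE x in m. 0 \<le> f x" and g: "g \<in> H" "AE x in m. 0 \<le> g x"
  shows "0 \<le> bint (\<lambda>l. exp (- s * l)) f g"
proof -
  have kb: "bounded_borel (\<lambda>l. (1 / (1 + \<epsilon> * l)) ^ n)" if "\<epsilon> > 0" for \<epsilon> :: real and n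
    by (rule bounded_borelI[where K = 1])
       (use that in \<open>auto intro!: measurable_restrict_space1 power_le_one simp: power_abs inverse_one_plus_le\<close>)
  have pos: "AE x in m. 0 \<le> T (\<lambda>l. (1 / (1 + \<epsilon> * l)) ^ n) f x" if e: "\<epsilon> > 0" for \<epsilon> n
  proof (induction n)
    case 0
    have "ip (T (\<lambda>l. 1) f) w = ip f w" if "w \<in> H" for w using f that by (simp add: T_ip bint_one)
    then have "AE x in m. T (\<lambda>l. 1) f x = f x" using L2_eq_AE_iff[of "T (\<lambda>l. 1) f" m f] f by blast
    with f(2) show ?case by eventually_elim simp
  next
    case (Suc n)
    let ?k = "\<lambda>l. 1 / (1 + \<epsilon> * l)"
    have k1: "bounded_borel ?k" using kb[OF e, of 1] by simp
    have m: "T (\<lambda>l. ?k l ^ n) f \<in> H" "T ?k (T (\<lambda>l. ?k l ^ n) f) \<in> H" "T (\<lambda>l. ?k l ^ Suc n) f \<in> H"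
      by (intro T_mem kb[OF e] k1 f)+
    have "ip (T ?k (T (\<lambda>l. ?k l ^ n) f)) w = ip (T (\<lambda>l. ?k l ^ Suc n) f) w" if "w \<in> H" for w
      using T_mult[OF kb[OF e, of n] k1 f(1) that] by simp
    then have "AE x in m. T ?k (T (\<lambda>l. ?k l ^ n) f) x = T (\<lambda>l. ?k l ^ Suc n) f x"
      using L2_eq_AE_iff[OF m(2,3)] by blast
    moreover have "AE x in m. 0 \<le> T ?k (T (\<lambda>l. ?k l ^ n) f) x"
      by (rule resolvent_nonneg[OF core abs e m(1) Suc])
    ultimately show ?case by eventually_elim simp
  qed
  let ?h = "\<lambda>n l. (1 / (1 + s / real (Suc n) * l)) ^ Suc n"
  have "(\<lambda>n. bint (?h n) f g) \<longlonglongrightarrow> bint (\<lambda>l. exp (- s * l)) f g"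
  proof (rule bint_tendsto[where k = "\<lambda>l. 1"])
    show "?h n \<in> borel_measurable half_line" for n
      using kb[of "s / real (Suc n)" "Suc n"] s by (intro bounded_borel_measurable) simp
    show "(\<lambda>l. exp (- s * l)) \<in> borel_measurable half_line" by (intro measurable_restrict_space1) measurable
    show "\<bar>?h n l\<bar> \<le> 1" if "l \<ge> 0" for n l
      using s that by (auto intro!: power_le_one simp: power_abs inverse_one_plus_le simp del: power_Suc)
    fix l :: real assume "l \<ge> 0"
    have "(\<lambda>n. inverse ((1 + (s * l) / real (Suc n)) ^ Suc n)) \<longlonglongrightarrow> inverse (exp (s * l))"
      by (intro tendsto_inverse LIMSEQ_Suc[OF tendsto_exp_limit_sequentially]) simp
    moreover have "inverse ((1 + (s * l) / real (Suc n)) ^ Suc n) = ?h n l" for n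
      by (simp only: power_one_over inverse_eq_divide times_divide_eq_left)
    ultimately show "(\<lambda>n. ?h n l) \<longlonglongrightarrow> exp (- s * l)" by (simp only: exp_minus mult_minus_left)
  qed (use f g in auto)
  moreover have "0 \<le> bint (?h n) f g" for n
  proof -
    have "0 \<le> ip (T (?h n) f) g" using pos[of "s / real (Suc n)" "Suc n"] s g(2) by (intro L2_inner_nonneg_AE) auto
    then show ?thesis using T_ip[OF kb[of "s / real (Suc n)" "Suc n"] f(1) g(1)] s by simp
  qed
  ultimately show ?thesis by (intro LIMSEQ_le_const) auto
qed

text \<open>Right minus left side is four times \<open>bint\<close> of the positive and the negative
  part of \<open>u\<close>, which \<open>exp_bint_nonneg\<close> makes nonnegative.\<close>

lemma exp_integral_abs:
  assumes core: "form_core m (Domain A2) (graph_form m A2) C"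
    and abs: "abs_contractive C (graph_form m A2)"
    and s: "s > 0" and u: "u \<in> H"
  shows "(\<integral>l. exp (- s * l) \<partial>\<mu> u) \<le> (\<integral>l. exp (- s * l) \<partial>\<mu> (\<lambda>x. \<bar>u x\<bar>))"
proof -
  let ?e = "\<lambda>l. exp (- s * l)" and ?p = "\<lambda>x. max 0 (u x)" and ?n = "\<lambda>x. max 0 ((- u) x)"
  have e: "bounded_borel ?e"
    by (rule bounded_borelI[where K = 1]) (use s in \<open>auto intro!: measurable_restrict_space1\<close>)
  interpret e: semi_inner_space H "bint ?e"
    using semi_inner_bint[OF bounded_borel_measurable[OF e]] e by simp
  have p: "?p \<in> H" using L2_max_0[OF u] .
  have n: "?n \<in> H" using L2_max_0[OF L2.V_mem(5)[OF u]] .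
  have a: "(\<lambda>x. \<bar>u x\<bar>) \<in> H" using L2_abs[OF u] .
  have abs_eq: "(\<lambda>x. \<bar>u x\<bar>) = ?p + ?n" and eq: "u = ?p - ?n" by (auto simp: fun_eq_iff)
  have "0 \<le> bint ?e ?p ?n" using exp_bint_nonneg[OF core abs s p _ n] by simp
  moreover have "bint ?e (?p + ?n) (?p + ?n) = bint ?e ?p ?p + 2 * bint ?e ?p ?n + bint ?e ?n ?n"
    using p n by (rule e.expand_add)
  moreover have "bint ?e (?p - ?n) (?p - ?n) = bint ?e ?p ?p - 2 * bint ?e ?p ?n + bint ?e ?n ?n"
    using p n by (rule e.expand_diff)
  ultimately have "bint ?e (?p - ?n) (?p - ?n) \<le> bint ?e (?p + ?n) (?p + ?n)" by linarith
  then have "bint ?e u u \<le> bint ?e (\<lambda>x. \<bar>u x\<bar>) (\<lambda>x. \<bar>u x\<bar>)"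
    unfolding abs_eq[symmetric] eq[symmetric] .
  then show ?thesis
    using bint_self[of u ?e] bint_self[of "\<lambda>x. \<bar>u x\<bar>" ?e] u a e by (simp add: bounded_borel_measurable)
qed

end

text \<open>Provides what Fubini's theorem will ask for: the integrand is bounded by
  \<open>max 1 l * min 1 s\<close>, and the compact intervals \<open>[1 / (n + 1), n + 1]\<close>
  have finite measure, so \<open>\<nu>\<close> is \<sigma>-finite.\<close>

lemma bernstein_representation:
  assumes "bernstein_function \<Phi>"
  obtains b \<nu> where "0 \<le> b" "sigma_finite_measure \<nu>" "sets \<nu> = sets (restrict_space borel {0<..})"
    "\<And>l. l \<ge> 0 \<Longrightarrow> integrable \<nu> (\<lambda>s. 1 - exp (- l * s))"
    "\<And>l. l \<ge> 0 \<Longrightarrow> \<Phi> l = b * l + (\<integral>s. 1 - exp (- l * s) \<partial>\<nu>)"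
proof -
  obtain b \<nu> where b: "0 \<le> b" and rad: "radon_on {0<..} \<nu>" and fin: "(\<integral>\<^sup>+ s. ennreal (min 1 s) \<partial>\<nu>) < \<infinity>"
    and \<Phi>: "\<And>l. l \<ge> 0 \<Longrightarrow> \<Phi> l = b * l + (\<integral>s. 1 - exp (- l * s) \<partial>\<nu>)"
    using assms unfolding bernstein_function_def by blast
  have sets: "sets \<nu> = sets (restrict_space borel {0<..})" using rad by (simp add: radon_on_def)
  have sp: "space \<nu> = {0<..}" using sets_eq_imp_space_eq[OF sets] by (simp add: space_restrict_space)
  have meas: "f \<in> borel_measurable \<nu>" if "f \<in> borel_measurable borel" for f :: "real \<Rightarrow> real"
    using measurable_restrict_space1[OF that] measurable_cong_sets[OF sets refl] by blast
  have "sigma_finite_measure \<nu>"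
  proof
    let ?A = "range (\<lambda>n::nat. {1 / real (Suc n)..real (Suc n)})"
    show "\<exists>A. countable A \<and> A \<subseteq> sets \<nu> \<and> \<Union> A = space \<nu> \<and> (\<forall>a\<in>A. emeasure \<nu> a \<noteq> \<infinity>)"
    proof (intro exI[of _ ?A] conjI)
      have pos: "{1 / real (Suc n)..real (Suc n)} \<subseteq> {0<..}" for n
        by (auto intro: less_le_trans[of 0 "1 / real (Suc n)"])
      show "?A \<subseteq> sets \<nu>" using pos unfolding sets by (auto simp: sets_restrict_space_iff)
      show "\<Union> ?A = space \<nu>"
      proof
        show "\<Union> ?A \<subseteq> space \<nu>" using pos sp by blast
        show "space \<nu> \<subseteq> \<Union> ?A"
        proof
          fix x assume "x \<in> space \<nu>"
          then have x: "x > 0" using sp by simp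
          obtain n :: nat where n: "max x (1 / x) < real n" using reals_Archimedean2 by blast
          then have "1 / x < real (Suc n)" "x \<le> real (Suc n)" by linarith+
          then have "1 / real (Suc n) \<le> x" using x by (simp add: field_simps)
          with \<open>x \<le> real (Suc n)\<close> have "x \<in> {1 / real (Suc n)..real (Suc n)}" by simp
          then show "x \<in> \<Union> ?A" by blast
        qed
      qed
      show "\<forall>a\<in>?A. emeasure \<nu> a \<noteq> \<infinity>"
      proof clarify
        fix n assume inf: "emeasure \<nu> {1 / real (Suc n)..real (Suc n)} = \<infinity>"
        have "emeasure \<nu> {1 / real (Suc n)..real (Suc n)} < \<infinity>"
          using rad pos[of n] by (simp add: radon_on_def)
        then show False using inf by simp
      qed
    qed simp
  qed
  moreover have "integrable \<nu> (\<lambda>s. 1 - exp (- l * s))" if l: "l \<ge> 0" for l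
  proof (rule Bochner_Integration.integrable_bound)
    have "integrable \<nu> (\<lambda>s. min 1 s)"
    proof (rule integrableI_nonneg)
      show "(\<lambda>s. min 1 s) \<in> borel_measurable \<nu>" by (rule meas) measurable
      show "AE s in \<nu>. 0 \<le> min 1 s" using sp by (intro AE_I2) simp
    qed (use fin in simp)
    then show "integrable \<nu> (\<lambda>s. max 1 l * min 1 s)" by simp
    show "(\<lambda>s. 1 - exp (- l * s)) \<in> borel_measurable \<nu>" by (rule meas) measurable
    show "AE s in \<nu>. norm (1 - exp (- l * s)) \<le> norm (max 1 l * min 1 s)"
    proof (rule AE_I2)
      fix s assume "s \<in> space \<nu>"
      then have s: "s > 0" using sp by simp
      have "0 \<le> 1 - exp (- l * s)" "1 - exp (- l * s) \<le> 1" using l s by auto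
      moreover have "1 - exp (- l * s) \<le> l * s" using exp_ge_add_one_self[of "- l * s"] by simp
      moreover have "l * s \<le> max 1 l * s" using s by (intro mult_right_mono) auto
      moreover have "1 \<le> max 1 l" by simp
      ultimately have "1 - exp (- l * s) \<le> max 1 l * min 1 s"
        unfolding min_def mult_1_right if_distrib[of "(*) (max 1 l)"] by (cases "1 \<le> s") (simp only: if_True if_False; linarith)+
      with \<open>0 \<le> 1 - exp (- l * s)\<close> show "norm (1 - exp (- l * s)) \<le> norm (max 1 l * min 1 s)"
        by (simp only: real_norm_def)
    qed
  qed
  ultimately show ?thesis using b sets \<Phi> by (intro that[of b \<nu>])
qed

section \<open>Bernstein functions of the operator\<close>

context pvm
begin

lemma bernstein_half_line:
  assumes "bernstein_function \<Phi>"
  shows "\<Phi> \<in> half_line \<rightarrow>\<^sub>M half_line" "l \<ge> 0 \<Longrightarrow> \<Phi> l \<ge> 0"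
proof -
  obtain b \<nu> where b: "0 \<le> b" "sigma_finite_measure \<nu>" "sets \<nu> = sets (restrict_space borel {0<..})"
    "\<And>l. l \<ge> 0 \<Longrightarrow> \<Phi> l = b * l + (\<integral>s. 1 - exp (- l * s) \<partial>\<nu>)"
    using bernstein_representation[OF assms] by metis
  interpret \<nu>: sigma_finite_measure \<nu> by (rule b(2))
  have sp: "space \<nu> = {0<..}" using sets_eq_imp_space_eq[OF b(3)] by (simp add: space_restrict_space)
  show nn: "\<Phi> l \<ge> 0" if "l \<ge> 0" for l
    unfolding b(4)[OF that] using b(1) that sp by (intro add_nonneg_nonneg integral_nonneg_AE AE_I2) auto
  have "(\<lambda>l. b * l + (\<integral>s. 1 - exp (- l * s) \<partial>\<nu>)) \<in> borel_measurable half_line"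
  proof (intro borel_measurable_add borel_measurable_times borel_measurable_const id_half_line \<nu>.borel_measurable_lebesgue_integral)
    have [measurable]: "(\<lambda>x. x) \<in> borel_measurable \<nu>"
      using measurable_restrict_space1[of "\<lambda>x. x" borel borel "{0<..}"] measurable_cong_sets[OF b(3) refl] by auto
    have [measurable]: "(\<lambda>x. x) \<in> borel_measurable half_line" by simp
    show "(\<lambda>(l, s). 1 - exp (- l * s)) \<in> borel_measurable (half_line \<Otimes>\<^sub>M \<nu>)"
      by measurable
  qed
  then have "\<Phi> \<in> borel_measurable half_line"
    using b(4) by (subst measurable_cong) (auto simp: space_half_line)
  then show "\<Phi> \<in> half_line \<rightarrow>\<^sub>M half_line"
    using nn by (intro measurable_restrict_space2) (auto simp: space_half_line)
qed

lemma one_minus_exp: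
  assumes "s \<ge> 0" "u \<in> H"
  shows "(\<integral>\<^sup>+l. ennreal (1 - exp (- s * l)) \<partial>\<mu> u) = ennreal (ip u u - (\<integral>l. exp (- s * l) \<partial>\<mu> u))"
proof -
  have e: "bounded_borel (\<lambda>l. exp (- s * l))"
    by (rule bounded_borelI[where K = 1]) (use assms in \<open>auto intro!: measurable_restrict_space1\<close>)
  have i: "integrable (\<mu> u) (\<lambda>l. exp (- s * l))" "integrable (\<mu> u) (\<lambda>l. 1 :: real)"
    using assms(2) e by auto
  have "(\<integral>\<^sup>+l. ennreal (1 - exp (- s * l)) \<partial>\<mu> u) = ennreal (\<integral>l. 1 - exp (- s * l) \<partial>\<mu> u)"
    using i assms by (intro nn_integral_eq_integral) (auto intro!: AE_I2)
  also have "(\<integral>l. 1 - exp (- s * l) \<partial>\<mu> u) = ip u u - (\<integral>l. exp (- s * l) \<partial>\<mu> u)"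
    using i assms by (simp add: measure_\<mu> P_total)
  finally show ?thesis .
qed

text \<open>The form of \<open>\<Phi>(A)\<close> is \<open>b \<E>(u, u) + \<integral> \<langle>u - T\<^sub>s u, u\<rangle> \<nu>(ds)\<close>, so it inherits the
  contraction \<open>u \<mapsto> |u|\<close> from the positivity of the semigroup.\<close>

lemma bernstein_integral_abs:
  assumes bf: "bernstein_function \<Phi>"
    and core: "form_core m (Domain A2) (graph_form m A2) C"
    and abs: "abs_contractive C (graph_form m A2)"
    and u: "u \<in> H"
  shows "(\<integral>\<^sup>+l. ennreal (\<Phi> l) \<partial>\<mu> (\<lambda>x. \<bar>u x\<bar>)) \<le> (\<integral>\<^sup>+l. ennreal (\<Phi> l) \<partial>\<mu> u)"
proof -
  let ?a = "\<lambda>x. \<bar>u x\<bar>"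
  have a: "?a \<in> H" using L2_abs[OF u] .
  obtain b \<nu> where b: "0 \<le> b" "sigma_finite_measure \<nu>" "sets \<nu> = sets (restrict_space borel {0<..})"
    and int: "\<And>l. l \<ge> 0 \<Longrightarrow> integrable \<nu> (\<lambda>s. 1 - exp (- l * s))"
    and \<Phi>: "\<And>l. l \<ge> 0 \<Longrightarrow> \<Phi> l = b * l + (\<integral>s. 1 - exp (- l * s) \<partial>\<nu>)"
    using bernstein_representation[OF bf] by metis
  have sp: "space \<nu> = {0<..}" using sets_eq_imp_space_eq[OF b(3)] by (simp add: space_restrict_space)
  have eq: "ip ?a ?a = ip u u" by (simp add: L2_inner_def)
  have exp_le: "(\<integral>\<^sup>+l. ennreal (1 - exp (- s * l)) \<partial>\<mu> ?a) \<le> (\<integral>\<^sup>+l. ennreal (1 - exp (- s * l)) \<partial>\<mu> u)" if "s > 0" for s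
    unfolding one_minus_exp[OF less_imp_le[OF that] a] one_minus_exp[OF less_imp_le[OF that] u] eq
    using exp_integral_abs[OF core abs that u] by (intro ennreal_leI diff_left_mono)
  \<comment> \<open>\<open>l\<close> is the limit of \<open>n * (1 - exp (- l / n))\<close> from
    below: Fatou's lemma on the left, the bound by \<open>l\<close> on the right.\<close>
  have id_le: "(\<integral>\<^sup>+l. ennreal l \<partial>\<mu> ?a) \<le> (\<integral>\<^sup>+l. ennreal l \<partial>\<mu> u)"
  proof -
    let ?g = "\<lambda>n l. real (Suc n) * (1 - exp (- (1 / real (Suc n)) * l))"
    have gm: "(\<lambda>l. ennreal (1 - exp (- c * l))) \<in> borel_measurable half_line" for c
      by (intro measurable_restrict_space1) measurable
    have "(\<integral>\<^sup>+l. ennreal l \<partial>\<mu> ?a) = (\<integral>\<^sup>+l. liminf (\<lambda>n. ennreal (?g n l)) \<partial>\<mu> ?a)"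
    proof (rule nn_integral_cong)
      fix l assume "l \<in> space (\<mu> ?a)"
      have "(\<lambda>n. real (Suc n) * (1 - exp (- (1 / real (Suc n)) * l))) \<longlonglongrightarrow> l" by real_asymp
      then have "(\<lambda>n. ennreal (?g n l)) \<longlonglongrightarrow> ennreal l" by (rule tendsto_ennrealI)
      then show "ennreal l = liminf (\<lambda>n. ennreal (?g n l))" by (rule lim_imp_Liminf[OF sequentially_bot, symmetric])
    qed
    also have "\<dots> \<le> liminf (\<lambda>n. \<integral>\<^sup>+l. ennreal (?g n l) \<partial>\<mu> ?a)"
    proof (rule nn_integral_liminf)
      show "(\<lambda>l. ennreal (?g n l)) \<in> borel_measurable (\<mu> ?a)" for n
      proof -
        have "(\<lambda>l. ennreal (?g n l)) \<in> borel_measurable half_line" by (intro measurable_restrict_space1) measurable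
        then show ?thesis by simp
      qed
    qed
    also have "\<dots> \<le> (\<integral>\<^sup>+l. ennreal l \<partial>\<mu> u)"
    proof (rule Liminf_le)
      show "\<forall>\<^sub>F n in sequentially. (\<integral>\<^sup>+l. ennreal (?g n l) \<partial>\<mu> ?a) \<le> (\<integral>\<^sup>+l. ennreal l \<partial>\<mu> u)"
      proof (intro always_eventually allI)
        fix n
        let ?s = "1 / real (Suc n)"
        have s: "?s > 0" by simp
        have mult: "(\<integral>\<^sup>+l. ennreal (?g n l) \<partial>\<mu> x) = ennreal (real (Suc n)) * (\<integral>\<^sup>+l. ennreal (1 - exp (- ?s * l)) \<partial>\<mu> x)" for x
        proof -
          have "(\<integral>\<^sup>+l. ennreal (?g n l) \<partial>\<mu> x) = (\<integral>\<^sup>+l. ennreal (real (Suc n)) * ennreal (1 - exp (- ?s * l)) \<partial>\<mu> x)"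
            by (intro nn_integral_cong ennreal_mult') simp
          then show ?thesis using gm[of ?s] by (simp add: nn_integral_cmult)
        qed
        have "(\<integral>\<^sup>+l. ennreal (?g n l) \<partial>\<mu> ?a) \<le> (\<integral>\<^sup>+l. ennreal (?g n l) \<partial>\<mu> u)"
          unfolding mult by (intro mult_left_mono exp_le[OF s]) simp
        also have "\<dots> \<le> (\<integral>\<^sup>+l. ennreal l \<partial>\<mu> u)"
        proof (intro nn_integral_mono ennreal_leI)
          fix l
          have "1 - exp (- ?s * l) \<le> ?s * l" using exp_ge_add_one_self[of "- ?s * l"] by simp
          then have "real (Suc n) * (1 - exp (- ?s * l)) \<le> real (Suc n) * (?s * l)" by (intro mult_left_mono) auto
          then show "?g n l \<le> l" by simp
        qed
        finally show "(\<integral>\<^sup>+l. ennreal (?g n l) \<partial>\<mu> ?a) \<le> (\<integral>\<^sup>+l. ennreal l \<partial>\<mu> u)" .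
      qed
    qed simp
    finally show ?thesis .
  qed
  have decomp: "(\<integral>\<^sup>+l. ennreal (\<Phi> l) \<partial>\<mu> x) = ennreal b * (\<integral>\<^sup>+l. ennreal l \<partial>\<mu> x)
      + (\<integral>\<^sup>+s. (\<integral>\<^sup>+l. ennreal (1 - exp (- s * l)) \<partial>\<mu> x) \<partial>\<nu>)" if x: "x \<in> H" for x
  proof -
    interpret \<nu>: sigma_finite_measure \<nu> by (rule b(2))
    interpret \<mu>x: finite_measure "\<mu> x" using x by simp
    interpret pair_sigma_finite "\<mu> x" \<nu> ..
    have [measurable]: "(\<lambda>x. x) \<in> borel_measurable \<nu>"
      using measurable_restrict_space1[of "\<lambda>x. x" borel borel "{0<..}"] measurable_cong_sets[OF b(3) refl] by auto
    have [measurable]: "(\<lambda>l. l) \<in> borel_measurable (\<mu> x)"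
      using id_half_line measurable_cong_sets[OF sets_\<mu> refl] by blast
    have m2: "(\<lambda>(l, s). ennreal (1 - exp (- s * l))) \<in> borel_measurable (\<mu> x \<Otimes>\<^sub>M \<nu>)" by measurable
    have "(\<integral>\<^sup>+l. ennreal (\<Phi> l) \<partial>\<mu> x) = (\<integral>\<^sup>+l. ennreal b * ennreal l + (\<integral>\<^sup>+s. ennreal (1 - exp (- s * l)) \<partial>\<nu>) \<partial>\<mu> x)"
    proof (rule nn_integral_cong)
      fix l assume "l \<in> space (\<mu> x)"
      then have l: "l \<ge> 0" by simp
      have nn: "AE s in \<nu>. 0 \<le> 1 - exp (- l * s)" using sp l by (intro AE_I2) auto
      have "(\<integral>\<^sup>+s. ennreal (1 - exp (- l * s)) \<partial>\<nu>) = ennreal (\<integral>s. 1 - exp (- l * s) \<partial>\<nu>)"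
        using int[OF l] nn by (rule nn_integral_eq_integral)
      then show "ennreal (\<Phi> l) = ennreal b * ennreal l + (\<integral>\<^sup>+s. ennreal (1 - exp (- s * l)) \<partial>\<nu>)"
        using \<Phi>[OF l] b(1) l integral_nonneg_AE[OF nn] by (simp add: ennreal_mult mult.commute)
    qed
    also have "\<dots> = ennreal b * (\<integral>\<^sup>+l. ennreal l \<partial>\<mu> x) + (\<integral>\<^sup>+l. (\<integral>\<^sup>+s. ennreal (1 - exp (- s * l)) \<partial>\<nu>) \<partial>\<mu> x)"
      by (subst nn_integral_add) (auto simp: nn_integral_cmult intro!: \<nu>.borel_measurable_nn_integral)
    also have "(\<integral>\<^sup>+l. (\<integral>\<^sup>+s. ennreal (1 - exp (- s * l)) \<partial>\<nu>) \<partial>\<mu> x) = (\<integral>\<^sup>+s. (\<integral>\<^sup>+l. ennreal (1 - exp (- s * l)) \<partial>\<mu> x) \<partial>\<nu>)"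
      using Fubini'[OF m2] by simp
    finally show ?thesis .
  qed
  show ?thesis unfolding decomp[OF a] decomp[OF u]
  proof (intro add_mono mult_left_mono id_le nn_integral_mono)
    show "(\<integral>\<^sup>+l. ennreal (1 - exp (- s * l)) \<partial>\<mu> ?a) \<le> (\<integral>\<^sup>+l. ennreal (1 - exp (- s * l)) \<partial>\<mu> u)" if "s \<in> space \<nu>" for s
      using exp_le that sp by simp
  qed simp
qed

text \<open>The spectral measures of \<open>push \<Phi> P\<close> are images of those of
  \<open>P\<close>, so its energy is the integral of \<open>\<Phi>\<close>, which
  \<open>bernstein_integral_abs\<close> estimates. \<open>sqrt_form_unique\<close> passes to the
  given resolution \<open>Q\<close>.\<close>

theorem subordinate_form_abs:
  assumes bf: "bernstein_function \<Phi>"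
    and core: "form_core m (Domain A2) (graph_form m A2) C"
    and abs: "abs_contractive C (graph_form m A2)"
    and Q: "pvm m Q" "spectral_integral m Q (\<lambda>l. l) = spectral_integral m P \<Phi>"
    and u: "u \<in> Domain (spectral_integral m Q sqrt)"
  shows "(\<lambda>x. \<bar>u x\<bar>) \<in> Domain (spectral_integral m Q sqrt)"
    "graph_form m (spectral_integral m Q sqrt) (\<lambda>x. \<bar>u x\<bar>) (\<lambda>x. \<bar>u x\<bar>) \<le> graph_form m (spectral_integral m Q sqrt) u u"
proof -
  let ?a = "\<lambda>x. \<bar>u x\<bar>"
  note \<Phi> = bernstein_half_line[OF bf]
  interpret R: pvm m "push \<Phi> P" using \<Phi>(1) by (rule pvm_push)
  have R1: "R.A1 = spectral_integral m P \<Phi>" using spectral_integral_push[OF \<Phi>(1) id_half_line] .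
  note uniq = sqrt_form_unique[OF Q(1) R.pvm_axioms, unfolded Q(2) R1, OF refl]
  have \<Phi>': "\<Phi> \<in> \<mu> f \<rightarrow>\<^sub>M half_line" for f using \<Phi>(1) by simp
  have \<Phi>m: "\<Phi> \<in> borel_measurable half_line"
    using measurable_compose[OF \<Phi>(1) id_half_line] by simp
  have Rint: "integrable (R.\<mu> f) (\<lambda>l. l) \<longleftrightarrow> integrable (\<mu> f) \<Phi>" "(\<integral>l. l \<partial>R.\<mu> f) = (\<integral>l. \<Phi> l \<partial>\<mu> f)" if "f \<in> H" for f
    unfolding scalar_spectral_measure_push[OF \<Phi>(1) that]
    using integrable_distr_eq[OF \<Phi>' id_half_line, of f] integral_distr[OF \<Phi>' id_half_line, of f] by auto
  have uR: "u \<in> Domain R.A2" using u uniq(1) by simp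
  then have u1: "u \<in> H" "integrable (\<mu> u) \<Phi>" using Rint(1) by (auto simp: R.Domain_sqrt R.ispace_def)
  have aH: "?a \<in> H" using L2_abs[OF u1(1)] .
  have nn: "AE l in \<mu> x. 0 \<le> \<Phi> l" for x using \<Phi>(2) by (intro AE_I2) simp
  have le: "(\<integral>\<^sup>+l. ennreal (\<Phi> l) \<partial>\<mu> ?a) \<le> ennreal (\<integral>l. \<Phi> l \<partial>\<mu> u)"
    using bernstein_integral_abs[OF bf core abs u1(1)] nn_integral_eq_integral[OF u1(2) nn] by simp
  have ia: "integrable (\<mu> ?a) \<Phi>"
    using le \<Phi>m nn by (intro integrableI_nonneg) (auto intro: le_less_trans)
  then have aR: "?a \<in> Domain R.A2" using Rint(1)[OF aH] aH by (simp add: R.Domain_sqrt R.ispace_def)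
  then show "?a \<in> Domain (spectral_integral m Q sqrt)" using uniq(1) by simp
  have "(\<integral>l. \<Phi> l \<partial>\<mu> ?a) \<le> (\<integral>l. \<Phi> l \<partial>\<mu> u)"
    using le nn_integral_eq_integral[OF ia nn] integral_nonneg_AE[OF nn, of u] by simp
  then have "graph_form m R.A2 ?a ?a \<le> graph_form m R.A2 u u"
    using R.sqrt_norm[OF aR] R.sqrt_norm[OF uR] Rint(2) u1(1) aH by simp
  then show "graph_form m (spectral_integral m Q sqrt) ?a ?a \<le> graph_form m (spectral_integral m Q sqrt) u u"
    using uniq(2) u aR uniq(1) by simp
qed

end

section \<open>Sequences tending to zero almost everywhere\<close>

lemma (in semi_inner_space) triangle_sum:
  assumes "finite F" "\<And>i. i \<in> F \<Longrightarrow> f i \<in> V"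
  shows "sqrt (B (\<Sum>i\<in>F. f i) (\<Sum>i\<in>F. f i)) \<le> (\<Sum>i\<in>F. sqrt (B (f i) (f i)))"
  using assms
proof (induction F rule: finite_induct)
  case (insert j F)
  have "f j \<in> V" "(\<Sum>i\<in>F. f i) \<in> V" using insert by auto
  then have "sqrt (B (f j + (\<Sum>i\<in>F. f i)) (f j + (\<Sum>i\<in>F. f i)))
      \<le> sqrt (B (f j) (f j)) + sqrt (B (\<Sum>i\<in>F. f i) (\<Sum>i\<in>F. f i))" by (rule triangle)
  also have "\<dots> \<le> sqrt (B (f j) (f j)) + (\<Sum>i\<in>F. sqrt (B (f i) (f i)))"
    using insert by simp
  finally show ?case unfolding sum.insert[OF insert.hyps] .
qed simp

text \<open>All that the rest of the proof keeps of the Schroedinger form and of the subordination.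
  Nothing is said about truncation at \<open>1\<close>, which the Markov property would
  give.\<close>

locale lattice_pvm = pvm +
  assumes abs_mem: "u \<in> Domain A2 \<Longrightarrow> (\<lambda>x. \<bar>u x\<bar>) \<in> Domain A2"
    and abs_le: "u \<in> Domain A2 \<Longrightarrow> graph_form m A2 (\<lambda>x. \<bar>u x\<bar>) (\<lambda>x. \<bar>u x\<bar>) \<le> graph_form m A2 u u"
begin

abbreviation "q \<equiv> graph_form m A2"
abbreviation "V \<equiv> Domain A2"
abbreviation "pp u \<equiv> (\<lambda>x. max 0 (u x))"
abbreviation "np u \<equiv> (\<lambda>x. max 0 (- u x))"

sublocale q: semi_inner_space V q by (rule semi_inner_graph_form[OF A2_self_adjoint])

lemma VH: "u \<in> V \<Longrightarrow> u \<in> H" using op_app_L2[OF A2_self_adjoint] by blast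

text \<open>Expanding both sides, the contraction under the absolute value says that
  \<open>q (pp u) (np u) \<le> 0\<close>; dropping the mixed term of \<open>q u u\<close> gives the
  estimate.\<close>

lemma pp_np:
  assumes u: "u \<in> V"
  shows pp_mem: "pp u \<in> V" and np_mem: "np u \<in> V"
    and pp_np_le: "q (pp u) (pp u) + q (np u) (np u) \<le> q u u"
proof -
  have eqs: "pp u = (1 / 2) *\<^sub>R ((\<lambda>x. \<bar>u x\<bar>) + u)" "np u = (1 / 2) *\<^sub>R ((\<lambda>x. \<bar>u x\<bar>) - u)"
    by (auto simp: fun_eq_iff)
  show p: "pp u \<in> V" unfolding eqs(1) by (intro q.V_mem abs_mem u)
  show n: "np u \<in> V" unfolding eqs(2) by (intro q.V_mem abs_mem u)
  have abs_eq: "(\<lambda>x. \<bar>u x\<bar>) = pp u + np u" and eq: "pp u - np u = u" by (auto simp: fun_eq_iff)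
  have "q (pp u + np u) (pp u + np u) \<le> q (pp u - np u) (pp u - np u)"
    using abs_le[OF u] unfolding abs_eq[symmetric] eq .
  moreover have "q (pp u - np u) (pp u - np u) = q (pp u) (pp u) - 2 * q (pp u) (np u) + q (np u) (np u)"
    using p n by (rule q.expand_diff)
  moreover have "q (pp u + np u) (pp u + np u) = q (pp u) (pp u) + 2 * q (pp u) (np u) + q (np u) (np u)"
    using p n by (rule q.expand_add)
  ultimately have "q (pp u) (pp u) + q (np u) (np u) \<le> q (pp u - np u) (pp u - np u)" by linarith
  then show "q (pp u) (pp u) + q (np u) (np u) \<le> q u u" unfolding eq .
qed

text \<open>The truncated square root is bounded, so its energy is
  \<open>L\<^sup>2\<close>-continuous and inherits the bound \<open>c\<close>. Pairing the
  truncations with the full square root of \<open>z\<close> gives \<open>\<parallel>\<surd>A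
  z\<parallel>\<^sup>2 \<le> \<surd>c \<parallel>\<surd>A z\<parallel>\<close> in the limit.\<close>

lemma lower_semicontinuous:
  assumes y: "\<And>n. y n \<in> V" "\<And>n. q (y n) (y n) \<le> c" and z: "z \<in> V" and lim: "form_tendsto ip y z"
  shows "q z z \<le> c"
proof -
  have zH: "z \<in> H" "op_app A2 z \<in> H" using op_app_L2[OF A2_self_adjoint z] by auto
  have yH: "y n \<in> H" for n using y(1) VH by blast
  have c0: "0 \<le> c" using y(2)[of 0] q.nonneg[OF y(1), of 0] by simp
  have le: "ip (T (trunc sqrt N) z) (T (trunc sqrt N) z) \<le> c" for N
  proof (rule LIMSEQ_le_const2)
    have b: "bounded_borel (trunc sqrt N)" by simp
    show "(\<lambda>n. ip (T (trunc sqrt N) (y n)) (T (trunc sqrt N) (y n))) \<longlonglongrightarrow> ip (T (trunc sqrt N) z) (T (trunc sqrt N) z)"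
      using T_tendsto[OF b yH zH(1) lim] b yH zH by (intro L2.tendsto_norm) auto
    have "ip (T (trunc sqrt N) (y n)) (T (trunc sqrt N) (y n)) \<le> c" for n
    proof -
      have "(\<integral>l. (trunc sqrt N l)\<^sup>2 \<partial>\<mu> (y n)) \<le> (\<integral>l. l \<partial>\<mu> (y n))"
      proof (rule integral_mono_AE)
        show "integrable (\<mu> (y n)) (\<lambda>l. (trunc sqrt N l)\<^sup>2)" using b yH by blast
        show "integrable (\<mu> (y n)) (\<lambda>l. l)" using y(1)[of n] by (simp add: Domain_sqrt ispace_def)
        show "AE l in \<mu> (y n). (trunc sqrt N l)\<^sup>2 \<le> l"
          by (intro AE_I2) (auto simp: trunc_def indicator_def)
      qed
      then show ?thesis using T_norm[OF b yH] sqrt_norm[OF y(1)] y(2)[of n] by simp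
    qed
    then show "\<exists>N'. \<forall>n\<ge>N'. ip (T (trunc sqrt N) (y n)) (T (trunc sqrt N) (y n)) \<le> c" by blast
  qed
  have "ip (op_app A2 z) (op_app A2 z) \<le> sqrt c * sqrt (ip (op_app A2 z) (op_app A2 z))" (is "?i \<le> _")
  proof (rule LIMSEQ_le_const2)
    show "(\<lambda>N. ip (T (trunc sqrt N) z) (op_app A2 z)) \<longlonglongrightarrow> ip (op_app A2 z) (op_app A2 z)"
      using op_app_mem[OF z] zH(2) by (intro spectral_integral_T_tendsto) auto
    have "ip (T (trunc sqrt N) z) (op_app A2 z) \<le> sqrt c * sqrt (ip (op_app A2 z) (op_app A2 z))" for N
    proof -
      have "T (trunc sqrt N) z \<in> H" using zH by auto
      then have "ip (T (trunc sqrt N) z) (op_app A2 z) \<le> sqrt (ip (T (trunc sqrt N) z) (T (trunc sqrt N) z)) * sqrt (ip (op_app A2 z) (op_app A2 z))"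
        using L2.abs_le[of "T (trunc sqrt N) z" m "op_app A2 z"] zH by simp
      also have "\<dots> \<le> sqrt c * sqrt (ip (op_app A2 z) (op_app A2 z))"
        using le[of N] L2.nonneg[OF zH(2)] by (intro mult_right_mono) auto
      finally show ?thesis .
    qed
    then show "\<exists>N'. \<forall>N\<ge>N'. ip (T (trunc sqrt N) z) (op_app A2 z) \<le> sqrt c * sqrt (ip (op_app A2 z) (op_app A2 z))" by blast
  qed
  then have "sqrt ?i * sqrt ?i \<le> sqrt c * sqrt ?i" using L2.nonneg[OF zH(2)] by simp
  then have "?i = 0 \<or> sqrt ?i \<le> sqrt c" using L2.nonneg[OF zH(2)] by (simp only: mult_le_cancel_right) auto
  then have "sqrt ?i \<le> sqrt c" using c0 by auto
  then show ?thesis by (simp add: graph_form_def)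
qed

text \<open>The positive part of \<open>k u - r\<^sub>n\<close> converges to \<open>k u\<close> in \<open>L\<^sup>2\<close> and has no more energy than
  \<open>k u - r\<^sub>n\<close>, so lower semicontinuity bounds \<open>2 k \<E>(u, r\<^sub>n)\<close> along every subsequence on which
  \<open>\<E>(u, r\<^sub>n)\<close> stays away from \<open>0\<close>, for all \<open>k\<close>.\<close>

lemma mutual_energy_eventually_le:
  assumes r: "\<And>n. r n \<in> V" "\<And>n x. 0 \<le> r n x" "\<And>n. q (r n) (r n) \<le> K"
    and r0: "AE x in m. (\<lambda>n. r n x) \<longlonglongrightarrow> 0" and u: "u \<in> V" "\<And>x. 0 \<le> u x" and e: "e > 0"
  shows "\<forall>\<^sub>F n in sequentially. q u (r n) \<le> e"
proof (rule ccontr)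
  assume "\<not> ?thesis"
  then have "\<exists>\<^sub>F n in sequentially. q u (r n) > e" by (simp add: not_eventually not_le)
  then have inf: "infinite {n. q u (r n) > e}" by (simp add: frequently_cofinite[symmetric] cofinite_eq_sequentially)
  obtain s :: "nat \<Rightarrow> nat" where s: "strict_mono s" "\<And>n. q u (r (s n)) > e"
    using infinite_enumerate[OF inf] unfolding mem_Collect_eq by blast
  have bound: "2 * k * e \<le> K" if k: "k > 0" for k :: real
  proof -
    define x where "x n = k *\<^sub>R u - r (s n)" for n
    have xV: "x n \<in> V" for n using r(1) u by (simp add: x_def)
    have yV: "pp (x n) \<in> V" for n using pp_mem[OF xV] .
    have kuV: "k *\<^sub>R u \<in> V" using u by simp
    have uH: "u \<in> H" using VH[OF u(1)] .
    have [measurable]: "u \<in> borel_measurable m" "r n \<in> borel_measurable m" for n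
      using VH u(1) r(1) by (auto intro: L2_space_measurable)
    have lim: "form_tendsto ip (\<lambda>n. pp (x n)) (k *\<^sub>R u)"
    proof -
      have "(\<lambda>n. \<integral>z. (pp (x n) z - k * u z)\<^sup>2 \<partial>m) \<longlonglongrightarrow> (\<integral>z. 0 \<partial>m)"
      proof (rule integral_dominated_convergence[where w = "\<lambda>z. k\<^sup>2 * (u z)\<^sup>2"])
        show "(\<lambda>z. 0) \<in> borel_measurable m" "(\<lambda>z. (pp (x n) z - k * u z)\<^sup>2) \<in> borel_measurable m" for n
          unfolding x_def by (auto simp: fun_diff_def scaleR_fun_def)
        show "integrable m (\<lambda>z. k\<^sup>2 * (u z)\<^sup>2)" using uH by (simp add: L2_space_def)
        show "AE z in m. (\<lambda>n. (pp (x n) z - k * u z)\<^sup>2) \<longlonglongrightarrow> 0"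
          using r0
        proof eventually_elim
          case (elim z)
          have "(\<lambda>n. r (s n) z) \<longlonglongrightarrow> 0" using LIMSEQ_subseq_LIMSEQ[OF elim s(1)] by (simp add: o_def)
          then have "(\<lambda>n. (max 0 (k * u z - r (s n) z) - k * u z)\<^sup>2) \<longlonglongrightarrow> (max 0 (k * u z - 0) - k * u z)\<^sup>2"
            by (intro tendsto_intros)
          then show ?case using k u(2)[of z] by (simp add: x_def)
        qed
        show "AE z in m. norm ((pp (x n) z - k * u z)\<^sup>2) \<le> k\<^sup>2 * (u z)\<^sup>2" for n
        proof (rule AE_I2)
          fix z
          have "0 \<le> k * u z" using k u(2)[of z] by simp
          then have "\<bar>pp (x n) z - k * u z\<bar> \<le> \<bar>k * u z\<bar>" using r(2)[of "s n" z] by (auto simp: x_def max_def)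
          then have "(pp (x n) z - k * u z)\<^sup>2 \<le> (k * u z)\<^sup>2" by (simp only: abs_le_square_iff)
          then show "norm ((pp (x n) z - k * u z)\<^sup>2) \<le> k\<^sup>2 * (u z)\<^sup>2" by (simp add: power_mult_distrib)
        qed
      qed
      then show ?thesis by (simp add: form_tendsto_def L2_inner_self)
    qed
    have "q (pp (x n)) (pp (x n)) \<le> k\<^sup>2 * q u u - 2 * k * e + K" for n
    proof -
      have "q (pp (x n)) (pp (x n)) \<le> q (x n) (x n)" using pp_np_le[OF xV, of n] q.nonneg[OF np_mem[OF xV], of n] by linarith
      also have "\<dots> = k\<^sup>2 * q u u - 2 * k * q u (r (s n)) + q (r (s n)) (r (s n))"
        unfolding x_def using kuV u(1) r(1) by (simp only: q.expand_diff[OF kuV r(1)] q.scale_left q.scale_right power2_eq_square mult.assoc)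
      also have "\<dots> \<le> k\<^sup>2 * q u u - 2 * k * e + K"
        using r(3)[of "s n"] mult_left_mono[OF less_imp_le[OF s(2)[of n]], of "2 * k"] k by linarith
      finally show ?thesis .
    qed
    then have "q (k *\<^sub>R u) (k *\<^sub>R u) \<le> k\<^sup>2 * q u u - 2 * k * e + K"
      by (rule lower_semicontinuous[where y = "\<lambda>n. pp (x n)", OF yV _ kuV lim])
    moreover have "q (k *\<^sub>R u) (k *\<^sub>R u) = k\<^sup>2 * q u u"
      using u(1) by (simp only: q.scale_left q.scale_right q.V_mem power2_eq_square mult.assoc)
    ultimately show ?thesis by linarith
  qed
  have "K \<ge> 0" using r(3)[of 0] q.nonneg[OF r(1), of 0] by simp
  \<comment> \<open>With \<open>k = (K + 1) / e\<close> the bound reads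
    \<open>2 * (K + 1) \<le> K\<close>, impossible for \<open>K \<ge> 0\<close>.\<close>
  then have "2 * ((K + 1) / e) * e \<le> K" using e by (intro bound) simp
  then show False using e \<open>K \<ge> 0\<close> by simp
qed

text \<open>A Banach-Saks argument: averages over sparse index sets have small energy, separately for the
  positive and the negative parts, while by the Cauchy property they stay close to the sequence.\<close>

lemma Cauchy_AE_zero:
  assumes w: "\<And>n. w n \<in> V" and cau: "form_Cauchy q w" and w0: "AE x in m. (\<lambda>n. w n x) \<longlonglongrightarrow> 0"
  shows "(\<lambda>n. q (w n) (w n)) \<longlonglongrightarrow> 0"
proof (rule LIMSEQ_I)
  obtain K where K: "K \<ge> 0" "\<And>n. q (w n) (w n) \<le> K" using q.Cauchy_bounded[OF w cau] by blast
  let ?p = "\<lambda>n. pp (w n)" and ?n = "\<lambda>n. np (w n)"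
  have pV: "?p n \<in> V" and nV: "?n n \<in> V" for n using pp_mem[OF w] np_mem[OF w] .
  have pK: "q (?p n) (?p n) \<le> K" and nK: "q (?n n) (?n n) \<le> K" for n
    using pp_np_le[OF w, of n] K(2)[of n] q.nonneg[OF pV, of n] q.nonneg[OF nV, of n] by linarith+
  have p0: "AE x in m. (\<lambda>n. ?p n x) \<longlonglongrightarrow> 0" and n0: "AE x in m. (\<lambda>n. ?n n x) \<longlonglongrightarrow> 0"
  proof -
    show "AE x in m. (\<lambda>n. ?p n x) \<longlonglongrightarrow> 0" using w0
    proof eventually_elim
      case (elim x)
      then have "(\<lambda>n. max 0 (w n x)) \<longlonglongrightarrow> max 0 0" by (intro tendsto_intros)
      then show ?case by simp
    qed
    show "AE x in m. (\<lambda>n. ?n n x) \<longlonglongrightarrow> 0" using w0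
    proof eventually_elim
      case (elim x)
      then have "(\<lambda>n. max 0 (- w n x)) \<longlonglongrightarrow> max 0 (- 0)" by (intro tendsto_intros)
      then show ?case by simp
    qed
  qed
  \<comment> \<open>Greedy choice: only finitely many \<open>i\<close> have been chosen, so some
    later \<open>j\<close> has mutual energy at most \<open>e\<close> with all of them, for positive
    and negative parts at once.\<close>
  have sparse: "\<exists>F. finite F \<and> F \<subseteq> {n0..} \<and> card F = N \<and>
      (\<forall>i\<in>F. \<forall>j\<in>F. i \<noteq> j \<longrightarrow> q (?p i) (?p j) \<le> e \<and> q (?n i) (?n j) \<le> e)" if e: "e > 0" for e N n0
  proof (induction N)
    case 0
    show ?case by (intro exI[of _ "{}"]) auto
  next
    case (Suc N)
    then obtain F where F: "finite F" "F \<subseteq> {n0..}" "card F = N"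
      "\<And>i j. i \<in> F \<Longrightarrow> j \<in> F \<Longrightarrow> i \<noteq> j \<Longrightarrow> q (?p i) (?p j) \<le> e \<and> q (?n i) (?n j) \<le> e" by blast
    have "\<forall>\<^sub>F j in sequentially. \<forall>i\<in>F. q (?p i) (?p j) \<le> e \<and> q (?n i) (?n j) \<le> e"
    proof (rule eventually_ball_finite[OF F(1)], intro ballI eventually_conj)
      fix i
      show "\<forall>\<^sub>F j in sequentially. q (?p i) (?p j) \<le> e"
        using pV pK p0 e by (intro mutual_energy_eventually_le[of ?p]) auto
      show "\<forall>\<^sub>F j in sequentially. q (?n i) (?n j) \<le> e"
        using nV nK n0 e by (intro mutual_energy_eventually_le[of ?n]) auto
    qed
    moreover have "\<forall>\<^sub>F j in sequentially. j > Max (insert n0 F)" by (rule eventually_gt_at_top)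
    ultimately have "\<forall>\<^sub>F j in sequentially. (\<forall>i\<in>F. q (?p i) (?p j) \<le> e \<and> q (?n i) (?n j) \<le> e) \<and> j > Max (insert n0 F)"
      by (rule eventually_conj)
    then obtain j where j: "\<And>i. i \<in> F \<Longrightarrow> q (?p i) (?p j) \<le> e \<and> q (?n i) (?n j) \<le> e" "j > Max (insert n0 F)"
      unfolding eventually_sequentially by blast
    have jF: "j \<notin> F" "n0 \<le> j"
      using j(2) F(1) Max_less_iff[of "insert n0 F" j] by auto
    show ?case
    proof (intro exI[of _ "insert j F"] conjI ballI impI)
      fix i k assume "i \<in> insert j F" "k \<in> insert j F" "i \<noteq> k"
      then show "q (?p i) (?p k) \<le> e" "q (?n i) (?n k) \<le> e"
        using F(4)[of i k] j(1)[of i] j(1)[of k] q.sym[OF pV pV, of i k] q.sym[OF nV nV, of i k] by auto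
    qed (use F jF in auto)
  qed
  have avg: "q (\<Sum>i\<in>F. f i) (\<Sum>i\<in>F. f i) \<le> real (card F) * K + (real (card F))\<^sup>2 * e"
    if F: "finite F" and f: "\<And>i. f i \<in> V" "\<And>i. q (f i) (f i) \<le> K" "\<And>i j. i \<in> F \<Longrightarrow> j \<in> F \<Longrightarrow> i \<noteq> j \<Longrightarrow> q (f i) (f j) \<le> e" and e: "e > 0"
    for F :: "nat set" and f e
  proof -
    have "q (\<Sum>i\<in>F. f i) (\<Sum>i\<in>F. f i) = (\<Sum>j\<in>F. \<Sum>i\<in>F. q (f i) (f j))"
      using f(1) by (simp add: q.sum_left q.sum_right q.V_sum)
    also have "\<dots> = (\<Sum>i\<in>F. \<Sum>j\<in>F. q (f i) (f j))" by (rule sum.swap)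
    also have "\<dots> \<le> (\<Sum>i\<in>F. \<Sum>j\<in>F. (if i = j then K else 0) + e)"
      using f(2,3) e K(1) by (intro sum_mono) (auto intro: add_increasing2)
    also have "\<dots> = real (card F) * K + (real (card F))\<^sup>2 * e"
      using F by (simp add: sum.distrib power2_eq_square algebra_simps)
    finally show ?thesis .
  qed
  fix \<epsilon> :: real assume "\<epsilon> > 0"
  \<comment> \<open>The averages of positive and of negative parts get at most \<open>2 * d\<close>
    each, the distance of \<open>w n\<close> from the average at most \<open>d\<close>: in total
    \<open>5 * d\<close>, below \<open>6 * d = sqrt \<epsilon>\<close>.\<close>
  define d where "d = sqrt \<epsilon> / 6"
  have d: "d > 0" using \<open>\<epsilon> > 0\<close> by (simp add: d_def)
  obtain n0 where n0: "\<And>i j. i \<ge> n0 \<Longrightarrow> j \<ge> n0 \<Longrightarrow> q (w i - w j) (w i - w j) < d\<^sup>2"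
    using cau d unfolding form_Cauchy_eq by (meson zero_less_power)
  \<comment> \<open>This \<open>N\<close> makes the diagonal contribution \<open>K / N\<close> at
    most \<open>d\<^sup>2\<close>, the size allowed to the off-diagonal one; together they stay
    below \<open>(2 * d)\<^sup>2\<close>.\<close>
  obtain N :: nat where N: "K / d\<^sup>2 < real N" using reals_Archimedean2 by blast
  have Npos: "real N > 0" using N K(1) d by (smt (verit) divide_nonneg_nonneg zero_le_power2)
  obtain F where F: "finite F" "F \<subseteq> {n0..}" "card F = N"
    "\<And>i j. i \<in> F \<Longrightarrow> j \<in> F \<Longrightarrow> i \<noteq> j \<Longrightarrow> q (?p i) (?p j) \<le> d\<^sup>2 \<and> q (?n i) (?n j) \<le> d\<^sup>2"
    using sparse[of "d\<^sup>2" n0 N] d by auto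
  have small: "sqrt (q ((1 / real N) *\<^sub>R (\<Sum>i\<in>F. f i)) ((1 / real N) *\<^sub>R (\<Sum>i\<in>F. f i))) \<le> 2 * d"
    if f: "\<And>i. f i \<in> V" "\<And>i. q (f i) (f i) \<le> K" "\<And>i j. i \<in> F \<Longrightarrow> j \<in> F \<Longrightarrow> i \<noteq> j \<Longrightarrow> q (f i) (f j) \<le> d\<^sup>2" for f
  proof -
    have sV: "(\<Sum>i\<in>F. f i) \<in> V" using f(1) by (intro q.V_sum)
    have "q ((1 / real N) *\<^sub>R (\<Sum>i\<in>F. f i)) ((1 / real N) *\<^sub>R (\<Sum>i\<in>F. f i)) = q (\<Sum>i\<in>F. f i) (\<Sum>i\<in>F. f i) / (real N)\<^sup>2"
      using sV by (simp only: q.scale_left q.scale_right q.V_mem) (simp add: power2_eq_square)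
    also have "\<dots> \<le> (real N * K + (real N)\<^sup>2 * d\<^sup>2) / (real N)\<^sup>2"
    proof (rule divide_right_mono)
      show "q (\<Sum>i\<in>F. f i) (\<Sum>i\<in>F. f i) \<le> real N * K + (real N)\<^sup>2 * d\<^sup>2"
        unfolding F(3)[symmetric] by (rule avg[OF F(1)]) (use f d in auto)
    qed simp
    also have "\<dots> = K / real N + d\<^sup>2" using Npos by (simp add: add_divide_distrib power2_eq_square)
    also have "\<dots> \<le> (2 * d)\<^sup>2"
    proof -
      have "K / real N \<le> d\<^sup>2" using N Npos d by (simp add: field_simps)
      moreover have "0 \<le> d\<^sup>2" by simp
      moreover have "(2 * d)\<^sup>2 = 4 * d\<^sup>2" by (simp add: power_mult_distrib)
      ultimately show ?thesis by linarith
    qed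
    finally show ?thesis using d by (intro real_le_lsqrt) auto
  qed
  let ?W = "(1 / real N) *\<^sub>R (\<Sum>i\<in>F. w i)"
  have WV: "?W \<in> V" using w by (intro q.V_mem q.V_sum)
  have Wsmall: "sqrt (q ?W ?W) \<le> 4 * d"
  proof -
    let ?Y = "(1 / real N) *\<^sub>R (\<Sum>i\<in>F. ?p i)" and ?Z = "(1 / real N) *\<^sub>R (\<Sum>i\<in>F. ?n i)"
    have YZ: "?Y \<in> V" "?Z \<in> V" using pV nV by (auto intro!: q.V_mem(4) q.V_sum)
    have "w i = ?p i - ?n i" for i by (auto simp: fun_eq_iff)
    then have "(\<Sum>i\<in>F. w i) = (\<Sum>i\<in>F. ?p i - ?n i)" by (intro sum.cong refl)
    then have "?W = ?Y - ?Z" by (simp only: sum_subtractf scaleR_diff_right)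
    then have "sqrt (q ?W ?W) \<le> sqrt (q ?Y ?Y) + sqrt (q ?Z ?Z)"
      using q.triangle_diff[OF YZ] by (simp only:)
    also have "\<dots> \<le> 2 * d + 2 * d"
      using small[of ?p] small[of ?n] pV nV pK nK F(4) by (intro add_mono) auto
    finally show ?thesis by simp
  qed
  have "norm (q (w n) (w n) - 0) < \<epsilon>" if n: "n \<ge> n0" for n
  proof -
    have scaled: "real N *\<^sub>R (w n - ?W) = (\<Sum>i\<in>F. w n - w i)"
      using Npos F(3) by (simp add: sum_subtractf scaleR_diff_right sum_constant_scaleR del: sum_constant)
    have eq: "w n - ?W = (1 / real N) *\<^sub>R (\<Sum>i\<in>F. w n - w i)"
      unfolding scaled[symmetric] scaleR_scaleR using Npos by simp
    have sV: "(\<Sum>i\<in>F. w n - w i) \<in> V" using w by (intro q.V_sum) auto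
    have "sqrt (q (w n - ?W) (w n - ?W)) = sqrt (q (\<Sum>i\<in>F. w n - w i) (\<Sum>i\<in>F. w n - w i)) / real N"
      unfolding eq using sV Npos by (simp only: q.scale_left q.scale_right q.V_mem) (simp add: real_sqrt_mult real_sqrt_divide)
    also have "\<dots> \<le> (\<Sum>i\<in>F. sqrt (q (w n - w i) (w n - w i))) / real N"
      using q.triangle_sum[OF F(1), of "\<lambda>i. w n - w i"] w Npos by (intro divide_right_mono) auto
    also have "\<dots> \<le> (\<Sum>i\<in>F. d) / real N"
    proof (intro divide_right_mono sum_mono)
      fix i assume "i \<in> F"
      then have "i \<ge> n0" using F(2) by auto
      then show "sqrt (q (w n - w i) (w n - w i)) \<le> d"
        using n0[OF n, of i] d by (intro real_le_lsqrt) auto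
    qed simp
    also have "\<dots> = d" using F(3) Npos by simp
    finally have 1: "sqrt (q (w n - ?W) (w n - ?W)) \<le> d" .
    have "sqrt (q (w n) (w n)) \<le> sqrt (q (w n - ?W) (w n - ?W)) + sqrt (q ?W ?W)"
      using q.triangle[OF q.V_mem(3)[OF w WV] WV, of n] by (simp only: diff_add_cancel)
    also have "\<dots> \<le> 5 * d" using 1 Wsmall by linarith
    also have "\<dots> < 6 * d" using d by simp
    also have "\<dots> = sqrt \<epsilon>" by (simp add: d_def)
    finally have "sqrt (q (w n) (w n)) < sqrt \<epsilon>" .
    then show ?thesis using q.nonneg[OF w, of n] by simp
  qed
  then show "\<exists>no. \<forall>n\<ge>no. norm (q (w n) (w n) - 0) < \<epsilon>" by blast
qed

end

section \<open>Green integral, dual bound and range of the square root\<close>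

context pvm
begin

text \<open>A window away from \<open>0\<close> and \<open>\<infinity>\<close>, where
  \<open>sqrt l\<close> and \<open>1 / sqrt l\<close> are both bounded. The windows exhaust
  \<open>(0,\<infinity>)\<close> and leave out \<open>0\<close>, the spectral point of the
  kernel.\<close>

definition reciprocal_cut :: "nat \<Rightarrow> real set" where
  "reciprocal_cut n = {1 / real (Suc n)..real (Suc n)}"

definition recip_sqrt :: "nat \<Rightarrow> real \<Rightarrow> real" where
  "recip_sqrt n l = indicator (reciprocal_cut n) l * (1 / sqrt l)"

lemma reciprocal_cut_pos: "l \<in> reciprocal_cut n \<Longrightarrow> 0 < l"
  by (auto simp: reciprocal_cut_def intro: less_le_trans[of 0 "1 / real (Suc n)"])

lemma reciprocal_cut_sets [simp]: "reciprocal_cut n \<in> sets half_line"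
  using reciprocal_cut_pos[of _ n] by (auto simp: sets_half_line reciprocal_cut_def intro: less_imp_le)

lemma reciprocal_cut_eventually:
  assumes "l > 0" shows "\<forall>\<^sub>F n in sequentially. l \<in> reciprocal_cut n"
proof -
  obtain N :: nat where N: "max l (1 / l) < real N" using reals_Archimedean2 by blast
  have "l \<in> reciprocal_cut n" if "n \<ge> N" for n
  proof -
    have "1 / l < real (Suc n)" "l \<le> real (Suc n)" using N that by auto
    then show ?thesis using assms by (auto simp: reciprocal_cut_def field_simps)
  qed
  then show ?thesis by (auto simp: eventually_sequentially)
qed

lemma recip_sqrt_bounded [simp]: "bounded_borel (recip_sqrt n)"
proof (rule bounded_borelI[where K = "sqrt (real (Suc n))"])
  have "(\<lambda>l. indicator {1 / real (Suc n)..real (Suc n)} l * (1 / sqrt l)) \<in> borel_measurable borel" by measurable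
  then show "recip_sqrt n \<in> borel_measurable half_line"
    unfolding recip_sqrt_def[abs_def] reciprocal_cut_def by (rule measurable_restrict_space1)
  fix l :: real assume "l \<ge> 0"
  show "\<bar>recip_sqrt n l\<bar> \<le> sqrt (real (Suc n))"
  proof (cases "l \<in> reciprocal_cut n")
    case True
    then have l: "l > 0" "1 / real (Suc n) \<le> l" using reciprocal_cut_pos by (auto simp: reciprocal_cut_def)
    then have "1 / l \<le> real (Suc n)" by (simp add: field_simps)
    then have "sqrt (1 / l) \<le> sqrt (real (Suc n))" by (rule real_sqrt_le_mono)
    then show ?thesis using True l by (simp add: recip_sqrt_def real_sqrt_divide)
  qed (simp add: recip_sqrt_def)
qed

lemma recip_sqrt_mult: "l \<ge> 0 \<Longrightarrow> recip_sqrt n l * sqrt l = indicator (reciprocal_cut n) l"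
  using reciprocal_cut_pos[of l n] by (auto simp: recip_sqrt_def indicator_def)

lemma recip_sqrt_mult_bounded: "bounded_borel (\<lambda>l. recip_sqrt n l * sqrt l)"
proof -
  have "bounded_borel (indicator (reciprocal_cut n))" using bounded_borel_indicator[of "reciprocal_cut n"] by simp
  moreover have "(\<lambda>l. recip_sqrt n l * sqrt l) \<in> borel_measurable half_line \<longleftrightarrow>
      (indicator (reciprocal_cut n) :: real \<Rightarrow> real) \<in> borel_measurable half_line"
    by (rule measurable_cong) (simp add: space_half_line recip_sqrt_mult)
  ultimately show ?thesis by (auto simp: bounded_borel_def recip_sqrt_mult)
qed

lemma T_recip_sqrt:
  assumes "(u, v) \<in> A2" "w \<in> H"
  shows "ip (T (recip_sqrt n) v) w = ip (P (reciprocal_cut n) u) w"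
proof -
  have u: "u \<in> H" using assms spectral_integral_iff[OF sqrt_half_line] by blast
  have "ip (T (recip_sqrt n) v) w = ip (T (\<lambda>l. recip_sqrt n l * sqrt l) u) w"
    using spectral_integral_T[OF sqrt_half_line assms recip_sqrt_bounded recip_sqrt_mult_bounded] .
  also have "T (\<lambda>l. recip_sqrt n l * sqrt l) u = T (indicator (reciprocal_cut n)) u"
    by (rule T_cong) (rule recip_sqrt_mult)
  finally show ?thesis using T_indicator[OF reciprocal_cut_sets u assms(2)] by simp
qed

lemma recip_sqrt_square: "l > 0 \<Longrightarrow> (recip_sqrt n l)\<^sup>2 = indicator (reciprocal_cut n) l / l"
  by (auto simp: recip_sqrt_def power_mult_distrib power_divide indicator_def)

text \<open>Equals \<open>1 / l\<close> for \<open>l > 0\<close> and \<open>\<infinity>\<close> for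
  \<open>l = 0\<close>, so that a finite integral also excludes spectral mass at \<open>0\<close>,
  where division would give \<open>1 / 0 = 0\<close>.\<close>

definition green :: "real \<Rightarrow> ennreal" where
  "green l = (\<integral>\<^sup>+t. ennreal (exp (- t * l)) * indicator {0..} t \<partial>lborel)"

lemma green_pos: "l > 0 \<Longrightarrow> green l = ennreal (1 / l)"
proof -
  assume l: "l > 0"
  have "(\<integral>\<^sup>+t. ennreal (exp (- t * l)) * indicator {0..} t \<partial>lborel) = ennreal (0 - (- (1 / l) * exp (- 0 * l)))"
  proof (rule nn_integral_FTC_atLeast[where F = "\<lambda>t. - (1 / l) * exp (- t * l)"])
    show "((\<lambda>t. - (1 / l) * exp (- t * l)) has_real_derivative exp (- x * l)) (at x)" for x
      using l by (auto intro!: derivative_eq_intros)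
    have "filterlim (\<lambda>t. - t * l) at_bot at_top" using l by real_asymp
    then have "((\<lambda>t. - (1 / l) * exp (- t * l)) \<longlongrightarrow> - (1 / l) * 0) at_top"
      by (intro tendsto_intros filterlim_compose[OF exp_at_bot])
    then show "((\<lambda>t. - (1 / l) * exp (- t * l)) \<longlongrightarrow> 0) at_top" by simp
  qed auto
  then show ?thesis by (simp add: green_def)
qed

lemma green_0: "green 0 = \<infinity>"
proof -
  have "green 0 = emeasure lborel {0::real..}" by (simp add: green_def)
  moreover have "emeasure lborel {0::real..real n} \<le> emeasure lborel {0::real..}" for n
    by (intro emeasure_mono) auto
  then have "of_nat n \<le> emeasure lborel {0::real..}" for n
    by (simp add: ennreal_of_nat_eq_real_of_nat)
  ultimately show ?thesis by (metis ennreal_Ex_less_of_nat infinity_ennreal_def not_le top.not_eq_extremum)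
qed

lemma green_measurable: "green \<in> borel_measurable half_line"
proof -
  have "green \<in> borel_measurable borel"
    unfolding green_def[abs_def] by (intro lborel.borel_measurable_nn_integral) measurable
  then show ?thesis by (rule measurable_restrict_space1)
qed

lemma green_integral:
  assumes f: "f \<in> H"
  shows "(\<integral>\<^sup>+t\<in>{0..}. ennreal (\<integral>l. exp (- t * l) \<partial>\<mu> f) \<partial>lborel) = (\<integral>\<^sup>+l. green l \<partial>\<mu> f)"
proof -
  interpret \<mu>f: finite_measure "\<mu> f" using f by simp
  interpret pair_sigma_finite "\<mu> f" lborel ..
  have [measurable]: "(\<lambda>l. l) \<in> borel_measurable (\<mu> f)"
    using id_half_line measurable_cong_sets[OF sets_\<mu> refl] by blast
  have m2: "(\<lambda>(l, t). ennreal (exp (- t * l)) * indicator {0..} t) \<in> borel_measurable (\<mu> f \<Otimes>\<^sub>M lborel)" by measurable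
  have "(\<integral>\<^sup>+t\<in>{0..}. ennreal (\<integral>l. exp (- t * l) \<partial>\<mu> f) \<partial>lborel)
      = (\<integral>\<^sup>+t. (\<integral>\<^sup>+l. ennreal (exp (- t * l)) * indicator {0..} t \<partial>\<mu> f) \<partial>lborel)"
  proof (rule nn_integral_cong)
    fix t :: real
    show "ennreal (\<integral>l. exp (- t * l) \<partial>\<mu> f) * indicator {0..} t = (\<integral>\<^sup>+l. ennreal (exp (- t * l)) * indicator {0..} t \<partial>\<mu> f)"
    proof (cases "t \<ge> 0")
      case True
      have e: "bounded_borel (\<lambda>l. exp (- t * l))"
        by (rule bounded_borelI[where K = 1]) (use True in \<open>auto intro!: measurable_restrict_space1\<close>)
      have "(\<integral>\<^sup>+l. ennreal (exp (- t * l)) \<partial>\<mu> f) = ennreal (\<integral>l. exp (- t * l) \<partial>\<mu> f)"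
        using e f by (intro nn_integral_eq_integral integrable_bounded) auto
      then show ?thesis using True by simp
    qed simp
  qed
  also have "\<dots> = (\<integral>\<^sup>+l. green l \<partial>\<mu> f)"
    unfolding green_def using Fubini'[OF m2] by simp
  finally show ?thesis .
qed

text \<open>With \<open>f = \<surd>A g\<close> the projection at \<open>0\<close> annihilates
  \<open>f\<close>, and on each window the integral of \<open>1 / l\<close> is \<open>\<parallel>P
  (reciprocal_cut n) g\<parallel>\<^sup>2 \<le> \<parallel>g\<parallel>\<^sup>2\<close>; Fatou's
  lemma removes the window.\<close>

lemma green_finite_if_range:
  assumes gf: "(g, f) \<in> A2"
  shows "(\<integral>\<^sup>+l. green l \<partial>\<mu> f) < \<infinity>"
proof -
  have g: "g \<in> H" and f: "f \<in> H" using gf spectral_integral_iff[OF sqrt_half_line] by auto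
  have s0: "{0} \<in> sets half_line" by (simp add: sets_half_line)
  have "ip (P {0} f) f = 0"
  proof -
    have i0: "bounded_borel (indicator {0})" using bounded_borel_indicator[OF s0] by simp
    have eq0: "(\<lambda>l. indicator {0} l * sqrt l) = (\<lambda>l::real. 0)" by (auto simp: fun_eq_iff indicator_def)
    have "bounded_borel (\<lambda>l. indicator {0} l * sqrt l)" unfolding eq0 by simp
    from spectral_integral_T[OF sqrt_half_line gf f i0 this]
    have "ip (T (indicator {0}) f) f = ip (T (\<lambda>l. 0) g) f" unfolding eq0 .
    also have "\<dots> = 0" using g f bint_one[OF g f, of 0] by (simp add: T_ip)
    finally show ?thesis using T_indicator[OF s0 f f] by simp
  qed
  then have "emeasure (\<mu> f) {0} = 0" using emeasure_\<mu>[OF f s0] by simp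
  then have ae: "AE l in \<mu> f. l \<noteq> 0" using s0 by (intro AE_I[where N = "{0}"]) auto
  have le: "(\<integral>\<^sup>+l. ennreal ((recip_sqrt n l)\<^sup>2) \<partial>\<mu> f) \<le> ennreal (ip g g)" for n
  proof -
    have c: "reciprocal_cut n \<in> sets half_line" by simp
    have Pg: "P (reciprocal_cut n) g \<in> H" and Tf: "T (recip_sqrt n) f \<in> H" using g f by auto
    have "(\<integral>\<^sup>+l. ennreal ((recip_sqrt n l)\<^sup>2) \<partial>\<mu> f) = ennreal (\<integral>l. (recip_sqrt n l)\<^sup>2 \<partial>\<mu> f)"
      using f by (intro nn_integral_eq_integral integrable_bounded bounded_borel_power2) auto
    also have "(\<integral>l. (recip_sqrt n l)\<^sup>2 \<partial>\<mu> f) = ip (T (recip_sqrt n) f) (T (recip_sqrt n) f)"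
      using f by (simp add: T_norm)
    also have "\<dots> = ip (P (reciprocal_cut n) g) (P (reciprocal_cut n) g)"
      using T_recip_sqrt[OF gf Tf, of n] T_recip_sqrt[OF gf Pg, of n] L2.sym[OF Pg Tf] by simp
    also have "\<dots> \<le> ip g g"
    proof -
      have "0 \<le> ip (g - P (reciprocal_cut n) g) (g - P (reciprocal_cut n) g)" using g Pg by (intro L2.nonneg) auto
      then show ?thesis using P_norm[OF c g] L2.sym[OF g Pg] g Pg by (simp add: L2.expand_diff)
    qed
    finally show ?thesis by (simp add: ennreal_leI)
  qed
  have "(\<integral>\<^sup>+l. green l \<partial>\<mu> f) = (\<integral>\<^sup>+l. liminf (\<lambda>n. ennreal ((recip_sqrt n l)\<^sup>2)) \<partial>\<mu> f)"
  proof (rule nn_integral_cong_AE)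
    show "AE l in \<mu> f. green l = liminf (\<lambda>n. ennreal ((recip_sqrt n l)\<^sup>2))"
      using ae AE_space
    proof eventually_elim
      case (elim l)
      then have l: "l > 0" by simp
      have "\<forall>\<^sub>F n in sequentially. ennreal ((recip_sqrt n l)\<^sup>2) = green l"
        using reciprocal_cut_eventually[OF l] by eventually_elim (simp add: recip_sqrt_square[OF l] green_pos[OF l])
      then have "(\<lambda>n. ennreal ((recip_sqrt n l)\<^sup>2)) \<longlonglongrightarrow> green l" by (rule tendsto_eventually)
      then show ?case by (rule lim_imp_Liminf[OF sequentially_bot, symmetric])
    qed
  qed
  also have "\<dots> \<le> liminf (\<lambda>n. \<integral>\<^sup>+l. ennreal ((recip_sqrt n l)\<^sup>2) \<partial>\<mu> f)"
    using bounded_borel_measurable[OF bounded_borel_power2[OF recip_sqrt_bounded]] by (intro nn_integral_liminf) auto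
  also have "\<dots> \<le> ennreal (ip g g)" using le by (intro Liminf_le) auto
  finally show ?thesis by (rule le_less_trans) simp
qed

text \<open>On each window \<open>\<langle>f, u\<rangle>\<close> becomes the pairing of
  \<open>T (recip_sqrt n) f\<close> with \<open>\<surd>A u\<close>, and the first factor has squared
  norm at most the Green integral. Absence of mass at \<open>0\<close> makes the parts of
  \<open>f\<close> in the windows converge to \<open>f\<close>.\<close>

lemma dual_bound_if_green_finite:
  assumes f: "f \<in> H" and fin: "(\<integral>\<^sup>+l. green l \<partial>\<mu> f) < \<infinity>"
  obtains c where "\<And>u. u \<in> Domain A2 \<Longrightarrow> \<bar>ip f u\<bar> \<le> c * sqrt (graph_form m A2 u u)"
proof -
  define c where "c = enn2real (\<integral>\<^sup>+l. green l \<partial>\<mu> f)"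
  have c: "(\<integral>\<^sup>+l. green l \<partial>\<mu> f) = ennreal c" "c \<ge> 0" using fin by (auto simp: c_def)
  have "AE l in \<mu> f. green l \<noteq> \<infinity>"
    using fin green_measurable by (intro nn_integral_PInf_AE) auto
  then have ae: "AE l in \<mu> f. l > 0" using AE_space
  proof eventually_elim
    case (elim l)
    then show ?case using green_0 by (cases "l = 0") auto
  qed
  have norm_le: "ip (T (recip_sqrt n) f) (T (recip_sqrt n) f) \<le> c" for n
  proof -
    have i: "integrable (\<mu> f) (\<lambda>l. (recip_sqrt n l)\<^sup>2)" using f by (intro integrable_bounded bounded_borel_power2) auto
    have "ennreal (ip (T (recip_sqrt n) f) (T (recip_sqrt n) f)) = (\<integral>\<^sup>+l. ennreal ((recip_sqrt n l)\<^sup>2) \<partial>\<mu> f)"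
      using f i by (simp add: T_norm nn_integral_eq_integral)
    also have "\<dots> \<le> (\<integral>\<^sup>+l. green l \<partial>\<mu> f)"
    proof (rule nn_integral_mono_AE)
      show "AE l in \<mu> f. ennreal ((recip_sqrt n l)\<^sup>2) \<le> green l"
        using ae by eventually_elim (auto simp: recip_sqrt_square green_pos indicator_def)
    qed
    finally show ?thesis using c by (simp add: ennreal_le_iff)
  qed
  have lim: "form_tendsto ip (\<lambda>n. P (reciprocal_cut n) f) f"
  proof -
    have "ip (P (reciprocal_cut n) f - f) (P (reciprocal_cut n) f - f) = ip f f - ip (P (reciprocal_cut n) f) f" for n
      using P_norm[OF reciprocal_cut_sets f] f by (simp add: L2.expand_diff)
    moreover have "(\<lambda>n. ip (P (reciprocal_cut n) f) f) \<longlonglongrightarrow> ip f f"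
    proof -
      have i: "integrable (\<mu> f) (\<lambda>l. 1 :: real)" using f by auto
      have "(\<lambda>n. \<integral>l. (indicator (reciprocal_cut n) l :: real) \<partial>\<mu> f) \<longlonglongrightarrow> (\<integral>l. 1 \<partial>\<mu> f)"
      proof (rule integral_dominated_convergence[where w = "\<lambda>l. 1"])
        show "AE l in \<mu> f. (\<lambda>n. indicator (reciprocal_cut n) l :: real) \<longlonglongrightarrow> 1"
          using ae
        proof eventually_elim
          case (elim l)
          have "\<forall>\<^sub>F n in sequentially. indicator (reciprocal_cut n) l = (1 :: real)"
            using reciprocal_cut_eventually[OF elim] by eventually_elim simp
          then show ?case by (rule tendsto_eventually)
        qed
        show "(indicator (reciprocal_cut n) :: real \<Rightarrow> real) \<in> borel_measurable (\<mu> f)" for n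
          by (rule borel_measurable_indicator) simp
      qed (use i in \<open>auto simp: indicator_le_1\<close>)
      moreover have "(\<integral>l. indicator (reciprocal_cut n) l \<partial>\<mu> f) = ip (P (reciprocal_cut n) f) f" for n
        using measure_\<mu>[OF f, of "reciprocal_cut n"] sets.Int_space_eq2[of "reciprocal_cut n" half_line] by (simp add: space_half_line)
      ultimately show ?thesis using f by (simp add: measure_\<mu> P_total)
    qed
    then have "(\<lambda>n. ip f f - ip (P (reciprocal_cut n) f) f) \<longlonglongrightarrow> ip f f - ip f f" by (intro tendsto_intros)
    ultimately show ?thesis by (simp add: form_tendsto_def)
  qed
  have "\<bar>ip f u\<bar> \<le> sqrt c * sqrt (graph_form m A2 u u)" if u: "u \<in> Domain A2" for u
  proof (rule LIMSEQ_le_const2)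
    have uH: "u \<in> H" "op_app A2 u \<in> H" using op_app_L2[OF A2_self_adjoint u] by auto
    show "(\<lambda>n. \<bar>ip (P (reciprocal_cut n) f) u\<bar>) \<longlonglongrightarrow> \<bar>ip f u\<bar>"
      using f uH lim by (intro tendsto_rabs L2.tendsto_left) auto
    have "\<bar>ip (P (reciprocal_cut n) f) u\<bar> \<le> sqrt c * sqrt (graph_form m A2 u u)" for n
    proof -
      have Tf: "T (recip_sqrt n) f \<in> H" using f by simp
      have "ip (P (reciprocal_cut n) f) u = ip f (P (reciprocal_cut n) u)" using f uH by (intro P_sym) auto
      also have "\<dots> = ip (P (reciprocal_cut n) u) f" using f uH by (intro L2.sym) auto
      also have "\<dots> = ip (T (recip_sqrt n) (op_app A2 u)) f" using T_recip_sqrt[OF op_app_mem[OF u] f] by simp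
      also have "\<dots> = ip (op_app A2 u) (T (recip_sqrt n) f)" using uH f by (intro T_sym) auto
      finally have "\<bar>ip (P (reciprocal_cut n) f) u\<bar> \<le> sqrt (ip (op_app A2 u) (op_app A2 u)) * sqrt (ip (T (recip_sqrt n) f) (T (recip_sqrt n) f))"
        using L2.abs_le[OF uH(2) Tf] by simp
      also have "\<dots> \<le> sqrt (ip (op_app A2 u) (op_app A2 u)) * sqrt c"
        using norm_le L2.nonneg[OF uH(2)] by (intro mult_left_mono) auto
      finally show ?thesis by (simp add: graph_form_def mult.commute)
    qed
    then show "\<exists>N. \<forall>n\<ge>N. \<bar>ip (P (reciprocal_cut n) f) u\<bar> \<le> sqrt c * sqrt (graph_form m A2 u u)" by blast
  qed
  then show ?thesis by (rule that)
qed

lemma range_if_dual_bound: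
  assumes f: "f \<in> H" and bound: "\<And>u. u \<in> Domain A2 \<Longrightarrow> \<bar>ip f u\<bar> \<le> c * sqrt (graph_form m A2 u u)"
  obtains g where "(g, f) \<in> A2"
proof -
  interpret q: semi_inner_space "Domain A2" "graph_form m A2" by (rule semi_inner_graph_form[OF A2_self_adjoint])
  note mem = op_app_L2[OF A2_self_adjoint]
  obtain u where u: "\<And>n. u n \<in> Domain A2" "form_Cauchy (graph_form m A2) u"
    "\<And>w. w \<in> Domain A2 \<Longrightarrow> (\<lambda>n. graph_form m A2 (u n) w) \<longlonglongrightarrow> ip f w"
  proof (rule q.Riesz_sequence[of "ip f" "c\<^sup>2"])
    show "(ip f x)\<^sup>2 \<le> c\<^sup>2 * graph_form m A2 x x" if x: "x \<in> Domain A2" for x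
    proof -
      have "\<bar>ip f x\<bar>\<^sup>2 \<le> (c * sqrt (graph_form m A2 x x))\<^sup>2" using bound[OF x] by (intro power_mono) auto
      then show ?thesis using q.nonneg[OF x] by (simp add: power_mult_distrib)
    qed
  qed (use f mem in \<open>auto simp: L2.add_right L2.scale_right\<close>)
  have Su: "op_app A2 (u n) \<in> H" for n using mem u(1) by blast
  \<comment> \<open>The \<open>u n\<close> may be unbounded in \<open>L\<^sup>2\<close>; their
    images under the square root do have a limit, and the adjoint test involves only these
    images.\<close>
  have "form_Cauchy ip (\<lambda>n. op_app A2 (u n))" using graph_form_Cauchy[OF A2_self_adjoint, of u] u by blast
  with Su obtain g where g: "g \<in> H" "form_tendsto ip (\<lambda>n. op_app A2 (u n)) g" by (rule L2_complete)
  have "(g, f) \<in> A2"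
  proof (rule self_adjoint_opI[OF A2_self_adjoint g(1) f])
    fix x y assume xy: "(x, y) \<in> A2"
    then have x: "x \<in> Domain A2" by blast
    have y: "y \<in> H" "x \<in> H" using self_adjoint_op_mem[OF A2_self_adjoint xy] by auto
    have "(\<lambda>n. ip (op_app A2 (u n)) y) \<longlonglongrightarrow> ip g y" using Su g y by (intro L2.tendsto_left)
    moreover have "ip (op_app A2 (u n)) y = graph_form m A2 (u n) x" for n
      using graph_form_eq[OF A2_self_adjoint op_app_mem[OF u(1)] xy] by simp
    ultimately show "ip g y = ip f x" using u(3)[OF x] by (simp add: LIMSEQ_unique)
  qed
  then show ?thesis by (rule that)
qed

end

section \<open>The range of the square root\<close>

lemma nonpos_resolution:
  assumes "nonpos_self_adjoint m L"
  shows "pvm m (spectral_resolution m (op_neg L))"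
    "spectral_integral m (spectral_resolution m (op_neg L)) (\<lambda>l. l) = op_neg L"
proof -
  have A: "self_adjoint_op m (op_neg L)" and pos: "\<And>u v. (u, v) \<in> op_neg L \<Longrightarrow> 0 \<le> L2_inner m v u"
    using assms by (auto simp: nonpos_self_adjoint_iff)
  obtain P where "pvm m P" "spectral_integral m P (\<lambda>l. l) = op_neg L"
    using A pos by (rule spectral_theorem_nonneg)
  then show "pvm m (spectral_resolution m (op_neg L))"
    "spectral_integral m (spectral_resolution m (op_neg L)) (\<lambda>l. l) = op_neg L"
    by (rule spectral_resolution_pvm)+
qed

lemma sqrt_neg_eq: "sqrt_neg m L = spectral_integral m (spectral_resolution m (op_neg L)) sqrt"
  by (simp add: sqrt_neg_def op_fun_def)

text \<open>The closure is identified with the form of the chosen square root of the Schroedinger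
  operator; the core \<open>D \<inter> Cc\<close> and its contraction under the absolute value carry
  over, and \<open>subordinate_form_abs\<close> applies.\<close>

theorem subordinate_schroedinger_lattice_pvm:
  fixes m \<mu>p \<mu>n :: "'a::{metric_space, second_countable_topology} measure"
  assumes df: "dirichlet_form m D \<E>" and reg: "regular_form m D \<E>"
    and \<mu>: "radon_on UNIV \<mu>p" "radon_on UNIV \<mu>n"
    and nonneg: "nonneg_definite_on (D \<inter> Cc) (schroedinger_form \<E> \<mu>p \<mu>n)"
    and cl: "closable_form m (D \<inter> Cc) (schroedinger_form \<E> \<mu>p \<mu>n)"
    and bf: "bernstein_function \<Phi>"
  defines "L \<equiv> subordinate_operator m \<Phi> (schroedinger_operator m D \<E> \<mu>p \<mu>n)"
  shows "lattice_pvm m (spectral_resolution m (op_neg L))"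
proof -
  let ?C = "D \<inter> Cc" and ?E = "schroedinger_form \<E> \<mu>p \<mu>n" and ?S = "schroedinger_operator m D \<E> \<mu>p \<mu>n"
  let ?V = "closure_dom m ?C ?E" and ?F = "closure_form m ?C ?E"
  have DH: "D \<subseteq> L2_space m" using df symmetric_formD unfolding dirichlet_form_def by blast
  interpret C: closable_L2_form m ?C ?E
    by (rule closable_L2_form.intro[OF schroedinger_semi_inner[OF df \<mu> nonneg] _ cl]) (use DH in blast)
  interpret G: dense_closed_form m ?V ?F
  proof
    show "closed_L2_form m ?V ?F" by (rule C.closed_closure_form)
    fix f assume "f \<in> L2_space m" "\<And>v. v \<in> ?V \<Longrightarrow> L2_inner m f v = 0"
    then show "L2_inner m f f = 0"
      using C.C_closure_dom by (intro regular_form_orthogonal_trivial[OF df reg]) auto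
  qed
  note gen = G.form_generator_closed_form[folded schroedinger_operator_def]
  interpret P: pvm m "spectral_resolution m (op_neg ?S)" by (rule nonpos_resolution(1)[OF gen(1)])
  have A2: "sqrt_neg m ?S = P.A2" by (rule sqrt_neg_eq)
  have V: "Domain P.A2 = ?V" using gen(2) by (simp add: op_form_dom_def A2)
  have F: "?F f g = graph_form m P.A2 f g" if "f \<in> ?V" "g \<in> ?V" for f g
    using gen(3)[OF that] by (simp add: op_form_eq A2)
  interpret F: semi_inner_space ?V ?F by (rule C.semi_inner_closure_form)
  have CV: "f \<in> ?V" if "f \<in> ?C" for f using that C.C_closure_dom by blast
  have core: "form_core m (Domain P.A2) (graph_form m P.A2) ?C"
    unfolding form_core_def V
  proof (intro conjI ballI C.C_closure_dom)
    fix f assume f: "f \<in> ?V"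
    then obtain u where u: "\<And>n. u n \<in> ?C" "form_tendsto (L2_inner m) u f" "form_tendsto ?F u f"
      using C.core_closure unfolding form_core_def by blast
    have "u n - f \<in> ?V" for n using CV[OF u(1)] f by (rule F.V_mem(3))
    then have "form_tendsto (graph_form m P.A2) u f" using u(3) by (simp add: form_tendsto_def F)
    then show "\<exists>u. (\<forall>n. u n \<in> ?C) \<and> form_tendsto (L2_inner m) u f \<and> form_tendsto (graph_form m P.A2) u f"
      using u by blast
  qed
  have abs: "abs_contractive ?C (graph_form m P.A2)"
    unfolding abs_contractive_def
  proof (intro ballI conjI)
    fix f assume f: "f \<in> ?C"
    note a = schroedinger_abs[OF df f]
    show "(\<lambda>x. \<bar>f x\<bar>) \<in> ?C" by (rule a(1))
    show "graph_form m P.A2 (\<lambda>x. \<bar>f x\<bar>) (\<lambda>x. \<bar>f x\<bar>) \<le> graph_form m P.A2 f f"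
      using a(2)[of \<mu>p \<mu>n] C.closure_form_eq[OF f f] C.closure_form_eq[OF a(1) a(1)]
        F[OF CV[OF f] CV[OF f]] F[OF CV[OF a(1)] CV[OF a(1)]] by simp
  qed
  have L: "op_neg L = spectral_integral m (spectral_resolution m (op_neg ?S)) \<Phi>"
    by (simp add: L_def subordinate_operator_def op_fun_def)
  note \<Phi> = P.bernstein_half_line(1)[OF bf]
  have push: "spectral_integral m (push \<Phi> (spectral_resolution m (op_neg ?S))) (\<lambda>l. l) = op_neg L"
    unfolding L by (rule P.spectral_integral_push[OF \<Phi> id_half_line])
  note Q = spectral_resolution_pvm[OF P.pvm_push[OF \<Phi>] push]
  interpret Q: pvm m "spectral_resolution m (op_neg L)" by (rule Q(1))
  show ?thesis
  proof
    fix u assume u: "u \<in> Domain Q.A2"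
    from P.subordinate_form_abs[OF bf core abs Q(1) trans[OF Q(2) L] u]
    show "(\<lambda>x. \<bar>u x\<bar>) \<in> Domain Q.A2"
      "graph_form m Q.A2 (\<lambda>x. \<bar>u x\<bar>) (\<lambda>x. \<bar>u x\<bar>) \<le> graph_form m Q.A2 u u" .
  qed
qed

section \<open>The extended space and the inclusions between range and dual spaces\<close>

context lattice_pvm
begin

context
  fixes L :: "'a operator"
  assumes L: "P = spectral_resolution m (op_neg L)"
begin

lemma sqrt_neg_A2: "sqrt_neg m L = A2"
  unfolding L by (rule sqrt_neg_eq)

lemma ext_approx_iff:
  "ext_approx m L us u \<longleftrightarrow> (\<forall>n. us n \<in> V) \<and> form_Cauchy q us \<and> (AE x in m. (\<lambda>n. us n x) \<longlonglongrightarrow> u x)"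
  by (simp add: ext_approx_def op_form_dom_def op_form_eq sqrt_neg_A2)

lemma ext_approx_const: "u \<in> V \<Longrightarrow> ext_approx m L (\<lambda>n. u) u"
  using q.zero_left[of 0] by (simp add: ext_approx_iff form_Cauchy_eq)

text \<open>The difference of two approximating sequences of \<open>u\<close> is Cauchy and tends to
  \<open>0\<close> a.e., the situation of \<open>Cauchy_AE_zero\<close>. Through this lemma
  \<open>ext_form\<close> and the extended pairing are well defined.\<close>

lemma ext_approx_diff:
  assumes u: "ext_approx m L us u" and v: "ext_approx m L vs u"
  shows "(\<lambda>n. q (us n - vs n) (us n - vs n)) \<longlonglongrightarrow> 0"
proof -
  have us: "us n \<in> V" and vs: "vs n \<in> V" for n using u v by (auto simp: ext_approx_iff)
  have "form_Cauchy q (\<lambda>n. us n + (-1) *\<^sub>R vs n)"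
    using u v us vs by (intro q.Cauchy_lincomb) (auto simp: ext_approx_iff)
  then have cau: "form_Cauchy q (\<lambda>n. us n - vs n)" by simp
  have "AE x in m. (\<lambda>n. us n x) \<longlonglongrightarrow> u x" "AE x in m. (\<lambda>n. vs n x) \<longlonglongrightarrow> u x"
    using u v by (auto simp: ext_approx_iff)
  then have "AE x in m. (\<lambda>n. (us n - vs n) x) \<longlonglongrightarrow> 0"
  proof eventually_elim
    case (elim x)
    then have "(\<lambda>n. us n x - vs n x) \<longlonglongrightarrow> u x - u x" by (rule tendsto_diff)
    then show ?case by simp
  qed
  then show ?thesis using us vs cau by (intro Cauchy_AE_zero) auto
qed

lemma ext_form_tendsto:
  assumes u: "ext_approx m L us u"
  shows "(\<lambda>n. q (us n) (us n)) \<longlonglongrightarrow> ext_form m L u"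
proof -
  have us: "us n \<in> V" for n using u by (auto simp: ext_approx_iff)
  obtain c where c: "(\<lambda>n. q (us n) (us n)) \<longlonglongrightarrow> c"
    using q.Cauchy_convergent_norm[of us] us u by (auto simp: ext_approx_iff convergent_def)
  have all: "(\<lambda>n. q (vs n) (vs n)) \<longlonglongrightarrow> c" if v: "ext_approx m L vs u" for vs
  proof -
    have vs: "vs n \<in> V" for n using v by (auto simp: ext_approx_iff)
    have "(\<lambda>n. sqrt (q (us n - vs n) (us n - vs n))) \<longlonglongrightarrow> sqrt 0"
      using ext_approx_diff[OF u v] by (rule tendsto_real_sqrt)
    then have d: "(\<lambda>n. sqrt (q (us n - vs n) (us n - vs n))) \<longlonglongrightarrow> 0" by simp
    have "(\<lambda>n. sqrt (q (us n) (us n)) - sqrt (q (vs n) (vs n))) \<longlonglongrightarrow> 0"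
    proof (rule Lim_null_comparison[OF always_eventually d], rule allI)
      fix n
      show "norm (sqrt (q (us n) (us n)) - sqrt (q (vs n) (vs n))) \<le> sqrt (q (us n - vs n) (us n - vs n))"
        using q.dist_sqrt[OF us[of n] vs[of n]] by simp
    qed
    from tendsto_diff[OF tendsto_real_sqrt[OF c] this]
    have "(\<lambda>n. sqrt (q (vs n) (vs n))) \<longlonglongrightarrow> sqrt c" by simp
    then have "(\<lambda>n. (sqrt (q (vs n) (vs n)))\<^sup>2) \<longlonglongrightarrow> (sqrt c)\<^sup>2" by (rule tendsto_power)
    moreover have "c \<ge> 0" using c q.nonneg[OF us] by (intro LIMSEQ_le_const) auto
    ultimately show ?thesis using q.nonneg[OF vs] by simp
  qed
  have "ext_form m L u = c"
    unfolding ext_form_def op_form_eq sqrt_neg_A2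
  proof (rule the_equality)
    show "\<forall>us. ext_approx m L us u \<longrightarrow> (\<lambda>n. q (us n) (us n)) \<longlonglongrightarrow> c" using all by blast
    fix c' assume "\<forall>us. ext_approx m L us u \<longrightarrow> (\<lambda>n. q (us n) (us n)) \<longlonglongrightarrow> c'"
    then have "(\<lambda>n. q (us n) (us n)) \<longlonglongrightarrow> c'" using u by blast
    then show "c' = c" using c by (rule LIMSEQ_unique)
  qed
  then show ?thesis using c by simp
qed

text \<open>The pairing moves to the \<open>L\<^sup>2\<close>-convergent sequence
  \<open>op_app A2 (us n)\<close>, since \<open>\<langle>f, us n\<rangle> = \<langle>g, \<surd>A (us
  n)\<rangle>\<close>; so its limit exists although \<open>us\<close> need not converge in
  \<open>L\<^sup>2\<close>. Independence of the sequence follows from \<open>ext_approx_diff\<close>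
  and the bound by the energy.\<close>

lemma range_subset_ext_dual:
  assumes gf: "(g, f) \<in> A2"
  shows "f \<in> ext_dual_dom m L"
proof -
  have g: "g \<in> H" and f: "f \<in> H" using self_adjoint_op_mem[OF A2_self_adjoint gf] .
  note mem = op_app_L2[OF A2_self_adjoint]
  have adj: "ip f x = ip g (op_app A2 x)" if x: "x \<in> V" for x
    using self_adjoint_op_sym[OF A2_self_adjoint gf op_app_mem[OF x]] by simp
  have bound: "\<bar>ip f x\<bar> \<le> sqrt (ip g g) * sqrt (q x x)" if x: "x \<in> V" for x
    using L2.abs_le[OF g mem(2)[OF x]] by (simp add: adj[OF x] graph_form_def)
  have "\<exists>p. (\<forall>us. ext_approx m L us u \<longrightarrow>
           (\<forall>n. integrable m (\<lambda>x. f x * us n x)) \<and> (\<lambda>n. ip f (us n)) \<longlonglongrightarrow> p) \<and>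
        \<bar>p\<bar> \<le> sqrt (ip g g) * sqrt (ext_form m L u)" if u: "u \<in> ext_dom m L" for u
  proof -
    obtain us where us: "ext_approx m L us u" using u by (auto simp: ext_dom_def)
    have usV: "us n \<in> V" for n using us by (auto simp: ext_approx_iff)
    have Sus: "op_app A2 (us n) \<in> H" for n using mem(2)[OF usV] .
    have "form_Cauchy q us" using us by (simp add: ext_approx_iff)
    then have "form_Cauchy ip (\<lambda>n. op_app A2 (us n))"
      using graph_form_Cauchy[OF A2_self_adjoint, of us] usV by blast
    with Sus obtain y where y: "y \<in> H" "form_tendsto ip (\<lambda>n. op_app A2 (us n)) y" by (rule L2_complete)
    have "(\<lambda>n. ip (op_app A2 (us n)) g) \<longlonglongrightarrow> ip y g" using Sus y g by (intro L2.tendsto_left)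
    then have lim: "(\<lambda>n. ip f (us n)) \<longlonglongrightarrow> ip y g"
      using adj[OF usV] L2.sym[OF g Sus] by simp
    show ?thesis
    proof (intro exI[of _ "ip y g"] conjI allI impI)
      fix vs n assume v: "ext_approx m L vs u"
      have vsV: "vs n \<in> V" for n using v by (auto simp: ext_approx_iff)
      show "integrable m (\<lambda>x. f x * vs n x)" by (rule L2_space_integrable_mult[OF f VH[OF vsV]])
      have "(\<lambda>n. sqrt (ip g g) * sqrt (q (us n - vs n) (us n - vs n))) \<longlonglongrightarrow> sqrt (ip g g) * sqrt 0"
        using ext_approx_diff[OF us v] by (intro tendsto_mult tendsto_const tendsto_real_sqrt)
      then have d: "(\<lambda>n. sqrt (ip g g) * sqrt (q (us n - vs n) (us n - vs n))) \<longlonglongrightarrow> 0" by simp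
      have "(\<lambda>n. ip f (us n) - ip f (vs n)) \<longlonglongrightarrow> 0"
      proof (rule Lim_null_comparison[OF always_eventually d], rule allI)
        fix n
        show "norm (ip f (us n) - ip f (vs n)) \<le> sqrt (ip g g) * sqrt (q (us n - vs n) (us n - vs n))"
          using bound[OF q.V_mem(3)[OF usV[of n] vsV[of n]]] L2.diff_right[OF VH[OF usV[of n]] VH[OF vsV[of n]] f] by simp
      qed
      from tendsto_diff[OF lim this] show "(\<lambda>n. ip f (vs n)) \<longlonglongrightarrow> ip y g" by simp
    next
      show "\<bar>ip y g\<bar> \<le> sqrt (ip g g) * sqrt (ext_form m L u)"
      proof (rule LIMSEQ_le[OF tendsto_rabs[OF lim]])
        show "(\<lambda>n. sqrt (ip g g) * sqrt (q (us n) (us n))) \<longlonglongrightarrow> sqrt (ip g g) * sqrt (ext_form m L u)"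
          using ext_form_tendsto[OF us] by (intro tendsto_mult tendsto_const tendsto_real_sqrt)
      qed (use bound[OF usV] in blast)
    qed
  qed
  then show ?thesis using L2_space_measurable[OF f] unfolding ext_dual_dom_def by blast
qed

text \<open>Constant sequences embed the domain into the extended space, with the same energy and
  the same pairing.\<close>

lemma ext_dual_subset_dual:
  assumes "f \<in> ext_dual_dom m L"
  shows "f \<in> dual_dom m L"
proof -
  obtain c where fm: "f \<in> borel_measurable m"
    and c: "\<And>u. u \<in> ext_dom m L \<Longrightarrow> \<exists>p. (\<forall>us. ext_approx m L us u \<longrightarrow>
           (\<forall>n. integrable m (\<lambda>x. f x * us n x)) \<and> (\<lambda>n. ip f (us n)) \<longlonglongrightarrow> p) \<and>
        \<bar>p\<bar> \<le> c * sqrt (ext_form m L u)"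
    using assms unfolding ext_dual_dom_def by blast
  have "integrable m (\<lambda>x. f x * u x) \<and> \<bar>ip f u\<bar> \<le> c * sqrt (q u u)" if u: "u \<in> V" for u
  proof -
    note a = ext_approx_const[OF u]
    have "u \<in> ext_dom m L" using a L2_space_measurable[OF VH[OF u]] by (auto simp: ext_dom_def)
    from c[OF this] a obtain p where p: "integrable m (\<lambda>x. f x * u x)" "(\<lambda>n::nat. ip f u) \<longlonglongrightarrow> p"
      "\<bar>p\<bar> \<le> c * sqrt (ext_form m L u)" by blast
    have "ip f u = p" using tendsto_const p(2) by (rule LIMSEQ_unique)
    moreover have "q u u = ext_form m L u" using tendsto_const ext_form_tendsto[OF a] by (rule LIMSEQ_unique)
    ultimately show ?thesis using p by simp
  qed
  then show ?thesis using fm unfolding dual_dom_def op_form_dom_def op_form_eq sqrt_neg_A2 by blast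
qed

lemma dual_range:
  assumes "f \<in> H" "f \<in> dual_dom m L"
  shows "f \<in> Range A2"
proof -
  obtain c where "\<And>u. u \<in> V \<Longrightarrow> \<bar>ip f u\<bar> \<le> c * sqrt (q u u)"
    using assms(2) unfolding dual_dom_def op_form_dom_def op_form_eq sqrt_neg_A2 by blast
  then obtain g where "(g, f) \<in> A2" using range_if_dual_bound[OF assms(1), of c] by blast
  then show ?thesis by blast
qed

text \<open>For \<open>t \<ge> 0\<close> the function \<open>exp (- t * l)\<close> is bounded, so
  \<open>f\<close> lies in the domain of the semigroup operator; the representative that
  \<open>op_app\<close> picks has the right inner product with \<open>f\<close>, and
  \<open>green_integral\<close> exchanges the integrals.\<close>

lemma green_energy_eq:
  assumes f: "f \<in> H"
  shows "green_energy m L f = (\<integral>\<^sup>+l. green l \<partial>\<mu> f)"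
proof -
  have "ip f (op_app (semigroup_op m L t) f) = (\<integral>l. exp (- t * l) \<partial>\<mu> f)" if t: "t \<ge> 0" for t
  proof -
    let ?e = "\<lambda>l. exp (- t * l)"
    have e: "bounded_borel ?e"
      by (rule bounded_borelI[where K = 1]) (use t in \<open>auto intro!: measurable_restrict_space1\<close>)
    have S: "semigroup_op m L t = spectral_integral m P ?e" by (simp add: semigroup_op_def op_fun_def L)
    have i: "ispace (\<lambda>l. (?e l)\<^sup>2) = H" using e by (intro ispace_bounded bounded_borel_power2)
    have "f \<in> Domain (spectral_integral m P ?e)"
      using Domain_spectral_integral[OF bounded_borel_measurable[OF e]] i f by simp
    from op_app_mem[OF this] have m: "(f, op_app (semigroup_op m L t) f) \<in> spectral_integral m P ?e" by (simp only: S)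
    then have v: "op_app (semigroup_op m L t) f \<in> H" and "ip (op_app (semigroup_op m L t) f) f = bint ?e f f"
      using f i unfolding spectral_integral_eq by auto
    moreover have "bint ?e f f = (\<integral>l. ?e l \<partial>\<mu> f)"
      using f e bounded_borel_measurable[OF e] by (intro bint_self) auto
    ultimately show ?thesis using L2.sym[OF f v] by simp
  qed
  then have "green_energy m L f = (\<integral>\<^sup>+t\<in>{0..}. ennreal (\<integral>l. exp (- t * l) \<partial>\<mu> f) \<partial>lborel)"
    unfolding green_energy_def by (intro nn_integral_cong) (auto simp: indicator_def)
  then show ?thesis using green_integral[OF f] by simp
qed

text \<open>Two cycles through the range: range, extended dual, dual, range; and range, finite Green
  energy, dual bound, range.\<close>

theorem range_sqrt_eq:
  "Range (sqrt_neg m L) = H \<inter> ext_dual_dom m L \<and>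
   H \<inter> ext_dual_dom m L = H \<inter> dual_dom m L \<and>
   H \<inter> dual_dom m L = {f \<in> H. green_energy m L f < \<infinity>}"
proof -
  have "f \<in> H \<and> f \<in> ext_dual_dom m L" if "f \<in> Range A2" for f
    using that range_subset_ext_dual self_adjoint_op_mem[OF A2_self_adjoint] by blast
  moreover have "f \<in> dual_dom m L" if "f \<in> ext_dual_dom m L" for f
    using that by (rule ext_dual_subset_dual)
  moreover have "f \<in> Range A2" if "f \<in> H" "f \<in> dual_dom m L" for f
    using that by (rule dual_range)
  moreover have "green_energy m L f < \<infinity>" if "f \<in> H" "f \<in> Range A2" for f
    using that green_finite_if_range green_energy_eq by auto
  moreover have "f \<in> Range A2" if f: "f \<in> H" and "green_energy m L f < \<infinity>" for f
  proof -
    have "(\<integral>\<^sup>+l. green l \<partial>\<mu> f) < \<infinity>" using that green_energy_eq by simp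
    with f obtain c where "\<And>u. u \<in> V \<Longrightarrow> \<bar>ip f u\<bar> \<le> c * sqrt (q u u)"
      by (rule dual_bound_if_green_finite) blast
    with f obtain g where "(g, f) \<in> A2" by (rule range_if_dual_bound)
    then show ?thesis by blast
  qed
  ultimately show ?thesis unfolding sqrt_neg_A2 by blast
qed

end

end

theorem theorem3p14:
  fixes m \<mu>p \<mu>n :: "'a::{metric_space, second_countable_topology} measure"
    and D :: "('a \<Rightarrow> real) set" and \<E> :: "'a form"
    and \<Phi> :: "real \<Rightarrow> real" and L :: "'a operator"
  assumes "locally compact (UNIV :: 'a set)"
    and "radon_on UNIV m" and "full_support m"
    and "dirichlet_form m D \<E>" and "regular_form m D \<E>"
    and "smooth_radon_measure m D \<E> \<mu>p" and "smooth_radon_measure m D \<E> \<mu>n"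
    and "nonneg_definite_on (D \<inter> Cc) (schroedinger_form \<E> \<mu>p \<mu>n)"
    and "closable_form m (D \<inter> Cc) (schroedinger_form \<E> \<mu>p \<mu>n)"
    and "bernstein_function \<Phi>"
    and "L = subordinate_operator m \<Phi> (schroedinger_operator m D \<E> \<mu>p \<mu>n)"
  shows "Range (sqrt_neg m L) = L2_space m \<inter> ext_dual_dom m L \<and>
         L2_space m \<inter> ext_dual_dom m L = L2_space m \<inter> dual_dom m L \<and>
         L2_space m \<inter> dual_dom m L = {f \<in> L2_space m. green_energy m L f < \<infinity>}"
proof -
  have "radon_on UNIV \<mu>p" "radon_on UNIV \<mu>n"
    using assms by (auto simp: smooth_radon_measure_def)
  then interpret lattice_pvm m "spectral_resolution m (op_neg L)"
    using assms subordinate_schroedinger_lattice_pvm by blast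
  show ?thesis by (rule range_sqrt_eq[OF refl])
qed

end
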